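(* Let $R$ be a (reduced) root system in a finite-dimensional Euclidean space $V$, let $W$ be its Weyl group, $\Lambda\subset V$ the lattice generated by $R$, and $G=\Lambda\rtimes W$ the affine Weyl group (of the coroot system $R^\vee$). Choose a basis $B\subset R$. Then $\{\,i_S\,1_{(G_S)_{cz}^+}\,r_S\mid S\subseteq B\,\}$ is a set of pairwise-orthogonal, $\mathrm{Cl}(G)$-linear, idempotent endomorphisms of $\mathrm{H}(\mathbb{C}(G))$, summing to the identity: $$\sum_{S\subseteq B}i_S\,1_{(G_S)_{cz}^+}\,r_S=1.$$
   Context: For an algebra $A$, $\mathrm{H}(A)$ denotes the long exact sequence $\cdots\to\mathrm{HC}_{n+1}(A)\xrightarrow{S}\mathrm{HC}_{n-1}(A)\xrightarrow{B}\mathrm{HH}_n(A)\xrightarrow{I}\mathrm{HC}_n(A)\to\cdots$ relating its Hochschild and cyclic homology, computed from the standard precyclic module $C_n(A)=A^{\otimes(n+1)}$; an endomorphism of $\mathrm{H}(A)$ is a pair of graded linear endomorphisms of $\mathrm{HH}_*(A)$ and $\mathrm{HC}_*(A)$ commuting with these maps. For a discrete group $G$, $\mathbb{C}(G)$ is the group algebra, and the algebra $\mathrm{Cl}(G)$ of class functions on $G$ acts on $C(\mathbb{C}(G))$, hence on $\mathrm{H}(\mathbb{C}(G))$, by $F(g_0\otimes\cdots\otimes g_n)=F(g_0g_1\cdots g_n)\,g_0\otimes\cdots\otimes g_n$. For a finite-index subgroup $L\subseteq G$, $i_L:\mathrm{H}(\mathbb{C}(L))\to\mathrm{H}(\mathbb{C}(G))$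 and $r_L:\mathrm{H}(\mathbb{C}(G))\to\mathrm{H}(\mathbb{C}(L))$ are the maps induced by the induction and restriction functors between modules: $i_L$ is induced by the inclusion $\mathbb{C}(L)\hookrightarrow\mathbb{C}(G)$, and $r_L$ is the trace map coming from a choice of $L$-equivariant isomorphism $\mathbb{C}(G)\cong\mathbb{C}(L)^{[G:L]}$. For $S\subseteq B$, $W_S\subseteq W$ is the subgroup generated by the reflections $s_\alpha$, $\alpha\in S$, and $G_S=\Lambda\rtimes W_S$; $i_S$ and $r_S$ denote the induction and restriction maps for $G_S\subseteq G$. The centre of $G_S$ is the group of invariants $\Lambda^{W_S}$. For every $\psi\in\mathrm{Hom}(\Lambda^{W_S},\mathbb{Z})$, the multiple $|W_S|\psi$ extends uniquely to a homomorphism $\psi_S:G_S\to\mathbb{Z}$. In particular each root $\alpha$, viewed as the homomorphism $\lambda\mapsto\langle\lambda,\alpha\rangle$ on $\Lambda^{W_S}$, where $\langle\lambda,\alpha\rangle=2(\lambda,\alpha)/(\alpha,\alpha)$ with $(\cdot,\cdot)$ the inner product on $V$, induces $\alpha_S:G_S\to\mathbb{Z}$, with $\alpha_S(\lambda)=|W_S|\langle\lambda,\alpha\rangle$ for $\lambda\in\Lambda^{W_S}$. Define $G_S^+=\{g\in G_S\mid\alpha_S(g)>0\text{ for all }\alpha\in B\setminus S\}$, let $(G_S)_{cz}$ be the set of elements of $G_S$ having finite order modulo the centre of $G_S$, and $(G_S)_{cz}^+=(G_S)_{cz}\cap G_S^+$. These sets are conjugation-invariant in $G_S$, so the characteristic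 function $1_{(G_S)_{cz}^+}$ acts on $\mathrm{H}(\mathbb{C}(G_S))$. *)

theory Defs
  imports "HOL-Analysis.Analysis" "HOL-Algebra.Bij" "HOL-Algebra.Elementary_Groups" "HOL-Algebra.Module"
begin

section \<open>Finitely supported functions\<close>

definition fin_span :: "'x set \<Rightarrow> ('x \<Rightarrow> complex) set" where
  "fin_span X = {f. finite {x. f x \<noteq> 0} \<and> {x. f x \<noteq> 0} \<subseteq> X}"

definition delta :: "'x \<Rightarrow> 'x \<Rightarrow> complex" where
  "delta x = (\<lambda>y. if y = x then 1 else 0)"

text \<open>The linear extension of a map given on basis elements.\<close>

definition lin_ext :: "('x \<Rightarrow> 'y \<Rightarrow> complex) \<Rightarrow> ('x \<Rightarrow> complex) \<Rightarrow> 'y \<Rightarrow> complex" where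
  "lin_ext k c = (\<lambda>y. \<Sum>x | c x \<noteq> 0. c x * k x y)"

definition group_algebra :: "('g, 'm) monoid_scheme \<Rightarrow> ('g \<Rightarrow> complex) set" where
  "group_algebra G = fin_span (carrier G)"

definition convol :: "('g, 'm) monoid_scheme \<Rightarrow> ('g \<Rightarrow> complex) \<Rightarrow> ('g \<Rightarrow> complex) \<Rightarrow> 'g \<Rightarrow> complex" where
  "convol G a b = lin_ext (\<lambda>g. lin_ext (\<lambda>h. delta (g \<otimes>\<^bsub>G\<^esub> h)) b) a"


section \<open>The precyclic module of a group algebra\<close>

text \<open>The elements \<open>g\<^sub>0 \<otimes> \<dots> \<otimes> g\<^sub>n\<close> with all \<open>g\<^sub>i\<close> in \<open>G\<close> form a basis of the tensor power
  \<open>\<complex>(G)\<^bsup>\<otimes>(n+1)\<^esup>\<close>. The latter is therefore represented by the finitely supported functions on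
  \<open>G\<^bsup>n+1\<^esup>\<close>, where the list \<open>[g\<^sub>0, \<dots>, g\<^sub>n]\<close> stands for the tensor \<open>g\<^sub>0 \<otimes> \<dots> \<otimes> g\<^sub>n\<close>.\<close>

definition tuples :: "('g, 'm) monoid_scheme \<Rightarrow> nat \<Rightarrow> 'g list set" where
  "tuples G n = {xs. length xs = Suc n \<and> set xs \<subseteq> carrier G}"

definition chains :: "('g, 'm) monoid_scheme \<Rightarrow> nat \<Rightarrow> ('g list \<Rightarrow> complex) set" where
  "chains G n = fin_span (tuples G n)"

text \<open>For a list of length \<open>n + 1\<close>, face \<open>i < n\<close> multiplies the entries \<open>i\<close> and \<open>i + 1\<close>, and the
  last face \<open>n\<close> sends \<open>g\<^sub>0 \<otimes> \<dots> \<otimes> g\<^sub>n\<close> to \<open>g\<^sub>n g\<^sub>0 \<otimes> g\<^sub>1 \<otimes> \<dots> \<otimes> g\<^bsub>n-1\<^esub>\<close>.\<close>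

definition face :: "('g, 'm) monoid_scheme \<Rightarrow> nat \<Rightarrow> 'g list \<Rightarrow> 'g list" where
  "face G i xs =
    (if Suc i < length xs
     then take i xs @ (xs ! i \<otimes>\<^bsub>G\<^esub> xs ! Suc i) # drop (i + 2) xs
     else (last xs \<otimes>\<^bsub>G\<^esub> hd xs) # butlast (tl xs))"

definition face_map :: "('g, 'm) monoid_scheme \<Rightarrow> nat \<Rightarrow> ('g list \<Rightarrow> complex) \<Rightarrow> 'g list \<Rightarrow> complex" where
  "face_map G i = lin_ext (\<lambda>xs. delta (face G i xs))"

text \<open>The signed cyclic operator in degree \<open>n\<close>:
  \<open>g\<^sub>0 \<otimes> \<dots> \<otimes> g\<^sub>n \<mapsto> (-1)\<^sup>n g\<^sub>n \<otimes> g\<^sub>0 \<otimes> \<dots> \<otimes> g\<^bsub>n-1\<^esub>\<close>.\<close>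

definition cyc :: "nat \<Rightarrow> ('g list \<Rightarrow> complex) \<Rightarrow> 'g list \<Rightarrow> complex" where
  "cyc n c = (\<lambda>ys. (-1) ^ n * lin_ext (\<lambda>xs. delta (last xs # butlast xs)) c ys)"

definition cyc_norm :: "nat \<Rightarrow> ('g list \<Rightarrow> complex) \<Rightarrow> 'g list \<Rightarrow> complex" where
  "cyc_norm n c = (\<lambda>ys. \<Sum>i\<le>n. (cyc n ^^ i) c ys)"

text \<open>The differentials \<open>b\<close> and \<open>b'\<close> from degree \<open>n\<close> to degree \<open>n - 1\<close>; both vanish in degree 0.\<close>

definition hoch_b :: "('g, 'm) monoid_scheme \<Rightarrow> nat \<Rightarrow> ('g list \<Rightarrow> complex) \<Rightarrow> 'g list \<Rightarrow> complex" where
  "hoch_b G n c = (\<lambda>ys. if n = 0 then 0 else \<Sum>i\<le>n. (-1) ^ i * face_map G i c ys)"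

definition hoch_b' :: "('g, 'm) monoid_scheme \<Rightarrow> nat \<Rightarrow> ('g list \<Rightarrow> complex) \<Rightarrow> 'g list \<Rightarrow> complex" where
  "hoch_b' G n c = (\<lambda>ys. \<Sum>i<n. (-1) ^ i * face_map G i c ys)"

text \<open>The contraction \<open>g\<^sub>0 \<otimes> \<dots> \<otimes> g\<^sub>n \<mapsto> 1 \<otimes> g\<^sub>0 \<otimes> \<dots> \<otimes> g\<^sub>n\<close> of the \<open>b'\<close>-complex.\<close>

definition contr :: "('g, 'm) monoid_scheme \<Rightarrow> ('g list \<Rightarrow> complex) \<Rightarrow> 'g list \<Rightarrow> complex" where
  "contr G = lin_ext (\<lambda>xs. delta (\<one>\<^bsub>G\<^esub> # xs))"

text \<open>The total complex of the cyclic bicomplex: column \<open>p\<close> holds \<open>C\<^bsub>n-p\<^esub>\<close> in total degree \<open>n\<close>.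
  The vertical differential is \<open>b\<close> in even and \<open>-b'\<close> in odd columns; the horizontal one is
  \<open>1 - t\<close> from odd to even columns and the norm from even to odd columns.\<close>

definition tot_chains :: "('g, 'm) monoid_scheme \<Rightarrow> nat \<Rightarrow> (nat \<times> 'g list \<Rightarrow> complex) set" where
  "tot_chains G n = fin_span {(p, xs). p \<le> n \<and> xs \<in> tuples G (n - p)}"

definition column :: "(nat \<times> 'g list \<Rightarrow> complex) \<Rightarrow> nat \<Rightarrow> 'g list \<Rightarrow> complex" where
  "column z p = (\<lambda>xs. z (p, xs))"

definition tot_d :: "('g, 'm) monoid_scheme \<Rightarrow> nat \<Rightarrow> (nat \<times> 'g list \<Rightarrow> complex) \<Rightarrow> nat \<times> 'g list \<Rightarrow> complex" where
  "tot_d G n z = (\<lambda>(p, ys).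
     if p < n then
       (if even p
        then hoch_b G (n - p) (column z p) ys
             + (column z (p + 1) ys - cyc (n - p - 1) (column z (p + 1)) ys)
        else - hoch_b' G (n - p) (column z p) ys
             + cyc_norm (n - p - 1) (column z (p + 1)) ys)
     else 0)"


section \<open>Hochschild and cyclic homology as complex vector spaces\<close>

definition coset :: "('x \<Rightarrow> complex) set \<Rightarrow> ('x \<Rightarrow> complex) \<Rightarrow> ('x \<Rightarrow> complex) set" where
  "coset U z = {w. (\<lambda>x. w x - z x) \<in> U}"

text \<open>The quotient \<open>Z / U\<close> of spaces of functions. The ring multiplication and unit that the record
  type provides play no role in a module.\<close>

definition quot_space ::
    "('x \<Rightarrow> complex) set \<Rightarrow> ('x \<Rightarrow> complex) set \<Rightarrow> (complex, ('x \<Rightarrow> complex) set) module" where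
  "quot_space Z U =
    \<lparr>carrier = coset U ` Z, monoid.mult = undefined, one = undefined,
     zero = U,
     add = (\<lambda>A A'. \<Union>u\<in>A. \<Union>v\<in>A'. coset U (\<lambda>x. u x + v x)),
     smult = (\<lambda>a A. \<Union>u\<in>A. coset U (\<lambda>x. a * u x))\<rparr>"

definition lin_maps :: "(complex, 'a) module \<Rightarrow> (complex, 'b) module \<Rightarrow> ('a \<Rightarrow> 'b) set" where
  "lin_maps M N = {f \<in> carrier M \<rightarrow> carrier N.
     (\<forall>x\<in>carrier M. \<forall>y\<in>carrier M. f (x \<oplus>\<^bsub>M\<^esub> y) = f x \<oplus>\<^bsub>N\<^esub> f y) \<and>
     (\<forall>a. \<forall>x\<in>carrier M. f (a \<odot>\<^bsub>M\<^esub> x) = a \<odot>\<^bsub>N\<^esub> f x)}"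

text \<open>The map of quotients induced by \<open>f\<close>, where \<open>U\<close> is the subspace divided out in the target.
  It is a single class whenever \<open>f\<close> respects the subspaces.\<close>

definition induced ::
    "('y \<Rightarrow> complex) set \<Rightarrow> (('x \<Rightarrow> complex) \<Rightarrow> 'y \<Rightarrow> complex) \<Rightarrow> ('x \<Rightarrow> complex) set \<Rightarrow> ('y \<Rightarrow> complex) set" where
  "induced U f A = (\<Union>z\<in>A. coset U (f z))"

definition HH_bdry :: "('g, 'm) monoid_scheme \<Rightarrow> nat \<Rightarrow> ('g list \<Rightarrow> complex) set" where
  "HH_bdry G n = hoch_b G (n + 1) ` chains G (n + 1)"

definition HC_bdry :: "('g, 'm) monoid_scheme \<Rightarrow> nat \<Rightarrow> (nat \<times> 'g list \<Rightarrow> complex) set" where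
  "HC_bdry G n = tot_d G (n + 1) ` tot_chains G (n + 1)"

text \<open>\<open>HH G n\<close> and \<open>HC G n\<close> are the Hochschild and cyclic homology of \<open>\<complex>(G)\<close> in degree \<open>n\<close>.\<close>

definition HH :: "('g, 'm) monoid_scheme \<Rightarrow> nat \<Rightarrow> (complex, ('g list \<Rightarrow> complex) set) module" where
  "HH G n = quot_space {c \<in> chains G n. hoch_b G n c = (\<lambda>_. 0)} (HH_bdry G n)"

definition HC :: "('g, 'm) monoid_scheme \<Rightarrow> nat \<Rightarrow> (complex, (nat \<times> 'g list \<Rightarrow> complex) set) module" where
  "HC G n = quot_space {z \<in> tot_chains G n. tot_d G n z = (\<lambda>_. 0)} (HC_bdry G n)"

text \<open>\<open>I : HH\<^sub>n \<rightarrow> HC\<^sub>n\<close> is the inclusion of column 0, and \<open>S : HC\<^bsub>n+2\<^esub> \<rightarrow> HC\<^sub>n\<close> forgets the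
  columns 0 and 1.\<close>

definition map_I :: "('g, 'm) monoid_scheme \<Rightarrow> nat \<Rightarrow> ('g list \<Rightarrow> complex) set \<Rightarrow> (nat \<times> 'g list \<Rightarrow> complex) set" where
  "map_I G n = induced (HC_bdry G n) (\<lambda>c (p, xs). if p = 0 then c xs else 0)"

definition map_S :: "('g, 'm) monoid_scheme \<Rightarrow> nat \<Rightarrow> (nat \<times> 'g list \<Rightarrow> complex) set \<Rightarrow> (nat \<times> 'g list \<Rightarrow> complex) set" where
  "map_S G n = induced (HC_bdry G n) (\<lambda>z (p, xs). z (p + 2, xs))"

text \<open>\<open>B : HC\<^sub>n \<rightarrow> HH\<^bsub>n+1\<^esub>\<close> is the connecting map. Lifting a cycle of the quotient complex to the
  columns \<open>\<ge> 2\<close> and applying the differential leaves the norm of its component in column 0, placed in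
  column 1; the contraction of column 1 moves this to \<open>(1 - t) s N\<close> of that component in column 0.\<close>

definition map_B :: "('g, 'm) monoid_scheme \<Rightarrow> nat \<Rightarrow> (nat \<times> 'g list \<Rightarrow> complex) set \<Rightarrow> ('g list \<Rightarrow> complex) set" where
  "map_B G n = induced (HH_bdry G (n + 1))
     (\<lambda>z. let c = contr G (cyc_norm n (column z 0)) in (\<lambda>ys. c ys - cyc (n + 1) c ys))"


section \<open>Graded maps between the sequences\<close>

text \<open>A pair of graded maps, on Hochschild and on cyclic homology.\<close>

type_synonym 'g H_map =
  "(nat \<Rightarrow> ('g list \<Rightarrow> complex) set \<Rightarrow> ('g list \<Rightarrow> complex) set) \<times>
   (nat \<Rightarrow> (nat \<times> 'g list \<Rightarrow> complex) set \<Rightarrow> (nat \<times> 'g list \<Rightarrow> complex) set)"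

text \<open>Compatibility with \<open>S\<close> on \<open>HC\<^sub>0\<close>, \<open>HC\<^sub>1\<close> and with \<open>B\<close> on \<open>HC\<^bsub>-1\<^esub>\<close> is omitted, as cyclic homology
  vanishes in negative degrees.\<close>

definition H_endo :: "('g, 'm) monoid_scheme \<Rightarrow> 'g H_map \<Rightarrow> bool" where
  "H_endo G E \<longleftrightarrow> (\<forall>n.
     fst E n \<in> lin_maps (HH G n) (HH G n) \<and>
     snd E n \<in> lin_maps (HC G n) (HC G n) \<and>
     (\<forall>x\<in>carrier (HH G n). map_I G n (fst E n x) = snd E n (map_I G n x)) \<and>
     (\<forall>x\<in>carrier (HC G (n + 2)). map_S G n (snd E (n + 2) x) = snd E n (map_S G n x)) \<and>
     (\<forall>x\<in>carrier (HC G n). map_B G n (snd E n x) = fst E (n + 1) (map_B G n x)))"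

definition H_eq :: "('g, 'm) monoid_scheme \<Rightarrow> 'g H_map \<Rightarrow> 'g H_map \<Rightarrow> bool" where
  "H_eq G E F \<longleftrightarrow> (\<forall>n.
     (\<forall>x\<in>carrier (HH G n). fst E n x = fst F n x) \<and>
     (\<forall>x\<in>carrier (HC G n). snd E n x = snd F n x))"

definition H_id :: "'g H_map" where
  "H_id = ((\<lambda>n x. x), (\<lambda>n x. x))"

definition H_zero :: "('g, 'm) monoid_scheme \<Rightarrow> 'g H_map" where
  "H_zero G = ((\<lambda>n x. \<zero>\<^bsub>HH G n\<^esub>), (\<lambda>n x. \<zero>\<^bsub>HC G n\<^esub>))"

definition H_comp :: "'g H_map \<Rightarrow> 'g H_map \<Rightarrow> 'g H_map" (infixr "\<circ>\<^sub>H" 55) where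
  "E \<circ>\<^sub>H F = ((\<lambda>n. fst E n \<circ> fst F n), (\<lambda>n. snd E n \<circ> snd F n))"

definition H_sum :: "('g, 'm) monoid_scheme \<Rightarrow> ('i \<Rightarrow> 'g H_map) \<Rightarrow> 'i set \<Rightarrow> 'g H_map" where
  "H_sum G E J =
    ((\<lambda>n x. finsum (HH G n) (\<lambda>j. fst (E j) n x) J),
     (\<lambda>n x. finsum (HC G n) (\<lambda>j. snd (E j) n x) J))"

text \<open>The map into the sequence of \<open>G\<close> that is induced by a map \<open>f\<close> of precyclic modules, which is
  applied to every column of the cyclic bicomplex.\<close>

definition H_induced :: "('g, 'm) monoid_scheme \<Rightarrow> (('g list \<Rightarrow> complex) \<Rightarrow> 'g list \<Rightarrow> complex) \<Rightarrow> 'g H_map" where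
  "H_induced G f =
    ((\<lambda>n. induced (HH_bdry G n) f),
     (\<lambda>n. induced (HC_bdry G n) (\<lambda>z (p, xs). f (column z p) xs)))"


section \<open>Class functions, induction and restriction\<close>

definition class_functions :: "('g, 'm) monoid_scheme \<Rightarrow> ('g \<Rightarrow> complex) set" where
  "class_functions G =
    {F. \<forall>g\<in>carrier G. \<forall>h\<in>carrier G. F (h \<otimes>\<^bsub>G\<^esub> g \<otimes>\<^bsub>G\<^esub> inv\<^bsub>G\<^esub> h) = F g}"

definition H_act :: "('g, 'm) monoid_scheme \<Rightarrow> ('g \<Rightarrow> complex) \<Rightarrow> 'g H_map" where
  "H_act G F = H_induced G (\<lambda>c gs. F (foldr (\<otimes>\<^bsub>G\<^esub>) gs \<one>\<^bsub>G\<^esub>) * c gs)"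

text \<open>For a subgroup \<open>L\<close> of \<open>G\<close>, chains of \<open>L\<close> are functions on lists over the type of \<open>G\<close>, so the
  inclusion of \<open>\<complex>(L)\<close> into \<open>\<complex>(G)\<close> induces the identity function on chains.\<close>

definition H_ind :: "('g, 'm) monoid_scheme \<Rightarrow> 'g H_map" where
  "H_ind G = H_induced G (\<lambda>c. c)"

definition sub_index :: "('g, 'm) monoid_scheme \<Rightarrow> 'g set \<Rightarrow> nat" where
  "sub_index G L = card (rcosets\<^bsub>G\<^esub> L)"

text \<open>\<open>\<phi>\<close> is an isomorphism of left \<open>\<complex>(L)\<close>-modules from \<open>\<complex>(G)\<close> to \<open>\<complex>(L)\<^bsup>[G:L]\<^esup>\<close>.\<close>

definition equivariant_iso ::
    "('g, 'm) monoid_scheme \<Rightarrow> 'g set \<Rightarrow> (('g \<Rightarrow> complex) \<Rightarrow> nat \<Rightarrow> 'g \<Rightarrow> complex) \<Rightarrow> bool" where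
  "equivariant_iso G L \<phi> \<longleftrightarrow>
     bij_betw \<phi> (group_algebra G)
       {v. (\<forall>i<sub_index G L. v i \<in> group_algebra (G\<lparr>carrier := L\<rparr>)) \<and>
           (\<forall>i\<ge>sub_index G L. v i = (\<lambda>_. 0))} \<and>
     (\<forall>a\<in>group_algebra G. \<forall>b\<in>group_algebra G. \<forall>i.
        \<phi> (\<lambda>x. a x + b x) i = (\<lambda>x. \<phi> a i x + \<phi> b i x)) \<and>
     (\<forall>k. \<forall>a\<in>group_algebra G. \<forall>i. \<phi> (\<lambda>x. k * a x) i = (\<lambda>x. k * \<phi> a i x)) \<and>
     (\<forall>l\<in>L. \<forall>a\<in>group_algebra G. \<forall>i. \<phi> (convol G (delta l) a) i = convol G (delta l) (\<phi> a i))"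

text \<open>Right multiplication by \<open>g\<close> on \<open>\<complex>(G)\<close> commutes with the left action of \<open>L\<close>. Through \<open>\<phi>\<close> it
  becomes right multiplication of row vectors over \<open>\<complex>(L)\<close> by a matrix, whose \<open>i\<close>-th row is the image
  of the \<open>i\<close>-th standard basis vector; \<open>g\<close> is sent to this matrix multiplicatively.\<close>

definition res_matrix ::
    "('g, 'm) monoid_scheme \<Rightarrow> (('g \<Rightarrow> complex) \<Rightarrow> nat \<Rightarrow> 'g \<Rightarrow> complex)
      \<Rightarrow> 'g \<Rightarrow> nat \<Rightarrow> nat \<Rightarrow> 'g \<Rightarrow> complex" where
  "res_matrix G \<phi> g i j =
     \<phi> (convol G (inv_into (group_algebra G) \<phi> (\<lambda>m. if m = i then delta \<one>\<^bsub>G\<^esub> else (\<lambda>_. 0))) (delta g)) j"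

text \<open>Writing \<open>\<rho>(g)\<close> for this matrix, the trace map sends \<open>g\<^sub>0 \<otimes> \<dots> \<otimes> g\<^sub>n\<close> to the sum of
  \<open>\<rho>(g\<^sub>0)\<^bsub>i\<^sub>0,i\<^sub>1\<^esub> \<otimes> \<rho>(g\<^sub>1)\<^bsub>i\<^sub>1,i\<^sub>2\<^esub> \<otimes> \<dots> \<otimes> \<rho>(g\<^sub>n)\<^bsub>i\<^sub>n,i\<^sub>0\<^esub>\<close> over all \<open>i\<^sub>0, \<dots>, i\<^sub>n < [G:L]\<close>.\<close>

definition trace_map ::
    "('g, 'm) monoid_scheme \<Rightarrow> 'g set \<Rightarrow> (('g \<Rightarrow> complex) \<Rightarrow> nat \<Rightarrow> 'g \<Rightarrow> complex)
      \<Rightarrow> ('g list \<Rightarrow> complex) \<Rightarrow> 'g list \<Rightarrow> complex" where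
  "trace_map G L \<phi> = lin_ext (\<lambda>gs ls.
     if length ls = length gs
     then \<Sum>ix | length ix = length gs \<and> set ix \<subseteq> {..<sub_index G L}.
            \<Prod>m<length gs. res_matrix G \<phi> (gs ! m) (ix ! m) (ix ! (Suc m mod length gs)) (ls ! m)
     else 0)"

definition H_res ::
    "('g, 'm) monoid_scheme \<Rightarrow> 'g set \<Rightarrow> (('g \<Rightarrow> complex) \<Rightarrow> nat \<Rightarrow> 'g \<Rightarrow> complex) \<Rightarrow> 'g H_map" where
  "H_res G L \<phi> = H_induced (G\<lparr>carrier := L\<rparr>) (trace_map G L \<phi>)"

definition center :: "('g, 'm) monoid_scheme \<Rightarrow> 'g set" where
  "center G = {z \<in> carrier G. \<forall>g\<in>carrier G. z \<otimes>\<^bsub>G\<^esub> g = g \<otimes>\<^bsub>G\<^esub> z}"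

definition center_torsion :: "('g, 'm) monoid_scheme \<Rightarrow> 'g set" where
  "center_torsion G = {g \<in> carrier G. \<exists>m::nat. m > 0 \<and> g [^]\<^bsub>G\<^esub> m \<in> center G}"


section \<open>Root systems and affine Weyl groups\<close>

definition pairing :: "'a::real_inner \<Rightarrow> 'a \<Rightarrow> real" where
  "pairing v \<alpha> = 2 * (v \<bullet> \<alpha>) / (\<alpha> \<bullet> \<alpha>)"

definition reflection :: "'a::real_inner \<Rightarrow> 'a \<Rightarrow> 'a" where
  "reflection \<alpha> v = v - pairing v \<alpha> *\<^sub>R \<alpha>"

text \<open>The Euclidean space \<open>V\<close> is a subspace of the ambient type, since the types of class
  \<open>euclidean_space\<close> do not include the zero space. The reflections in elements of \<open>V\<close> act trivially on
  its orthogonal complement, so it is harmless to regard them as maps of the ambient type.\<close>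

definition root_system :: "'a::euclidean_space set \<Rightarrow> 'a set \<Rightarrow> bool" where
  "root_system V R \<longleftrightarrow>
     subspace V \<and> finite R \<and> span R = V \<and> 0 \<notin> R \<and>
     (\<forall>\<alpha>\<in>R. reflection \<alpha> ` R = R) \<and>
     (\<forall>\<alpha>\<in>R. \<forall>\<beta>\<in>R. pairing \<beta> \<alpha> \<in> \<int>) \<and>
     (\<forall>\<alpha>\<in>R. \<forall>c::real. c *\<^sub>R \<alpha> \<in> R \<longrightarrow> c = 1 \<or> c = -1)"

definition root_basis :: "'a::euclidean_space set \<Rightarrow> 'a set \<Rightarrow> 'a set \<Rightarrow> bool" where
  "root_basis V R B \<longleftrightarrow>
     B \<subseteq> R \<and> independent B \<and> span B = V \<and>
     (\<forall>\<alpha>\<in>R. \<exists>k::'a \<Rightarrow> int. \<alpha> = (\<Sum>\<beta>\<in>B. of_int (k \<beta>) *\<^sub>R \<beta>) \<and>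
        ((\<forall>\<beta>\<in>B. k \<beta> \<ge> 0) \<or> (\<forall>\<beta>\<in>B. k \<beta> \<le> 0)))"

definition root_lattice :: "'a::euclidean_space set \<Rightarrow> 'a set" where
  "root_lattice R = {\<Sum>\<alpha>\<in>R. of_int (k \<alpha>) *\<^sub>R \<alpha> | k :: 'a \<Rightarrow> int. True}"

text \<open>For \<open>S = R\<close> this is the Weyl group, for a set \<open>S\<close> of simple roots a parabolic subgroup of it.\<close>

definition reflection_group :: "'a::euclidean_space set \<Rightarrow> ('a \<Rightarrow> 'a) set" where
  "reflection_group S = generate (BijGroup UNIV) (reflection ` S)"

definition affine_weyl :: "'a::euclidean_space set \<Rightarrow> ('a \<times> ('a \<Rightarrow> 'a)) monoid" where
  "affine_weyl R =
    \<lparr>carrier = root_lattice R \<times> reflection_group R,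
     monoid.mult = (\<lambda>(l, w) (l', w'). (l + w l', w \<circ> w')),
     one = (0, id)\<rparr>"

definition parabolic :: "'a::euclidean_space set \<Rightarrow> 'a set \<Rightarrow> ('a \<times> ('a \<Rightarrow> 'a)) set" where
  "parabolic R S = root_lattice R \<times> reflection_group S"

abbreviation parabolic_group :: "'a::euclidean_space set \<Rightarrow> 'a set \<Rightarrow> ('a \<times> ('a \<Rightarrow> 'a)) monoid" where
  "parabolic_group R S \<equiv> (affine_weyl R)\<lparr>carrier := parabolic R S\<rparr>"

definition invariants :: "'a::euclidean_space set \<Rightarrow> 'a set \<Rightarrow> 'a set" where
  "invariants R S = {l \<in> root_lattice R. \<forall>w\<in>reflection_group S. w l = l}"

text \<open>The unique homomorphism from \<open>G\<^sub>S\<close> to the integers that extends the multiple by the order of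
  \<open>W\<^sub>S\<close> of the homomorphism on the invariants given by the root \<open>\<alpha>\<close>. Extensionality makes the
  description unique among functions on the whole type.\<close>

definition root_hom :: "'a::euclidean_space set \<Rightarrow> 'a set \<Rightarrow> 'a \<Rightarrow> ('a \<times> ('a \<Rightarrow> 'a)) \<Rightarrow> int" where
  "root_hom R S \<alpha> = (THE f.
     f \<in> extensional (parabolic R S) \<and>
     f \<in> hom (parabolic_group R S) integer_group \<and>
     (\<forall>l\<in>invariants R S. real_of_int (f (l, id)) = real (card (reflection_group S)) * pairing l \<alpha>))"

definition parabolic_plus :: "'a::euclidean_space set \<Rightarrow> 'a set \<Rightarrow> 'a set \<Rightarrow> ('a \<times> ('a \<Rightarrow> 'a)) set" where
  "parabolic_plus R B S = {g \<in> parabolic R S. \<forall>\<alpha>\<in>B - S. root_hom R S \<alpha> g > 0}"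

definition parabolic_cz_plus :: "'a::euclidean_space set \<Rightarrow> 'a set \<Rightarrow> 'a set \<Rightarrow> ('a \<times> ('a \<Rightarrow> 'a)) set" where
  "parabolic_cz_plus R B S = center_torsion (parabolic_group R S) \<inter> parabolic_plus R B S"

text \<open>The map \<open>i\<^sub>S 1 r\<^sub>S\<close>, where \<open>1\<close> is the characteristic function of \<open>parabolic_cz_plus R B S\<close> and
  \<open>r\<^sub>S\<close> is formed by means of \<open>\<phi>\<close>.\<close>

definition parabolic_endo ::
    "'a::euclidean_space set \<Rightarrow> 'a set
      \<Rightarrow> (('a \<times> ('a \<Rightarrow> 'a) \<Rightarrow> complex) \<Rightarrow> nat \<Rightarrow> 'a \<times> ('a \<Rightarrow> 'a) \<Rightarrow> complex)
      \<Rightarrow> 'a set \<Rightarrow> ('a \<times> ('a \<Rightarrow> 'a)) H_map" where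
  "parabolic_endo R B \<phi> S =
     H_ind (affine_weyl R)
     \<circ>\<^sub>H H_act (parabolic_group R S) (indicator (parabolic_cz_plus R B S))
     \<circ>\<^sub>H H_res (affine_weyl R) (parabolic R S) \<phi>"

end

theory Submission
  imports Defs "HOL-Library.Function_Algebras" "HOL-Algebra.Multiplicative_Group"
begin

text \<open>
  Every \<open>i\<^sub>S 1 r\<^sub>S\<close> acts on homology as the multiplication by a class function on \<open>G\<close>, and the theorem
  then is a statement about these functions: they are the characteristic functions of sets that
  partition \<open>G\<close>.

  The first half holds for a subgroup \<open>L\<close> of finite index in any group \<open>G\<close> and a class function \<open>F\<close> on
  \<open>L\<close>: the map \<open>i F r\<close> is multiplication by \<open>g \<mapsto> \<Sum>\<^sub>x F(x g x\<^sup>-\<^sup>1)\<close>, where \<open>x\<close> runs through representatives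
  of the cosets \<open>L x\<close> with \<open>x g x\<^sup>-\<^sup>1 \<in> L\<close> (\<open>induction_restriction_acts_as\<close>). The map \<open>r\<close> is the trace of the
  matrices by which \<open>G\<close> acts on a frame of \<open>\<complex>(G)\<close> over \<open>\<complex>(L)\<close>. Two frames, the one given by \<open>\<phi>\<close> and the
  one of the coset representatives, are joined to a single matrix representation of the semigroup of
  group elements with a label, where the label says which frame is used
  (\<open>labelled_entry_matrix_rep\<close>). For one constant label its trace is \<open>i F r\<close>. For the other one, after
  a conjugation that undoes the translation by the representatives, it is the multiplication. So it
  is enough to compare the two constant labellings in the homology of the labelled tensors.
  They agree after forgetting the labels, and the kernel of forgetting is acyclic: for \<open>b\<close> by inserting
  units that change the labels one after the other (\<open>hoch_b_unit_homotopy\<close>), for \<open>b'\<close> by the usual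
  contraction, and then for the total complex by removing the columns of a cycle from the right
  (\<open>kernel_total_acyclic\<close>). Thus Hochschild and cyclic homology are treated at once, and the maps of
  the long exact sequence enter only to see that multiplication by a class function respects them
  (\<open>acts_as_H_endo\<close>).

  The second half attaches to \<open>g\<close> its Newton point \<open>\<nu>\<close>, the vector such that \<open>g\<^sup>n\<close> is translation by \<open>n \<nu>\<close>
  for suitable \<open>n > 0\<close>. An element has finite order modulo the centre of \<open>G\<^sub>S\<close> and positive values under
  all \<open>\<alpha>\<^sub>S\<close> exactly if \<open>\<nu>\<close> is orthogonal to \<open>S\<close> and has positive inner product with the other simple roots
  (\<open>parabolic_cz_plus_iff\<close>), that is, if \<open>\<nu>\<close> lies on the face of the dominant chamber that belongs to \<open>S\<close>.
  Conjugation moves \<open>\<nu>\<close> in its orbit under the Weyl group. This orbit contains exactly one dominant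
  vector, whose stabilizer is generated by the simple reflections that fix it (\<open>dominant_unique\<close>,
  \<open>dominant_exists\<close>). Therefore the sum over the cosets of \<open>G\<^sub>S\<close> has exactly one nonzero term, equal to 1, if
  the dominant conjugate of \<open>\<nu>\<close> lies on the face of \<open>S\<close>, and is zero otherwise
  (\<open>face_indicator_transfer\<close>); and each dominant vector lies on the face of exactly one \<open>S\<close>.\<close>


section \<open>Finitely supported functions\<close>

lemma sum_fun_apply: "(\<Sum>i\<in>A. f i) x = (\<Sum>i\<in>A. f i x)" for f :: "'i \<Rightarrow> 'x \<Rightarrow> complex"
  by (induction A rule: infinite_finite_induct) auto

definition fscale :: "complex \<Rightarrow> ('x \<Rightarrow> complex) \<Rightarrow> 'x \<Rightarrow> complex" where
  "fscale a c = (\<lambda>x. a * c x)"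

lemma fscale_apply [simp]: "fscale a c x = a * c x"
  by (simp add: fscale_def)

lemma fscale_simps [simp]:
  "fscale 1 c = c" "fscale 0 c = 0" "fscale a 0 = 0" "fscale a (fscale b c) = fscale (a * b) c"
  "fscale (-1) c = - c"
  by (auto simp: fun_eq_iff)

lemma fscale_distrib:
  "fscale a (c + d) = fscale a c + fscale a d" "fscale a (c - d) = fscale a c - fscale a d"
  "fscale a (- c) = - fscale a c"
  by (auto simp: fun_eq_iff algebra_simps)

lemma fscale_sum: "fscale a (\<Sum>i\<in>A. f i) = (\<Sum>i\<in>A. fscale a (f i))"
  by (auto simp: fun_eq_iff sum_fun_apply sum_distrib_left)

lemma fin_span_iff: "c \<in> fin_span X \<longleftrightarrow> finite {x. c x \<noteq> 0} \<and> (\<forall>x. c x \<noteq> 0 \<longrightarrow> x \<in> X)"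
  by (auto simp: fin_span_def)

lemma fin_span_zero [simp, intro]: "0 \<in> fin_span X"
  by (simp add: fin_span_iff)

lemma fin_span_add [intro]:
  assumes "c \<in> fin_span X" "d \<in> fin_span X" shows "c + d \<in> fin_span X"
proof -
  have "{x. (c + d) x \<noteq> 0} \<subseteq> {x. c x \<noteq> 0} \<union> {x. d x \<noteq> 0}" by auto
  with assms show ?thesis unfolding fin_span_iff
    by (metis (no_types, lifting) add.left_neutral finite_UnI finite_subset plus_fun_apply)
qed

lemma fin_span_fscale [intro]:
  assumes "c \<in> fin_span X" shows "fscale a c \<in> fin_span X"
proof -
  have "{x. fscale a c x \<noteq> 0} \<subseteq> {x. c x \<noteq> 0}" by auto
  with assms show ?thesis unfolding fin_span_iff by (auto intro: finite_subset)
qed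

lemma fin_span_uminus [intro]: "c \<in> fin_span X \<Longrightarrow> - c \<in> fin_span X"
  by (simp add: fin_span_iff)

lemma fin_span_diff [intro]: "c \<in> fin_span X \<Longrightarrow> d \<in> fin_span X \<Longrightarrow> c - d \<in> fin_span X"
  using fin_span_add[of c X "- d"] by auto

lemma fin_span_sum [intro]: "(\<And>i. i \<in> A \<Longrightarrow> f i \<in> fin_span X) \<Longrightarrow> (\<Sum>i\<in>A. f i) \<in> fin_span X"
  by (induction A rule: infinite_finite_induct) auto

lemma fin_span_delta [simp]: "delta x \<in> fin_span X \<longleftrightarrow> x \<in> X"
proof -
  have "{y. delta x y \<noteq> 0} = {x}" by (auto simp: delta_def)
  thus ?thesis by (auto simp: fin_span_def)
qed

lemma fin_span_mono: "X \<subseteq> Y \<Longrightarrow> c \<in> fin_span X \<Longrightarrow> c \<in> fin_span Y"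
  by (auto simp: fin_span_iff)

lemma fin_span_supp: "c \<in> fin_span X \<Longrightarrow> c x \<noteq> 0 \<Longrightarrow> x \<in> X"
  by (auto simp: fin_span_iff)

lemma fin_span_decompose:
  assumes "c \<in> fin_span X" shows "c = (\<Sum>x | c x \<noteq> 0. fscale (c x) (delta x))"
proof
  fix y
  have "(\<Sum>x | c x \<noteq> 0. c x * delta x y) = (\<Sum>x | c x \<noteq> 0. if x = y then c x else 0)"
    by (intro sum.cong) (auto simp: delta_def)
  also have "\<dots> = c y" using assms by (subst sum.delta) (auto simp: fin_span_iff)
  finally show "c y = (\<Sum>x | c x \<noteq> 0. fscale (c x) (delta x)) y" by (simp add: sum_fun_apply)
qed

lemma fin_span_induct [consumes 1, case_names zero add]:
  assumes "c \<in> fin_span X"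
    and z: "P 0"
    and s: "\<And>a x d. x \<in> X \<Longrightarrow> d \<in> fin_span X \<Longrightarrow> P d \<Longrightarrow> P (fscale a (delta x) + d)"
  shows "P c"
proof -
  have "P (\<Sum>x\<in>F. fscale (c x) (delta x)) \<and> (\<Sum>x\<in>F. fscale (c x) (delta x)) \<in> fin_span X"
    if "finite F" "F \<subseteq> X" for F
    using that
  proof (induction F rule: finite_induct)
    case empty
    show ?case unfolding sum.empty using z by blast
  next
    case (insert a F)
    hence "a \<in> X" "P (\<Sum>x\<in>F. fscale (c x) (delta x))" "(\<Sum>x\<in>F. fscale (c x) (delta x)) \<in> fin_span X"
      by blast+
    thus ?case unfolding sum.insert[OF insert(1,2)]
      by (intro conjI s fin_span_add fin_span_fscale iffD2[OF fin_span_delta])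
  qed
  moreover have "finite {x. c x \<noteq> 0}" "{x. c x \<noteq> 0} \<subseteq> X" using assms(1) by (auto simp: fin_span_iff)
  ultimately have "P (\<Sum>x | c x \<noteq> 0. fscale (c x) (delta x))" by blast
  thus ?thesis unfolding fin_span_decompose[OF assms(1), symmetric] .
qed

text \<open>Many identities between finitely supported functions are checked by summing them against an
  arbitrary test function, which turns fibre sums into plain substitutions.\<close>

definition integral_of :: "('x \<Rightarrow> complex) \<Rightarrow> ('x \<Rightarrow> complex) \<Rightarrow> complex" where
  "integral_of c \<psi> = (\<Sum>x | c x \<noteq> 0. c x * \<psi> x)"

lemma lin_ext_integral: "lin_ext k c y = integral_of c (\<lambda>x. k x y)"
  by (simp add: lin_ext_def integral_of_def)

lemma integral_of_superset:
  assumes "finite A" "\<And>x. c x \<noteq> 0 \<Longrightarrow> x \<in> A"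
  shows "integral_of c \<psi> = (\<Sum>x\<in>A. c x * \<psi> x)"
  unfolding integral_of_def by (rule sum.mono_neutral_left) (use assms in auto)

lemma integral_of_zero [simp]: "integral_of 0 \<psi> = 0"
  by (simp add: integral_of_def)

lemma integral_of_add:
  assumes "c \<in> fin_span X" "d \<in> fin_span Y"
  shows "integral_of (c + d) \<psi> = integral_of c \<psi> + integral_of d \<psi>"
proof -
  let ?A = "{x. c x \<noteq> 0} \<union> {x. d x \<noteq> 0}"
  have fin: "finite ?A" using assms by (auto simp: fin_span_iff)
  have "integral_of (c + d) \<psi> = (\<Sum>x\<in>?A. (c + d) x * \<psi> x)"
    by (rule integral_of_superset[OF fin]) auto
  moreover have "integral_of c \<psi> = (\<Sum>x\<in>?A. c x * \<psi> x)"
    by (rule integral_of_superset[OF fin]) auto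
  moreover have "integral_of d \<psi> = (\<Sum>x\<in>?A. d x * \<psi> x)"
    by (rule integral_of_superset[OF fin]) auto
  ultimately show ?thesis by (simp add: sum.distrib[symmetric] distrib_right)
qed

lemma integral_of_fscale: "integral_of (fscale a c) \<psi> = a * integral_of c \<psi>"
proof (cases "a = 0")
  case False
  hence "{x. a * c x \<noteq> 0} = {x. c x \<noteq> 0}" by auto
  thus ?thesis by (simp add: integral_of_def sum_distrib_left mult.assoc)
qed auto

lemma integral_of_sum:
  "(\<And>i. i \<in> A \<Longrightarrow> c i \<in> fin_span X) \<Longrightarrow> integral_of (\<Sum>i\<in>A. c i) \<psi> = (\<Sum>i\<in>A. integral_of (c i) \<psi>)"
  by (induction A rule: infinite_finite_induct) (auto simp: integral_of_add[of _ X _ X] fin_span_sum)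

lemma integral_of_delta [simp]: "integral_of (delta x) \<psi> = \<psi> x"
proof -
  have "{y. delta x y \<noteq> 0} = {x}" by (auto simp: delta_def)
  thus ?thesis by (simp add: integral_of_def delta_def)
qed

lemma integral_of_cong: "(\<And>x. c x \<noteq> 0 \<Longrightarrow> \<psi> x = \<theta> x) \<Longrightarrow> integral_of c \<psi> = integral_of c \<theta>"
  by (simp add: integral_of_def)

lemma integral_of_scale_right: "integral_of c (\<lambda>x. a * \<psi> x) = a * integral_of c \<psi>"
  by (simp add: integral_of_def sum_distrib_left algebra_simps)

lemma integral_of_zero_right [simp]: "integral_of c (\<lambda>x. 0) = 0"
  by (simp add: integral_of_def)

lemma integral_of_sum_right: "integral_of c (\<lambda>x. \<Sum>i\<in>A. \<psi> i x) = (\<Sum>i\<in>A. integral_of c (\<psi> i))"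
  unfolding integral_of_def sum_distrib_left by (rule sum.swap)

lemma integral_of_swap:
  "integral_of c (\<lambda>x. integral_of d (\<lambda>y. \<psi> x y)) = integral_of d (\<lambda>y. integral_of c (\<lambda>x. \<psi> x y))"
  unfolding integral_of_def sum_distrib_left
  by (subst sum.swap) (auto intro!: sum.cong simp: algebra_simps)

lemma integral_of_point:
  assumes "c \<in> fin_span X" shows "integral_of c (\<lambda>x. delta x y) = c y"
proof -
  have "integral_of c (\<lambda>x. delta x y) = (\<Sum>x | c x \<noteq> 0. fscale (c x) (delta x)) y"
    by (simp add: integral_of_def sum_fun_apply)
  thus ?thesis using fin_span_decompose[OF assms] by simp
qed

lemma fin_span_eqI:
  assumes "c \<in> fin_span X" "d \<in> fin_span Y" "\<And>\<psi>. integral_of c \<psi> = integral_of d \<psi>"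
  shows "c = d"
  using integral_of_point[OF assms(1)] integral_of_point[OF assms(2)] assms(3) by (intro ext) metis

lemma fin_span_lin_ext [intro]:
  assumes "c \<in> fin_span X" "\<And>x. x \<in> X \<Longrightarrow> k x \<in> fin_span Y"
  shows "lin_ext k c \<in> fin_span Y"
proof -
  have "lin_ext k c = (\<Sum>x | c x \<noteq> 0. fscale (c x) (k x))"
    by (auto simp: lin_ext_def fun_eq_iff sum_fun_apply)
  thus ?thesis using assms by (auto simp: fin_span_iff[of c] intro!: fin_span_sum fin_span_fscale)
qed

lemma integral_of_lin_ext:
  assumes "c \<in> fin_span X" "\<And>x. x \<in> X \<Longrightarrow> k x \<in> fin_span Y"
  shows "integral_of (lin_ext k c) \<psi> = integral_of c (\<lambda>x. integral_of (k x) \<psi>)"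
proof -
  have e: "lin_ext k c = (\<Sum>x | c x \<noteq> 0. fscale (c x) (k x))"
    by (auto simp: lin_ext_def fun_eq_iff sum_fun_apply)
  show ?thesis unfolding e using assms
    by (subst integral_of_sum[where X = Y])
      (auto simp: fin_span_iff[of c] integral_of_fscale integral_of_def[of c] intro!: fin_span_fscale)
qed

lemma lin_ext_add:
  "c \<in> fin_span X \<Longrightarrow> d \<in> fin_span Y \<Longrightarrow> lin_ext k (c + d) = lin_ext k c + lin_ext k d"
  by (auto simp: fun_eq_iff lin_ext_integral integral_of_add)

lemma lin_ext_fscale: "lin_ext k (fscale a c) = fscale a (lin_ext k c)"
  by (auto simp: fun_eq_iff lin_ext_integral integral_of_fscale)

lemma lin_ext_delta [simp]: "lin_ext k (delta x) = k x"
  by (auto simp: fun_eq_iff lin_ext_integral)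

section \<open>Linear maps between spaces of finitely supported functions\<close>

text \<open>The operators below are only controlled on tensors with entries in a given group, so linearity is
  required on the span of \<open>X\<close> and nowhere else.\<close>

definition linear_map :: "'x set \<Rightarrow> 'y set \<Rightarrow> (('x \<Rightarrow> complex) \<Rightarrow> 'y \<Rightarrow> complex) \<Rightarrow> bool" where
  "linear_map X Y f \<longleftrightarrow> (\<forall>c\<in>fin_span X. f c \<in> fin_span Y) \<and>
     (\<forall>c\<in>fin_span X. \<forall>d\<in>fin_span X. f (c + d) = f c + f d) \<and>
     (\<forall>a. \<forall>c\<in>fin_span X. f (fscale a c) = fscale a (f c))"

lemma linear_map_closed: "linear_map X Y f \<Longrightarrow> c \<in> fin_span X \<Longrightarrow> f c \<in> fin_span Y"
  and linear_map_add: "linear_map X Y f \<Longrightarrow> c \<in> fin_span X \<Longrightarrow> d \<in> fin_span X \<Longrightarrow> f (c + d) = f c + f d"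
  and linear_map_fscale: "linear_map X Y f \<Longrightarrow> c \<in> fin_span X \<Longrightarrow> f (fscale a c) = fscale a (f c)"
  by (auto simp: linear_map_def)

lemma linear_map_zero: "linear_map X Y f \<Longrightarrow> f 0 = 0"
  using linear_map_fscale[of X Y f 0 0] by simp

lemma linear_map_uminus: "linear_map X Y f \<Longrightarrow> c \<in> fin_span X \<Longrightarrow> f (- c) = - f c"
  using linear_map_fscale[of X Y f c "-1"] by simp

lemma linear_map_diff:
  "linear_map X Y f \<Longrightarrow> c \<in> fin_span X \<Longrightarrow> d \<in> fin_span X \<Longrightarrow> f (c - d) = f c - f d"
  using linear_map_add[of X Y f c "- d"] linear_map_uminus[of X Y f d] by auto

lemma linear_map_sum:
  "linear_map X Y f \<Longrightarrow> (\<And>i. i \<in> A \<Longrightarrow> c i \<in> fin_span X) \<Longrightarrow> f (\<Sum>i\<in>A. c i) = (\<Sum>i\<in>A. f (c i))"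
  by (induction A rule: infinite_finite_induct)
    (auto simp: linear_map_zero linear_map_add fin_span_sum)

lemma linear_map_eqI:
  assumes "linear_map X Y f" "linear_map X Z g" "\<And>x. x \<in> X \<Longrightarrow> f (delta x) = g (delta x)"
    and "c \<in> fin_span X"
  shows "f c = g c"
  using assms(4)
proof (induction rule: fin_span_induct)
  case zero
  show ?case by (simp only: linear_map_zero[OF assms(1)] linear_map_zero[OF assms(2)])
next
  case (add a x d)
  have m: "fscale a (delta x) \<in> fin_span X" "delta x \<in> fin_span X" using add(1) by auto
  have "f (fscale a (delta x) + d) = fscale a (f (delta x)) + f d"
    unfolding linear_map_add[OF assms(1) m(1) add(2)] linear_map_fscale[OF assms(1) m(2)] ..
  also have "\<dots> = fscale a (g (delta x)) + g d" unfolding assms(3)[OF add(1)] add(3) ..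
  also have "\<dots> = g (fscale a (delta x) + d)"
    unfolding linear_map_add[OF assms(2) m(1) add(2)] linear_map_fscale[OF assms(2) m(2)] ..
  finally show ?case .
qed

lemma linear_map_lin_ext [intro]:
  "(\<And>x. x \<in> X \<Longrightarrow> k x \<in> fin_span Y) \<Longrightarrow> linear_map X Y (lin_ext k)"
  unfolding linear_map_def by (auto simp: lin_ext_add lin_ext_fscale)

lemma linear_map_id: "linear_map X X (\<lambda>c. c)"
  by (auto simp: linear_map_def)

lemma linear_map_const_zero: "linear_map X Y (\<lambda>c. 0)"
  by (auto simp: linear_map_def)

lemma linear_map_comp:
  "linear_map Y Z g \<Longrightarrow> linear_map X Y f \<Longrightarrow> linear_map X Z (\<lambda>c. g (f c))"
  unfolding linear_map_def by auto

lemma linear_map_plus: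
  "linear_map X Y f \<Longrightarrow> linear_map X Y g \<Longrightarrow> linear_map X Y (\<lambda>c. f c + g c)"
  unfolding linear_map_def by (auto simp: algebra_simps fscale_distrib)

lemma linear_map_scaled: "linear_map X Y f \<Longrightarrow> linear_map X Y (\<lambda>c. fscale a (f c))"
  unfolding linear_map_def by (auto simp: fscale_distrib mult.commute)

lemma linear_map_neg: "linear_map X Y f \<Longrightarrow> linear_map X Y (\<lambda>c. - f c)"
  using linear_map_scaled[of X Y f "-1"] by simp

lemma linear_map_minus:
  "linear_map X Y f \<Longrightarrow> linear_map X Y g \<Longrightarrow> linear_map X Y (\<lambda>c. f c - g c)"
  using linear_map_plus[OF _ linear_map_neg, of X Y f g] by simp

lemma linear_map_setsum:
  "(\<And>i. i \<in> A \<Longrightarrow> linear_map X Y (f i)) \<Longrightarrow> linear_map X Y (\<lambda>c. \<Sum>i\<in>A. f i c)"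
  by (induction A rule: infinite_finite_induct)
    (auto simp: linear_map_const_zero intro!: linear_map_plus)

lemma linear_map_mono: "linear_map X Y f \<Longrightarrow> X' \<subseteq> X \<Longrightarrow> Y \<subseteq> Y' \<Longrightarrow> linear_map X' Y' f"
  unfolding linear_map_def by (meson fin_span_mono)

lemma linear_map_mult: "linear_map X X (\<lambda>c x. m x * c x)"
proof -
  have "(\<lambda>x. m x * c x) \<in> fin_span X" if "c \<in> fin_span X" for c
  proof -
    have "{x. m x * c x \<noteq> 0} \<subseteq> {x. c x \<noteq> 0}" by auto
    with that show ?thesis unfolding fin_span_iff by (auto intro: finite_subset)
  qed
  thus ?thesis by (auto simp: linear_map_def fun_eq_iff algebra_simps)
qed

section \<open>Faces and cyclic operators\<close>

text \<open>The tensors to which the bicomplex is applied come from groups and also from a semigroup of labelled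
  group elements, in which the unit is neutral on the left only.\<close>

locale left_unital_semigroup =
  fixes H :: "('h, 'm) monoid_scheme" (structure)
  assumes mult_closed: "x \<in> carrier H \<Longrightarrow> y \<in> carrier H \<Longrightarrow> x \<otimes> y \<in> carrier H"
    and mult_assoc: "x \<in> carrier H \<Longrightarrow> y \<in> carrier H \<Longrightarrow> z \<in> carrier H \<Longrightarrow>
      (x \<otimes> y) \<otimes> z = x \<otimes> (y \<otimes> z)"
    and unit_closed: "\<one> \<in> carrier H"
    and left_unit: "x \<in> carrier H \<Longrightarrow> \<one> \<otimes> x = x"

definition rot :: "'h list \<Rightarrow> 'h list" where
  "rot xs = last xs # butlast xs"

definition rot_map :: "('h list \<Rightarrow> complex) \<Rightarrow> 'h list \<Rightarrow> complex" where
  "rot_map = lin_ext (\<lambda>xs. delta (rot xs))"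

lemma rot_snoc [simp]: "rot (us @ [g]) = g # us"
  by (simp add: rot_def)

lemma length_rot [simp]: "xs \<noteq> [] \<Longrightarrow> length (rot xs) = length xs"
  by (simp add: rot_def)

lemma set_rot [simp]: "xs \<noteq> [] \<Longrightarrow> set (rot xs) = set xs"
  by (cases xs rule: rev_cases) auto

lemma length_rot_iter: "xs \<noteq> [] \<Longrightarrow> length ((rot ^^ k) xs) = length xs"
proof (induction k)
  case (Suc k)
  hence "(rot ^^ k) xs \<noteq> []" by (metis length_0_conv)
  with Suc show ?case by simp
qed simp

lemma rot_full_turn: "xs \<noteq> [] \<Longrightarrow> (rot ^^ length xs) xs = xs"
proof -
  assume ne: "xs \<noteq> []"
  have r: "rotate1 (rot ys) = ys" if "ys \<noteq> []" for ys :: "'a list"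
    using that by (cases ys rule: rev_cases) auto
  have "rotate k ((rot ^^ k) xs) = xs" for k
  proof (induction k)
    case (Suc k)
    have "(rot ^^ k) xs \<noteq> []" using ne length_rot_iter[OF ne, of k] by (metis length_0_conv)
    hence "rotate1 (rot ((rot ^^ k) xs)) = (rot ^^ k) xs" by (rule r)
    thus ?case using Suc by (simp add: rotate_def funpow_swap1[of rotate1])
  qed simp
  from this[of "length xs"] show ?thesis
    by (metis length_rot_iter[OF ne] rotate_length01 rotate_id mod_self)
qed

lemma face_0: "face H 0 (x # y # r) = (x \<otimes>\<^bsub>H\<^esub> y) # r"
  by (simp add: face_def)

lemma face_Suc: "Suc i < length xs \<Longrightarrow> face H (Suc i) (x # xs) = x # face H i xs"
  by (simp add: face_def)

lemma face_last: "Suc (length us) \<le> i \<Longrightarrow> face H i (x # us @ [z]) = (z \<otimes>\<^bsub>H\<^esub> x) # us"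
  by (simp add: face_def)

lemma length_face: "2 \<le> length xs \<Longrightarrow> length (face H i xs) = length xs - 1"
  by (auto simp: face_def)

lemma two_le_lengthE:
  assumes "2 \<le> length xs"
  obtains x us z where "xs = x # us @ [z]"
proof -
  obtain x ys where xy: "xs = x # ys" using assms by (cases xs) auto
  hence "ys \<noteq> []" using assms by auto
  then obtain us z where "ys = us @ [z]" by (cases ys rule: rev_cases) auto
  with xy that show ?thesis by blast
qed

lemma last_face_rot: "2 \<le> length xs \<Longrightarrow> length xs = Suc n \<Longrightarrow> face H n xs = face H 0 (rot xs)"
proof -
  assume l: "2 \<le> length xs" "length xs = Suc n"
  obtain x us z where "xs = x # us @ [z]" by (rule two_le_lengthE[OF l(1)])
  moreover have "rot (x # us @ [z]) = z # x # us" using rot_snoc[of "x # us" z] by simp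
  ultimately show ?thesis using l by (simp add: face_last face_0)
qed

lemma face_append: "Suc i < length us \<Longrightarrow> face H i (us @ vs) = face H i us @ vs"
  by (simp add: face_def nth_append)

lemma face_rot:
  assumes "2 \<le> length xs" "Suc i < length xs"
  shows "face H (Suc i) (rot xs) = rot (face H i xs)"
proof -
  obtain us z where xs: "xs = us @ [z]" using assms by (cases xs rule: rev_cases) auto
  show ?thesis
  proof (cases "Suc i < length us")
    case True
    thus ?thesis by (simp add: xs face_Suc face_append)
  next
    case False
    hence i: "length us = Suc i" using assms xs by auto
    then obtain vs y where us: "us = vs @ [y]" by (cases us rule: rev_cases) auto
    hence "length vs = i" using i by simp
    hence "face H i (vs @ [y] @ [z]) = vs @ [y \<otimes>\<^bsub>H\<^esub> z]"
      by (simp add: face_def nth_append)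
    moreover have "face H (Suc i) (z # vs @ [y]) = (y \<otimes>\<^bsub>H\<^esub> z) # vs"
      using \<open>length vs = i\<close> by (subst face_last) auto
    moreover have "rot (vs @ [y, z]) = z # vs @ [y]" using rot_snoc[of "vs @ [y]" z] by simp
    ultimately show ?thesis by (simp add: xs us)
  qed
qed

lemma face_rot_iter:
  assumes "2 \<le> length xs" "i < length xs"
  shows "face H i ((rot ^^ i) xs) = (rot ^^ i) (face H 0 xs)"
  using assms(2)
proof (induction i)
  case (Suc i)
  have "length ((rot ^^ i) xs) = length xs" using assms by (intro length_rot_iter) auto
  thus ?case using Suc assms(1) by (simp add: face_rot)
qed simp

context left_unital_semigroup begin

lemma face_carrier:
  assumes "2 \<le> length xs" "set xs \<subseteq> carrier H"
  shows "set (face H i xs) \<subseteq> carrier H"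
proof (cases "Suc i < length xs")
  case True
  hence "xs ! i \<in> carrier H" "xs ! Suc i \<in> carrier H" using assms(2) by (auto simp: subset_iff)
  thus ?thesis using True assms set_take_subset[of i xs] set_drop_subset[of "i + 2" xs]
    by (auto simp: face_def mult_closed)
next
  case False
  obtain x us z where xs: "xs = x # us @ [z]" by (rule two_le_lengthE[OF assms(1)])
  have "face H i xs = (z \<otimes> x) # us" unfolding xs using False by (intro face_last) (auto simp: xs)
  thus ?thesis using assms by (auto simp: xs mult_closed)
qed

lemma inner_face_face:
  assumes "i < j" "Suc j < length xs" "set xs \<subseteq> carrier H"
  shows "face H i (face H j xs) = face H (j - 1) (face H i xs)"
  using assms
proof (induction xs arbitrary: i j)
  case (Cons x xs)
  obtain j' where j: "j = Suc j'" using Cons.prems by (cases j) auto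
  obtain y r where xs: "xs = y # r" using Cons.prems by (cases xs) auto
  have j1: "face H j (x # xs) = x # face H j' xs" unfolding j using Cons.prems j by (intro face_Suc) auto
  show ?case
  proof (cases i)
    case 0
    show ?thesis
    proof (cases j')
      case 0
      then obtain z r' where "r = z # r'" using Cons.prems j xs by (cases r) auto
      thus ?thesis using 0 \<open>i = 0\<close> j xs j1 Cons.prems(3) by (simp add: face_0 mult_assoc)
    next
      case (Suc k)
      hence "face H j' xs = y # face H k r" unfolding xs using Cons.prems j xs by (simp add: face_Suc)
      moreover have "face H (Suc k) ((x \<otimes> y) # r) = (x \<otimes> y) # face H k r"
        using Cons.prems j xs Suc by (intro face_Suc) auto
      ultimately show ?thesis using j1 \<open>i = 0\<close> Suc j xs by (simp add: face_0)
    qed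
  next
    case (Suc k)
    have l: "length (face H j' xs) = length xs - 1" using Cons.prems j by (intro length_face) auto
    have l': "length (face H k xs) = length xs - 1" using Cons.prems j Suc by (intro length_face) auto
    have "face H i (face H j (x # xs)) = x # face H k (face H j' xs)"
      unfolding j1 Suc using Cons.prems j Suc l by (intro face_Suc) auto
    also have "\<dots> = x # face H (j' - 1) (face H k xs)" using Cons j Suc by auto
    also have "\<dots> = face H (Suc (j' - 1)) (x # face H k xs)"
      using Cons.prems j Suc l' by (intro face_Suc[symmetric]) auto
    also have "x # face H k xs = face H i (x # xs)" unfolding Suc using Cons.prems j Suc
      by (intro face_Suc[symmetric]) auto
    finally show ?thesis using Cons.prems j Suc by simp
  qed
qed simp

text \<open>The last face is the first one after a rotation, and rotating shifts the index of a face, so the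
  identities that involve the last face follow from the inner ones.\<close>

lemma face_face:
  assumes "i < j" "j < length xs" "3 \<le> length xs" "set xs \<subseteq> carrier H"
  shows "face H i (face H j xs) = face H (j - 1) (face H i xs)"
proof (cases "Suc j < length xs")
  case True
  thus ?thesis using assms by (intro inner_face_face) auto
next
  case False
  define n where "n = length xs - 3"
  with False assms have n: "length xs = Suc (Suc (Suc n))" "j = Suc (Suc n)" by auto
  have len: "length (face H k ys) = Suc (Suc n)" if "length ys = length xs" for k ys
    using that n by (simp add: length_face)
  have ne: "xs \<noteq> []" using assms(3) by auto
  have lr: "length (rot xs) = length xs" "set (rot xs) \<subseteq> carrier H"
    using length_rot[OF ne] set_rot[OF ne] assms(4) by auto
  have last: "face H (j - 1) ys = face H 0 (rot ys)" if "length ys = Suc (Suc n)" for ys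
    using that n by (intro last_face_rot) auto
  have lastj: "face H j ys = face H 0 (rot ys)" if "length ys = length xs" for ys
    using that n by (intro last_face_rot) auto
  have shift: "face H (Suc k) (rot ys) = rot (face H k ys)" if "length ys = length xs" "k < j" for k ys
    using that n by (intro face_rot) auto
  have gen: "face H i (face H j xs) = face H (j - 1) (face H i xs)" if "i < Suc n" for i
  proof -
    have "face H i (face H 0 (rot xs)) = face H 0 (face H (Suc i) (rot xs))"
      using inner_face_face[of 0 "Suc i" "rot xs"] lr n that by simp
    also have "\<dots> = face H 0 (rot (face H i xs))" using that n by (simp add: shift)
    also have "\<dots> = face H (j - 1) (face H i xs)" by (rule last[OF len, symmetric]) simp
    finally show ?thesis by (simp add: lastj)
  qed
  show ?thesis
  proof (cases "i < Suc n")
    case True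
    thus ?thesis by (rule gen)
  next
    case False
    hence i: "i = Suc n" using assms n by auto
    have l0: "length (face H j xs) = Suc (Suc n)" by (rule len) simp
    have "face H i (face H j xs) = face H 0 (rot (face H j xs))" using last[OF l0] i n by simp
    also have "\<dots> = face H 0 (rot (face H 0 (rot xs)))" by (simp only: lastj[OF refl])
    also have "\<dots> = face H 0 (face H 1 (rot (rot xs)))"
      using shift[of "rot xs" 0] lr n by simp
    also have "\<dots> = face H 0 (face H 0 (rot (rot xs)))"
      using inner_face_face[of 0 1 "rot (rot xs)"] lr n
        length_rot[of "rot xs"] set_rot[of "rot xs"] by (simp add: rot_def[of xs])
    also have "\<dots> = face H 0 (face H j (rot xs))" using lastj[of "rot xs"] lr by simp
    also have "\<dots> = face H 0 (rot (face H (Suc n) xs))" using shift[of xs "Suc n"] n by simp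
    also have "\<dots> = face H (j - 1) (face H i xs)" unfolding i by (rule last[OF len, symmetric]) simp
    finally show ?thesis .
  qed
qed

end

section \<open>Operators on chains\<close>

lemma tuples_not_Nil [simp]: "xs \<in> tuples H n \<Longrightarrow> xs \<noteq> []"
  by (auto simp: tuples_def)

lemma rot_tuples: "xs \<in> tuples H n \<Longrightarrow> rot xs \<in> tuples H n"
  by (cases xs rule: rev_cases) (auto simp: tuples_def)

lemma rot_iter_tuples: "xs \<in> tuples H n \<Longrightarrow> (rot ^^ k) xs \<in> tuples H n"
  by (induction k) (auto intro: rot_tuples)

lemma rot_map_delta [simp]: "rot_map (delta xs) = delta (rot xs)"
  by (simp add: rot_map_def)

lemma face_map_delta [simp]: "face_map H i (delta xs) = delta (face H i xs)"
  by (simp add: face_map_def)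

lemma cyc_eq: "cyc n c = fscale ((-1) ^ n) (rot_map c)"
  by (simp add: cyc_def rot_map_def rot_def fun_eq_iff)

lemma cyc_norm_eq: "cyc_norm n c = (\<Sum>i\<le>n. (cyc n ^^ i) c)"
  by (simp add: cyc_norm_def fun_eq_iff sum_fun_apply)

lemma hoch_b_0 [simp]: "hoch_b H 0 c = 0"
  by (simp add: hoch_b_def fun_eq_iff)

lemma hoch_b'_0 [simp]: "hoch_b' H 0 c = 0"
  by (simp add: hoch_b'_def fun_eq_iff)

lemma hoch_b_Suc: "hoch_b H (Suc n) c = (\<Sum>i\<le>Suc n. fscale ((-1) ^ i) (face_map H i c))"
  by (simp add: hoch_b_def fun_eq_iff sum_fun_apply del: sum.atMost_Suc)

lemma hoch_b'_eq: "hoch_b' H n c = (\<Sum>i<n. fscale ((-1) ^ i) (face_map H i c))"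
  by (simp add: hoch_b'_def fun_eq_iff sum_fun_apply)

lemma rot_map_linear: "linear_map (tuples H n) (tuples H n) rot_map"
  unfolding rot_map_def by (rule linear_map_lin_ext) (simp add: rot_tuples)

lemma cyc_linear: "linear_map (tuples H n) (tuples H n) (cyc n)"
  unfolding cyc_eq[abs_def] by (intro linear_map_scaled rot_map_linear)

lemma cyc_iter_linear: "linear_map (tuples H n) (tuples H n) (\<lambda>c. (cyc n ^^ k) c)"
proof (induction k)
  case 0
  show ?case by (simp add: linear_map_id)
next
  case (Suc k)
  show ?case using linear_map_comp[OF cyc_linear Suc] by simp
qed

lemma cyc_norm_linear: "linear_map (tuples H n) (tuples H n) (cyc_norm n)"
  unfolding cyc_norm_eq[abs_def] by (intro linear_map_setsum cyc_iter_linear)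

lemma cyc_iter_delta: "xs \<in> tuples H n \<Longrightarrow> (cyc n ^^ k) (delta xs) = fscale ((-1) ^ (n * k)) (delta ((rot ^^ k) xs))"
proof (induction k)
  case (Suc k)
  have "(cyc n ^^ Suc k) (delta xs) = cyc n (fscale ((-1) ^ (n * k)) (delta ((rot ^^ k) xs)))"
    by (simp only: funpow.simps o_apply Suc.IH[OF Suc.prems])
  also have "\<dots> = fscale ((-1) ^ (n * k)) (cyc n (delta ((rot ^^ k) xs)))"
    by (rule linear_map_fscale[OF cyc_linear[of H]]) (simp add: rot_iter_tuples Suc)
  finally have e: "(cyc n ^^ Suc k) (delta xs) = fscale ((-1) ^ (n * k)) (cyc n (delta ((rot ^^ k) xs)))" .
  have "(-1) ^ (n * k) * (-1) ^ n = ((-1) ^ (n * Suc k) :: complex)" by (simp add: power_add mult.commute)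
  thus ?case unfolding e by (simp only: cyc_eq rot_map_delta fscale_simps funpow.simps o_apply)
qed simp

lemma cyc_full_turn:
  assumes "c \<in> chains H n" shows "(cyc n ^^ Suc n) c = c"
proof (rule linear_map_eqI[OF cyc_iter_linear linear_map_id _ assms[unfolded chains_def]])
  fix xs assume xs: "xs \<in> tuples H n"
  have "(rot ^^ Suc n) xs = xs" using rot_full_turn[of xs] xs by (auto simp: tuples_def)
  moreover have "even (n * Suc n)" by simp
  ultimately show "(cyc n ^^ Suc n) (delta xs) = delta xs"
    unfolding cyc_iter_delta[OF xs] by (simp only: neg_one_even_power fscale_simps)
qed

lemma cyc_closed: "c \<in> chains H n \<Longrightarrow> cyc n c \<in> chains H n"
  unfolding chains_def by (rule linear_map_closed[OF cyc_linear])

lemma cyc_iter_closed: "c \<in> chains H n \<Longrightarrow> (cyc n ^^ k) c \<in> chains H n"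
  unfolding chains_def by (rule linear_map_closed[OF cyc_iter_linear])

lemma cyc_norm_closed: "c \<in> chains H n \<Longrightarrow> cyc_norm n c \<in> chains H n"
  unfolding chains_def by (rule linear_map_closed[OF cyc_norm_linear])

lemma cyc_sum_shift:
  assumes "c \<in> chains H n"
  shows "(\<Sum>i\<le>n. (cyc n ^^ Suc i) c) = cyc_norm n c"
proof -
  have "(\<Sum>i\<le>n. (cyc n ^^ Suc i) c) + c = (\<Sum>i\<le>Suc n. (cyc n ^^ i) c)"
    by (subst sum.atMost_Suc_shift) simp
  also have "\<dots> = cyc_norm n c + c" using cyc_full_turn[OF assms] by (simp add: cyc_norm_eq)
  finally show ?thesis by simp
qed

lemma cyc_norm_cyc:
  assumes "c \<in> chains H n" shows "cyc_norm n (cyc n c) = cyc_norm n c"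
  using cyc_sum_shift[OF assms] by (simp add: cyc_norm_eq[of n "cyc n c"] funpow_swap1)

lemma cyc_cyc_norm:
  assumes "c \<in> chains H n" shows "cyc n (cyc_norm n c) = cyc_norm n c"
proof -
  have "cyc n (cyc_norm n c) = (\<Sum>i\<le>n. cyc n ((cyc n ^^ i) c))" unfolding cyc_norm_eq
    by (rule linear_map_sum[OF cyc_linear[of H]]) (use cyc_iter_closed[OF assms] in \<open>simp add: chains_def\<close>)
  thus ?thesis using cyc_sum_shift[OF assms] by simp
qed

lemma cyc_iter_cyc_norm: "c \<in> chains H n \<Longrightarrow> (cyc n ^^ i) (cyc_norm n c) = cyc_norm n c"
  by (induction i) (simp_all add: cyc_cyc_norm)

lemma cyc_norm_cyc_iter: "c \<in> chains H n \<Longrightarrow> cyc_norm n ((cyc n ^^ i) c) = cyc_norm n c"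
  by (induction i) (simp_all add: cyc_norm_cyc[OF cyc_iter_closed])

text \<open>The double sums of faces cancel in pairs: the term \<open>(i, j)\<close> with \<open>i < j\<close> is cancelled by
  \<open>(j - 1, i)\<close>.\<close>

lemma alternating_double_sum:
  fixes a :: "nat \<Rightarrow> nat \<Rightarrow> 'x \<Rightarrow> complex"
  assumes "\<And>i j. i < j \<Longrightarrow> j \<le> Suc m \<Longrightarrow> a i j = a (j - 1) i"
  shows "(\<Sum>i\<le>m. \<Sum>j\<le>Suc m. fscale ((-1) ^ (i + j)) (a i j)) = 0"
proof -
  let ?f = "\<lambda>(i, j). fscale ((-1) ^ (i + j)) (a i j)"
  let ?L = "{(i, j). i \<le> m \<and> j \<le> Suc m \<and> i < j}" and ?U = "{(i, j). i \<le> m \<and> j \<le> i}"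
  have fin: "finite ?L" "finite ?U"
    by (rule finite_subset[of _ "{..m} \<times> {..Suc m}"]; auto)+
  have "(\<Sum>i\<le>m. \<Sum>j\<le>Suc m. fscale ((-1) ^ (i + j)) (a i j)) = sum ?f ({..m} \<times> {..Suc m})"
    by (rule sum.cartesian_product)
  also have "{..m} \<times> {..Suc m} = ?L \<union> ?U" by auto
  also have "sum ?f (?L \<union> ?U) = sum ?f ?L + sum ?f ?U" using fin by (intro sum.union_disjoint) auto
  also have "sum ?f ?L = sum (\<lambda>p. - ?f p) ?U"
  proof (rule sum.reindex_bij_witness[where j = "\<lambda>(i, j). (j - 1, i)" and i = "\<lambda>(i, j). (j, Suc i)"])
    fix p assume "p \<in> ?L"
    then obtain i j where p: "p = (i, Suc j)" "i \<le> j" "j \<le> m"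
      by (cases p, cases "snd p") auto
    hence "a i (Suc j) = a j i" using assms[of i "Suc j"] by simp
    thus "- (case (case p of (i, j) \<Rightarrow> (j - 1, i)) of (i, j) \<Rightarrow> fscale ((-1) ^ (i + j)) (a i j)) =
      (case p of (i, j) \<Rightarrow> fscale ((-1) ^ (i + j)) (a i j))"
      by (simp add: p fun_eq_iff add.commute)
  qed auto
  also have "\<dots> = - sum ?f ?U" by (simp add: sum_negf)
  also have "- sum ?f ?U + sum ?f ?U = 0" by simp
  finally show ?thesis .
qed

context left_unital_semigroup begin

lemma face_tuples: "xs \<in> tuples H (Suc n) \<Longrightarrow> face H i xs \<in> tuples H n"
  using face_carrier[of xs i] length_face[of xs H i] by (auto simp: tuples_def)

lemma face_map_linear: "linear_map (tuples H (Suc n)) (tuples H n) (face_map H i)"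
  unfolding face_map_def by (rule linear_map_lin_ext) (simp add: face_tuples)

lemma hoch_b_Suc_linear: "linear_map (tuples H (Suc n)) (tuples H n) (hoch_b H (Suc n))"
  unfolding hoch_b_Suc[abs_def] by (intro linear_map_setsum linear_map_scaled face_map_linear)

lemma hoch_b'_Suc_linear: "linear_map (tuples H (Suc n)) (tuples H n) (hoch_b' H (Suc n))"
  unfolding hoch_b'_eq[abs_def] by (intro linear_map_setsum linear_map_scaled face_map_linear)

lemma hoch_b_linear: "linear_map (tuples H n) (tuples H (n - 1)) (hoch_b H n)"
  using hoch_b_Suc_linear[of "n - 1"] linear_map_const_zero by (cases n) (auto simp: hoch_b_0[abs_def])

lemma hoch_b'_linear: "linear_map (tuples H n) (tuples H (n - 1)) (hoch_b' H n)"
  using hoch_b'_Suc_linear[of "n - 1"] linear_map_const_zero by (cases n) (auto simp: hoch_b'_0[abs_def])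

lemma hoch_b_closed: "c \<in> chains H n \<Longrightarrow> hoch_b H n c \<in> chains H (n - 1)"
  unfolding chains_def by (rule linear_map_closed[OF hoch_b_linear])

lemma hoch_b'_closed: "c \<in> chains H n \<Longrightarrow> hoch_b' H n c \<in> chains H (n - 1)"
  unfolding chains_def by (rule linear_map_closed[OF hoch_b'_linear])

lemma face_map_closed: "c \<in> chains H (Suc n) \<Longrightarrow> face_map H i c \<in> chains H n"
  unfolding chains_def by (rule linear_map_closed[OF face_map_linear])

lemma face_map_face_map:
  assumes "c \<in> chains H (Suc (Suc n))" "i < j" "j \<le> Suc (Suc n)"
  shows "face_map H i (face_map H j c) = face_map H (j - 1) (face_map H i c)"
  by (rule linear_map_eqI[OF linear_map_comp[OF face_map_linear face_map_linear]
        linear_map_comp[OF face_map_linear face_map_linear] _ assms(1)[unfolded chains_def]])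
    (use assms in \<open>auto simp: tuples_def face_face\<close>)

lemma double_face_sum:
  assumes c: "c \<in> chains H (Suc (Suc n))"
  shows "(\<Sum>i\<in>I. fscale ((-1) ^ i) (face_map H i (\<Sum>j\<in>J. fscale ((-1) ^ j) (face_map H j c)))) =
    (\<Sum>i\<in>I. \<Sum>j\<in>J. fscale ((-1) ^ (i + j)) (face_map H i (face_map H j c)))"
proof (rule sum.cong)
  fix i
  have f: "face_map H j c \<in> fin_span (tuples H (Suc n))" for j
    using face_map_closed[OF c] by (simp add: chains_def)
  have "face_map H i (\<Sum>j\<in>J. fscale ((-1) ^ j) (face_map H j c)) =
    (\<Sum>j\<in>J. face_map H i (fscale ((-1) ^ j) (face_map H j c)))"
    using f by (intro linear_map_sum[OF face_map_linear]) auto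
  also have "\<dots> = (\<Sum>j\<in>J. fscale ((-1) ^ j) (face_map H i (face_map H j c)))"
    using f by (intro sum.cong refl linear_map_fscale[OF face_map_linear]) auto
  finally show "fscale ((-1) ^ i) (face_map H i (\<Sum>j\<in>J. fscale ((-1) ^ j) (face_map H j c))) =
    (\<Sum>j\<in>J. fscale ((-1) ^ (i + j)) (face_map H i (face_map H j c)))"
    by (simp add: fscale_sum power_add)
qed simp

lemma hoch_b_hoch_b:
  assumes c: "c \<in> chains H n" shows "hoch_b H (n - 1) (hoch_b H n c) = 0"
proof (cases "n < 2")
  case True
  thus ?thesis by (cases n) auto
next
  case False
  then obtain m where n: "n = Suc (Suc m)" by (metis add_2_eq_Suc not_less le_Suc_ex)
  show ?thesis unfolding n diff_Suc_1 hoch_b_Suc double_face_sum[OF c[unfolded n]]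
    by (rule alternating_double_sum) (rule face_map_face_map[OF c[unfolded n]])
qed

lemma hoch_b'_hoch_b':
  assumes c: "c \<in> chains H n" shows "hoch_b' H (n - 1) (hoch_b' H n c) = 0"
proof (cases "n < 2")
  case True
  thus ?thesis by (cases n) auto
next
  case False
  then obtain m where n: "n = Suc (Suc m)" by (metis add_2_eq_Suc not_less le_Suc_ex)
  show ?thesis unfolding n diff_Suc_1 hoch_b'_eq lessThan_Suc_atMost double_face_sum[OF c[unfolded n]]
    by (rule alternating_double_sum) (rule face_map_face_map[OF c[unfolded n]], auto)
qed

lemma face_map_cyc:
  assumes c: "c \<in> chains H (Suc n)" and i: "i \<le> n"
  shows "face_map H (Suc i) (cyc (Suc n) c) = - cyc n (face_map H i c)"
proof (rule linear_map_eqI[OF linear_map_comp[OF face_map_linear cyc_linear]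
      linear_map_neg[OF linear_map_comp[OF cyc_linear face_map_linear]] _ c[unfolded chains_def]])
  fix xs assume xs: "xs \<in> tuples H (Suc n)"
  have "face H (Suc i) (rot xs) = rot (face H i xs)"
    using xs i by (intro face_rot) (auto simp: tuples_def)
  moreover have "face_map H (Suc i) (fscale ((-1) ^ Suc n) (delta (rot xs))) =
      fscale ((-1) ^ Suc n) (face_map H (Suc i) (delta (rot xs)))"
    by (rule linear_map_fscale[OF face_map_linear[of n]]) (simp add: rot_tuples[OF xs])
  ultimately show "face_map H (Suc i) (cyc (Suc n) (delta xs)) = - cyc n (face_map H i (delta xs))"
    by (simp add: cyc_eq) (simp add: fun_eq_iff)
qed

lemma face_map_0_cyc:
  assumes c: "c \<in> chains H (Suc n)"
  shows "face_map H 0 (cyc (Suc n) c) = fscale ((-1) ^ Suc n) (face_map H (Suc n) c)"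
proof (rule linear_map_eqI[OF linear_map_comp[OF face_map_linear cyc_linear]
      linear_map_scaled[OF face_map_linear] _ c[unfolded chains_def]])
  fix xs assume xs: "xs \<in> tuples H (Suc n)"
  have "face H (Suc n) xs = face H 0 (rot xs)"
    using xs by (intro last_face_rot) (auto simp: tuples_def)
  moreover have "face_map H 0 (fscale ((-1) ^ Suc n) (delta (rot xs))) =
      fscale ((-1) ^ Suc n) (face_map H 0 (delta (rot xs)))"
    by (rule linear_map_fscale[OF face_map_linear[of n]]) (simp add: rot_tuples[OF xs])
  ultimately show "face_map H 0 (cyc (Suc n) (delta xs)) = fscale ((-1) ^ Suc n) (face_map H (Suc n) (delta xs))"
    by (simp add: cyc_eq)
qed

lemma hoch_b_split:
  "hoch_b H (Suc n) c = hoch_b' H (Suc n) c + fscale ((-1) ^ Suc n) (face_map H (Suc n) c)"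
  by (simp add: hoch_b_Suc hoch_b'_eq lessThan_Suc_atMost)

text \<open>A rotation shifts the index of a face by one; the first face of a rotated tensor is the last face,
  which is the one by which \<open>b\<close> differs from \<open>b'\<close>.\<close>

lemma hoch_b_one_minus_cyc:
  assumes c: "c \<in> chains H n"
  shows "hoch_b H n (c - cyc n c) = hoch_b' H n c - cyc (n - 1) (hoch_b' H n c)"
proof (cases n)
  case 0
  thus ?thesis using linear_map_zero[OF cyc_linear[of H 0]] by simp
next
  case (Suc m)
  have c: "c \<in> chains H (Suc m)" using c Suc by simp
  have f: "face_map H i c \<in> fin_span (tuples H m)" for i
    using face_map_closed[OF c] by (simp add: chains_def)
  have "hoch_b H (Suc m) (cyc (Suc m) c) = face_map H 0 (cyc (Suc m) c) +
      (\<Sum>i\<le>m. fscale ((-1) ^ Suc i) (face_map H (Suc i) (cyc (Suc m) c)))"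
    by (simp add: hoch_b_Suc sum.atMost_Suc_shift del: sum.atMost_Suc power_Suc)
  also have "(\<Sum>i\<le>m. fscale ((-1) ^ Suc i) (face_map H (Suc i) (cyc (Suc m) c))) =
      (\<Sum>i\<le>m. fscale ((-1) ^ i) (cyc m (face_map H i c)))"
    by (intro sum.cong) (auto simp: face_map_cyc[OF c] fun_eq_iff)
  also have "\<dots> = (\<Sum>i\<le>m. cyc m (fscale ((-1) ^ i) (face_map H i c)))"
    by (intro sum.cong refl linear_map_fscale[OF cyc_linear[of H], symmetric] f)
  also have "\<dots> = cyc m (hoch_b' H (Suc m) c)" unfolding hoch_b'_eq lessThan_Suc_atMost
    by (intro linear_map_sum[OF cyc_linear[of H], symmetric] fin_span_fscale f)
  finally have t: "hoch_b H (Suc m) (cyc (Suc m) c) = face_map H 0 (cyc (Suc m) c) + cyc m (hoch_b' H (Suc m) c)" .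
  have "hoch_b H (Suc m) (cyc (Suc m) c) =
      hoch_b H (Suc m) c - hoch_b' H (Suc m) c + cyc m (hoch_b' H (Suc m) c)"
    unfolding t hoch_b_split[of m c] face_map_0_cyc[OF c] by (simp add: fun_eq_iff)
  moreover have "hoch_b H (Suc m) (c - cyc (Suc m) c) =
      hoch_b H (Suc m) c - hoch_b H (Suc m) (cyc (Suc m) c)"
    using c cyc_closed[OF c] by (intro linear_map_diff[OF hoch_b_Suc_linear]) (auto simp: chains_def)
  ultimately show ?thesis by (simp add: Suc)
qed

text \<open>This writes every signed face in terms of the first one, so that an alternating sum of faces becomes a
  sum over powers of the cyclic operator.\<close>

lemma signed_face_conjugate:
  assumes c: "c \<in> chains H (Suc n)" and i: "i \<le> Suc n"
  shows "fscale ((-1) ^ i) (face_map H i ((cyc (Suc n) ^^ i) c)) = (cyc n ^^ i) (face_map H 0 c)"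
proof (rule linear_map_eqI[OF linear_map_scaled[OF linear_map_comp[OF face_map_linear cyc_iter_linear]]
      linear_map_comp[OF cyc_iter_linear face_map_linear] _ c[unfolded chains_def]])
  fix xs assume xs: "xs \<in> tuples H (Suc n)"
  have "face H i ((rot ^^ i) xs) = (rot ^^ i) (face H 0 xs)"
    using xs i by (intro face_rot_iter) (auto simp: tuples_def)
  moreover have "face_map H i (fscale ((-1) ^ (Suc n * i)) (delta ((rot ^^ i) xs))) =
      fscale ((-1) ^ (Suc n * i)) (face_map H i (delta ((rot ^^ i) xs)))"
    by (rule linear_map_fscale[OF face_map_linear[of n]]) (simp add: rot_iter_tuples[OF xs])
  moreover have "(-1) ^ i * (-1) ^ (Suc n * i) = ((-1) ^ (n * i) :: complex)"
    by (simp add: power_add flip: mult.assoc power_mult_distrib)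
  ultimately show "fscale ((-1) ^ i) (face_map H i ((cyc (Suc n) ^^ i) (delta xs))) =
      (cyc n ^^ i) (face_map H 0 (delta xs))"
    by (simp add: cyc_iter_delta[OF xs] cyc_iter_delta[OF face_tuples[OF xs]] del: mult_Suc)
qed

text \<open>By the previous lemma \<open>b' = \<Sum>\<^sub>i t\<^sup>i d\<^sub>0 t\<^sup>-\<^sup>i\<close> over \<open>i < n\<close>, and \<open>b\<close> is the same sum over \<open>i \<le> n\<close>. As the norm
  \<open>N\<close> absorbs \<open>t\<close>, both sides are equal to \<open>N d\<^sub>0 N\<close>.\<close>

lemma hoch_b'_cyc_norm:
  assumes c: "c \<in> chains H n"
  shows "hoch_b' H n (cyc_norm n c) = cyc_norm (n - 1) (hoch_b H n c)"
proof (cases n)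
  case 0
  thus ?thesis using linear_map_zero[OF cyc_norm_linear[of H 0]] by simp
next
  case (Suc m)
  have c: "c \<in> chains H (Suc m)" using c Suc by simp
  let ?N = "cyc_norm (Suc m) c"
  have N: "?N \<in> chains H (Suc m)" by (rule cyc_norm_closed[OF c])
  have "hoch_b' H (Suc m) ?N = (\<Sum>i\<le>m. (cyc m ^^ i) (face_map H 0 ?N))"
    unfolding hoch_b'_eq lessThan_Suc_atMost
  proof (rule sum.cong)
    fix i assume "i \<in> {..m}"
    thus "fscale ((-1) ^ i) (face_map H i ?N) = (cyc m ^^ i) (face_map H 0 ?N)"
      using signed_face_conjugate[OF N, of i] by (simp add: cyc_iter_cyc_norm[OF c])
  qed simp
  hence L: "hoch_b' H (Suc m) ?N = cyc_norm m (face_map H 0 ?N)" by (simp add: cyc_norm_eq)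
  let ?k = "\<lambda>i. Suc (Suc m) - i"
  have t: "(cyc (Suc m) ^^ k) c \<in> chains H (Suc m)" for k by (rule cyc_iter_closed[OF c])
  have f0: "face_map H 0 ((cyc (Suc m) ^^ k) c) \<in> chains H m" for k by (rule face_map_closed[OF t])
  have signed: "fscale ((-1) ^ i) (face_map H i c) = (cyc m ^^ i) (face_map H 0 ((cyc (Suc m) ^^ ?k i) c))"
    if "i \<le> Suc m" for i
  proof -
    have "(cyc (Suc m) ^^ i) ((cyc (Suc m) ^^ ?k i) c) = (cyc (Suc m) ^^ (i + ?k i)) c"
      by (simp add: funpow_add)
    also have "i + ?k i = Suc (Suc m)" using that by simp
    also have "(cyc (Suc m) ^^ Suc (Suc m)) c = c" by (rule cyc_full_turn[OF c])
    finally show ?thesis using signed_face_conjugate[OF t that, of "?k i"] by simp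
  qed
  have "cyc_norm m (hoch_b H (Suc m) c) =
      (\<Sum>i\<le>Suc m. cyc_norm m (fscale ((-1) ^ i) (face_map H i c)))"
    unfolding hoch_b_Suc using face_map_closed[OF c]
    by (intro linear_map_sum[OF cyc_norm_linear[of H]] fin_span_fscale) (simp add: chains_def)
  also have "\<dots> = (\<Sum>i\<le>Suc m. cyc_norm m (face_map H 0 ((cyc (Suc m) ^^ ?k i) c)))"
    by (intro sum.cong refl) (simp only: atMost_iff signed cyc_norm_cyc_iter[OF f0])
  also have "\<dots> = cyc_norm m (face_map H 0 (\<Sum>i\<le>Suc m. (cyc (Suc m) ^^ ?k i) c))"
    using t by (intro linear_map_sum[OF linear_map_comp[OF cyc_norm_linear face_map_linear], symmetric])
      (simp add: chains_def)
  also have "(\<Sum>i\<le>Suc m. (cyc (Suc m) ^^ ?k i) c) = (\<Sum>i\<le>Suc m. (cyc (Suc m) ^^ Suc i) c)"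
    by (rule sum.reindex_bij_witness[of _ "\<lambda>i. Suc m - i" "\<lambda>i. Suc m - i"]) (auto simp: Suc_diff_le)
  also have "\<dots> = ?N" by (rule cyc_sum_shift[OF c])
  finally show ?thesis using L by (simp add: Suc)
qed

lemma contr_delta [simp]: "contr H (delta xs) = delta (\<one> # xs)"
  by (simp add: contr_def)

lemma contr_linear: "linear_map (tuples H n) (tuples H (Suc n)) (contr H)"
  unfolding contr_def by (rule linear_map_lin_ext) (auto simp: tuples_def unit_closed)

lemma contr_closed: "c \<in> chains H n \<Longrightarrow> contr H c \<in> chains H (Suc n)"
  unfolding chains_def by (rule linear_map_closed[OF contr_linear])

lemma face_map_0_contr: "c \<in> chains H n \<Longrightarrow> face_map H 0 (contr H c) = c"
proof (unfold chains_def, erule linear_map_eqI[rotated -1, OF _ linear_map_comp[OF face_map_linear contr_linear] linear_map_id])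
  fix xs assume "xs \<in> tuples H n"
  thus "face_map H 0 (contr H (delta xs)) = delta xs"
    by (cases xs) (auto simp: tuples_def face_0 left_unit)
qed

lemma face_map_Suc_contr:
  assumes c: "c \<in> chains H (Suc n)" and i: "i < Suc n"
  shows "face_map H (Suc i) (contr H c) = contr H (face_map H i c)"
  by (rule linear_map_eqI[OF linear_map_comp[OF face_map_linear contr_linear]
      linear_map_comp[OF contr_linear face_map_linear] _ c[unfolded chains_def]])
   (use i in \<open>auto simp: tuples_def face_Suc\<close>)

lemma hoch_b'_contr:
  assumes c: "c \<in> chains H n"
  shows "hoch_b' H (Suc n) (contr H c) + contr H (hoch_b' H n c) = c"
proof -
  have f: "contr H (hoch_b' H n c) = (\<Sum>i<n. fscale ((-1) ^ i) (face_map H (Suc i) (contr H c)))"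
  proof (cases n)
    case 0
    thus ?thesis using linear_map_zero[OF contr_linear] by simp
  next
    case (Suc m)
    have fm: "face_map H i c \<in> fin_span (tuples H m)" for i
      using face_map_closed c Suc by (simp add: chains_def)
    have "contr H (hoch_b' H n c) = (\<Sum>i<n. contr H (fscale ((-1) ^ i) (face_map H i c)))"
      unfolding hoch_b'_eq by (intro linear_map_sum[OF contr_linear[of m]] fin_span_fscale fm)
    also have "\<dots> = (\<Sum>i<n. fscale ((-1) ^ i) (contr H (face_map H i c)))"
      by (intro sum.cong refl linear_map_fscale[OF contr_linear[of m]] fm)
    also have "\<dots> = (\<Sum>i<n. fscale ((-1) ^ i) (face_map H (Suc i) (contr H c)))"
      using c Suc by (intro sum.cong refl) (simp add: face_map_Suc_contr)
    finally show ?thesis .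
  qed
  have "hoch_b' H (Suc n) (contr H c) = face_map H 0 (contr H c) +
      (\<Sum>i<n. fscale ((-1) ^ Suc i) (face_map H (Suc i) (contr H c)))"
    by (simp add: hoch_b'_eq sum.lessThan_Suc_shift del: sum.lessThan_Suc power_Suc)
  also have "(\<Sum>i<n. fscale ((-1) ^ Suc i) (face_map H (Suc i) (contr H c))) = - contr H (hoch_b' H n c)"
    unfolding f sum_negf[symmetric] by (intro sum.cong) (auto simp: fun_eq_iff)
  finally show ?thesis unfolding face_map_0_contr[OF c] by (simp add: fun_eq_iff)
qed

end

section \<open>The total complex of the cyclic bicomplex\<close>

text \<open>With the parity of the column built into the two differentials, the identities of the bicomplex
  read the same in even and in odd columns.\<close>

definition vert :: "('h, 'm) monoid_scheme \<Rightarrow> nat \<Rightarrow> nat \<Rightarrow> ('h list \<Rightarrow> complex) \<Rightarrow> 'h list \<Rightarrow> complex" where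
  "vert H p n c = (if even p then hoch_b H n c else - hoch_b' H n c)"

definition horiz :: "nat \<Rightarrow> nat \<Rightarrow> ('h list \<Rightarrow> complex) \<Rightarrow> 'h list \<Rightarrow> complex" where
  "horiz p n c = (if even p then c - cyc n c else cyc_norm n c)"

lemma column_add [simp]: "column (z + w) p = column z p + column w p"
  and column_diff [simp]: "column (z - w) p = column z p - column w p"
  and column_zero [simp]: "column 0 p = 0"
  and column_fscale [simp]: "column (fscale a z) p = fscale a (column z p)"
  by (auto simp: column_def fun_eq_iff)

lemma column_eqI: "(\<And>p. column z p = column w p) \<Longrightarrow> z = w"
  by (auto simp: column_def fun_eq_iff)

lemma column_tot_d:
  "column (tot_d H n z) p = (if p < n then vert H p (n - p) (column z p) +
     horiz p (n - p - 1) (column z (Suc p)) else 0)"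
  by (auto simp: column_def tot_d_def vert_def horiz_def fun_eq_iff)

lemma tot_chains_iff:
  "z \<in> tot_chains H n \<longleftrightarrow> (\<forall>p\<le>n. column z p \<in> chains H (n - p)) \<and> (\<forall>p>n. column z p = 0)"
  (is "_ \<longleftrightarrow> ?R")
proof
  assume z: "z \<in> tot_chains H n"
  hence fin: "finite {x. z x \<noteq> 0}" and s: "{x. z x \<noteq> 0} \<subseteq> {(p, xs). p \<le> n \<and> xs \<in> tuples H (n - p)}"
    by (auto simp: tot_chains_def fin_span_def)
  have "finite {xs. z (p, xs) \<noteq> 0}" for p
    by (rule finite_surj[OF fin, of _ snd]) force
  thus ?R using s by (auto simp: chains_def fin_span_def column_def fun_eq_iff)
next
  assume R: ?R
  have s: "p \<le> n \<and> xs \<in> tuples H (n - p)" if "z (p, xs) \<noteq> 0" for p xs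
  proof
    show p: "p \<le> n" using R that by (metis column_def not_le zero_fun_apply)
    show "xs \<in> tuples H (n - p)" using R p that fin_span_supp[of "column z p" _ xs]
      by (auto simp: chains_def column_def)
  qed
  hence "{x. z x \<noteq> 0} \<subseteq> (\<Union>p\<in>{..n}. Pair p ` {xs. column z p xs \<noteq> 0})"
    by (auto simp: column_def)
  moreover have "finite (\<Union>p\<in>{..n}. Pair p ` {xs. column z p xs \<noteq> 0})"
    using R by (auto simp: chains_def fin_span_def)
  ultimately show "z \<in> tot_chains H n"
    unfolding tot_chains_def fin_span_def using s by (auto dest: finite_subset)
qed

lemma horiz_linear: "linear_map (tuples H n) (tuples H n) (horiz p n)"
  unfolding horiz_def[abs_def]
  by (cases "even p") (auto intro!: linear_map_minus linear_map_id cyc_linear cyc_norm_linear)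

lemma horiz_closed: "c \<in> chains H n \<Longrightarrow> horiz p n c \<in> chains H n"
  unfolding chains_def by (rule linear_map_closed[OF horiz_linear])

lemma horiz_zero [simp]: "horiz p n 0 = 0"
  by (rule linear_map_zero[OF horiz_linear])

lemma horiz_horiz:
  assumes "c \<in> chains H n" shows "horiz p n (horiz (Suc p) n c) = 0"
proof (cases "even p")
  case True
  thus ?thesis by (simp add: horiz_def cyc_cyc_norm[OF assms])
next
  case False
  have "cyc_norm n (c - cyc n c) = cyc_norm n c - cyc_norm n (cyc n c)"
    using assms cyc_closed[OF assms] by (intro linear_map_diff[OF cyc_norm_linear[of H]]) (auto simp: chains_def)
  thus ?thesis using False by (simp add: horiz_def cyc_norm_cyc[OF assms])
qed

definition single_column :: "nat \<Rightarrow> ('h list \<Rightarrow> complex) \<Rightarrow> nat \<times> 'h list \<Rightarrow> complex" where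
  "single_column q c = (\<lambda>(p, xs). if p = q then c xs else 0)"

lemma column_single_column [simp]: "column (single_column q c) p = (if p = q then c else 0)"
  by (auto simp: column_def single_column_def fun_eq_iff)

lemma single_column_tot_chains:
  "c \<in> chains H (n - q) \<Longrightarrow> q \<le> n \<Longrightarrow> single_column q c \<in> tot_chains H n"
  by (auto simp: tot_chains_iff chains_def)

lemma chains_zero [simp]: "0 \<in> chains H n"
  and chains_add: "c \<in> chains H n \<Longrightarrow> d \<in> chains H n \<Longrightarrow> c + d \<in> chains H n"
  and chains_diff: "c \<in> chains H n \<Longrightarrow> d \<in> chains H n \<Longrightarrow> c - d \<in> chains H n"
  by (auto simp: chains_def)

lemma tot_chains_zero [simp]: "0 \<in> tot_chains H n"
  and tot_chains_add: "z \<in> tot_chains H n \<Longrightarrow> w \<in> tot_chains H n \<Longrightarrow> z + w \<in> tot_chains H n"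
  and tot_chains_diff: "z \<in> tot_chains H n \<Longrightarrow> w \<in> tot_chains H n \<Longrightarrow> z - w \<in> tot_chains H n"
  by (auto simp: tot_chains_def)

lemma column_chains: "z \<in> tot_chains H n \<Longrightarrow> p \<le> n \<Longrightarrow> column z p \<in> chains H (n - p)"
  by (auto simp: tot_chains_iff)

context left_unital_semigroup begin

lemma vert_linear: "linear_map (tuples H n) (tuples H (n - 1)) (vert H p n)"
  unfolding vert_def[abs_def] by (cases "even p") (simp_all add: hoch_b_linear linear_map_neg hoch_b'_linear del: One_nat_def)

lemma vert_closed: "c \<in> chains H n \<Longrightarrow> vert H p n c \<in> chains H (n - 1)"
  unfolding chains_def by (rule linear_map_closed[OF vert_linear])

lemma vert_zero [simp]: "vert H p n 0 = 0"
  by (rule linear_map_zero[OF vert_linear])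

lemma vert_vert: "c \<in> chains H n \<Longrightarrow> vert H p (n - 1) (vert H p n c) = 0"
  using linear_map_uminus[OF hoch_b'_linear[of "n - 1"], of "hoch_b' H n c"] hoch_b'_closed[of c n]
  by (cases "even p") (simp_all add: vert_def hoch_b_hoch_b[unfolded chains_def] hoch_b'_hoch_b'[unfolded chains_def] chains_def
        del: One_nat_def)

lemma vert_horiz:
  assumes c: "c \<in> chains H n"
  shows "vert H p n (horiz p n c) + horiz p (n - 1) (vert H (Suc p) n c) = 0"
proof (cases "even p")
  case True
  have "cyc (n - 1) (- hoch_b' H n c) = - cyc (n - 1) (hoch_b' H n c)"
    using hoch_b'_closed[OF c] by (intro linear_map_uminus[OF cyc_linear[of H]]) (simp add: chains_def)
  thus ?thesis using True by (simp add: vert_def horiz_def hoch_b_one_minus_cyc[OF c])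
next
  case False
  thus ?thesis by (simp add: vert_def horiz_def hoch_b'_cyc_norm[OF c])
qed

lemma tot_d_linear:
  "linear_map {(p, xs). p \<le> n \<and> xs \<in> tuples H (n - p)} {(p, xs). p \<le> n - 1 \<and> xs \<in> tuples H (n - 1 - p)} (tot_d H n)"
proof -
  have cl: "tot_d H n z \<in> tot_chains H (n - 1)" if z: "z \<in> tot_chains H n" for z
    unfolding tot_chains_iff
  proof (intro conjI allI impI)
    fix p assume p: "p \<le> n - 1"
    show "column (tot_d H n z) p \<in> chains H (n - 1 - p)"
    proof (cases "p < n")
      case True
      hence "column z p \<in> chains H (n - p)" "column z (Suc p) \<in> chains H (n - p - 1)"
        using column_chains[OF z, of p] column_chains[OF z, of "Suc p"] by auto
      thus ?thesis using True vert_closed[of "column z p" "n - p" p]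
          horiz_closed[of "column z (Suc p)" H "n - p - 1" p]
        by (auto simp: column_tot_d diff_commute intro!: chains_add)
    qed (auto simp: column_tot_d)
  qed (auto simp: column_tot_d)
  have add: "tot_d H n (z + w) = tot_d H n z + tot_d H n w"
    if z: "z \<in> tot_chains H n" and w: "w \<in> tot_chains H n" for z w
  proof (rule column_eqI)
    fix p
    show "column (tot_d H n (z + w)) p = column (tot_d H n z + tot_d H n w) p"
    proof (cases "p < n")
      case True
      hence "column z p \<in> chains H (n - p)" "column z (Suc p) \<in> chains H (n - p - 1)"
        "column w p \<in> chains H (n - p)" "column w (Suc p) \<in> chains H (n - p - 1)"
        using column_chains[OF z, of p] column_chains[OF z, of "Suc p"]
          column_chains[OF w, of p] column_chains[OF w, of "Suc p"] by auto
      thus ?thesis using True linear_map_add[OF vert_linear] linear_map_add[OF horiz_linear[of H]]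
        by (simp add: column_tot_d chains_def)
    qed (simp add: column_tot_d)
  qed
  have scale: "tot_d H n (fscale a z) = fscale a (tot_d H n z)"
    if z: "z \<in> tot_chains H n" for a z
  proof (rule column_eqI)
    fix p
    show "column (tot_d H n (fscale a z)) p = column (fscale a (tot_d H n z)) p"
    proof (cases "p < n")
      case True
      hence "column z p \<in> chains H (n - p)" "column z (Suc p) \<in> chains H (n - p - 1)"
        using column_chains[OF z, of p] column_chains[OF z, of "Suc p"] by auto
      thus ?thesis using True linear_map_fscale[OF vert_linear] linear_map_fscale[OF horiz_linear[of H]]
        by (simp add: column_tot_d chains_def fscale_distrib)
    qed (simp add: column_tot_d)
  qed
  show ?thesis using cl add scale unfolding tot_chains_def linear_map_def by auto
qed

lemma tot_d_closed: "z \<in> tot_chains H n \<Longrightarrow> tot_d H n z \<in> tot_chains H (n - 1)"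
  unfolding tot_chains_def by (rule linear_map_closed[OF tot_d_linear])

lemma tot_d_tot_d:
  assumes z: "z \<in> tot_chains H (Suc n)" shows "tot_d H n (tot_d H (Suc n) z) = 0"
proof (rule column_eqI)
  fix p
  show "column (tot_d H n (tot_d H (Suc n) z)) p = column 0 p"
  proof (cases "p < n")
    case True
    define m where "m = n - p - 1"
    have m: "n - p = Suc m" "Suc n - p = Suc (Suc m)" "n - p - 1 = m" "n - Suc p = m"
      using True unfolding m_def by linarith+
    have z0: "column z p \<in> chains H (Suc (Suc m))" and z1: "column z (Suc p) \<in> chains H (Suc m)"
      and z2: "column z (Suc (Suc p)) \<in> chains H m"
      using column_chains[OF z, of p] column_chains[OF z, of "Suc p"] column_chains[OF z, of "Suc (Suc p)"]
        True by (simp_all add: m)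
    have "vert H p (Suc m) (vert H p (Suc (Suc m)) (column z p) + horiz p (Suc m) (column z (Suc p))) =
        vert H p (Suc m) (horiz p (Suc m) (column z (Suc p)))"
      using linear_map_add[OF vert_linear, of _ "Suc m"] vert_closed[OF z0] horiz_closed[OF z1] vert_vert[OF z0]
      by (simp add: chains_def)
    moreover have "horiz p m (vert H (Suc p) (Suc m) (column z (Suc p)) + horiz (Suc p) m (column z (Suc (Suc p)))) =
        horiz p m (vert H (Suc p) (Suc m) (column z (Suc p)))"
      using linear_map_add[OF horiz_linear[of H m]] vert_closed[OF z1] horiz_closed[OF z2] horiz_horiz[OF z2]
      by (simp add: chains_def)
    ultimately show ?thesis using True vert_horiz[OF z1] by (simp add: column_tot_d m)
  qed (simp add: column_tot_d)
qed

end

section \<open>Maps of precyclic modules\<close>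

text \<open>The last face is a rotation followed by the first one, so compatibility with it is a consequence.\<close>

definition precyclic_map ::
    "('h, 'm) monoid_scheme \<Rightarrow> ('g, 'k) monoid_scheme \<Rightarrow> (('h list \<Rightarrow> complex) \<Rightarrow> 'g list \<Rightarrow> complex) \<Rightarrow> bool" where
  "precyclic_map H G f \<longleftrightarrow> (\<forall>n. linear_map (tuples H n) (tuples G n) f \<and>
     (\<forall>c\<in>chains H n. f (rot_map c) = rot_map (f c)) \<and>
     (\<forall>i\<le>n. \<forall>c\<in>chains H (Suc n). f (face_map H i c) = face_map G i (f c)))"

definition on_columns ::
    "(('h list \<Rightarrow> complex) \<Rightarrow> 'g list \<Rightarrow> complex) \<Rightarrow> (nat \<times> 'h list \<Rightarrow> complex) \<Rightarrow> nat \<times> 'g list \<Rightarrow> complex" where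
  "on_columns f z = (\<lambda>(p, xs). f (column z p) xs)"

lemma column_on_columns [simp]: "column (on_columns f z) p = f (column z p)"
  by (auto simp: column_def on_columns_def)

locale precyclic = H: left_unital_semigroup H + G: left_unital_semigroup G
  for H :: "('h, 'm) monoid_scheme" and G :: "('g, 'k) monoid_scheme" +
  fixes f :: "('h list \<Rightarrow> complex) \<Rightarrow> 'g list \<Rightarrow> complex"
  assumes precyclic: "precyclic_map H G f"
begin

lemma linear: "linear_map (tuples H n) (tuples G n) f"
  using precyclic by (simp add: precyclic_map_def)

lemma closed: "c \<in> chains H n \<Longrightarrow> f c \<in> chains G n"
  unfolding chains_def by (rule linear_map_closed[OF linear])

lemma zero [simp]: "f 0 = 0"
  by (rule linear_map_zero[OF linear])

lemma map_rot: "c \<in> chains H n \<Longrightarrow> f (rot_map c) = rot_map (f c)"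
  using precyclic by (simp add: precyclic_map_def)

lemma last_face_map:
  assumes "left_unital_semigroup K" "c \<in> chains K (Suc n)"
  shows "face_map K (Suc n) c = face_map K 0 (rot_map c)"
proof (rule linear_map_eqI[OF left_unital_semigroup.face_map_linear[OF assms(1)]
      linear_map_comp[OF left_unital_semigroup.face_map_linear[OF assms(1)] rot_map_linear]
      _ assms(2)[unfolded chains_def]])
  fix xs assume "xs \<in> tuples K (Suc n)"
  thus "face_map K (Suc n) (delta xs) = face_map K 0 (rot_map (delta xs))"
    using last_face_rot[of xs "Suc n" K] by (auto simp: tuples_def)
qed

lemma map_face:
  assumes c: "c \<in> chains H (Suc n)" and i: "i \<le> Suc n"
  shows "f (face_map H i c) = face_map G i (f c)"
proof (cases "i \<le> n")
  case True
  thus ?thesis using precyclic c by (simp add: precyclic_map_def)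
next
  case False
  hence i: "i = Suc n" using i by simp
  have "rot_map c \<in> chains H (Suc n)"
    using c unfolding chains_def by (rule linear_map_closed[OF rot_map_linear])
  hence "f (face_map H 0 (rot_map c)) = face_map G 0 (f (rot_map c))"
    using precyclic by (simp add: precyclic_map_def)
  thus ?thesis unfolding i last_face_map[OF H.left_unital_semigroup_axioms c]
      last_face_map[OF G.left_unital_semigroup_axioms closed[OF c]] map_rot[OF c] .
qed

lemma map_cyc:
  assumes c: "c \<in> chains H n" shows "f (cyc n c) = cyc n (f c)"
proof -
  have "f (fscale ((-1) ^ n) (rot_map c)) = fscale ((-1) ^ n) (f (rot_map c))"
    using linear_map_closed[OF rot_map_linear c[unfolded chains_def]]
    by (rule linear_map_fscale[OF linear])
  thus ?thesis by (simp only: cyc_eq map_rot[OF c])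
qed

lemma map_cyc_iter: "c \<in> chains H n \<Longrightarrow> f ((cyc n ^^ k) c) = (cyc n ^^ k) (f c)"
  by (induction k) (simp_all add: map_cyc[OF cyc_iter_closed])

lemma map_cyc_norm:
  assumes c: "c \<in> chains H n" shows "f (cyc_norm n c) = cyc_norm n (f c)"
proof -
  have "f (cyc_norm n c) = (\<Sum>i\<le>n. f ((cyc n ^^ i) c))"
    unfolding cyc_norm_eq using cyc_iter_closed[OF c]
    by (intro linear_map_sum[OF linear]) (simp add: chains_def)
  thus ?thesis by (simp add: cyc_norm_eq map_cyc_iter[OF c])
qed

lemma map_signed_faces:
  assumes c: "c \<in> chains H (Suc n)" and I: "I \<subseteq> {..Suc n}"
  shows "f (\<Sum>i\<in>I. fscale ((-1) ^ i) (face_map H i c)) = (\<Sum>i\<in>I. fscale ((-1) ^ i) (face_map G i (f c)))"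
proof -
  have fm: "face_map H i c \<in> fin_span (tuples H n)" for i
    using H.face_map_closed[OF c] by (simp add: chains_def)
  have "f (\<Sum>i\<in>I. fscale ((-1) ^ i) (face_map H i c)) = (\<Sum>i\<in>I. f (fscale ((-1) ^ i) (face_map H i c)))"
    by (intro linear_map_sum[OF linear[of n]] fin_span_fscale fm)
  also have "\<dots> = (\<Sum>i\<in>I. fscale ((-1) ^ i) (f (face_map H i c)))"
    by (intro sum.cong refl linear_map_fscale[OF linear[of n]] fm)
  also have "\<dots> = (\<Sum>i\<in>I. fscale ((-1) ^ i) (face_map G i (f c)))"
    using I map_face[OF c] by (intro sum.cong refl) auto
  finally show ?thesis .
qed

lemma map_hoch_b: "c \<in> chains H n \<Longrightarrow> f (hoch_b H n c) = hoch_b G n (f c)"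
  by (cases n) (simp_all add: hoch_b_Suc map_signed_faces del: sum.atMost_Suc)

lemma map_hoch_b': "c \<in> chains H n \<Longrightarrow> f (hoch_b' H n c) = hoch_b' G n (f c)"
proof (cases n)
  case (Suc m)
  assume "c \<in> chains H n"
  thus ?thesis unfolding Suc hoch_b'_eq by (intro map_signed_faces) auto
qed simp

lemma map_vert:
  assumes c: "c \<in> chains H n" shows "f (vert H p n c) = vert G p n (f c)"
  using linear_map_uminus[OF linear, of "hoch_b' H n c" "n - 1"] H.hoch_b'_closed[OF c]
  by (cases "even p") (simp_all add: vert_def map_hoch_b[OF c] map_hoch_b'[OF c] chains_def)

lemma map_horiz:
  assumes c: "c \<in> chains H n" shows "f (horiz p n c) = horiz p n (f c)"
  using linear_map_diff[OF linear, of c n "cyc n c"] cyc_closed[OF c] c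
  by (cases "even p") (simp_all add: horiz_def map_cyc[OF c] map_cyc_norm[OF c] chains_def)

lemma on_columns_closed: "z \<in> tot_chains H n \<Longrightarrow> on_columns f z \<in> tot_chains G n"
  by (auto simp: tot_chains_iff closed)

lemma on_columns_add:
  assumes "z \<in> tot_chains H n" "w \<in> tot_chains H n"
  shows "on_columns f (z + w) = on_columns f z + on_columns f w"
proof (rule column_eqI)
  fix p
  show "column (on_columns f (z + w)) p = column (on_columns f z + on_columns f w) p"
    using assms linear_map_add[OF linear, of "column z p" "n - p" "column w p"]
    by (cases "p \<le> n") (auto simp: tot_chains_iff chains_def)
qed

lemma on_columns_fscale:
  assumes "z \<in> tot_chains H n"
  shows "on_columns f (fscale a z) = fscale a (on_columns f z)"
proof (rule column_eqI)
  fix p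
  show "column (on_columns f (fscale a z)) p = column (fscale a (on_columns f z)) p"
    using assms linear_map_fscale[OF linear, of "column z p" "n - p" a]
    by (cases "p \<le> n") (auto simp: tot_chains_iff chains_def)
qed

lemma tot_d_on_columns:
  assumes z: "z \<in> tot_chains H n"
  shows "tot_d G n (on_columns f z) = on_columns f (tot_d H n z)"
proof (rule column_eqI)
  fix p
  show "column (tot_d G n (on_columns f z)) p = column (on_columns f (tot_d H n z)) p"
  proof (cases "p < n")
    case True
    hence c: "column z p \<in> chains H (n - p)" "column z (Suc p) \<in> chains H (n - Suc p)"
      using column_chains[OF z, of p] column_chains[OF z, of "Suc p"] by auto
    have "f (vert H p (n - p) (column z p) + horiz p (n - Suc p) (column z (Suc p))) =
      f (vert H p (n - p) (column z p)) + f (horiz p (n - Suc p) (column z (Suc p)))"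
      using H.vert_closed[OF c(1)] horiz_closed[OF c(2)]
      by (intro linear_map_add[OF linear]) (auto simp: chains_def)
    thus ?thesis using True
      by (simp add: column_tot_d map_vert[OF c(1)] map_horiz[OF c(2)] fun_eq_iff)
  qed (simp add: column_tot_d fun_eq_iff)
qed

end

lemma precyclic_mapI:
  assumes H: "left_unital_semigroup H" and G: "left_unital_semigroup G"
    and lin: "\<And>n. linear_map (tuples H n) (tuples G n) f"
    and rot: "\<And>n xs. xs \<in> tuples H n \<Longrightarrow> f (delta (rot xs)) = rot_map (f (delta xs))"
    and face: "\<And>n xs i. xs \<in> tuples H (Suc n) \<Longrightarrow> i \<le> n \<Longrightarrow>
      f (delta (face H i xs)) = face_map G i (f (delta xs))"
  shows "precyclic H G f"
proof -
  have "f (rot_map c) = rot_map (f c)" if "c \<in> chains H n" for n c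
    by (rule linear_map_eqI[OF linear_map_comp[OF lin rot_map_linear] linear_map_comp[OF rot_map_linear lin]
        _ that[unfolded chains_def]]) (simp add: rot)
  moreover have "f (face_map H i c) = face_map G i (f c)" if "c \<in> chains H (Suc n)" "i \<le> n" for n c i
    by (rule linear_map_eqI[OF linear_map_comp[OF lin left_unital_semigroup.face_map_linear[OF H]]
        linear_map_comp[OF left_unital_semigroup.face_map_linear[OF G] lin]
        _ that(1)[unfolded chains_def]]) (simp add: face that(2))
  ultimately show ?thesis
    unfolding precyclic_def precyclic_axioms_def precyclic_map_def using H G lin by blast
qed

definition on_factors :: "('h \<Rightarrow> 'g) \<Rightarrow> ('h list \<Rightarrow> complex) \<Rightarrow> 'g list \<Rightarrow> complex" where
  "on_factors h = lin_ext (\<lambda>xs. delta (map h xs))"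

lemma on_factors_delta [simp]: "on_factors h (delta xs) = delta (map h xs)"
  by (simp add: on_factors_def)

lemma on_factors_precyclic:
  assumes H: "left_unital_semigroup H" and G: "left_unital_semigroup G"
    and cl: "\<And>x. x \<in> carrier H \<Longrightarrow> h x \<in> carrier G"
    and hom: "\<And>x y. x \<in> carrier H \<Longrightarrow> y \<in> carrier H \<Longrightarrow> h (x \<otimes>\<^bsub>H\<^esub> y) = h x \<otimes>\<^bsub>G\<^esub> h y"
  shows "precyclic H G (on_factors h)"
proof (rule precyclic_mapI[OF H G])
  show "linear_map (tuples H n) (tuples G n) (on_factors h)" for n
    unfolding on_factors_def by (rule linear_map_lin_ext) (auto simp: tuples_def cl)
next
  fix n xs assume xs: "xs \<in> tuples H n"
  hence "map h (rot xs) = rot (map h xs)" by (cases xs rule: rev_cases) (auto simp: tuples_def)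
  thus "on_factors h (delta (rot xs)) = rot_map (on_factors h (delta xs))" by simp
next
  fix n i xs assume xs: "xs \<in> tuples H (Suc n)" and i: "i \<le> n"
  hence "xs ! i \<in> carrier H" "xs ! Suc i \<in> carrier H" by (auto simp: tuples_def subset_iff)
  hence "map h (face H i xs) = face G i (map h xs)"
    using xs i by (simp add: face_def tuples_def take_map drop_map hom)
  thus "on_factors h (delta (face H i xs)) = face_map G i (on_factors h (delta xs))" by simp
qed

section \<open>Labelled tensors and homotopies\<close>

text \<open>Two precyclic maps out of \<open>\<complex>(G)\<close> are compared by means of tensors whose factors carry a label.
  A factor is thought of as an arrow whose target has the label; in a product only the target of
  the last factor survives. A precyclic map on labelled tensors interpolates between its restrictions
  to the two constant labellings, and these induce the same maps in homology.\<close>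

definition labelled :: "('g, 'm) monoid_scheme \<Rightarrow> ('g \<times> bool) monoid" where
  "labelled G = \<lparr>carrier = carrier G \<times> UNIV,
     monoid.mult = (\<lambda>x y. (fst x \<otimes>\<^bsub>G\<^esub> fst y, snd y)), one = (\<one>\<^bsub>G\<^esub>, False)\<rparr>"

definition forget :: "(('g \<times> bool) list \<Rightarrow> complex) \<Rightarrow> 'g list \<Rightarrow> complex" where
  "forget = on_factors fst"

definition label :: "bool \<Rightarrow> ('g list \<Rightarrow> complex) \<Rightarrow> ('g \<times> bool) list \<Rightarrow> complex" where
  "label e = on_factors (\<lambda>g. (g, e))"

definition insert_unit :: "('g, 'm) monoid_scheme \<Rightarrow> nat \<Rightarrow> ('g \<times> bool) list \<Rightarrow> ('g \<times> bool) list" where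
  "insert_unit G j xs = map (\<lambda>x. (fst x, False)) (take (Suc j) xs) @ (\<one>\<^bsub>G\<^esub>, snd (xs ! j)) # drop (Suc j) xs"

lemma labelled_simps [simp]:
  "carrier (labelled G) = carrier G \<times> UNIV"
  "x \<otimes>\<^bsub>labelled G\<^esub> y = (fst x \<otimes>\<^bsub>G\<^esub> fst y, snd y)"
  "\<one>\<^bsub>labelled G\<^esub> = (\<one>\<^bsub>G\<^esub>, False)"
  by (simp_all add: labelled_def)

lemma insert_unit_0: "insert_unit G 0 (x # xs) = (fst x, False) # (\<one>\<^bsub>G\<^esub>, snd x) # xs"
  and insert_unit_Suc: "insert_unit G (Suc j) (x # xs) = (fst x, False) # insert_unit G j xs"
  by (simp_all add: insert_unit_def)

lemma length_insert_unit: "j < length xs \<Longrightarrow> length (insert_unit G j xs) = Suc (length xs)"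
  by (simp add: insert_unit_def)

lemma insert_unit_append: "j < length us \<Longrightarrow> insert_unit G j (us @ vs) = insert_unit G j us @ vs"
  by (simp add: insert_unit_def nth_append)

lemma face_insert_unit_below:
  assumes "i < j" "j < length xs"
  shows "face (labelled G) i (insert_unit G j xs) = insert_unit G (j - 1) (face (labelled G) i xs)"
  using assms
proof (induction xs arbitrary: i j)
  case (Cons x xs)
  obtain j' where j: "j = Suc j'" using Cons.prems by (cases j) auto
  obtain y r where xs: "xs = y # r" using Cons.prems by (cases xs) auto
  show ?case
  proof (cases i)
    case 0
    show ?thesis using 0 j xs by (cases j') (simp_all add: insert_unit_0 insert_unit_Suc face_0)
  next
    case (Suc k)
    then obtain l where l: "j' = Suc l" using Cons.prems j by (cases j') auto
    have "face (labelled G) i (insert_unit G j (x # xs)) =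
        (fst x, False) # face (labelled G) k (insert_unit G j' xs)"
      unfolding j Suc insert_unit_Suc using Cons.prems j Suc
      by (intro face_Suc) (auto simp: length_insert_unit)
    also have "\<dots> = insert_unit G j' (x # face (labelled G) k xs)"
      using Cons.IH[of k j'] Cons.prems j Suc l by (simp add: insert_unit_Suc)
    also have "x # face (labelled G) k xs = face (labelled G) i (x # xs)"
      unfolding Suc using Cons.prems j Suc by (intro face_Suc[symmetric]) auto
    finally show ?thesis by (simp add: j)
  qed
qed simp

lemma face_insert_unit_above:
  assumes "Suc j < i" "i < length xs"
  shows "face (labelled G) i (insert_unit G j xs) = insert_unit G j (face (labelled G) (i - 1) xs)"
  using assms
proof (induction xs arbitrary: i j)
  case (Cons x xs)
  define k where "k = i - 2"
  with Cons.prems have i: "i = Suc (Suc k)" by auto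
  have f: "face (labelled G) (Suc k) (x # xs) = x # face (labelled G) k xs"
    using Cons.prems i by (intro face_Suc) auto
  show ?case
  proof (cases j)
    case 0
    have "face (labelled G) i (insert_unit G j (x # xs)) =
        (fst x, False) # face (labelled G) (Suc k) ((\<one>\<^bsub>G\<^esub>, snd x) # xs)"
      unfolding 0 i insert_unit_0 using Cons.prems i by (intro face_Suc) auto
    also have "face (labelled G) (Suc k) ((\<one>\<^bsub>G\<^esub>, snd x) # xs) = (\<one>\<^bsub>G\<^esub>, snd x) # face (labelled G) k xs"
      using Cons.prems i by (intro face_Suc) auto
    finally show ?thesis using f by (simp add: 0 i insert_unit_0)
  next
    case (Suc l)
    have "face (labelled G) i (insert_unit G j (x # xs)) =
        (fst x, False) # face (labelled G) (Suc k) (insert_unit G l xs)"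
      unfolding i Suc insert_unit_Suc using Cons.prems i Suc
      by (intro face_Suc) (auto simp: length_insert_unit)
    thus ?thesis using f Cons.IH[of l "Suc k"] Cons.prems i Suc by (simp add: insert_unit_Suc)
  qed
qed simp

lemma last_face_insert_unit:
  assumes "j < n" "length xs = Suc n"
  shows "face (labelled G) (Suc n) (insert_unit G j xs) = insert_unit G j (face (labelled G) n xs)"
proof -
  have "2 \<le> length xs" using assms by simp
  then obtain x us z where xs: "xs = x # us @ [z]" by (rule two_le_lengthE)
  have n: "n = Suc (length us)" using assms xs by simp
  have f: "face (labelled G) n (x # us @ [z]) = (fst z \<otimes>\<^bsub>G\<^esub> fst x, snd x) # us"
    using n by (subst face_last) auto
  show ?thesis
  proof (cases j)
    case 0
    have "face (labelled G) (Suc n) ((fst x, False) # ((\<one>\<^bsub>G\<^esub>, snd x) # us) @ [z]) =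
        (fst z \<otimes>\<^bsub>G\<^esub> fst x, False) # (\<one>\<^bsub>G\<^esub>, snd x) # us"
      using n by (subst face_last) auto
    thus ?thesis using f by (simp add: xs 0 insert_unit_0)
  next
    case (Suc k)
    have "face (labelled G) (Suc n) ((fst x, False) # insert_unit G k us @ [z]) =
        (fst z \<otimes>\<^bsub>G\<^esub> fst x, False) # insert_unit G k us"
      using n assms Suc by (subst face_last) (auto simp: length_insert_unit)
    moreover have "insert_unit G k (us @ [z]) = insert_unit G k us @ [z]"
      using n assms Suc by (intro insert_unit_append) auto
    ultimately show ?thesis using f by (simp add: xs Suc insert_unit_Suc)
  qed
qed

text \<open>The cancellation pattern of a presimplicial homotopy.\<close>

lemma alternating_homotopy_sum:
  fixes u v :: "nat \<Rightarrow> nat \<Rightarrow> 'x \<Rightarrow> complex"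
  assumes below: "\<And>i j. i < j \<Longrightarrow> j \<le> n \<Longrightarrow> u i j = v (j - 1) i"
    and above: "\<And>i j. Suc j < i \<Longrightarrow> i \<le> Suc n \<Longrightarrow> u i j = v j (i - 1)"
    and diag: "\<And>i. i < n \<Longrightarrow> u (Suc i) (Suc i) = u (Suc i) i"
  shows "(\<Sum>i\<le>Suc n. \<Sum>j\<le>n. fscale ((-1) ^ (i + j)) (u i j)) +
    (\<Sum>i<n. \<Sum>j\<le>n. fscale ((-1) ^ (i + j)) (v i j)) = u 0 0 - u (Suc n) n"
proof -
  let ?f = "\<lambda>(i, j). fscale ((-1) ^ (i + j)) (u i j)" and ?g = "\<lambda>(i, j). fscale ((-1) ^ (i + j)) (v i j)"
  let ?L = "{(i, j). i < j \<and> j \<le> n}" and ?U = "{(i, j). Suc j < i \<and> i \<le> Suc n}"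
  let ?D = "(\<lambda>i. (i, i)) ` {..n}" and ?E = "(\<lambda>i. (Suc i, i)) ` {..n}"
  let ?L' = "{(i, j). j \<le> i \<and> i < n}" and ?U' = "{(i, j). i < j \<and> j \<le> n}"
  have fin: "finite ?L" "finite ?U" "finite ?L'" "finite ?U'"
    by (rule finite_subset[of _ "{..Suc n} \<times> {..Suc n}"]; auto)+
  have "(\<Sum>i\<le>Suc n. \<Sum>j\<le>n. fscale ((-1) ^ (i + j)) (u i j)) = sum ?f ({..Suc n} \<times> {..n})"
    by (rule sum.cartesian_product)
  also have "{..Suc n} \<times> {..n} = ((?L \<union> ?U) \<union> ?D) \<union> ?E"
  proof (rule Set.set_eqI)
    fix p :: "nat \<times> nat"
    obtain i j where p: "p = (i, j)" by (cases p)
    have "p \<in> ?D \<longleftrightarrow> i = j \<and> j \<le> n" "p \<in> ?E \<longleftrightarrow> i = Suc j \<and> j \<le> n" by (auto simp: p)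
    moreover have "p \<in> {..Suc n} \<times> {..n} \<longleftrightarrow> i \<le> Suc n \<and> j \<le> n" "p \<in> ?L \<longleftrightarrow> i < j \<and> j \<le> n"
      "p \<in> ?U \<longleftrightarrow> Suc j < i \<and> i \<le> Suc n" by (auto simp: p)
    ultimately show "p \<in> {..Suc n} \<times> {..n} \<longleftrightarrow> p \<in> ((?L \<union> ?U) \<union> ?D) \<union> ?E"
      unfolding Un_iff by linarith
  qed
  also have "sum ?f (((?L \<union> ?U) \<union> ?D) \<union> ?E) = sum ?f ((?L \<union> ?U) \<union> ?D) + sum ?f ?E"
    using fin by (intro sum.union_disjoint) auto
  also have "sum ?f ((?L \<union> ?U) \<union> ?D) = sum ?f (?L \<union> ?U) + sum ?f ?D"
    using fin by (intro sum.union_disjoint) auto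
  also have "sum ?f (?L \<union> ?U) = sum ?f ?L + sum ?f ?U"
    using fin by (intro sum.union_disjoint) auto
  finally have 1: "(\<Sum>i\<le>Suc n. \<Sum>j\<le>n. fscale ((-1) ^ (i + j)) (u i j)) =
    sum ?f ?L + sum ?f ?U + sum ?f ?D + sum ?f ?E" .
  have "(\<Sum>i<n. \<Sum>j\<le>n. fscale ((-1) ^ (i + j)) (v i j)) = sum ?g ({..<n} \<times> {..n})"
    by (rule sum.cartesian_product)
  also have "{..<n} \<times> {..n} = ?L' \<union> ?U'" by auto
  also have "sum ?g (?L' \<union> ?U') = sum ?g ?L' + sum ?g ?U'"
    using fin by (intro sum.union_disjoint) auto
  finally have 2: "(\<Sum>i<n. \<Sum>j\<le>n. fscale ((-1) ^ (i + j)) (v i j)) = sum ?g ?L' + sum ?g ?U'" .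
  have "sum ?f ?L = sum (\<lambda>p. - ?g p) ?L'"
  proof (rule sum.reindex_bij_witness[where j = "\<lambda>(i, j). (j - 1, i)" and i = "\<lambda>(i, j). (j, Suc i)"])
    fix p assume "p \<in> ?L"
    then obtain i j where p: "p = (i, Suc j)" "i \<le> j" "Suc j \<le> n"
      by (cases p, cases "snd p") auto
    hence "u i (Suc j) = v j i" using below[of i "Suc j"] by simp
    thus "- (case (case p of (i, j) \<Rightarrow> (j - 1, i)) of (i, j) \<Rightarrow> fscale ((-1) ^ (i + j)) (v i j)) =
      (case p of (i, j) \<Rightarrow> fscale ((-1) ^ (i + j)) (u i j))"
      by (simp add: p fun_eq_iff add.commute)
  qed auto
  hence 3: "sum ?f ?L = - sum ?g ?L'" by (simp add: sum_negf)
  have "sum ?f ?U = sum (\<lambda>p. - ?g p) ?U'"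
  proof (rule sum.reindex_bij_witness[where j = "\<lambda>(i, j). (j, i - 1)" and i = "\<lambda>(i, j). (Suc j, i)"])
    fix p assume "p \<in> ?U"
    then obtain i j where p: "p = (Suc i, j)" "j < i" "i \<le> n"
      by (cases p, cases "fst p") auto
    hence "u (Suc i) j = v j i" using above[of j "Suc i"] by simp
    thus "- (case (case p of (i, j) \<Rightarrow> (j, i - 1)) of (i, j) \<Rightarrow> fscale ((-1) ^ (i + j)) (v i j)) =
      (case p of (i, j) \<Rightarrow> fscale ((-1) ^ (i + j)) (u i j))"
      by (simp add: p fun_eq_iff add.commute)
  qed auto
  hence 4: "sum ?f ?U = - sum ?g ?U'" by (simp add: sum_negf)
  have "sum ?f ?D = (\<Sum>i<Suc n. u i i)"
    by (subst sum.reindex) (auto simp: inj_on_def lessThan_Suc_atMost)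
  also have "\<dots> = u 0 0 + (\<Sum>i<n. u (Suc i) (Suc i))" by (rule sum.lessThan_Suc_shift)
  also have "(\<Sum>i<n. u (Suc i) (Suc i)) = (\<Sum>i<n. u (Suc i) i)"
    by (rule sum.cong) (auto simp: diag)
  finally have 5: "sum ?f ?D = u 0 0 + (\<Sum>i<n. u (Suc i) i)" .
  have "sum ?f ?E = (\<Sum>i<Suc n. - u (Suc i) i)"
    by (subst sum.reindex) (auto simp: inj_on_def lessThan_Suc_atMost intro!: sum.cong)
  also have "\<dots> = - (\<Sum>i<n. u (Suc i) i) - u (Suc n) n" by (simp add: sum_negf fun_eq_iff)
  finally have 6: "sum ?f ?E = - (\<Sum>i<n. u (Suc i) i) - u (Suc n) n" .
  show ?thesis unfolding 1 2 3 4 5 6 by (rule ext) simp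
qed

definition insert_unit_map :: "('g, 'm) monoid_scheme \<Rightarrow> nat \<Rightarrow> (('g \<times> bool) list \<Rightarrow> complex) \<Rightarrow> ('g \<times> bool) list \<Rightarrow> complex" where
  "insert_unit_map G j = lin_ext (\<lambda>xs. delta (insert_unit G j xs))"

definition unit_homotopy :: "('g, 'm) monoid_scheme \<Rightarrow> nat \<Rightarrow> (('g \<times> bool) list \<Rightarrow> complex) \<Rightarrow> ('g \<times> bool) list \<Rightarrow> complex" where
  "unit_homotopy G n c = (\<Sum>j\<le>n. fscale ((-1) ^ j) (insert_unit_map G j c))"

lemma insert_unit_map_delta [simp]: "insert_unit_map G j (delta xs) = delta (insert_unit G j xs)"
  by (simp add: insert_unit_map_def)

context monoid begin

lemma left_unital_semigroup: "left_unital_semigroup G"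
  by unfold_locales (auto simp: m_assoc)

lemma left_unital_semigroup_labelled: "left_unital_semigroup (labelled G)"
  by unfold_locales (auto simp: m_assoc)

sublocale Q: left_unital_semigroup "labelled G"
  by (rule left_unital_semigroup_labelled)

lemma forget_precyclic: "precyclic (labelled G) G forget"
  unfolding forget_def
  by (rule on_factors_precyclic[OF left_unital_semigroup_labelled left_unital_semigroup]) auto

lemma label_precyclic: "precyclic G (labelled G) (label e)"
  unfolding label_def
  by (rule on_factors_precyclic[OF left_unital_semigroup left_unital_semigroup_labelled]) auto

lemma face_insert_unit_diagonal:
  assumes "Suc i < length xs" "set xs \<subseteq> carrier (labelled G)"
  shows "face (labelled G) (Suc i) (insert_unit G (Suc i) xs) = face (labelled G) (Suc i) (insert_unit G i xs)"
  using assms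
proof (induction xs arbitrary: i)
  case (Cons x xs)
  then obtain y r where xs: "xs = y # r" by (cases xs) auto
  show ?case
  proof (cases i)
    case 0
    have "face (labelled G) (Suc 0) ((fst x, False) # (fst y, False) # (\<one>, snd y) # r) =
        (fst x, False) # (fst y, snd y) # r"
      using Cons.prems xs by (subst face_Suc) (auto simp: face_0)
    moreover have "face (labelled G) (Suc 0) ((fst x, False) # (\<one>, snd x) # y # r) =
        (fst x, False) # (fst y, snd y) # r"
      using Cons.prems xs by (subst face_Suc) (auto simp: face_0)
    ultimately show ?thesis using 0 xs by (simp add: insert_unit_0 insert_unit_Suc)
  next
    case (Suc k)
    have "face (labelled G) (Suc i) (insert_unit G (Suc i) (x # xs)) =
        (fst x, False) # face (labelled G) i (insert_unit G i xs)"
      unfolding insert_unit_Suc using Cons.prems by (intro face_Suc) (auto simp: length_insert_unit)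
    moreover have "face (labelled G) (Suc i) (insert_unit G i (x # xs)) =
        (fst x, False) # face (labelled G) i (insert_unit G k xs)"
      unfolding Suc insert_unit_Suc using Cons.prems Suc by (intro face_Suc) (auto simp: length_insert_unit)
    ultimately show ?thesis using Cons.IH[of k] Cons.prems Suc by simp
  qed
qed simp

lemma insert_unit_tuples:
  assumes "xs \<in> tuples (labelled G) n" "j \<le> n"
  shows "insert_unit G j xs \<in> tuples (labelled G) (Suc n)"
  using assms set_take_subset[of "Suc j" xs] set_drop_subset[of "Suc j" xs]
  by (auto simp: tuples_def length_insert_unit insert_unit_def)

lemma insert_unit_map_linear:
  "j \<le> n \<Longrightarrow> linear_map (tuples (labelled G) n) (tuples (labelled G) (Suc n)) (insert_unit_map G j)"
  unfolding insert_unit_map_def by (rule linear_map_lin_ext) (simp add: insert_unit_tuples)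

lemma unit_homotopy_linear:
  "linear_map (tuples (labelled G) n) (tuples (labelled G) (Suc n)) (unit_homotopy G n)"
  unfolding unit_homotopy_def[abs_def]
  by (intro linear_map_setsum linear_map_scaled insert_unit_map_linear) simp

text \<open>Inserting a unit whose target keeps the old label, while the targets before it are relabelled,
  deforms the identity into the operator that forgets all labels.\<close>

lemma hoch_b_unit_homotopy:
  assumes c: "c \<in> chains (labelled G) n"
  shows "hoch_b (labelled G) (Suc n) (unit_homotopy G n c) + unit_homotopy G (n - 1) (hoch_b (labelled G) n c)
    = c - label False (forget c)"
proof -
  let ?Q = "labelled G"
  define u where "u = (\<lambda>i j. face_map ?Q i (insert_unit_map G j c))"
  define v where "v = (\<lambda>i j. insert_unit_map G i (face_map ?Q j c))"
  note c' = c[unfolded chains_def]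
  note dh = linear_map_comp[OF Q.face_map_linear insert_unit_map_linear]
  have h: "insert_unit_map G j c \<in> fin_span (tuples ?Q (Suc n))" if "j \<le> n" for j
    by (rule linear_map_closed[OF insert_unit_map_linear[OF that] c'])
  have hd: "linear_map (tuples ?Q n) (tuples ?Q n) (\<lambda>c. insert_unit_map G i (face_map ?Q j c))" if "i < n" for i j
  proof -
    obtain m where m: "n = Suc m" using \<open>i < n\<close> by (cases n) auto
    hence "i \<le> m" using \<open>i < n\<close> by simp
    from linear_map_comp[OF insert_unit_map_linear[OF this] Q.face_map_linear, of j] show ?thesis
      by (simp add: m)
  qed
  have 1: "hoch_b ?Q (Suc n) (unit_homotopy G n c) = (\<Sum>i\<le>Suc n. \<Sum>j\<le>n. fscale ((-1) ^ (i + j)) (u i j))"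
    unfolding hoch_b_Suc
  proof (intro sum.cong refl)
    fix i
    have "face_map ?Q i (unit_homotopy G n c) = (\<Sum>j\<le>n. face_map ?Q i (fscale ((-1) ^ j) (insert_unit_map G j c)))"
      unfolding unit_homotopy_def by (intro linear_map_sum[OF Q.face_map_linear[of n]] fin_span_fscale h) auto
    also have "\<dots> = (\<Sum>j\<le>n. fscale ((-1) ^ j) (u i j))"
      unfolding u_def by (intro sum.cong refl linear_map_fscale[OF Q.face_map_linear[of n]] h) auto
    finally show "fscale ((-1) ^ i) (face_map ?Q i (unit_homotopy G n c)) =
        (\<Sum>j\<le>n. fscale ((-1) ^ (i + j)) (u i j))" by (simp add: fscale_sum power_add)
  qed
  have 2: "unit_homotopy G (n - 1) (hoch_b ?Q n c) = (\<Sum>i<n. \<Sum>j\<le>n. fscale ((-1) ^ (i + j)) (v i j))"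
  proof (cases n)
    case 0
    thus ?thesis using linear_map_zero[OF unit_homotopy_linear] by simp
  next
    case (Suc m)
    have d: "face_map ?Q j c \<in> fin_span (tuples ?Q m)" for j
      using Q.face_map_closed[of c m j] c Suc by (simp add: chains_def)
    have "unit_homotopy G m (hoch_b ?Q (Suc m) c) = (\<Sum>i\<le>m. \<Sum>j\<le>Suc m. fscale ((-1) ^ (i + j)) (v i j))"
      unfolding unit_homotopy_def
    proof (intro sum.cong refl)
      fix i assume "i \<in> {..m}"
      hence i: "i \<le> m" by simp
      have "insert_unit_map G i (hoch_b ?Q (Suc m) c) =
          (\<Sum>j\<le>Suc m. insert_unit_map G i (fscale ((-1) ^ j) (face_map ?Q j c)))"
        unfolding hoch_b_Suc by (intro linear_map_sum[OF insert_unit_map_linear[OF i]] fin_span_fscale d)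
      also have "\<dots> = (\<Sum>j\<le>Suc m. fscale ((-1) ^ j) (v i j))"
        unfolding v_def by (intro sum.cong refl linear_map_fscale[OF insert_unit_map_linear[OF i]] d)
      finally show "fscale ((-1) ^ i) (insert_unit_map G i (hoch_b ?Q (Suc m) c)) =
          (\<Sum>j\<le>Suc m. fscale ((-1) ^ (i + j)) (v i j))" by (simp only: fscale_sum power_add fscale_simps)
    qed
    thus ?thesis by (simp only: Suc diff_Suc_1 lessThan_Suc_atMost)
  qed
  have "hoch_b ?Q (Suc n) (unit_homotopy G n c) + unit_homotopy G (n - 1) (hoch_b ?Q n c) = u 0 0 - u (Suc n) n"
    unfolding 1 2
  proof (rule alternating_homotopy_sum)
    fix i j assume ij: "i < j" "j \<le> n"
    hence j: "j - 1 < n" by simp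
    show "u i j = v (j - 1) i" unfolding u_def v_def
      by (rule linear_map_eqI[OF dh[OF ij(2)] hd[OF j] _ c'])
        (use ij in \<open>simp add: tuples_def face_insert_unit_below del: One_nat_def\<close>)
  next
    fix i j assume ij: "Suc j < i" "i \<le> Suc n"
    hence j: "j < n" "j \<le> n" by auto
    show "u i j = v j (i - 1)" unfolding u_def v_def
    proof (rule linear_map_eqI[OF dh[OF j(2)] hd[OF j(1)] _ c'])
      fix xs assume "xs \<in> tuples ?Q n"
      hence "face ?Q i (insert_unit G j xs) = insert_unit G j (face ?Q (i - 1) xs)"
        using face_insert_unit_above[of j i xs G] last_face_insert_unit[of j n xs G] ij j
        by (cases "i = Suc n") (auto simp: tuples_def)
      thus "face_map ?Q i (insert_unit_map G j (delta xs)) = insert_unit_map G j (face_map ?Q (i - 1) (delta xs))"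
        by simp
    qed
  next
    fix i assume i: "i < n"
    hence i': "Suc i \<le> n" "i \<le> n" by auto
    show "u (Suc i) (Suc i) = u (Suc i) i" unfolding u_def
      by (rule linear_map_eqI[OF dh[OF i'(1)] dh[OF i'(2)] _ c'])
        (use i in \<open>auto simp: tuples_def intro!: face_insert_unit_diagonal arg_cong[of _ _ delta]\<close>)
  qed
  also have "u 0 0 = c" unfolding u_def
  proof (rule linear_map_eqI[OF dh linear_map_id _ c'])
    fix xs assume "xs \<in> tuples ?Q n"
    thus "face_map ?Q 0 (insert_unit_map G 0 (delta xs)) = delta xs"
      by (cases xs) (auto simp: tuples_def insert_unit_0 face_0)
  qed simp
  also have "u (Suc n) n = label False (forget c)" unfolding u_def
  proof (rule linear_map_eqI[OF dh linear_map_comp[OF precyclic.linear[OF label_precyclic] precyclic.linear[OF forget_precyclic]] _ c'])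
    fix xs assume xs: "xs \<in> tuples ?Q n"
    then obtain x ys where x: "xs = x # ys" by (cases xs) (auto simp: tuples_def)
    hence ys: "length ys = n" using xs by (simp add: tuples_def)
    have "insert_unit G n xs = (fst x, False) # map (\<lambda>x. (fst x, False)) ys @ [(\<one>, snd (xs ! n))]"
      using x ys by (simp add: insert_unit_def)
    hence "face ?Q (Suc n) (insert_unit G n xs) = (\<one> \<otimes> fst x, False) # map (\<lambda>x. (fst x, False)) ys"
      using ys by (simp add: face_last)
    hence "face ?Q (Suc n) (insert_unit G n xs) = map (\<lambda>x. (fst x, False)) xs"
      using x xs by (auto simp: tuples_def)
    thus "face_map ?Q (Suc n) (insert_unit_map G n (delta xs)) = label False (forget (delta xs))"
      by (simp add: label_def forget_def comp_def)
  qed simp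
  finally show ?thesis .
qed

text \<open>Forgetting the labels turns the homotopy into an alternating sum of degeneracies.\<close>

lemma forget_unit_homotopy:
  assumes c: "c \<in> chains (labelled G) n" and k: "forget c = 0"
  shows "forget (unit_homotopy G n c) = 0"
proof -
  note fl = precyclic.linear[OF forget_precyclic]
  define s where "s = (\<lambda>j. lin_ext (\<lambda>xs. delta (take (Suc j) xs @ \<one> # drop (Suc j) xs)))"
  have s: "linear_map (tuples G n) (tuples G (Suc n)) (s j)" for j
    unfolding s_def
  proof (rule linear_map_lin_ext)
    fix xs assume "xs \<in> tuples G n"
    thus "delta (take (Suc j) xs @ \<one> # drop (Suc j) xs) \<in> fin_span (tuples G (Suc n))"
      using set_take_subset[of "Suc j" xs] set_drop_subset[of "Suc j" xs] by (auto simp: tuples_def min_def)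
  qed
  have "forget (insert_unit_map G j c) = s j (forget c)" if "j \<le> n" for j
  proof (rule linear_map_eqI[OF linear_map_comp[OF fl insert_unit_map_linear[OF that]] linear_map_comp[OF s fl] _
        c[unfolded chains_def]])
    fix xs :: "('a \<times> bool) list"
    show "forget (insert_unit_map G j (delta xs)) = s j (forget (delta xs))"
      by (simp add: s_def forget_def insert_unit_def take_map drop_map comp_def)
  qed
  hence z: "forget (insert_unit_map G j c) = 0" if "j \<le> n" for j
    using that k linear_map_zero[OF s] by simp
  have h: "insert_unit_map G j c \<in> fin_span (tuples (labelled G) (Suc n))" if "j \<le> n" for j
    by (rule linear_map_closed[OF insert_unit_map_linear[OF that] c[unfolded chains_def]])
  have "forget (unit_homotopy G n c) = (\<Sum>j\<le>n. forget (fscale ((-1) ^ j) (insert_unit_map G j c)))"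
    unfolding unit_homotopy_def by (intro linear_map_sum[OF fl[of "Suc n"]] fin_span_fscale h) auto
  also have "\<dots> = (\<Sum>j\<le>n. fscale ((-1) ^ j) (forget (insert_unit_map G j c)))"
    by (intro sum.cong refl linear_map_fscale[OF fl[of "Suc n"]] h) auto
  also have "\<dots> = 0" by (intro sum.neutral ballI) (simp add: z)
  finally show ?thesis .
qed

text \<open>Hence the kernel of \<open>forget\<close> is acyclic in every column of the cyclic bicomplex: the unit homotopy
  contracts it for \<open>b\<close>, the usual contraction for \<open>b'\<close>.\<close>

lemma kernel_column_acyclic:
  assumes c: "c \<in> chains (labelled G) n" and k: "forget c = 0" and z: "vert (labelled G) p n c = 0"
  obtains y where "y \<in> chains (labelled G) (Suc n)" "forget y = 0" "vert (labelled G) p (Suc n) y = c"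
proof (cases "even p")
  case True
  let ?y = "unit_homotopy G n c"
  have b: "hoch_b (labelled G) n c = 0" using z True by (simp add: vert_def)
  have "label False (0 :: 'a list \<Rightarrow> complex) = 0" by (rule precyclic.zero[OF label_precyclic])
  hence "hoch_b (labelled G) (Suc n) ?y = c"
    using hoch_b_unit_homotopy[OF c] linear_map_zero[OF unit_homotopy_linear[of "n - 1"]]
    unfolding b k by simp
  hence "vert (labelled G) p (Suc n) ?y = c" using True by (simp add: vert_def)
  moreover have "?y \<in> chains (labelled G) (Suc n)"
    using linear_map_closed[OF unit_homotopy_linear] c by (simp add: chains_def)
  ultimately show ?thesis using forget_unit_homotopy[OF c k] that by blast
next
  case False
  let ?Q = "labelled G"
  let ?y = "- contr ?Q c"
  have b: "hoch_b' ?Q n c = 0" using z False by (simp add: vert_def)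
  note cc = Q.contr_closed[OF c]
  have "hoch_b' ?Q (Suc n) (contr ?Q c) = c"
    using Q.hoch_b'_contr[OF c] linear_map_zero[OF Q.contr_linear] unfolding b by simp
  moreover have "hoch_b' ?Q (Suc n) ?y = - hoch_b' ?Q (Suc n) (contr ?Q c)"
    using cc by (intro linear_map_uminus[OF Q.hoch_b'_linear]) (simp add: chains_def)
  ultimately have "vert ?Q p (Suc n) ?y = c" using False by (simp add: vert_def)
  moreover have "?y \<in> chains ?Q (Suc n)" using cc by (auto simp: chains_def)
  moreover have "forget ?y = 0"
  proof -
    note fl = precyclic.linear[OF forget_precyclic]
    interpret G: left_unital_semigroup G by (rule left_unital_semigroup)
    have "forget (contr ?Q c) = contr G (forget c)"
    proof (rule linear_map_eqI[OF linear_map_comp[OF fl Q.contr_linear] linear_map_comp[OF G.contr_linear fl] _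
        c[unfolded chains_def]])
      fix xs :: "('a \<times> bool) list"
      show "forget (contr ?Q (delta xs)) = contr G (forget (delta xs))" by (simp add: forget_def)
    qed
    also have "\<dots> = 0" unfolding k by (rule linear_map_zero[OF G.contr_linear])
    finally have "forget (contr ?Q c) = 0" .
    moreover have "forget ?y = - forget (contr ?Q c)"
      using cc by (intro linear_map_uminus[OF fl]) (simp add: chains_def)
    ultimately show ?thesis by simp
  qed
  ultimately show ?thesis using that by blast
qed

text \<open>A bicomplex in the first quadrant with acyclic columns has an acyclic total complex: the last
  nonzero column of a cycle is a vertical cycle, so it can be removed by subtracting a boundary.\<close>

lemma kernel_total_acyclic:
  assumes "z \<in> tot_chains (labelled G) n" "tot_d (labelled G) n z = 0"
    and "\<And>p. forget (column z p) = 0" and "\<And>p. q \<le> p \<Longrightarrow> column z p = 0" and "q \<le> Suc n"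
  shows "\<exists>y\<in>tot_chains (labelled G) (Suc n). tot_d (labelled G) (Suc n) y = z"
  using assms
proof (induction q arbitrary: z)
  case 0
  hence "z = 0" by (intro column_eqI) auto
  moreover have "tot_d (labelled G) (Suc n) 0 = 0" by (rule linear_map_zero[OF Q.tot_d_linear])
  ultimately show ?case using tot_chains_zero by metis
next
  case (Suc q)
  let ?Q = "labelled G"
  interpret F: precyclic ?Q G forget by (rule forget_precyclic)
  have q: "q \<le> n" using Suc.prems by simp
  have c: "column z q \<in> chains ?Q (n - q)" by (rule column_chains[OF Suc.prems(1) q])
  have v: "vert ?Q q (n - q) (column z q) = 0"
  proof (cases "q < n")
    case True
    have "column z (Suc q) = 0" by (rule Suc.prems(4)) simp
    moreover have "column (tot_d ?Q n z) q = 0" unfolding Suc.prems(2) by simp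
    ultimately show ?thesis using True unfolding column_tot_d by (simp only: if_True horiz_zero add_0_right)
  qed (use q in \<open>simp add: vert_def\<close>)
  obtain y where y: "y \<in> chains ?Q (Suc (n - q))" "forget y = 0" "vert ?Q q (Suc (n - q)) y = column z q"
    by (rule kernel_column_acyclic[OF c Suc.prems(3) v])
  define w where "w = single_column q y"
  have w: "w \<in> tot_chains ?Q (Suc n)" unfolding w_def
    using y q by (intro single_column_tot_chains) (auto simp: Suc_diff_le)
  have dw: "tot_d ?Q (Suc n) w \<in> tot_chains ?Q n" using Q.tot_d_closed[OF w] by simp
  have cw: "column (tot_d ?Q (Suc n) w) p =
      (if p = q then column z q else if Suc p = q then horiz p (n - p) y else 0)" for p
    using q y(3) by (auto simp: column_tot_d w_def Suc_diff_le)
  let ?z = "z - tot_d ?Q (Suc n) w"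
  have "\<exists>y'\<in>tot_chains ?Q (Suc n). tot_d ?Q (Suc n) y' = ?z"
  proof (rule Suc.IH)
    show "?z \<in> tot_chains ?Q n" by (rule tot_chains_diff[OF Suc.prems(1) dw])
    have "tot_d ?Q n ?z = tot_d ?Q n z - tot_d ?Q n (tot_d ?Q (Suc n) w)"
      using Suc.prems(1) dw by (intro linear_map_diff[OF Q.tot_d_linear]) (auto simp: tot_chains_def)
    also have "\<dots> = 0" unfolding Suc.prems(2) Q.tot_d_tot_d[OF w] by simp
    finally show "tot_d ?Q n ?z = 0" .
    show "forget (column ?z p) = 0" for p
    proof (cases "p \<le> n")
      case True
      have "forget (horiz p (n - p) y) = 0" if "Suc p = q"
      proof -
        have "Suc (n - q) = n - p" using that q by simp
        hence "y \<in> chains ?Q (n - p)" using y(1) by simp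
        from F.map_horiz[OF this, of p] show ?thesis unfolding y(2) horiz_zero .
      qed
      hence fw: "forget (column (tot_d ?Q (Suc n) w) p) = 0"
        using Suc.prems(3)[of q] unfolding cw by (simp add: fun_eq_iff)
      have "forget (column ?z p) = forget (column z p) - forget (column (tot_d ?Q (Suc n) w) p)"
        using column_chains[OF Suc.prems(1) True] column_chains[OF dw True]
        by (simp only: column_diff) (intro linear_map_diff[OF F.linear], auto simp: chains_def)
      also have "\<dots> = 0" unfolding fw Suc.prems(3)[of p] by simp
      finally show ?thesis .
    next
      case False
      thus ?thesis using Suc.prems(1) dw by (simp add: tot_chains_iff)
    qed
    show "column ?z p = 0" if "q \<le> p" for p
      using that Suc.prems(4)[of p] by (cases "p = q") (auto simp: cw)
    show "q \<le> Suc n" using q by simp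
  qed
  then obtain y' where y': "y' \<in> tot_chains ?Q (Suc n)" "tot_d ?Q (Suc n) y' = ?z" by blast
  have "tot_d ?Q (Suc n) (y' + w) = tot_d ?Q (Suc n) y' + tot_d ?Q (Suc n) w"
    using y'(1) w by (intro linear_map_add[OF Q.tot_d_linear]) (auto simp: tot_chains_def)
  hence "tot_d ?Q (Suc n) (y' + w) = z" unfolding y'(2) by simp
  thus ?case using tot_chains_add[OF y'(1) w] by blast
qed

lemma forget_label_difference:
  assumes c: "c \<in> chains G n"
  shows "forget (label True c - label False c) = 0"
proof -
  note fl = precyclic.linear[OF forget_precyclic]
  have "forget (label e c) = c" for e
    by (rule linear_map_eqI[OF linear_map_comp[OF fl precyclic.linear[OF label_precyclic]] linear_map_id _
        c[unfolded chains_def]]) (simp add: forget_def label_def comp_def)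
  moreover have "forget (label True c - label False c) = forget (label True c) - forget (label False c)"
    using precyclic.closed[OF label_precyclic c]
    by (intro linear_map_diff[OF fl]) (auto simp: chains_def)
  ultimately show ?thesis by simp
qed

text \<open>The two constant labellings of a cycle differ by a cycle in the kernel of \<open>forget\<close>, hence by a boundary.\<close>

theorem labels_homotopic_HH:
  assumes f: "precyclic (labelled G) K f" and c: "c \<in> chains G n" "hoch_b G n c = 0"
  shows "f (label True c) - f (label False c) \<in> HH_bdry K n"
proof -
  let ?Q = "labelled G"
  interpret f: precyclic ?Q K f by (rule f)
  let ?k = "label True c - label False c"
  have lc: "label e c \<in> chains ?Q n" for e by (rule precyclic.closed[OF label_precyclic c(1)])
  have kc: "?k \<in> chains ?Q n" by (rule chains_diff[OF lc lc])
  have "hoch_b ?Q n (label e c) = 0" for e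
    using precyclic.map_hoch_b[OF label_precyclic[of e] c(1)] c(2) precyclic.zero[OF label_precyclic[of e]] by simp
  moreover have "hoch_b ?Q n ?k = hoch_b ?Q n (label True c) - hoch_b ?Q n (label False c)"
    using lc by (intro linear_map_diff[OF Q.hoch_b_linear]) (auto simp: chains_def)
  ultimately have "vert ?Q 0 n ?k = 0" by (simp add: vert_def)
  then obtain y where y: "y \<in> chains ?Q (Suc n)" "vert ?Q 0 (Suc n) y = ?k"
    by (rule kernel_column_acyclic[OF kc forget_label_difference[OF c(1)]])
  have "hoch_b K (Suc n) (f y) = f ?k" using y f.map_hoch_b[OF y(1)] by (simp add: vert_def)
  also have "f ?k = f (label True c) - f (label False c)"
    using lc by (intro linear_map_diff[OF f.linear]) (auto simp: chains_def)
  finally show ?thesis using f.closed[OF y(1)] unfolding HH_bdry_def by force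
qed

theorem labels_homotopic_HC:
  assumes f: "precyclic (labelled G) K f" and z: "z \<in> tot_chains G n" "tot_d G n z = 0"
  shows "on_columns f (on_columns (label True) z) - on_columns f (on_columns (label False) z) \<in> HC_bdry K n"
proof -
  let ?Q = "labelled G"
  interpret f: precyclic ?Q K f by (rule f)
  let ?l = "\<lambda>e. on_columns (label e) z"
  let ?k = "?l True - ?l False"
  have lc: "?l e \<in> tot_chains ?Q n" for e by (rule precyclic.on_columns_closed[OF label_precyclic z(1)])
  have kc: "?k \<in> tot_chains ?Q n" by (rule tot_chains_diff[OF lc lc])
  have l0: "label e (0 :: 'a list \<Rightarrow> complex) = 0" for e by (rule precyclic.zero[OF label_precyclic])
  have "on_columns (label e) (0 :: nat \<times> 'a list \<Rightarrow> complex) = 0" for e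
    by (rule column_eqI) (simp add: l0 fun_eq_iff)
  hence "tot_d ?Q n (?l e) = 0" for e
    using precyclic.tot_d_on_columns[OF label_precyclic[of e] z(1)] z(2) by simp
  moreover have "tot_d ?Q n ?k = tot_d ?Q n (?l True) - tot_d ?Q n (?l False)"
    using lc by (intro linear_map_diff[OF Q.tot_d_linear]) (auto simp: tot_chains_def)
  ultimately have d: "tot_d ?Q n ?k = 0" by simp
  have fk: "forget (column ?k p) = 0" for p
  proof (cases "p \<le> n")
    case True
    thus ?thesis using forget_label_difference[OF column_chains[OF z(1) True]] by simp
  next
    case False
    thus ?thesis using z(1) precyclic.zero[OF forget_precyclic] by (simp add: tot_chains_iff l0)
  qed
  have "\<exists>y\<in>tot_chains ?Q (Suc n). tot_d ?Q (Suc n) y = ?k"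
    by (rule kernel_total_acyclic[OF kc d fk, of "Suc n"]) (use kc in \<open>auto simp: tot_chains_iff\<close>)
  then obtain y where y: "y \<in> tot_chains ?Q (Suc n)" "tot_d ?Q (Suc n) y = ?k" by blast
  have "on_columns f (?l True) = on_columns f (?k + ?l False)" by simp
  also have "\<dots> = on_columns f ?k + on_columns f (?l False)" by (rule f.on_columns_add[OF kc lc])
  finally have "on_columns f ?k = on_columns f (?l True) - on_columns f (?l False)" by simp
  moreover have "tot_d K (Suc n) (on_columns f y) = on_columns f ?k"
    using f.tot_d_on_columns[OF y(1)] y(2) by simp
  ultimately show ?thesis using f.on_columns_closed[OF y(1)] unfolding HC_bdry_def by force
qed

end

section \<open>Traces of matrix representations\<close>

lemma integral_of_weighted:
  assumes "c \<in> fin_span X" shows "integral_of (\<lambda>x. w x * c x) \<psi> = integral_of c (\<lambda>x. w x * \<psi> x)"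
proof -
  have "finite {x. c x \<noteq> 0}" using assms by (simp add: fin_span_iff)
  thus ?thesis
    by (subst integral_of_superset[of "{x. c x \<noteq> 0}"]) (auto simp: integral_of_def algebra_simps)
qed

lemma fin_span_weighted: "c \<in> fin_span X \<Longrightarrow> (\<lambda>x. w x * c x) \<in> fin_span X"
  using linear_map_closed[OF linear_map_mult] .

text \<open>For matrices \<open>\<rho> x\<close> with entries in a group algebra, this is the integral of a test function
  over the \<open>(i, j)\<close> entry of the product \<open>\<rho> x\<^sub>0 \<cdot> \<dots> \<cdot> \<rho> x\<^sub>n\<close> that is formed with tensor products in
  place of products.\<close>

fun path_integral ::
    "'i set \<Rightarrow> ('h \<Rightarrow> 'i \<Rightarrow> 'i \<Rightarrow> 'g \<Rightarrow> complex) \<Rightarrow> 'i \<Rightarrow> 'h list \<Rightarrow> 'i \<Rightarrow> ('g list \<Rightarrow> complex) \<Rightarrow> complex" where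
  "path_integral J \<rho> i [] j \<psi> = (if i = j then \<psi> [] else 0)"
| "path_integral J \<rho> i (x # xs) j \<psi> =
     (\<Sum>k\<in>J. integral_of (\<rho> x i k) (\<lambda>h. path_integral J \<rho> k xs j (\<lambda>hs. \<psi> (h # hs))))"

definition trace_kernel ::
    "'i set \<Rightarrow> ('h \<Rightarrow> 'i \<Rightarrow> 'i \<Rightarrow> 'g \<Rightarrow> complex) \<Rightarrow> ('i \<Rightarrow> 'g list \<Rightarrow> complex) \<Rightarrow> 'h list \<Rightarrow> 'g list \<Rightarrow> complex" where
  "trace_kernel J \<rho> v xs = (\<lambda>ys. \<Sum>i\<in>J. path_integral J \<rho> i xs i (\<lambda>hs. v i hs * delta hs ys))"

definition rep_trace ::
    "'i set \<Rightarrow> ('h \<Rightarrow> 'i \<Rightarrow> 'i \<Rightarrow> 'g \<Rightarrow> complex) \<Rightarrow> ('i \<Rightarrow> 'g list \<Rightarrow> complex) \<Rightarrow> ('h list \<Rightarrow> complex) \<Rightarrow> 'g list \<Rightarrow> complex" where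
  "rep_trace J \<rho> v = lin_ext (trace_kernel J \<rho> v)"

lemma path_integral_zero: "path_integral J \<rho> i xs j (\<lambda>hs. 0) = 0"
  by (induction xs arbitrary: i) simp_all

lemma path_integral_append:
  assumes "finite J" "i \<in> J"
  shows "path_integral J \<rho> i (us @ ws) j \<psi> =
    (\<Sum>k\<in>J. path_integral J \<rho> i us k (\<lambda>hs. path_integral J \<rho> k ws j (\<lambda>hs'. \<psi> (hs @ hs'))))"
  using assms(2)
proof (induction us arbitrary: i \<psi>)
  case Nil
  thus ?case using assms(1) by simp
next
  case (Cons u us)
  have "path_integral J \<rho> i ((u # us) @ ws) j \<psi> =
    (\<Sum>l\<in>J. integral_of (\<rho> u i l) (\<lambda>h. \<Sum>k\<in>J. path_integral J \<rho> l us k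
      (\<lambda>hs. path_integral J \<rho> k ws j (\<lambda>hs'. \<psi> (h # hs @ hs')))))"
    by (simp add: Cons.IH)
  also have "\<dots> = (\<Sum>k\<in>J. path_integral J \<rho> i (u # us) k (\<lambda>hs. path_integral J \<rho> k ws j (\<lambda>hs'. \<psi> (hs @ hs'))))"
    unfolding integral_of_sum_right by (subst sum.swap) simp
  finally show ?case .
qed

lemma path_integral_single:
  "finite J \<Longrightarrow> j \<in> J \<Longrightarrow> path_integral J \<rho> i [x] j \<psi> = integral_of (\<rho> x i j) (\<lambda>h. \<psi> [h])"
proof -
  assume J: "finite J" "j \<in> J"
  have "path_integral J \<rho> i [x] j \<psi> = (\<Sum>k\<in>J. if k = j then integral_of (\<rho> x i k) (\<lambda>h. \<psi> [h]) else 0)"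
    by (auto intro!: sum.cong)
  thus ?thesis using J by (simp add: sum.delta)
qed

locale matrix_rep = H: left_unital_semigroup H + G: left_unital_semigroup G
  for H :: "('h, 'm) monoid_scheme" and G :: "('g, 'k) monoid_scheme" +
  fixes J :: "'i set" and \<rho> :: "'h \<Rightarrow> 'i \<Rightarrow> 'i \<Rightarrow> 'g \<Rightarrow> complex"
  assumes finite_index: "finite J"
    and entry: "x \<in> carrier H \<Longrightarrow> i \<in> J \<Longrightarrow> j \<in> J \<Longrightarrow> \<rho> x i j \<in> group_algebra G"
    and multiplicative: "x \<in> carrier H \<Longrightarrow> y \<in> carrier H \<Longrightarrow> i \<in> J \<Longrightarrow> k \<in> J \<Longrightarrow>
      (\<Sum>j\<in>J. integral_of (\<rho> x i j) (\<lambda>g. integral_of (\<rho> y j k) (\<lambda>h. \<theta> (g \<otimes>\<^bsub>G\<^esub> h)))) =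
      integral_of (\<rho> (x \<otimes>\<^bsub>H\<^esub> y) i k) \<theta>"
begin

text \<open>The integrals come from an element of the tensor power; with it, they can be restricted to tuples in
  the group and interchanged with other integrals.\<close>

lemma path_integral_representable:
  assumes "set xs \<subseteq> carrier H" "i \<in> J"
  shows "\<exists>c. c \<in> fin_span {hs. length hs = length xs \<and> set hs \<subseteq> carrier G} \<and>
    (\<forall>\<psi>. path_integral J \<rho> i xs j \<psi> = integral_of c \<psi>)"
  using assms
proof (induction xs arbitrary: i)
  case Nil
  show ?case
    by (rule exI[of _ "if i = j then delta [] else 0"]) auto
next
  case (Cons x xs)
  let ?Y = "{hs. length hs = length xs \<and> set hs \<subseteq> carrier G}"
  let ?Z = "{hs. length hs = length (x # xs) \<and> set hs \<subseteq> carrier G}"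
  have "\<forall>k\<in>J. \<exists>c. c \<in> fin_span ?Y \<and> (\<forall>\<psi>. path_integral J \<rho> k xs j \<psi> = integral_of c \<psi>)"
    using Cons by auto
  from bchoice[OF this] obtain c where c: "\<And>k. k \<in> J \<Longrightarrow> c k \<in> fin_span ?Y"
    "\<And>k \<psi>. k \<in> J \<Longrightarrow> path_integral J \<rho> k xs j \<psi> = integral_of (c k) \<psi>"
    by blast
  define d where "d = (\<lambda>k. lin_ext (\<lambda>h. lin_ext (\<lambda>hs. delta (h # hs)) (c k)) (\<rho> x i k))"
  have r: "\<rho> x i k \<in> fin_span (carrier G)" if "k \<in> J" for k
    using entry[of x i k] that Cons.prems by (simp add: group_algebra_def)
  have inner: "lin_ext (\<lambda>hs. delta (h # hs)) (c k) \<in> fin_span ?Z" if "k \<in> J" "h \<in> carrier G" for h k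
    by (rule fin_span_lin_ext[OF c(1)]) (use that in auto)
  have d: "d k \<in> fin_span ?Z" if "k \<in> J" for k
    unfolding d_def by (rule fin_span_lin_ext[OF r[OF that]]) (use that inner in auto)
  have id: "integral_of (d k) \<psi> = integral_of (\<rho> x i k) (\<lambda>h. path_integral J \<rho> k xs j (\<lambda>hs. \<psi> (h # hs)))"
    if k: "k \<in> J" for k \<psi>
  proof -
    have "integral_of (d k) \<psi> = integral_of (\<rho> x i k) (\<lambda>h. integral_of (lin_ext (\<lambda>hs. delta (h # hs)) (c k)) \<psi>)"
      unfolding d_def by (rule integral_of_lin_ext[OF r[OF k]]) (use k inner in auto)
    also have "\<dots> = integral_of (\<rho> x i k) (\<lambda>h. integral_of (c k) (\<lambda>hs. \<psi> (h # hs)))"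
    proof (rule integral_of_cong)
      fix h assume "\<rho> x i k h \<noteq> 0"
      hence "h \<in> carrier G" using fin_span_supp[OF r[OF k]] by blast
      thus "integral_of (lin_ext (\<lambda>hs. delta (h # hs)) (c k)) \<psi> = integral_of (c k) (\<lambda>hs. \<psi> (h # hs))"
        using integral_of_lin_ext[OF c(1)[OF k], of "\<lambda>hs. delta (h # hs)" UNIV \<psi>] by simp
    qed
    finally show ?thesis by (simp add: c(2)[OF k])
  qed
  have "\<forall>\<psi>. path_integral J \<rho> i (x # xs) j \<psi> = integral_of (\<Sum>k\<in>J. d k) \<psi>"
    using integral_of_sum[of J d ?Z] d id by simp
  moreover have "(\<Sum>k\<in>J. d k) \<in> fin_span ?Z" using d by (rule fin_span_sum)
  ultimately show ?case by blast
qed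

lemma path_integral_cong:
  assumes "set xs \<subseteq> carrier H" "i \<in> J"
    and "\<And>hs. length hs = length xs \<Longrightarrow> set hs \<subseteq> carrier G \<Longrightarrow> \<psi> hs = \<theta> hs"
  shows "path_integral J \<rho> i xs j \<psi> = path_integral J \<rho> i xs j \<theta>"
proof -
  obtain c where c: "c \<in> fin_span {hs. length hs = length xs \<and> set hs \<subseteq> carrier G}"
    "\<And>\<psi>. path_integral J \<rho> i xs j \<psi> = integral_of c \<psi>"
    using path_integral_representable[OF assms(1,2)] by blast
  show ?thesis unfolding c(2)
    by (rule integral_of_cong, rule assms(3)) (use fin_span_supp[OF c(1)] in auto)
qed

lemma path_integral_swap:
  assumes "set xs \<subseteq> carrier H" "i \<in> J"
  shows "path_integral J \<rho> i xs j (\<lambda>hs. integral_of c (\<lambda>h. \<psi> hs h)) =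
    integral_of c (\<lambda>h. path_integral J \<rho> i xs j (\<lambda>hs. \<psi> hs h))"
proof -
  obtain d where d: "\<And>\<psi>. path_integral J \<rho> i xs j \<psi> = integral_of d \<psi>"
    using path_integral_representable[OF assms] by blast
  show ?thesis unfolding d by (rule integral_of_swap)
qed

lemma path_integral_face:
  assumes "Suc m < length xs" "set xs \<subseteq> carrier H" "i \<in> J"
  shows "path_integral J \<rho> i (face H m xs) j \<psi> = path_integral J \<rho> i xs j (\<lambda>hs. \<psi> (face G m hs))"
  using assms
proof (induction xs arbitrary: i m \<psi>)
  case (Cons x xs)
  obtain y r where xs: "xs = y # r" using Cons.prems by (cases xs) auto
  have car: "x \<in> carrier H" "y \<in> carrier H" "set r \<subseteq> carrier H" using Cons.prems xs by auto
  show ?case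
  proof (cases m)
    case 0
    have "path_integral J \<rho> i (face H m (x # xs)) j \<psi> =
        (\<Sum>k\<in>J. integral_of (\<rho> (x \<otimes>\<^bsub>H\<^esub> y) i k) (\<lambda>h. path_integral J \<rho> k r j (\<lambda>hs. \<psi> (h # hs))))"
      by (simp add: 0 xs face_0)
    also have "\<dots> = (\<Sum>k\<in>J. \<Sum>l\<in>J. integral_of (\<rho> x i l) (\<lambda>a. integral_of (\<rho> y l k)
        (\<lambda>b. path_integral J \<rho> k r j (\<lambda>hs. \<psi> ((a \<otimes>\<^bsub>G\<^esub> b) # hs)))))"
    proof (intro sum.cong refl)
      fix k assume "k \<in> J"
      from multiplicative[OF car(1,2) Cons.prems(3) this, of "\<lambda>h. path_integral J \<rho> k r j (\<lambda>hs. \<psi> (h # hs))"]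
      show "integral_of (\<rho> (x \<otimes>\<^bsub>H\<^esub> y) i k) (\<lambda>h. path_integral J \<rho> k r j (\<lambda>hs. \<psi> (h # hs))) =
          (\<Sum>l\<in>J. integral_of (\<rho> x i l) (\<lambda>a. integral_of (\<rho> y l k)
            (\<lambda>b. path_integral J \<rho> k r j (\<lambda>hs. \<psi> ((a \<otimes>\<^bsub>G\<^esub> b) # hs)))))" ..
    qed
    also have "\<dots> = (\<Sum>l\<in>J. \<Sum>k\<in>J. integral_of (\<rho> x i l) (\<lambda>a. integral_of (\<rho> y l k)
        (\<lambda>b. path_integral J \<rho> k r j (\<lambda>hs. \<psi> ((a \<otimes>\<^bsub>G\<^esub> b) # hs)))))"
      by (rule sum.swap)
    also have "\<dots> = path_integral J \<rho> i (x # xs) j (\<lambda>hs. \<psi> (face G m hs))"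
      by (simp add: 0 xs face_0 integral_of_sum_right)
    finally show ?thesis .
  next
    case (Suc l)
    have f: "face H m (x # xs) = x # face H l xs" unfolding Suc using Cons.prems Suc by (intro face_Suc) auto
    have "path_integral J \<rho> k (face H l xs) j (\<lambda>hs. \<psi> (h # hs)) =
        path_integral J \<rho> k xs j (\<lambda>hs. \<psi> (face G m (h # hs)))" if k: "k \<in> J" for k h
    proof -
      have "path_integral J \<rho> k (face H l xs) j (\<lambda>hs. \<psi> (h # hs)) =
          path_integral J \<rho> k xs j (\<lambda>hs. \<psi> (h # face G l hs))"
        using Cons.IH[of l k "\<lambda>hs. \<psi> (h # hs)"] Cons.prems Suc k by simp
      also have "\<dots> = path_integral J \<rho> k xs j (\<lambda>hs. \<psi> (face G m (h # hs)))"
        by (rule path_integral_cong) (use Cons.prems Suc k in \<open>auto simp: face_Suc\<close>)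
      finally show ?thesis .
    qed
    thus ?thesis unfolding f by simp
  qed
qed simp

end

text \<open>A weight may be put on the diagonal entries if it behaves like a class function.\<close>

locale weighted_matrix_rep = matrix_rep H G J \<rho>
  for H :: "('h, 'm) monoid_scheme" and G :: "('g, 'k) monoid_scheme"
    and J :: "'i set" and \<rho> :: "'h \<Rightarrow> 'i \<Rightarrow> 'i \<Rightarrow> 'g \<Rightarrow> complex" +
  fixes v :: "'i \<Rightarrow> 'g list \<Rightarrow> complex"
  assumes weight_face: "i \<in> J \<Longrightarrow> hs \<in> tuples G (Suc n) \<Longrightarrow> m \<le> n \<Longrightarrow> v i (face G m hs) = v i hs"
    and weight_rot: "x \<in> carrier H \<Longrightarrow> i \<in> J \<Longrightarrow> k \<in> J \<Longrightarrow> \<rho> x k i h \<noteq> 0 \<Longrightarrow> set hs \<subseteq> carrier G \<Longrightarrow>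
      v i (hs @ [h]) = v k (h # hs)"
begin

lemma trace_kernel_integral:
  assumes xs: "xs \<in> tuples H n"
  shows "trace_kernel J \<rho> v xs \<in> fin_span (tuples G n)"
    and "integral_of (trace_kernel J \<rho> v xs) \<psi> = (\<Sum>i\<in>J. path_integral J \<rho> i xs i (\<lambda>hs. v i hs * \<psi> hs))"
proof -
  have t: "{hs. length hs = length xs \<and> set hs \<subseteq> carrier G} = tuples G n"
    using xs by (auto simp: tuples_def)
  have "\<forall>i\<in>J. \<exists>c. c \<in> fin_span (tuples G n) \<and> (\<forall>\<psi>. path_integral J \<rho> i xs i \<psi> = integral_of c \<psi>)"
    using path_integral_representable[of xs] xs unfolding t by (auto simp: tuples_def)
  from bchoice[OF this] obtain c where c: "\<And>i. i \<in> J \<Longrightarrow> c i \<in> fin_span (tuples G n)"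
    "\<And>i \<psi>. i \<in> J \<Longrightarrow> path_integral J \<rho> i xs i \<psi> = integral_of (c i) \<psi>"
    by blast
  define d where "d = (\<lambda>i hs. v i hs * c i hs)"
  have d: "d i \<in> fin_span (tuples G n)" if "i \<in> J" for i
    unfolding d_def using c(1)[OF that] by (rule fin_span_weighted)
  have di: "integral_of (d i) \<psi> = path_integral J \<rho> i xs i (\<lambda>hs. v i hs * \<psi> hs)" if "i \<in> J" for i \<psi>
    unfolding d_def c(2)[OF that] by (rule integral_of_weighted[OF c(1)[OF that]])
  have k: "trace_kernel J \<rho> v xs = (\<Sum>i\<in>J. d i)"
  proof
    fix ys
    have "d i ys = path_integral J \<rho> i xs i (\<lambda>hs. v i hs * delta hs ys)" if "i \<in> J" for i
      using di[OF that, of "\<lambda>hs. delta hs ys"] integral_of_point[OF d[OF that]] by simp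
    thus "trace_kernel J \<rho> v xs ys = (\<Sum>i\<in>J. d i) ys" by (simp add: trace_kernel_def sum_fun_apply)
  qed
  show "trace_kernel J \<rho> v xs \<in> fin_span (tuples G n)" unfolding k using d by (rule fin_span_sum)
  show "integral_of (trace_kernel J \<rho> v xs) \<psi> = (\<Sum>i\<in>J. path_integral J \<rho> i xs i (\<lambda>hs. v i hs * \<psi> hs))"
    unfolding k using integral_of_sum[of J d, OF d] di by simp
qed

text \<open>Inner faces multiply neighbouring matrices, and rotating the factors is the cyclicity of the trace.\<close>

theorem rep_trace_precyclic: "precyclic H G (rep_trace J \<rho> v)"
proof (rule precyclic_mapI)
  show "left_unital_semigroup H" "left_unital_semigroup G"
    by (rule H.left_unital_semigroup_axioms G.left_unital_semigroup_axioms)+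
  show "linear_map (tuples H n) (tuples G n) (rep_trace J \<rho> v)" for n
    unfolding rep_trace_def by (rule linear_map_lin_ext) (rule trace_kernel_integral)
next
  fix n xs assume xs: "xs \<in> tuples H n"
  note K = trace_kernel_integral[OF xs] and K' = trace_kernel_integral[OF rot_tuples[OF xs]]
  obtain us x where us: "xs = us @ [x]" using xs by (cases xs rule: rev_cases) (auto simp: tuples_def)
  have car: "x \<in> carrier H" "set us \<subseteq> carrier H" using xs us by (auto simp: tuples_def)
  have "trace_kernel J \<rho> v (rot xs) = rot_map (trace_kernel J \<rho> v xs)"
  proof (rule fin_span_eqI[OF K'(1)])
    show "rot_map (trace_kernel J \<rho> v xs) \<in> fin_span (tuples G n)"
      using K(1) by (rule linear_map_closed[OF rot_map_linear])
    fix \<psi>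
    have "integral_of (rot_map (trace_kernel J \<rho> v xs)) \<psi> = integral_of (trace_kernel J \<rho> v xs) (\<lambda>hs. \<psi> (rot hs))"
      unfolding rot_map_def by (subst integral_of_lin_ext[OF K(1), where Y = UNIV]) auto
    also have "\<dots> = (\<Sum>i\<in>J. path_integral J \<rho> i (us @ [x]) i (\<lambda>hs. v i hs * \<psi> (rot hs)))"
      unfolding us[symmetric] K(2) ..
    also have "\<dots> = (\<Sum>i\<in>J. \<Sum>k\<in>J. path_integral J \<rho> i us k (\<lambda>hs. integral_of (\<rho> x k i)
        (\<lambda>h. v i (hs @ [h]) * \<psi> (h # hs))))"
      by (intro sum.cong refl)
        (simp add: path_integral_append[OF finite_index] path_integral_single[OF finite_index] del: path_integral.simps)
    also have "\<dots> = (\<Sum>i\<in>J. \<Sum>k\<in>J. integral_of (\<rho> x k i) (\<lambda>h. path_integral J \<rho> i us k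
        (\<lambda>hs. v i (hs @ [h]) * \<psi> (h # hs))))"
      by (intro sum.cong refl path_integral_swap car)
    also have "\<dots> = (\<Sum>i\<in>J. \<Sum>k\<in>J. integral_of (\<rho> x k i) (\<lambda>h. path_integral J \<rho> i us k
        (\<lambda>hs. v k (h # hs) * \<psi> (h # hs))))"
      by (intro sum.cong refl integral_of_cong path_integral_cong car arg_cong2[of _ _ _ _ "(*)"]
          weight_rot[OF car(1)])
    also have "\<dots> = (\<Sum>k\<in>J. \<Sum>i\<in>J. integral_of (\<rho> x k i) (\<lambda>h. path_integral J \<rho> i us k
        (\<lambda>hs. v k (h # hs) * \<psi> (h # hs))))"
      by (rule sum.swap)
    also have "\<dots> = integral_of (trace_kernel J \<rho> v (rot xs)) \<psi>" unfolding K'(2) by (simp add: us)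
    finally show "integral_of (trace_kernel J \<rho> v (rot xs)) \<psi> = integral_of (rot_map (trace_kernel J \<rho> v xs)) \<psi>" ..
  qed
  thus "rep_trace J \<rho> v (delta (rot xs)) = rot_map (rep_trace J \<rho> v (delta xs))"
    by (simp add: rep_trace_def)
next
  fix n xs m assume xs: "xs \<in> tuples H (Suc n)" and m: "m \<le> n"
  note K = trace_kernel_integral[OF xs] and K' = trace_kernel_integral[OF H.face_tuples[OF xs], of m]
  have car: "set xs \<subseteq> carrier H" "Suc m < length xs" "length xs = Suc (Suc n)"
    using xs m by (auto simp: tuples_def)
  have "trace_kernel J \<rho> v (face H m xs) = face_map G m (trace_kernel J \<rho> v xs)"
  proof (rule fin_span_eqI[OF K'(1)])
    show "face_map G m (trace_kernel J \<rho> v xs) \<in> fin_span (tuples G n)"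
      using K(1) by (rule linear_map_closed[OF G.face_map_linear])
    fix \<psi>
    have "integral_of (face_map G m (trace_kernel J \<rho> v xs)) \<psi> =
        integral_of (trace_kernel J \<rho> v xs) (\<lambda>hs. \<psi> (face G m hs))"
      unfolding face_map_def by (subst integral_of_lin_ext[OF K(1), where Y = UNIV]) auto
    also have "\<dots> = (\<Sum>i\<in>J. path_integral J \<rho> i xs i (\<lambda>hs. v i hs * \<psi> (face G m hs)))"
      unfolding K(2) ..
    also have "\<dots> = (\<Sum>i\<in>J. path_integral J \<rho> i xs i (\<lambda>hs. v i (face G m hs) * \<psi> (face G m hs)))"
      by (intro sum.cong refl path_integral_cong[OF car(1)])
        (use weight_face[of _ _ n m] m car in \<open>auto simp: tuples_def\<close>)
    also have "\<dots> = integral_of (trace_kernel J \<rho> v (face H m xs)) \<psi>"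
      unfolding K'(2) by (intro sum.cong refl path_integral_face[OF car(2,1), symmetric])
    finally show "integral_of (trace_kernel J \<rho> v (face H m xs)) \<psi> =
        integral_of (face_map G m (trace_kernel J \<rho> v xs)) \<psi>" ..
  qed
  thus "rep_trace J \<rho> v (delta (face H m xs)) = face_map G m (rep_trace J \<rho> v (delta xs))"
    by (simp add: rep_trace_def)
qed

end

subsection \<open>The trace as a sum over closed index paths\<close>

context matrix_rep begin

lemma path_integral_delta_Cons:
  assumes "x \<in> carrier H" "i \<in> J"
  shows "path_integral J \<rho> i (x # xs) j (\<lambda>hs. delta hs (y # ys)) =
    (\<Sum>k\<in>J. \<rho> x i k y * path_integral J \<rho> k xs j (\<lambda>hs. delta hs ys))"
  unfolding path_integral.simps
proof (intro sum.cong refl)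
  fix k assume k: "k \<in> J"
  have "(\<lambda>h. path_integral J \<rho> k xs j (\<lambda>hs. delta (h # hs) (y # ys))) =
      (\<lambda>h. path_integral J \<rho> k xs j (\<lambda>hs. delta hs ys) * delta h y)"
  proof
    fix h show "path_integral J \<rho> k xs j (\<lambda>hs. delta (h # hs) (y # ys)) =
      path_integral J \<rho> k xs j (\<lambda>hs. delta hs ys) * delta h y"
      by (cases "h = y") (simp_all add: delta_def path_integral_zero)
  qed
  thus "integral_of (\<rho> x i k) (\<lambda>h. path_integral J \<rho> k xs j (\<lambda>hs. delta (h # hs) (y # ys))) =
      \<rho> x i k y * path_integral J \<rho> k xs j (\<lambda>hs. delta hs ys)"
    using integral_of_point[OF entry[OF assms k, unfolded group_algebra_def], of y]
    by (simp add: integral_of_scale_right)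
qed

lemma path_integral_delta:
  assumes "set xs \<subseteq> carrier H" "i \<in> J" "length ys = length xs"
  shows "path_integral J \<rho> i xs j (\<lambda>hs. delta hs ys) =
    (\<Sum>ks | length ks = length xs \<and> set ks \<subseteq> J \<and> last (i # ks) = j.
      \<Prod>m<length xs. \<rho> (xs ! m) ((i # ks) ! m) (ks ! m) (ys ! m))"
  using assms
proof (induction xs arbitrary: i ys)
  case Nil
  have "{ks. length ks = length [] \<and> set ks \<subseteq> J \<and> last (i # ks) = j} = (if i = j then {[]} else {})" by auto
  thus ?case using Nil by (simp add: delta_def)
next
  case (Cons x xs)
  then obtain y ys' where ys: "ys = y # ys'" by (cases ys) auto
  let ?T = "\<lambda>k. {ks. length ks = length xs \<and> set ks \<subseteq> J \<and> last (k # ks) = j}"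
  let ?f = "\<lambda>ks. \<Prod>m<length (x # xs). \<rho> ((x # xs) ! m) ((i # ks) ! m) (ks ! m) (ys ! m)"
  have fin: "finite (?T k)" for k
    by (rule finite_subset[OF _ finite_lists_length_eq[OF finite_index, of "length xs"]]) auto
  have set: "{ks. length ks = length (x # xs) \<and> set ks \<subseteq> J \<and> last (i # ks) = j} =
      (\<lambda>(k, ks). k # ks) ` Sigma J ?T"
  proof (rule Set.set_eqI)
    fix ks show "ks \<in> {ks. length ks = length (x # xs) \<and> set ks \<subseteq> J \<and> last (i # ks) = j} \<longleftrightarrow>
      ks \<in> (\<lambda>(k, ks). k # ks) ` Sigma J ?T"
      by (cases ks) (auto simp: image_iff)
  qed
  have "path_integral J \<rho> i (x # xs) j (\<lambda>hs. delta hs ys) =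
      (\<Sum>k\<in>J. \<rho> x i k y * path_integral J \<rho> k xs j (\<lambda>hs. delta hs ys'))"
    unfolding ys using Cons.prems by (intro path_integral_delta_Cons) auto
  also have "\<dots> = (\<Sum>k\<in>J. \<Sum>ks\<in>?T k. ?f (k # ks))"
  proof (rule sum.cong)
    fix k assume k: "k \<in> J"
    have "path_integral J \<rho> k xs j (\<lambda>hs. delta hs ys') =
        (\<Sum>ks\<in>?T k. \<Prod>m<length xs. \<rho> (xs ! m) ((k # ks) ! m) (ks ! m) (ys' ! m))"
      using Cons.IH[of k ys'] Cons.prems k ys by auto
    moreover have "?f (k # ks) = \<rho> x i k y * (\<Prod>m<length xs. \<rho> (xs ! m) ((k # ks) ! m) (ks ! m) (ys' ! m))" for ks
      by (simp add: ys prod.lessThan_Suc_shift del: prod.lessThan_Suc)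
    ultimately show "\<rho> x i k y * path_integral J \<rho> k xs j (\<lambda>hs. delta hs ys') = (\<Sum>ks\<in>?T k. ?f (k # ks))"
      by (simp add: sum_distrib_left)
  qed simp
  also have "\<dots> = (\<Sum>p\<in>Sigma J ?T. ?f (fst p # snd p))"
    using finite_index fin by (subst sum.Sigma) (auto simp: case_prod_beta)
  also have "\<dots> = sum ?f ((\<lambda>(k, ks). k # ks) ` Sigma J ?T)"
    by (subst sum.reindex) (auto simp: inj_on_def case_prod_beta)
  finally show ?case unfolding set .
qed

text \<open>A closed path is recorded either by the targets or by the sources of its steps; the two lists differ
  by a rotation.\<close>

lemma trace_kernel_index_sum:
  assumes xs: "set xs \<subseteq> carrier H" "xs \<noteq> []" and ys: "length ys = length xs"
  shows "trace_kernel J \<rho> (\<lambda>i hs. 1) xs ys =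
    (\<Sum>ix | length ix = length xs \<and> set ix \<subseteq> J.
      \<Prod>m<length xs. \<rho> (xs ! m) (ix ! m) (ix ! (Suc m mod length xs)) (ys ! m))"
proof -
  let ?n = "length xs"
  let ?A = "{ks. length ks = ?n \<and> set ks \<subseteq> J}"
  let ?f = "\<lambda>i ks. \<Prod>m<?n. \<rho> (xs ! m) ((i # ks) ! m) (ks ! m) (ys ! m)"
  have finA: "finite ?A"
    using finite_lists_length_eq[OF finite_index, of ?n] by (simp add: conj_commute)
  have ne: "ks \<noteq> []" if "ks \<in> ?A" for ks using that xs(2) by auto
  have "trace_kernel J \<rho> (\<lambda>i hs. 1) xs ys =
      (\<Sum>i\<in>J. \<Sum>ks | ks \<in> ?A \<and> last (i # ks) = i. ?f i ks)"
    unfolding trace_kernel_def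
    by (intro sum.cong refl) (simp add: path_integral_delta[OF xs(1) _ ys] conj_assoc)
  also have "\<dots> = (\<Sum>i\<in>J. \<Sum>ks\<in>?A. if last ks = i then ?f i ks else 0)"
  proof (rule sum.cong)
    fix i
    have "{ks. ks \<in> ?A \<and> last (i # ks) = i} = {ks \<in> ?A. last ks = i}" using ne by auto
    thus "(\<Sum>ks | ks \<in> ?A \<and> last (i # ks) = i. ?f i ks) = (\<Sum>ks\<in>?A. if last ks = i then ?f i ks else 0)"
      using sum.inter_filter[OF finA, of "?f i" "\<lambda>ks. last ks = i"] by simp
  qed simp
  also have "\<dots> = (\<Sum>ks\<in>?A. \<Sum>i\<in>J. if last ks = i then ?f i ks else 0)" by (rule sum.swap)
  also have "\<dots> = (\<Sum>ks\<in>?A. ?f (last ks) ks)"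
  proof (rule sum.cong)
    fix ks assume ks: "ks \<in> ?A"
    hence "last ks \<in> J" using ne[OF ks] last_in_set by blast
    thus "(\<Sum>i\<in>J. if last ks = i then ?f i ks else 0) = ?f (last ks) ks"
      using finite_index by (simp add: sum.delta')
  qed simp
  also have "\<dots> = (\<Sum>ix\<in>?A. \<Prod>m<?n. \<rho> (xs ! m) (ix ! m) (ix ! (Suc m mod ?n)) (ys ! m))"
  proof (rule sum.reindex_bij_witness[of _ rotate1 rot])
    fix ks assume ks: "ks \<in> ?A"
    note n = ne[OF ks]
    show r: "rotate1 (rot ks) = ks" using n by (cases ks rule: rev_cases) auto
    show "rot ks \<in> ?A" using ks n by simp
    have "\<rho> (xs ! m) ((last ks # ks) ! m) (ks ! m) (ys ! m) =
        \<rho> (xs ! m) (rot ks ! m) (rot ks ! (Suc m mod ?n)) (ys ! m)" if "m < ?n" for m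
    proof -
      have "(last ks # ks) ! m = rot ks ! m"
        using that ks by (cases m) (auto simp: rot_def nth_butlast)
      moreover have "ks ! m = rot ks ! (Suc m mod ?n)"
        using nth_rotate1[of m "rot ks"] that ks n by (simp add: r)
      ultimately show ?thesis by simp
    qed
    thus "(\<Prod>m<?n. \<rho> (xs ! m) (rot ks ! m) (rot ks ! (Suc m mod ?n)) (ys ! m)) = ?f (last ks) ks"
      by (intro prod.cong) auto
  next
    fix ix assume ix: "ix \<in> ?A"
    show "rot (rotate1 ix) = ix" using ne[OF ix] by (cases ix) auto
    show "rotate1 ix \<in> ?A" using ix by simp
  qed
  finally show ?thesis .
qed

end

section \<open>Frames of the group algebra over a subgroup\<close>

context group begin

lemma convol_integral:
  assumes "a \<in> fin_span (carrier G)" "b \<in> fin_span (carrier G)"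
  shows "integral_of (convol G a b) \<theta> = integral_of a (\<lambda>g. integral_of b (\<lambda>h. \<theta> (g \<otimes> h)))"
proof -
  have *: "lin_ext (\<lambda>h. delta (g \<otimes> h)) b \<in> fin_span UNIV" for g
    by (rule fin_span_lin_ext[OF assms(2)]) simp
  show ?thesis unfolding convol_def
    by (simp add: integral_of_lin_ext[OF assms(1), where Y = UNIV] * integral_of_lin_ext[OF assms(2), where Y = UNIV])
qed

lemma convol_closed:
  assumes "a \<in> fin_span M" "b \<in> fin_span M" "\<And>x y. x \<in> M \<Longrightarrow> y \<in> M \<Longrightarrow> x \<otimes> y \<in> M"
  shows "convol G a b \<in> fin_span M"
  unfolding convol_def
  by (rule fin_span_lin_ext[OF assms(1)], rule fin_span_lin_ext[OF assms(2)]) (simp add: assms(3))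

lemma convol_in: "a \<in> fin_span (carrier G) \<Longrightarrow> b \<in> fin_span (carrier G) \<Longrightarrow> convol G a b \<in> fin_span (carrier G)"
  by (rule convol_closed) auto

lemma convol_delta: "convol G (delta g) (delta h) = delta (g \<otimes> h)"
  by (simp add: convol_def)

lemma convol_zero_left [simp]: "convol G 0 b = 0"
  by (simp add: convol_def lin_ext_def fun_eq_iff)

lemma convol_zero_right: "a \<in> fin_span (carrier G) \<Longrightarrow> convol G a 0 = 0"
  by (rule fin_span_eqI[where X = "carrier G" and Y = UNIV])
    (simp_all add: convol_in convol_integral)

lemma convol_one_right: "a \<in> fin_span (carrier G) \<Longrightarrow> convol G a (delta \<one>) = a"
  by (rule fin_span_eqI[where X = "carrier G" and Y = "carrier G"])
    (auto simp: convol_in convol_integral intro!: integral_of_cong dest: fin_span_supp)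

lemma convol_add_left:
  "a \<in> fin_span (carrier G) \<Longrightarrow> b \<in> fin_span (carrier G) \<Longrightarrow> convol G (a + b) c = convol G a c + convol G b c"
  unfolding convol_def by (rule lin_ext_add)

lemma convol_fscale_left: "convol G (fscale k a) c = fscale k (convol G a c)"
  unfolding convol_def by (rule lin_ext_fscale)

lemma convol_sum_left:
  "(\<And>i. i \<in> A \<Longrightarrow> a i \<in> fin_span (carrier G)) \<Longrightarrow> convol G (\<Sum>i\<in>A. a i) c = (\<Sum>i\<in>A. convol G (a i) c)"
  by (induction A rule: infinite_finite_induct) (auto simp: convol_add_left fin_span_sum)

lemma convol_assoc:
  assumes "a \<in> fin_span (carrier G)" "b \<in> fin_span (carrier G)" "c \<in> fin_span (carrier G)"
  shows "convol G (convol G a b) c = convol G a (convol G b c)"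
proof (rule fin_span_eqI[where X = "carrier G" and Y = "carrier G"])
  fix \<psi>
  have "integral_of a (\<lambda>g. integral_of b (\<lambda>h. integral_of c (\<lambda>k. \<psi> (g \<otimes> h \<otimes> k)))) =
      integral_of a (\<lambda>g. integral_of b (\<lambda>h. integral_of c (\<lambda>k. \<psi> (g \<otimes> (h \<otimes> k)))))"
    by (intro integral_of_cong arg_cong[of _ _ \<psi>] m_assoc)
      (use fin_span_supp[OF assms(1)] fin_span_supp[OF assms(2)] fin_span_supp[OF assms(3)] in blast)+
  thus "integral_of (convol G (convol G a b) c) \<psi> = integral_of (convol G a (convol G b c)) \<psi>"
    using assms by (simp add: convol_integral convol_in)
qed (auto intro!: convol_in assms)

lemma left_equivariant_extend:
  assumes f: "linear_map (carrier G) L f" and L: "L \<subseteq> carrier G"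
    and eq: "\<And>l y. l \<in> L \<Longrightarrow> y \<in> fin_span (carrier G) \<Longrightarrow> f (convol G (delta l) y) = convol G (delta l) (f y)"
    and a: "a \<in> fin_span L" and y: "y \<in> fin_span (carrier G)"
  shows "f (convol G a y) = convol G a (f y)"
  using a
proof (induction rule: fin_span_induct)
  case zero
  show ?case unfolding convol_zero_left by (rule linear_map_zero[OF f])
next
  case (add k l d)
  have l: "delta l \<in> fin_span (carrier G)" and d: "d \<in> fin_span (carrier G)"
    using add L fin_span_mono by auto
  have "f (convol G (fscale k (delta l) + d) y) = f (fscale k (convol G (delta l) y) + convol G d y)"
    using l d by (subst convol_add_left) (auto simp: convol_fscale_left)
  also have "\<dots> = fscale k (f (convol G (delta l) y)) + f (convol G d y)"
    using convol_in[OF l y] convol_in[OF d y]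
    by (subst linear_map_add[OF f]) (auto simp: linear_map_fscale[OF f])
  also have "\<dots> = fscale k (convol G (delta l) (f y)) + convol G d (f y)"
    unfolding eq[OF add(1) y] add(3) ..
  also have "\<dots> = convol G (fscale k (delta l) + d) (f y)"
    using l d by (subst convol_add_left) (auto simp: convol_fscale_left)
  finally show ?case .
qed

lemma foldr_closed: "set hs \<subseteq> carrier G \<Longrightarrow> foldr (\<otimes>) hs \<one> \<in> carrier G"
  by (induction hs) auto

lemma foldr_append:
  "set us \<subseteq> carrier G \<Longrightarrow> set ws \<subseteq> carrier G \<Longrightarrow>
    foldr (\<otimes>) (us @ ws) \<one> = foldr (\<otimes>) us \<one> \<otimes> foldr (\<otimes>) ws \<one>"
  by (induction us) (auto simp: m_assoc foldr_closed simp del: List.foldr_append)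

lemma foldr_face:
  "Suc m < length hs \<Longrightarrow> set hs \<subseteq> carrier G \<Longrightarrow> foldr (\<otimes>) (face G m hs) \<one> = foldr (\<otimes>) hs \<one>"
proof (induction hs arbitrary: m)
  case (Cons h hs)
  then obtain k r where hs: "hs = k # r" by (cases hs) auto
  show ?case
  proof (cases m)
    case 0
    thus ?thesis using Cons.prems hs by (simp add: face_0 m_assoc foldr_closed)
  next
    case (Suc l)
    have "face G m (h # hs) = h # face G l hs" unfolding Suc using Cons.prems Suc by (intro face_Suc) auto
    thus ?thesis using Cons Suc by simp
  qed
qed simp

end

text \<open>A family \<open>b\<^sub>j\<close> of elements of \<open>\<complex>(G)\<close> with \<open>\<complex>(L)\<close>-linear coordinate functions that expand every
  element allows to write right multiplications as matrices over \<open>\<complex>(L)\<close>. The index set is the union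
  of two such families, which are distinguished by \<open>kind\<close>, so that there are also mixed matrix entries.
  Conjugation by the elements \<open>gauge j\<close> moves the entries to other places in \<open>\<complex>(G)\<close>.\<close>

locale frames = group G + L: subgroup L G
  for G :: "('g, 'm) monoid_scheme" (structure) and L +
  fixes J :: "'i set" and kind :: "'i \<Rightarrow> bool" and b :: "'i \<Rightarrow> 'g \<Rightarrow> complex"
    and coord :: "'i \<Rightarrow> ('g \<Rightarrow> complex) \<Rightarrow> 'g \<Rightarrow> complex" and gauge :: "'i \<Rightarrow> 'g"
  assumes finite_J: "finite J"
    and b_in: "i \<in> J \<Longrightarrow> b i \<in> fin_span (carrier G)"
    and coord_linear: "i \<in> J \<Longrightarrow> linear_map (carrier G) L (coord i)"
    and coord_equivariant: "i \<in> J \<Longrightarrow> l \<in> L \<Longrightarrow> y \<in> fin_span (carrier G) \<Longrightarrow>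
      coord i (convol G (delta l) y) = convol G (delta l) (coord i y)"
    and expansion: "y \<in> fin_span (carrier G) \<Longrightarrow> (\<Sum>j | j \<in> J \<and> kind j = e. convol G (coord j y) (b j)) = y"
    and gauge_in: "i \<in> J \<Longrightarrow> gauge i \<in> carrier G"
begin

definition entry :: "'g \<Rightarrow> 'i \<Rightarrow> 'i \<Rightarrow> 'g \<Rightarrow> complex" where
  "entry g i j = coord j (convol G (b i) (delta g))"

lemma fin_span_L: "a \<in> fin_span L \<Longrightarrow> a \<in> fin_span (carrier G)"
  using fin_span_mono[OF L.subset] .

lemma entry_in: "g \<in> carrier G \<Longrightarrow> i \<in> J \<Longrightarrow> j \<in> J \<Longrightarrow> entry g i j \<in> fin_span L"
  unfolding entry_def by (intro linear_map_closed[OF coord_linear] convol_in b_in) auto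

text \<open>Expand \<open>b\<^sub>i g\<close> in the frame of kind \<open>e\<close>, multiply by \<open>h\<close> and take the \<open>k\<close>-th coordinate.\<close>

lemma entry_multiplicative:
  assumes g: "g \<in> carrier G" and h: "h \<in> carrier G" and i: "i \<in> J" and k: "k \<in> J"
  shows "(\<Sum>j | j \<in> J \<and> kind j = e. convol G (entry g i j) (entry h j k)) = entry (g \<otimes> h) i k"
proof -
  let ?K = "{j. j \<in> J \<and> kind j = e}"
  let ?y = "convol G (b i) (delta g)"
  have y: "?y \<in> fin_span (carrier G)" using b_in[OF i] g by (intro convol_in) auto
  have dh: "delta h \<in> fin_span (carrier G)" using h by simp
  have e: "entry g i j \<in> fin_span L" if "j \<in> J" for j by (rule entry_in[OF g i that])
  have bh: "convol G (b j) (delta h) \<in> fin_span (carrier G)" if "j \<in> J" for j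
    using b_in[OF that] dh by (rule convol_in)
  have summand: "convol G (entry g i j) (convol G (b j) (delta h)) \<in> fin_span (carrier G)" if "j \<in> J" for j
    by (rule convol_in[OF fin_span_L[OF e[OF that]] bh[OF that]])
  have "(\<Sum>j\<in>?K. convol G (entry g i j) (entry h j k)) =
      (\<Sum>j\<in>?K. coord k (convol G (entry g i j) (convol G (b j) (delta h))))"
    unfolding entry_def[of h]
    by (intro sum.cong refl left_equivariant_extend[OF coord_linear[OF k] L.subset coord_equivariant[OF k], symmetric]
        e bh) auto
  also have "\<dots> = coord k (\<Sum>j\<in>?K. convol G (entry g i j) (convol G (b j) (delta h)))"
    by (rule linear_map_sum[OF coord_linear[OF k], symmetric]) (use summand in auto)
  also have "(\<Sum>j\<in>?K. convol G (entry g i j) (convol G (b j) (delta h))) =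
      (\<Sum>j\<in>?K. convol G (convol G (entry g i j) (b j)) (delta h))"
    by (intro sum.cong refl convol_assoc[symmetric] fin_span_L e b_in dh) auto
  also have "\<dots> = convol G (\<Sum>j\<in>?K. convol G (entry g i j) (b j)) (delta h)"
    by (rule convol_sum_left[symmetric], rule convol_in[OF fin_span_L[OF e] b_in]) auto
  also have "(\<Sum>j\<in>?K. convol G (entry g i j) (b j)) = ?y" unfolding entry_def by (rule expansion[OF y])
  also have "convol G ?y (delta h) = convol G (b i) (delta (g \<otimes> h))"
    using convol_assoc[OF b_in[OF i] _ dh, of "delta g"] g by (simp add: convol_delta)
  finally show ?thesis by (simp add: entry_def)
qed

lemma entry_matrix_rep: "matrix_rep G (G\<lparr>carrier := L\<rparr>) {j. j \<in> J \<and> kind j = e} entry"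
proof -
  interpret GL: group "G\<lparr>carrier := L\<rparr>" by (rule L.subgroup_is_group[OF group_axioms])
  interpret H: left_unital_semigroup G by (rule left_unital_semigroup)
  interpret K: left_unital_semigroup "G\<lparr>carrier := L\<rparr>" by (rule GL.left_unital_semigroup)
  let ?K = "{j. j \<in> J \<and> kind j = e}"
  show ?thesis
  proof unfold_locales
    show "finite ?K" using finite_J by simp
    show "entry x i j \<in> group_algebra (G\<lparr>carrier := L\<rparr>)" if "x \<in> carrier G" "i \<in> ?K" "j \<in> ?K" for x i j
      using entry_in[of x i j] that by (simp add: group_algebra_def)
    fix x y i k \<theta> assume *: "x \<in> carrier G" "y \<in> carrier G" "i \<in> ?K" "k \<in> ?K"
    hence e: "entry x i j \<in> fin_span (carrier G)" "entry y j k \<in> fin_span (carrier G)" if "j \<in> ?K" for j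
      using that by (auto intro: fin_span_L entry_in)
    have "(\<Sum>j\<in>?K. integral_of (entry x i j) (\<lambda>g. integral_of (entry y j k) (\<lambda>h. \<theta> (g \<otimes> h)))) =
        (\<Sum>j\<in>?K. integral_of (convol G (entry x i j) (entry y j k)) \<theta>)"
      by (intro sum.cong refl convol_integral[symmetric] e)
    also have "\<dots> = integral_of (\<Sum>j\<in>?K. convol G (entry x i j) (entry y j k)) \<theta>"
      by (intro integral_of_sum[where X = "carrier G", symmetric] convol_in e)
    also have "\<dots> = integral_of (entry (x \<otimes> y) i k) \<theta>"
      using entry_multiplicative[of x y i k e] * by simp
    finally show "(\<Sum>j\<in>?K. integral_of (entry x i j) (\<lambda>g. integral_of (entry y j k)
        (\<lambda>h. \<theta> (g \<otimes>\<^bsub>G\<lparr>carrier := L\<rparr>\<^esub> h)))) = integral_of (entry (x \<otimes> y) i k) \<theta>" by simp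
  qed
qed

definition labelled_entry :: "'g \<times> bool \<Rightarrow> 'i \<Rightarrow> 'i \<Rightarrow> 'g \<Rightarrow> complex" where
  "labelled_entry x i j = (if kind j = snd x
     then lin_ext (\<lambda>l. delta (gauge i \<otimes> l \<otimes> inv gauge j)) (entry (fst x) i j) else 0)"

lemma labelled_entry_in:
  assumes "g \<in> carrier G" "i \<in> J" "j \<in> J"
  shows "labelled_entry (g, e) i j \<in> fin_span {gauge i \<otimes> l \<otimes> inv gauge j | l. l \<in> L}"
  unfolding labelled_entry_def by (auto intro!: fin_span_lin_ext[OF entry_in] assms)

lemma labelled_entry_integral:
  assumes "g \<in> carrier G" "i \<in> J" "j \<in> J" "kind j = e"
  shows "integral_of (labelled_entry (g, e) i j) \<theta> =
    integral_of (entry g i j) (\<lambda>l. \<theta> (gauge i \<otimes> l \<otimes> inv gauge j))"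
  unfolding labelled_entry_def using assms
  by (simp add: integral_of_lin_ext[OF entry_in, where Y = UNIV])

text \<open>The value of \<open>F\<close> at the product of the entries before conjugation by the gauge.\<close>

definition weight :: "('g \<Rightarrow> complex) \<Rightarrow> 'i \<Rightarrow> 'g list \<Rightarrow> complex" where
  "weight F i hs = F (inv gauge i \<otimes> foldr (\<otimes>) hs \<one> \<otimes> gauge i)"

text \<open>The labels only record which of the two frames is used at each index of the matrix product.\<close>

theorem labelled_entry_matrix_rep:
  assumes F: "\<And>l h. l \<in> L \<Longrightarrow> h \<in> carrier G \<Longrightarrow> F (l \<otimes> h \<otimes> inv l) = F h"
  shows "weighted_matrix_rep (labelled G) G J labelled_entry (weight F)"
proof -
  interpret H: left_unital_semigroup "labelled G" by (rule left_unital_semigroup_labelled)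
  interpret K: left_unital_semigroup G by (rule left_unital_semigroup)
  have cancel: "gauge i \<otimes> l \<otimes> inv gauge j \<otimes> (gauge j \<otimes> m \<otimes> inv gauge k) = gauge i \<otimes> (l \<otimes> m) \<otimes> inv gauge k"
    if "i \<in> J" "j \<in> J" "k \<in> J" "l \<in> L" "m \<in> L" for i j k l m
  proof -
    have c: "l \<in> carrier G" "m \<in> carrier G" using that L.mem_carrier by auto
    have "inv gauge j \<otimes> (gauge j \<otimes> (m \<otimes> inv gauge k)) = m \<otimes> inv gauge k"
      using that c gauge_in by (simp add: m_assoc[symmetric])
    thus ?thesis using that c gauge_in by (simp add: m_assoc)
  qed
  show ?thesis
  proof unfold_locales
    show "finite J" by (rule finite_J)
    show "labelled_entry x i j \<in> group_algebra G" if "x \<in> carrier (labelled G)" "i \<in> J" "j \<in> J" for x i j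
      unfolding group_algebra_def
      by (rule fin_span_mono[OF _ labelled_entry_in[of "fst x" i j "snd x", simplified]])
        (use that gauge_in L.mem_carrier in auto)
    fix x y i k \<theta> assume "x \<in> carrier (labelled G)" "y \<in> carrier (labelled G)" and ik: "i \<in> J" "k \<in> J"
    then obtain g e h e' where x: "x = (g, e)" and y: "y = (h, e')" and g: "g \<in> carrier G" and h: "h \<in> carrier G"
      by auto
    let ?K = "{j. j \<in> J \<and> kind j = e}"
    let ?t = "\<lambda>j. integral_of (labelled_entry x i j) (\<lambda>g. integral_of (labelled_entry y j k) (\<lambda>h. \<theta> (g \<otimes> h)))"
    show "(\<Sum>j\<in>J. ?t j) = integral_of (labelled_entry (x \<otimes>\<^bsub>labelled G\<^esub> y) i k) \<theta>"
    proof (cases "kind k = e'")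
      case False
      hence "labelled_entry y j k = 0" "labelled_entry (x \<otimes>\<^bsub>labelled G\<^esub> y) i k = 0" for j
        by (simp_all add: labelled_entry_def y)
      thus ?thesis by simp
    next
      case True
      have gh: "g \<otimes> h \<in> carrier G" using g h by simp
      have "(\<Sum>j\<in>J. ?t j) = (\<Sum>j\<in>?K. ?t j)"
        using finite_J by (intro sum.mono_neutral_right) (auto simp: labelled_entry_def x)
      also have "\<dots> = (\<Sum>j\<in>?K. integral_of (convol G (entry g i j) (entry h j k)) (\<lambda>l. \<theta> (gauge i \<otimes> l \<otimes> inv gauge k)))"
      proof (rule sum.cong)
        fix j assume "j \<in> ?K"
        hence j: "j \<in> J" "kind j = e" by auto
        have "?t j = integral_of (entry g i j) (\<lambda>l. integral_of (entry h j k)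
            (\<lambda>m. \<theta> (gauge i \<otimes> l \<otimes> inv gauge j \<otimes> (gauge j \<otimes> m \<otimes> inv gauge k))))"
          unfolding x y labelled_entry_integral[OF g ik(1) j] labelled_entry_integral[OF h j(1) ik(2) True] ..
        also have "\<dots> = integral_of (entry g i j) (\<lambda>l. integral_of (entry h j k)
            (\<lambda>m. \<theta> (gauge i \<otimes> (l \<otimes> m) \<otimes> inv gauge k)))"
          using fin_span_supp[OF entry_in[OF g ik(1) j(1)]] fin_span_supp[OF entry_in[OF h j(1) ik(2)]]
          by (intro integral_of_cong arg_cong[of _ _ \<theta>] cancel ik j(1))
        also have "\<dots> = integral_of (convol G (entry g i j) (entry h j k)) (\<lambda>l. \<theta> (gauge i \<otimes> l \<otimes> inv gauge k))"
          by (intro convol_integral[symmetric] fin_span_L entry_in g h ik j)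
        finally show "?t j = integral_of (convol G (entry g i j) (entry h j k)) (\<lambda>l. \<theta> (gauge i \<otimes> l \<otimes> inv gauge k))" .
      qed simp
      also have "\<dots> = integral_of (\<Sum>j\<in>?K. convol G (entry g i j) (entry h j k)) (\<lambda>l. \<theta> (gauge i \<otimes> l \<otimes> inv gauge k))"
        by (intro integral_of_sum[where X = "carrier G", symmetric] convol_in fin_span_L entry_in g h ik) auto
      also have "\<dots> = integral_of (labelled_entry (g \<otimes> h, e') i k) \<theta>"
        unfolding entry_multiplicative[OF g h ik] labelled_entry_integral[OF gh ik True] ..
      finally show ?thesis by (simp add: x y)
    qed
  next
    fix i hs n m assume "i \<in> J" "hs \<in> tuples G (Suc n)" "m \<le> n"
    thus "weight F i (face G m hs) = weight F i hs" by (simp add: weight_def foldr_face tuples_def)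
  next
    fix x i k h hs assume x: "x \<in> carrier (labelled G)" and ik: "i \<in> J" "k \<in> J"
      and ne: "labelled_entry x k i h \<noteq> 0" and hs: "set hs \<subseteq> carrier G"
    have "h \<in> {gauge k \<otimes> l \<otimes> inv gauge i | l. l \<in> L}"
      using labelled_entry_in[of "fst x" k i "snd x"] x ik ne fin_span_supp by fastforce
    then obtain l where l: "l \<in> L" "h = gauge k \<otimes> l \<otimes> inv gauge i" by blast
    define P where "P = foldr (\<otimes>) hs \<one>"
    note c = gauge_in[OF ik(1)] gauge_in[OF ik(2)] foldr_closed[OF hs, folded P_def] L.mem_carrier[OF l(1)]
    have h: "h \<in> carrier G" using c l by simp
    have Ph: "foldr (\<otimes>) (hs @ [h]) \<one> = P \<otimes> h" using foldr_append[of hs "[h]"] hs h by (simp add: P_def)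
    let ?z = "inv gauge i \<otimes> P \<otimes> gauge k"
    have z: "?z \<in> carrier G" using c by simp
    have "inv gauge i \<otimes> (P \<otimes> h) \<otimes> gauge i = ?z \<otimes> l" using c by (simp add: l(2) m_assoc)
    moreover have "inv gauge k \<otimes> (h \<otimes> P) \<otimes> gauge k = l \<otimes> ?z"
    proof -
      have "inv gauge k \<otimes> (gauge k \<otimes> (l \<otimes> (inv gauge i \<otimes> (P \<otimes> gauge k)))) = l \<otimes> (inv gauge i \<otimes> (P \<otimes> gauge k))"
        using c by (simp add: m_assoc[symmetric])
      thus ?thesis using c by (simp add: l(2) m_assoc)
    qed
    moreover have "l \<otimes> (?z \<otimes> l) \<otimes> inv l = l \<otimes> ?z" using c z by (simp add: m_assoc)
    ultimately show "weight F i (hs @ [h]) = weight F k (h # hs)"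
      using F[OF l(1), of "?z \<otimes> l"] z c unfolding weight_def Ph by (simp add: P_def)
  qed
qed

end

text \<open>The rows indexed by the image of \<open>f\<close> vanish outside it, so a path that starts there never leaves it.\<close>

lemma path_integral_restrict:
  assumes J: "finite J" "inj_on f I" "f ` I \<subseteq> J"
    and zero: "\<And>x i k. x \<in> set xs \<Longrightarrow> i \<in> I \<Longrightarrow> k \<in> J - f ` I \<Longrightarrow> \<rho> (t x) (f i) k = 0"
    and eq: "\<And>x i k. x \<in> set xs \<Longrightarrow> i \<in> I \<Longrightarrow> k \<in> I \<Longrightarrow> \<rho> (t x) (f i) (f k) = \<rho>' x i k"
    and ij: "i \<in> I" "j \<in> I"
  shows "path_integral J \<rho> (f i) (map t xs) (f j) \<psi> = path_integral I \<rho>' i xs j \<psi>"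
  using zero eq ij(1)
proof (induction xs arbitrary: i \<psi>)
  case Nil
  thus ?case using J(2) ij(2) by (auto simp: inj_on_def)
next
  case (Cons x xs)
  have "path_integral J \<rho> (f i) (map t (x # xs)) (f j) \<psi> =
      (\<Sum>k\<in>f ` I. integral_of (\<rho> (t x) (f i) k) (\<lambda>h. path_integral J \<rho> k (map t xs) (f j) (\<lambda>hs. \<psi> (h # hs))))"
    unfolding list.map path_integral.simps
    by (rule sum.mono_neutral_right[OF J(1) J(3)], intro ballI, subst Cons.prems(1))
      (use Cons.prems(3) in auto)
  also have "\<dots> = (\<Sum>k\<in>I. integral_of (\<rho>' x i k) (\<lambda>h. path_integral I \<rho>' k xs j (\<lambda>hs. \<psi> (h # hs))))"
    unfolding sum.reindex[OF J(2)] comp_def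
    by (intro sum.cong refl) (use Cons in simp)
  finally show ?case by simp
qed

lemma path_integral_delta_scaled:
  "path_integral J \<rho> i xs j (\<lambda>hs. w hs * delta hs ys) = w ys * path_integral J \<rho> i xs j (\<lambda>hs. delta hs ys)"
proof -
  have "path_integral J \<rho> i xs j (\<lambda>hs. a * \<psi> hs) = a * path_integral J \<rho> i xs j \<psi>" for a \<psi>
    by (induction xs arbitrary: i \<psi>) (simp_all add: integral_of_scale_right sum_distrib_left)
  moreover have "(\<lambda>hs. w hs * delta hs ys) = (\<lambda>hs. w ys * delta hs ys)"
    by (auto simp: delta_def fun_eq_iff)
  ultimately show ?thesis by metis
qed

lemma path_integral_last_zero:
  assumes "finite J" "i \<in> J" "j \<in> J" "\<And>k. k \<in> J \<Longrightarrow> \<rho> x k j = 0"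
  shows "path_integral J \<rho> i (us @ [x]) j \<psi> = 0"
  unfolding path_integral_append[OF assms(1,2)] path_integral_single[OF assms(1,3)]
  by (rule sum.neutral, intro ballI, subst assms(4)) (auto simp: path_integral_zero)

lemma matrix_rep_reindex:
  assumes "matrix_rep H G J \<rho>" "inj_on f I" "J = f ` I"
  shows "matrix_rep H G I (\<lambda>x i j. \<rho> x (f i) (f j))"
proof -
  interpret matrix_rep H G J \<rho> by (rule assms(1))
  show ?thesis
  proof unfold_locales
    show "finite I" using finite_index assms by (simp add: finite_image_iff)
    fix x y i k \<theta> assume "x \<in> carrier H" "y \<in> carrier H" "i \<in> I" "k \<in> I"
    thus "(\<Sum>j\<in>I. integral_of (\<rho> x (f i) (f j)) (\<lambda>g. integral_of (\<rho> y (f j) (f k)) (\<lambda>h. \<theta> (g \<otimes>\<^bsub>G\<^esub> h)))) =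
        integral_of (\<rho> (x \<otimes>\<^bsub>H\<^esub> y) (f i) (f k)) \<theta>"
      using multiplicative[of x y "f i" "f k" \<theta>] assms(3) by (simp add: sum.reindex[OF assms(2)])
  qed (use entry assms(3) in auto)
qed

section \<open>Induction after restriction multiplies by an induced class function\<close>

lemma precyclic_cong:
  assumes f: "precyclic H G f" and g: "\<And>n. linear_map (tuples H n) (tuples G n) g"
    and eq: "\<And>n xs. xs \<in> tuples H n \<Longrightarrow> g (delta xs) = f (delta xs)"
  shows "precyclic H G g"
proof -
  interpret f: precyclic H G f by (rule f)
  show ?thesis
  proof (rule precyclic_mapI[OF f.H.left_unital_semigroup_axioms f.G.left_unital_semigroup_axioms g])
    fix n xs assume xs: "xs \<in> tuples H n"
    hence "f (rot_map (delta xs)) = rot_map (f (delta xs))" by (intro f.map_rot[of _ n]) (simp add: chains_def)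
    thus "g (delta (rot xs)) = rot_map (g (delta xs))" using eq[OF rot_tuples[OF xs]] eq[OF xs] by simp
  next
    fix n xs i assume xs: "xs \<in> tuples H (Suc n)" and i: "i \<le> n"
    hence "f (face_map H i (delta xs)) = face_map G i (f (delta xs))"
      by (intro f.map_face[of _ n]) (auto simp: chains_def)
    thus "g (delta (face H i xs)) = face_map G i (g (delta xs))"
      using eq[OF f.H.face_tuples[OF xs]] eq[OF xs] by simp
  qed
qed

lemma face_carrier_update [simp]: "face (G\<lparr>carrier := L\<rparr>) = face G"
  by (simp add: face_def fun_eq_iff)

lemma face_map_carrier_update [simp]: "face_map (G\<lparr>carrier := L\<rparr>) = face_map G"
  by (simp add: face_map_def fun_eq_iff)

locale transversal_iso = group G + L: subgroup L G
  for G :: "('g, 'm) monoid_scheme" (structure) and L +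
  fixes \<phi> :: "('g \<Rightarrow> complex) \<Rightarrow> nat \<Rightarrow> 'g \<Rightarrow> complex" and X :: "'g set"
  assumes iso: "equivariant_iso G L \<phi>"
    and finite_X: "finite X" and X_in: "X \<subseteq> carrier G"
    and X_transversal: "g \<in> carrier G \<Longrightarrow> \<exists>!x. x \<in> X \<and> g \<otimes> inv x \<in> L"
begin

abbreviation "N \<equiv> sub_index G L"
abbreviation "GL \<equiv> G\<lparr>carrier := L\<rparr>"

definition iso_basis :: "nat \<Rightarrow> 'g \<Rightarrow> complex" where
  "iso_basis i = inv_into (group_algebra G) \<phi> (\<lambda>m. if m = i then delta \<one> else (\<lambda>_. 0))"

lemma L_group: "group GL"
  by (rule L.subgroup_is_group[OF group_axioms])

lemma convol_delta_left_linear: "l \<in> carrier G \<Longrightarrow> linear_map (carrier G) (carrier G) (convol G (delta l))"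
  unfolding convol_def lin_ext_delta by (rule linear_map_lin_ext) simp

lemma convol_delta_right_linear: "x \<in> carrier G \<Longrightarrow> linear_map (carrier G) (carrier G) (\<lambda>a. convol G a (delta x))"
  unfolding convol_def by (rule linear_map_lin_ext) simp

lemma iso_maps: "y \<in> fin_span (carrier G) \<Longrightarrow> i < N \<Longrightarrow> \<phi> y i \<in> fin_span L"
  and iso_above: "y \<in> fin_span (carrier G) \<Longrightarrow> N \<le> i \<Longrightarrow> \<phi> y i = 0"
  using iso bij_betwE unfolding equivariant_iso_def group_algebra_def by (fastforce simp: fun_eq_iff)+

lemma iso_linear:
  assumes "j < N" shows "linear_map (carrier G) L (\<lambda>y. \<phi> y j)"
proof -
  have "\<phi> (a + b) j = \<phi> a j + \<phi> b j" if "a \<in> fin_span (carrier G)" "b \<in> fin_span (carrier G)" for a b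
    using iso that unfolding equivariant_iso_def group_algebra_def plus_fun_def by simp
  moreover have "\<phi> (fscale k a) j = fscale k (\<phi> a j)" if "a \<in> fin_span (carrier G)" for k a
    using iso that unfolding equivariant_iso_def group_algebra_def fscale_def by simp
  ultimately show ?thesis using iso_maps[OF _ assms] by (simp add: linear_map_def)
qed

lemma iso_equivariant:
  "l \<in> L \<Longrightarrow> y \<in> fin_span (carrier G) \<Longrightarrow> \<phi> (convol G (delta l) y) j = convol G (delta l) (\<phi> y j)"
  using iso unfolding equivariant_iso_def group_algebra_def by simp

lemma iso_basis:
  assumes "i < N"
  shows "iso_basis i \<in> fin_span (carrier G)" "\<phi> (iso_basis i) j = (if j = i then delta \<one> else 0)"
proof -
  let ?T = "{v. (\<forall>i<N. v i \<in> group_algebra GL) \<and> (\<forall>i\<ge>N. v i = (\<lambda>_. 0))}"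
  let ?e = "\<lambda>m. if m = i then delta \<one> else (\<lambda>_. 0)"
  have "bij_betw \<phi> (group_algebra G) ?T" using iso by (simp add: equivariant_iso_def)
  moreover have "?e \<in> ?T" using assms fin_span_zero[of L] by (auto simp: group_algebra_def zero_fun_def)
  ultimately have "?e \<in> \<phi> ` group_algebra G" by (simp add: bij_betw_def)
  hence "iso_basis i \<in> group_algebra G" "\<phi> (iso_basis i) = ?e"
    unfolding iso_basis_def by (rule inv_into_into, rule f_inv_into_f)
  thus "iso_basis i \<in> fin_span (carrier G)" "\<phi> (iso_basis i) j = (if j = i then delta \<one> else 0)"
    by (auto simp: group_algebra_def zero_fun_def)
qed

text \<open>Both sides have the same image under the injective map \<open>\<phi>\<close>, which is \<open>\<complex>(L)\<close>-linear because it is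
  \<open>L\<close>-equivariant and linear.\<close>

lemma iso_expansion:
  assumes y: "y \<in> fin_span (carrier G)"
  shows "(\<Sum>j<N. convol G (\<phi> y j) (iso_basis j)) = y"
proof -
  let ?y = "\<Sum>j<N. convol G (\<phi> y j) (iso_basis j)"
  have c: "\<phi> y j \<in> fin_span (carrier G)" if "j < N" for j
    using iso_maps[OF y that] fin_span_mono[OF L.subset] by blast
  have in': "convol G (\<phi> y j) (iso_basis j) \<in> fin_span (carrier G)" if "j < N" for j
    using that by (intro convol_in c iso_basis)
  have y': "?y \<in> fin_span (carrier G)" using in' by (intro fin_span_sum) simp
  have "\<phi> ?y i = \<phi> y i" for i
  proof (cases "i < N")
    case True
    note lin = iso_linear[OF True]
    have "\<phi> ?y i = (\<Sum>j<N. \<phi> (convol G (\<phi> y j) (iso_basis j)) i)"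
      by (rule linear_map_sum[OF lin]) (simp add: in')
    also have "\<dots> = (\<Sum>j<N. convol G (\<phi> y j) (\<phi> (iso_basis j) i))"
      using iso_maps[OF y] iso_basis(1)
      by (intro sum.cong refl left_equivariant_extend[OF lin L.subset iso_equivariant]) auto
    also have "\<dots> = (\<Sum>j<N. if j = i then \<phi> y j else 0)"
      by (intro sum.cong refl) (auto simp: iso_basis(2) convol_one_right[OF c] convol_zero_right[OF c])
    also have "\<dots> = \<phi> y i" using True by (simp add: sum.delta)
    finally show ?thesis .
  next
    case False
    thus ?thesis using iso_above[OF y'] iso_above[OF y] by simp
  qed
  hence "\<phi> ?y = \<phi> y" by (rule ext)
  moreover have "inj_on \<phi> (group_algebra G)" using iso by (simp add: equivariant_iso_def bij_betw_def)
  ultimately show ?thesis using y y' by (auto simp: inj_on_def group_algebra_def)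
qed

subsection \<open>The frames of a transversal and of an equivariant isomorphism\<close>

definition coset_coord :: "'g \<Rightarrow> ('g \<Rightarrow> complex) \<Rightarrow> 'g \<Rightarrow> complex" where
  "coset_coord x = lin_ext (\<lambda>g. if g \<otimes> inv x \<in> L then delta (g \<otimes> inv x) else 0)"

definition index_set :: "('g + nat) set" where
  "index_set = Inl ` X \<union> Inr ` {..<N}"

definition frame_kind :: "'g + nat \<Rightarrow> bool" where
  "frame_kind = case_sum (\<lambda>_. False) (\<lambda>_. True)"

definition frame_vector :: "'g + nat \<Rightarrow> 'g \<Rightarrow> complex" where
  "frame_vector = case_sum delta iso_basis"

definition frame_coord :: "'g + nat \<Rightarrow> ('g \<Rightarrow> complex) \<Rightarrow> 'g \<Rightarrow> complex" where
  "frame_coord = case_sum coset_coord (\<lambda>j y. \<phi> y j)"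

text \<open>This gauge turns the matrix entry from the coset of \<open>x\<close> to the coset of \<open>x'\<close>, which is
  \<open>x g x'\<^sup>-\<^sup>1\<close>, back into \<open>g\<close>.\<close>

definition frame_gauge :: "'g + nat \<Rightarrow> 'g" where
  "frame_gauge = case_sum (\<lambda>x. inv x) (\<lambda>_. \<one>)"

lemma frame_simps:
  "frame_kind (Inl x) = False" "frame_kind (Inr i) = True"
  "frame_vector (Inl x) = delta x" "frame_vector (Inr i) = iso_basis i"
  "frame_coord (Inl x) = coset_coord x" "frame_coord (Inr i) = (\<lambda>y. \<phi> y i)"
  "frame_gauge (Inl x) = inv x" "frame_gauge (Inr i) = \<one>"
  by (simp_all add: frame_kind_def frame_vector_def frame_coord_def frame_gauge_def)

lemma coset_coord_linear:
  "x \<in> carrier G \<Longrightarrow> linear_map (carrier G) L (coset_coord x)"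
  unfolding coset_coord_def by (rule linear_map_lin_ext) auto

lemma coset_coord_equivariant:
  assumes x: "x \<in> carrier G" and l: "l \<in> L" and y: "y \<in> fin_span (carrier G)"
  shows "coset_coord x (convol G (delta l) y) = convol G (delta l) (coset_coord x y)"
proof -
  have lc: "l \<in> carrier G" using l by simp
  show ?thesis
  proof (rule linear_map_eqI[OF linear_map_comp[OF coset_coord_linear[OF x] convol_delta_left_linear[OF lc]]
        linear_map_comp[OF convol_delta_left_linear[OF lc] linear_map_mono[OF coset_coord_linear[OF x] subset_refl L.subset]] _ y])
    fix g assume g: "g \<in> carrier G"
    let ?z = "g \<otimes> inv x"
    have z: "?z \<in> carrier G" "l \<otimes> g \<otimes> inv x = l \<otimes> ?z" using g x lc by (simp_all add: m_assoc)
    have "?z \<in> L" if "l \<otimes> ?z \<in> L"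
    proof -
      have "inv l \<otimes> (l \<otimes> ?z) \<in> L" by (rule L.m_closed[OF L.m_inv_closed[OF l] that])
      thus ?thesis using z lc by (simp add: m_assoc[symmetric])
    qed
    hence "l \<otimes> ?z \<in> L \<longleftrightarrow> ?z \<in> L" using l by blast
    hence "coset_coord x (convol G (delta l) (delta g)) = (if ?z \<in> L then delta (l \<otimes> ?z) else 0)"
      unfolding coset_coord_def convol_delta lin_ext_delta z(2) by (simp only:)
    also have "\<dots> = convol G (delta l) (if ?z \<in> L then delta ?z else 0)"
      using lc by (cases "?z \<in> L") (simp_all only: if_True if_False convol_delta convol_zero_right fin_span_delta)
    finally show "coset_coord x (convol G (delta l) (delta g)) = convol G (delta l) (coset_coord x (delta g))"
      unfolding coset_coord_def lin_ext_delta .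
  qed
qed

lemma coset_expansion:
  assumes y: "y \<in> fin_span (carrier G)"
  shows "(\<Sum>x\<in>X. convol G (coset_coord x y) (delta x)) = y"
proof -
  have x: "x \<in> carrier G" if "x \<in> X" for x using that X_in by blast
  have lin: "linear_map (carrier G) (carrier G) (\<lambda>y. \<Sum>x\<in>X. convol G (coset_coord x y) (delta x))"
    by (intro linear_map_setsum linear_map_comp[OF convol_delta_right_linear
          linear_map_mono[OF coset_coord_linear subset_refl L.subset]] x)
  show ?thesis
  proof (rule linear_map_eqI[OF lin linear_map_id _ y])
    fix g assume g: "g \<in> carrier G"
    obtain x0 where x0: "x0 \<in> X \<and> g \<otimes> inv x0 \<in> L" "\<forall>x. x \<in> X \<and> g \<otimes> inv x \<in> L \<longrightarrow> x = x0"
      using X_transversal[OF g] by (rule ex1E)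
    have "(\<Sum>x\<in>X. convol G (coset_coord x (delta g)) (delta x)) = (\<Sum>x\<in>X. if x = x0 then delta g else 0)"
    proof (rule sum.cong)
      fix x' assume x': "x' \<in> X"
      have "g \<otimes> inv x0 \<otimes> x0 = g" using g x[of x0] x0(1) by (simp add: m_assoc)
      show "convol G (coset_coord x' (delta g)) (delta x') = (if x' = x0 then delta g else 0)"
      proof (cases "x' = x0")
        case True
        thus ?thesis using x0(1) \<open>g \<otimes> inv x0 \<otimes> x0 = g\<close> by (simp add: coset_coord_def convol_delta)
      next
        case False
        hence "g \<otimes> inv x' \<notin> L" using x0(2) x' by blast
        hence "coset_coord x' (delta g) = 0" unfolding coset_coord_def lin_ext_delta by simp
        thus ?thesis using False by (simp only: convol_zero_left if_False)
      qed
    qed simp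
    thus "(\<Sum>x\<in>X. convol G (coset_coord x (delta g)) (delta x)) = delta g"
      using finite_X x0(1) by (simp add: sum.delta)
  qed
qed

lemma frame_kind_sets:
  "{j. j \<in> index_set \<and> frame_kind j = True} = Inr ` {..<N}"
  "{j. j \<in> index_set \<and> frame_kind j = False} = Inl ` X"
  by (auto simp: index_set_def frame_kind_def)

sublocale frames G L index_set frame_kind frame_vector frame_coord frame_gauge
proof unfold_locales
  show "finite index_set" using finite_X by (simp add: index_set_def)
  show "frame_vector i \<in> fin_span (carrier G)" if "i \<in> index_set" for i
    using that X_in iso_basis(1) by (auto simp: index_set_def frame_vector_def)
  show "linear_map (carrier G) L (frame_coord i)" if "i \<in> index_set" for i
    using that X_in coset_coord_linear iso_linear by (auto simp: index_set_def frame_coord_def)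
  show "frame_coord i (convol G (delta l) y) = convol G (delta l) (frame_coord i y)"
    if "i \<in> index_set" "l \<in> L" "y \<in> fin_span (carrier G)" for i l y
    using that X_in coset_coord_equivariant iso_equivariant by (auto simp: index_set_def frame_coord_def)
  show "(\<Sum>j | j \<in> index_set \<and> frame_kind j = e. convol G (frame_coord j y) (frame_vector j)) = y"
    if "y \<in> fin_span (carrier G)" for y e
    using iso_expansion[OF that] coset_expansion[OF that]
    by (cases e) (simp_all only: frame_kind_sets, simp_all add: sum.reindex frame_coord_def frame_vector_def comp_def)
  show "frame_gauge i \<in> carrier G" if "i \<in> index_set" for i
    using that X_in by (auto simp: index_set_def frame_gauge_def)
qed

lemma entry_Inr: "entry g (Inr i) (Inr j) = res_matrix G \<phi> g i j"
  unfolding entry_def by (simp add: res_matrix_def frame_simps iso_basis_def)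

lemma entry_Inl:
  "entry g (Inl x) (Inl y) = (if x \<otimes> g \<otimes> inv y \<in> L then delta (x \<otimes> g \<otimes> inv y) else 0)"
  unfolding entry_def by (simp add: frame_simps convol_delta coset_coord_def)

lemma res_matrix_rep: "matrix_rep G GL {..<N} (res_matrix G \<phi>)"
  using matrix_rep_reindex[OF entry_matrix_rep[of True], of Inr "{..<N}"]
  by (simp only: frame_kind_sets entry_Inr) simp

lemma res_weighted_matrix_rep: "weighted_matrix_rep G GL {..<N} (res_matrix G \<phi>) (\<lambda>i hs. 1)"
  by (intro weighted_matrix_rep.intro res_matrix_rep weighted_matrix_rep_axioms.intro) auto

lemma trace_map_delta:
  assumes gs: "gs \<in> tuples G n"
  shows "trace_map G L \<phi> (delta gs) = trace_kernel {..<N} (res_matrix G \<phi>) (\<lambda>i hs. 1) gs"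
proof
  fix ys
  interpret W: weighted_matrix_rep G GL "{..<N}" "res_matrix G \<phi>" "\<lambda>i hs. 1"
    by (rule res_weighted_matrix_rep)
  have "trace_kernel {..<N} (res_matrix G \<phi>) (\<lambda>i hs. 1) gs ys = 0" if "length ys \<noteq> length gs"
    using fin_span_supp[OF W.trace_kernel_integral(1)[OF gs], of ys] gs that by (auto simp: tuples_def)
  moreover have "trace_kernel {..<N} (res_matrix G \<phi>) (\<lambda>i hs. 1) gs ys =
      (\<Sum>ix | length ix = length gs \<and> set ix \<subseteq> {..<N}.
        \<Prod>m<length gs. res_matrix G \<phi> (gs ! m) (ix ! m) (ix ! (Suc m mod length gs)) (ys ! m))"
    if "length ys = length gs"
    using gs that by (intro W.trace_kernel_index_sum) (auto simp: tuples_def)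
  ultimately show "trace_map G L \<phi> (delta gs) ys = trace_kernel {..<N} (res_matrix G \<phi>) (\<lambda>i hs. 1) gs ys"
    by (simp add: trace_map_def)
qed

lemma trace_map_linear: "linear_map (tuples G n) (tuples GL n) (trace_map G L \<phi>)"
proof -
  interpret W: weighted_matrix_rep G GL "{..<N}" "res_matrix G \<phi>" "\<lambda>i hs. 1"
    by (rule res_weighted_matrix_rep)
  show ?thesis unfolding trace_map_def
  proof (rule linear_map_lin_ext)
    fix gs assume gs: "gs \<in> tuples G n"
    show "(\<lambda>ls. if length ls = length gs
      then \<Sum>ix | length ix = length gs \<and> set ix \<subseteq> {..<N}.
        \<Prod>m<length gs. res_matrix G \<phi> (gs ! m) (ix ! m) (ix ! (Suc m mod length gs)) (ls ! m)
      else 0) \<in> fin_span (tuples GL n)"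
      using W.trace_kernel_integral(1)[OF gs] trace_map_delta[OF gs] by (simp add: trace_map_def)
  qed
qed

lemma trace_map_precyclic: "precyclic G GL (trace_map G L \<phi>)"
proof -
  interpret W: weighted_matrix_rep G GL "{..<N}" "res_matrix G \<phi>" "\<lambda>i hs. 1"
    by (rule res_weighted_matrix_rep)
  show ?thesis
    by (rule precyclic_cong[OF W.rep_trace_precyclic trace_map_linear]) (simp add: trace_map_delta rep_trace_def)
qed

subsection \<open>The two constant labellings\<close>

definition transfer_index :: "('g \<Rightarrow> complex) \<Rightarrow> 'g \<Rightarrow> complex" where
  "transfer_index F g = (\<Sum>x\<in>X. F (x \<otimes> g \<otimes> inv x))"

lemma trace_labelled:
  assumes gs: "gs \<in> tuples G n" and I: "inj_on f I" "f ` I = {j. j \<in> index_set \<and> frame_kind j = e}"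
    and eq: "\<And>g i k. g \<in> carrier G \<Longrightarrow> i \<in> I \<Longrightarrow> k \<in> I \<Longrightarrow> labelled_entry (g, e) (f i) (f k) = \<rho> g i k"
  shows "trace_kernel index_set labelled_entry (weight F) (map (\<lambda>g. (g, e)) gs) ys =
    (\<Sum>i\<in>I. weight F (f i) ys * path_integral I \<rho> i gs i (\<lambda>hs. delta hs ys))"
proof -
  let ?t = "\<lambda>g. (g, e)"
  let ?p = "\<lambda>i. weight F i ys * path_integral index_set labelled_entry i (map ?t gs) i (\<lambda>hs. delta hs ys)"
  have fI: "f ` I \<subseteq> index_set" using I(2) by auto
  obtain us g where us: "gs = us @ [g]" using gs by (cases gs rule: rev_cases) (auto simp: tuples_def)
  have "trace_kernel index_set labelled_entry (weight F) (map ?t gs) ys = (\<Sum>i\<in>index_set. ?p i)"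
    by (simp add: trace_kernel_def path_integral_delta_scaled)
  also have "\<dots> = (\<Sum>i\<in>f ` I. ?p i)"
  proof (rule sum.mono_neutral_right[OF finite_J fI], intro ballI)
    fix i assume i: "i \<in> index_set - f ` I"
    hence "frame_kind i \<noteq> e" unfolding I(2) by auto
    hence "labelled_entry (g, e) k i = 0" for k by (simp add: labelled_entry_def)
    hence "path_integral index_set labelled_entry i (map ?t us @ [?t g]) i (\<lambda>hs. delta hs ys) = 0"
      using i by (intro path_integral_last_zero finite_J) auto
    thus "?p i = 0" by (simp add: us)
  qed
  also have "\<dots> = (\<Sum>i\<in>I. ?p (f i))" by (simp add: sum.reindex[OF I(1)])
  also have "\<dots> = (\<Sum>i\<in>I. weight F (f i) ys * path_integral I \<rho> i gs i (\<lambda>hs. delta hs ys))"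
  proof (intro sum.cong refl arg_cong2[of _ _ _ _ "(*)"] path_integral_restrict finite_J I(1) fI eq)
    fix x i k assume k: "k \<in> index_set - f ` I"
    hence "frame_kind k \<noteq> e" unfolding I(2) by auto
    thus "labelled_entry (x, e) (f i) k = 0" by (simp add: labelled_entry_def)
  qed (use gs in \<open>auto simp: tuples_def\<close>)
  finally show ?thesis .
qed

text \<open>With the label of \<open>\<phi>\<close> on every factor, only indices of the frame of \<open>\<phi>\<close> contribute and the gauge is
  trivial. What remains is the trace map that defines restriction.\<close>

lemma trace_label_True:
  assumes gs: "gs \<in> tuples G n"
  shows "trace_kernel index_set labelled_entry (weight F) (map (\<lambda>g. (g, True)) gs) =
    (\<lambda>ys. F (foldr (\<otimes>) ys \<one>) * trace_map G L \<phi> (delta gs) ys)"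
proof
  fix ys
  interpret W: weighted_matrix_rep G GL "{..<N}" "res_matrix G \<phi>" "\<lambda>i hs. 1"
    by (rule res_weighted_matrix_rep)
  have "labelled_entry (g, True) (Inr i) (Inr k) = res_matrix G \<phi> g i k"
    if "g \<in> carrier G" "i < N" "k < N" for g i k
  proof -
    have e: "entry g (Inr i) (Inr k) \<in> fin_span L"
      using that by (intro entry_in) (auto simp: index_set_def)
    have "lin_ext (\<lambda>l. delta (\<one> \<otimes> l \<otimes> inv \<one>)) (entry g (Inr i) (Inr k)) = entry g (Inr i) (Inr k)"
      by (rule linear_map_eqI[OF linear_map_lin_ext[where Y = UNIV] linear_map_id _ e]) auto
    thus ?thesis unfolding labelled_entry_def by (simp add: frame_simps entry_Inr)
  qed
  hence "trace_kernel index_set labelled_entry (weight F) (map (\<lambda>g. (g, True)) gs) ys =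
      (\<Sum>i<N. weight F (Inr i) ys * path_integral {..<N} (res_matrix G \<phi>) i gs i (\<lambda>hs. delta hs ys))"
    using frame_kind_sets(1) by (intro trace_labelled[OF gs]) auto
  also have "\<dots> = F (inv \<one> \<otimes> foldr (\<otimes>) ys \<one> \<otimes> \<one>) * trace_map G L \<phi> (delta gs) ys"
    unfolding trace_map_delta[OF gs]
    by (simp add: trace_kernel_def weight_def frame_simps sum_distrib_left)
  also have "\<dots> = F (foldr (\<otimes>) ys \<one>) * trace_map G L \<phi> (delta gs) ys"
  proof (cases "trace_map G L \<phi> (delta gs) ys = 0")
    case False
    hence "ys \<in> tuples GL n"
      by (rule fin_span_supp[OF linear_map_closed[OF trace_map_linear], rotated]) (simp add: gs)
    hence "foldr (\<otimes>) ys \<one> \<in> carrier G" using L.subset by (intro foldr_closed) (auto simp: tuples_def)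
    thus ?thesis by simp
  qed simp
  finally show "trace_kernel index_set labelled_entry (weight F) (map (\<lambda>g. (g, True)) gs) ys =
      F (foldr (\<otimes>) ys \<one>) * trace_map G L \<phi> (delta gs) ys" .
qed

text \<open>The matrices are those of the action of \<open>G\<close> on the cosets of \<open>L\<close>: each row has one nonzero entry, so
  from every coset there is exactly one path.\<close>

lemma permutation_path_integral:
  assumes "set gs \<subseteq> carrier G" "x \<in> X" "y \<in> X"
  shows "path_integral X (\<lambda>g x y. if x \<otimes> g \<otimes> inv y \<in> L then delta g else 0) x gs y \<psi> =
    (if x \<otimes> foldr (\<otimes>) gs \<one> \<otimes> inv y \<in> L then \<psi> gs else 0)"
  using assms
proof (induction gs arbitrary: x \<psi>)
  case Nil
  have xy: "x \<in> carrier G" "y \<in> carrier G" using Nil X_in by auto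
  have "x \<otimes> inv x \<in> L" using xy by simp
  hence "x \<otimes> inv y \<in> L \<longleftrightarrow> x = y" using X_transversal[OF xy(1)] Nil by auto
  thus ?case using xy by simp
next
  case (Cons g gs)
  have c: "x \<in> carrier G" "y \<in> carrier G" "g \<in> carrier G" "set gs \<subseteq> carrier G" "x \<otimes> g \<in> carrier G"
    using Cons.prems X_in by auto
  let ?P = "foldr (\<otimes>) gs \<one>"
  have P: "?P \<in> carrier G" by (rule foldr_closed[OF c(4)])
  obtain k where k1: "k \<in> X \<and> x \<otimes> g \<otimes> inv k \<in> L" and k2: "\<forall>k'. k' \<in> X \<and> x \<otimes> g \<otimes> inv k' \<in> L \<longrightarrow> k' = k"
    using X_transversal[OF c(5)] by (rule ex1E)
  note k = conjunct1[OF k1] conjunct2[OF k1] k2[rule_format, OF conjI]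
  have kc: "k \<in> carrier G" using k(1) X_in by blast
  let ?l = "x \<otimes> g \<otimes> inv k" and ?r = "k \<otimes> ?P \<otimes> inv y"
  have r: "?r \<in> carrier G" using kc P c by simp
  have lr: "x \<otimes> (g \<otimes> ?P) \<otimes> inv y = ?l \<otimes> ?r"
  proof -
    have "inv k \<otimes> (k \<otimes> (?P \<otimes> inv y)) = ?P \<otimes> inv y" using kc P c by (simp add: m_assoc[symmetric])
    thus ?thesis using kc P c by (simp add: m_assoc)
  qed
  have iff: "x \<otimes> (g \<otimes> ?P) \<otimes> inv y \<in> L \<longleftrightarrow> ?r \<in> L"
  proof
    assume "x \<otimes> (g \<otimes> ?P) \<otimes> inv y \<in> L"
    hence "inv ?l \<otimes> (?l \<otimes> ?r) \<in> L" unfolding lr by (rule L.m_closed[OF L.m_inv_closed[OF k(2)]])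
    moreover have "inv ?l \<otimes> (?l \<otimes> ?r) = ?r" using r L.mem_carrier[OF k(2)] by (simp add: m_assoc[symmetric])
    ultimately show "?r \<in> L" by simp
  qed (use k(2) lr in auto)
  have "path_integral X (\<lambda>g x y. if x \<otimes> g \<otimes> inv y \<in> L then delta g else 0) x (g # gs) y \<psi> =
      (\<Sum>k'\<in>X. if k' = k then (if k' \<otimes> ?P \<otimes> inv y \<in> L then \<psi> (g # gs) else 0) else 0)"
    unfolding path_integral.simps
  proof (rule sum.cong)
    fix k' assume k': "k' \<in> X"
    show "integral_of (if x \<otimes> g \<otimes> inv k' \<in> L then delta g else 0)
        (\<lambda>h. path_integral X (\<lambda>g x y. if x \<otimes> g \<otimes> inv y \<in> L then delta g else 0) k' gs y (\<lambda>hs. \<psi> (h # hs))) =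
        (if k' = k then (if k' \<otimes> ?P \<otimes> inv y \<in> L then \<psi> (g # gs) else 0) else 0)"
    proof (cases "k' = k")
      case True
      thus ?thesis using k(2) Cons.IH[OF c(4) k' Cons.prems(3)] by simp
    next
      case False
      hence "x \<otimes> g \<otimes> inv k' \<notin> L" using k(3)[OF k'] by blast
      thus ?thesis using False by simp
    qed
  qed simp
  thus ?case using finite_X k(1) iff by (simp add: sum.delta)
qed

text \<open>With the label of the transversal on every factor, a closed path is a coset that is fixed by the
  product of the factors, and it contributes the tensor itself with the weight of that product.\<close>

lemma trace_label_False:
  assumes gs: "gs \<in> tuples G n" and F: "\<And>h. h \<in> carrier G \<Longrightarrow> h \<notin> L \<Longrightarrow> F h = 0"
  shows "trace_kernel index_set labelled_entry (weight F) (map (\<lambda>g. (g, False)) gs) =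
    (\<lambda>ys. transfer_index F (foldr (\<otimes>) ys \<one>) * delta gs ys)"
proof
  fix ys
  let ?\<rho> = "\<lambda>g x y. if x \<otimes> g \<otimes> inv y \<in> L then delta g else 0"
  have car: "set gs \<subseteq> carrier G" using gs by (auto simp: tuples_def)
  have "labelled_entry (g, False) (Inl x) (Inl y) = ?\<rho> g x y"
    if "g \<in> carrier G" "x \<in> X" "y \<in> X" for g x y
  proof -
    have c: "x \<in> carrier G" "y \<in> carrier G" using that X_in by auto
    have "inv x \<otimes> (x \<otimes> g \<otimes> inv y) \<otimes> inv (inv y) = inv x \<otimes> (x \<otimes> (g \<otimes> (inv y \<otimes> y)))"
      using c that(1) by (simp add: m_assoc)
    also have "\<dots> = g" using c that(1) by (simp add: m_assoc[symmetric])
    finally have "inv x \<otimes> (x \<otimes> g \<otimes> inv y) \<otimes> inv (inv y) = g" .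
    moreover have "lin_ext k 0 = 0" for k :: "'g \<Rightarrow> 'g \<Rightarrow> complex" by (simp add: lin_ext_def fun_eq_iff)
    ultimately show ?thesis unfolding labelled_entry_def by (simp add: frame_simps entry_Inl)
  qed
  hence "trace_kernel index_set labelled_entry (weight F) (map (\<lambda>g. (g, False)) gs) ys =
      (\<Sum>x\<in>X. weight F (Inl x) ys * path_integral X ?\<rho> x gs x (\<lambda>hs. delta hs ys))"
    using frame_kind_sets(2) by (intro trace_labelled[OF gs]) auto
  also have "\<dots> = (\<Sum>x\<in>X. F (x \<otimes> foldr (\<otimes>) ys \<one> \<otimes> inv x) * delta gs ys)"
  proof (rule sum.cong)
    fix x assume x: "x \<in> X"
    hence xc: "x \<in> carrier G" using X_in by auto
    have P: "foldr (\<otimes>) gs \<one> \<in> carrier G" by (rule foldr_closed[OF car])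
    show "weight F (Inl x) ys * path_integral X ?\<rho> x gs x (\<lambda>hs. delta hs ys) =
        F (x \<otimes> foldr (\<otimes>) ys \<one> \<otimes> inv x) * delta gs ys"
      unfolding permutation_path_integral[OF car x x]
      using F[of "x \<otimes> foldr (\<otimes>) gs \<one> \<otimes> inv x"] xc P
      by (auto simp: delta_def weight_def frame_simps)
  qed simp
  also have "\<dots> = transfer_index F (foldr (\<otimes>) ys \<one>) * delta gs ys"
    by (simp add: transfer_index_def sum_distrib_right)
  finally show "trace_kernel index_set labelled_entry (weight F) (map (\<lambda>g. (g, False)) gs) ys =
      transfer_index F (foldr (\<otimes>) ys \<one>) * delta gs ys" .
qed

end

section \<open>Quotients of spaces of functions\<close>

definition fun_subspace :: "('x \<Rightarrow> complex) set \<Rightarrow> bool" where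
  "fun_subspace U \<longleftrightarrow> 0 \<in> U \<and> (\<forall>u\<in>U. \<forall>v\<in>U. u + v \<in> U) \<and> (\<forall>a. \<forall>u\<in>U. fscale a u \<in> U)"

lemma fun_subspaceD:
  assumes "fun_subspace U"
  shows "0 \<in> U" "u \<in> U \<Longrightarrow> v \<in> U \<Longrightarrow> u + v \<in> U" "u \<in> U \<Longrightarrow> fscale a u \<in> U" "u \<in> U \<Longrightarrow> - u \<in> U"
    "u \<in> U \<Longrightarrow> v \<in> U \<Longrightarrow> u - v \<in> U"
proof -
  show *: "0 \<in> U" "u \<in> U \<Longrightarrow> v \<in> U \<Longrightarrow> u + v \<in> U" "u \<in> U \<Longrightarrow> fscale a u \<in> U" for u v a
    using assms by (auto simp: fun_subspace_def)
  show m: "u \<in> U \<Longrightarrow> - u \<in> U" for u using *(3)[of u "-1"] by simp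
  show "u \<in> U \<Longrightarrow> v \<in> U \<Longrightarrow> u - v \<in> U" using *(2)[of u "- v"] m[of v] by simp
qed

lemma fun_subspace_image: "linear_map X Y f \<Longrightarrow> fun_subspace (f ` fin_span X)"
  unfolding fun_subspace_def
proof (intro conjI ballI allI)
  assume f: "linear_map X Y f"
  show "0 \<in> f ` fin_span X" using linear_map_zero[OF f] fin_span_zero by (metis image_eqI)
  fix u a assume "u \<in> f ` fin_span X"
  then obtain c where c: "c \<in> fin_span X" "u = f c" by blast
  show "fscale a u \<in> f ` fin_span X"
    using linear_map_fscale[OF f c(1), of a] c fin_span_fscale[OF c(1), of a] by (metis image_eqI)
  fix v assume "v \<in> f ` fin_span X"
  then obtain d where d: "d \<in> fin_span X" "v = f d" by blast
  show "u + v \<in> f ` fin_span X"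
    using linear_map_add[OF f c(1) d(1)] c d fin_span_add[OF c(1) d(1)] by (metis image_eqI)
qed

lemma coset_iff: "w \<in> coset U z \<longleftrightarrow> w - z \<in> U"
proof -
  have "(\<lambda>x. w x - z x) = w - z" by (simp add: fun_eq_iff)
  thus ?thesis by (simp add: coset_def)
qed

context
  fixes U :: "('x \<Rightarrow> complex) set"
  assumes U: "fun_subspace U"
begin

lemma coset_self: "z \<in> coset U z"
  using fun_subspaceD(1)[OF U] by (simp add: coset_iff)

lemma coset_eqI: "z - w \<in> U \<Longrightarrow> coset U z = coset U w"
proof (rule Set.set_eqI)
  fix v assume zw: "z - w \<in> U"
  have "v - w = (v - z) + (z - w)" "v - z = (v - w) - (z - w)" by (simp_all add: fun_eq_iff)
  thus "v \<in> coset U z \<longleftrightarrow> v \<in> coset U w"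
    unfolding coset_iff using fun_subspaceD[OF U] zw by metis
qed

lemma Union_coset: "(\<And>w. w - z \<in> U \<Longrightarrow> h w = A) \<Longrightarrow> (\<Union>w\<in>coset U z. h w) = A"
proof -
  assume "\<And>w. w - z \<in> U \<Longrightarrow> h w = A"
  hence "\<And>w. w \<in> coset U z \<Longrightarrow> h w = A" by (simp add: coset_iff)
  thus ?thesis using coset_self[of z] by blast
qed

lemma quot_add: "coset U z \<oplus>\<^bsub>quot_space Z U\<^esub> coset U w = coset U (z + w)"
proof -
  have "coset U (\<lambda>x. u x + v x) = coset U (z + w)" if "u - z \<in> U" "v - w \<in> U" for u v
  proof (rule coset_eqI)
    have e: "(\<lambda>x. u x + v x) - (z + w) = (u - z) + (v - w)" by (simp add: fun_eq_iff)
    show "(\<lambda>x. u x + v x) - (z + w) \<in> U" unfolding e by (rule fun_subspaceD(2)[OF U that])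
  qed
  thus ?thesis unfolding quot_space_def by (simp add: Union_coset)
qed

lemma quot_smult: "a \<odot>\<^bsub>quot_space Z U\<^esub> coset U z = coset U (fscale a z)"
proof -
  have "coset U (\<lambda>x. a * u x) = coset U (fscale a z)" if "u - z \<in> U" for u
  proof (rule coset_eqI)
    have e: "(\<lambda>x. a * u x) - fscale a z = fscale a (u - z)" by (simp add: fun_eq_iff algebra_simps)
    show "(\<lambda>x. a * u x) - fscale a z \<in> U" unfolding e by (rule fun_subspaceD(3)[OF U that])
  qed
  thus ?thesis unfolding quot_space_def by (simp add: Union_coset)
qed

lemma quot_carrier: "carrier (quot_space Z U) = coset U ` Z"
  by (simp add: quot_space_def)

lemma quot_zero: "\<zero>\<^bsub>quot_space Z U\<^esub> = coset U 0"
proof -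
  have "coset U 0 = U" by (auto simp: coset_iff)
  thus ?thesis by (simp add: quot_space_def)
qed

lemma quot_abelian_monoid:
  assumes Z: "fun_subspace Z" shows "abelian_monoid (quot_space Z U)"
proof (rule abelian_monoidI)
  fix A A' A'' assume "A \<in> carrier (quot_space Z U)" "A' \<in> carrier (quot_space Z U)" "A'' \<in> carrier (quot_space Z U)"
  then obtain z w v where zw: "z \<in> Z" "w \<in> Z" and A: "A = coset U z" "A' = coset U w" "A'' = coset U v"
    unfolding quot_carrier by blast
  show "A \<oplus>\<^bsub>quot_space Z U\<^esub> A' \<in> carrier (quot_space Z U)"
    unfolding A quot_add quot_carrier using fun_subspaceD(2)[OF Z zw] by blast
  show "A \<oplus>\<^bsub>quot_space Z U\<^esub> A' \<oplus>\<^bsub>quot_space Z U\<^esub> A'' = A \<oplus>\<^bsub>quot_space Z U\<^esub> (A' \<oplus>\<^bsub>quot_space Z U\<^esub> A'')"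
    unfolding A quot_add by (simp only: add.assoc)
  show "A \<oplus>\<^bsub>quot_space Z U\<^esub> A' = A' \<oplus>\<^bsub>quot_space Z U\<^esub> A"
    unfolding A quot_add by (simp only: add.commute)
  show "\<zero>\<^bsub>quot_space Z U\<^esub> \<oplus>\<^bsub>quot_space Z U\<^esub> A = A" unfolding A quot_zero quot_add by simp
next
  show "\<zero>\<^bsub>quot_space Z U\<^esub> \<in> carrier (quot_space Z U)"
    unfolding quot_zero quot_carrier using fun_subspaceD(1)[OF Z] by blast
qed

lemma quot_finsum:
  assumes Z: "fun_subspace Z" and J: "finite J" and z: "\<And>j. j \<in> J \<Longrightarrow> z j \<in> Z"
    and f: "\<And>j. j \<in> J \<Longrightarrow> f j = coset U (z j)"
  shows "finsum (quot_space Z U) f J = coset U (\<Sum>j\<in>J. z j)"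
proof -
  interpret abelian_monoid "quot_space Z U" by (rule quot_abelian_monoid[OF Z])
  show ?thesis using J z f
  proof (induction J rule: finite_induct)
    case empty
    show ?case unfolding finsum_empty sum.empty quot_zero ..
  next
    case (insert j J)
    have fc: "f \<in> J \<rightarrow> carrier (quot_space Z U)" "f j \<in> carrier (quot_space Z U)"
      unfolding quot_carrier using insert by auto
    have "finsum (quot_space Z U) f (insert j J) = coset U (z j) \<oplus>\<^bsub>quot_space Z U\<^esub> coset U (\<Sum>j\<in>J. z j)"
      using insert fc by (simp add: finsum_insert)
    thus ?case unfolding quot_add sum.insert[OF insert.hyps] .
  qed
qed

end

lemma induced_coset:
  assumes U: "fun_subspace U" and U': "fun_subspace U'" and f: "\<And>w. w - z \<in> U \<Longrightarrow> f w - f z \<in> U'"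
  shows "induced U' f (coset U z) = coset U' (f z)"
  unfolding induced_def by (rule Union_coset[OF U]) (rule coset_eqI[OF U' f])

lemma lin_maps_quotI:
  assumes U: "fun_subspace U" and U': "fun_subspace U'" and Z: "fun_subspace Z"
    and F: "\<And>z. z \<in> Z \<Longrightarrow> F (coset U z) = coset U' (f z)"
    and f: "\<And>z. z \<in> Z \<Longrightarrow> f z \<in> Z'" "\<And>z w. z \<in> Z \<Longrightarrow> w \<in> Z \<Longrightarrow> f (z + w) = f z + f w"
      "\<And>a z. z \<in> Z \<Longrightarrow> f (fscale a z) = fscale a (f z)"
  shows "F \<in> lin_maps (quot_space Z U) (quot_space Z' U')"
  unfolding lin_maps_def quot_carrier[OF U] quot_carrier[OF U']
  using fun_subspaceD[OF Z] F f by (auto simp: quot_add[OF U] quot_add[OF U'] quot_smult[OF U] quot_smult[OF U'])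

section \<open>Maps of precyclic modules on homology\<close>

definition HH_cycles :: "('g, 'm) monoid_scheme \<Rightarrow> nat \<Rightarrow> ('g list \<Rightarrow> complex) set" where
  "HH_cycles G n = {c \<in> chains G n. hoch_b G n c = 0}"

definition HC_cycles :: "('g, 'm) monoid_scheme \<Rightarrow> nat \<Rightarrow> (nat \<times> 'g list \<Rightarrow> complex) set" where
  "HC_cycles G n = {z \<in> tot_chains G n. tot_d G n z = 0}"

lemma HH_quot: "HH G n = quot_space (HH_cycles G n) (HH_bdry G n)"
  by (simp add: HH_def HH_cycles_def zero_fun_def)

lemma HC_quot: "HC G n = quot_space (HC_cycles G n) (HC_bdry G n)"
  by (simp add: HC_def HC_cycles_def zero_fun_def)

context left_unital_semigroup begin

lemma HH_bdry_subspace: "fun_subspace (HH_bdry H n)"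
  unfolding HH_bdry_def chains_def by (rule fun_subspace_image[OF hoch_b_linear])

lemma HC_bdry_subspace: "fun_subspace (HC_bdry H n)"
  unfolding HC_bdry_def tot_chains_def by (rule fun_subspace_image[OF tot_d_linear])

lemma HH_cycles_subspace: "fun_subspace (HH_cycles H n)"
  unfolding fun_subspace_def HH_cycles_def chains_def
  using linear_map_add[OF hoch_b_linear] linear_map_fscale[OF hoch_b_linear] linear_map_zero[OF hoch_b_linear]
  by auto

lemma HC_cycles_subspace: "fun_subspace (HC_cycles H n)"
  unfolding fun_subspace_def HC_cycles_def tot_chains_def
  using linear_map_add[OF tot_d_linear] linear_map_fscale[OF tot_d_linear] linear_map_zero[OF tot_d_linear]
  by auto

lemma HH_carrier: "carrier (HH H n) = coset (HH_bdry H n) ` HH_cycles H n"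
  unfolding HH_quot by (rule quot_carrier[OF HH_bdry_subspace])

lemma HC_carrier: "carrier (HC H n) = coset (HC_bdry H n) ` HC_cycles H n"
  unfolding HC_quot by (rule quot_carrier[OF HC_bdry_subspace])

lemma HH_bdry_chains: "w - c \<in> HH_bdry H n \<Longrightarrow> c \<in> chains H n \<Longrightarrow> w \<in> chains H n"
proof -
  assume w: "w - c \<in> HH_bdry H n" and c: "c \<in> chains H n"
  have "w - c \<in> chains H n" using w hoch_b_closed[of _ "n + 1"] by (auto simp: HH_bdry_def)
  from chains_add[OF this c] show ?thesis by simp
qed

lemma HC_bdry_chains: "w - z \<in> HC_bdry H n \<Longrightarrow> z \<in> tot_chains H n \<Longrightarrow> w \<in> tot_chains H n"
proof -
  assume w: "w - z \<in> HC_bdry H n" and z: "z \<in> tot_chains H n"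
  have "w - z \<in> tot_chains H n" using w tot_d_closed[of _ "n + 1"] by (auto simp: HC_bdry_def)
  from tot_chains_add[OF this z] show ?thesis by simp
qed

end

lemma on_columns_eq: "(\<lambda>z (p, xs). f (column z p) xs) = on_columns f"
  by (simp add: on_columns_def fun_eq_iff)

context precyclic begin

lemma HH_bdry_map: "u \<in> HH_bdry H n \<Longrightarrow> f u \<in> HH_bdry G n"
  using map_hoch_b[of _ "n + 1"] closed[of _ "n + 1"] unfolding HH_bdry_def by force

lemma HC_bdry_map: "u \<in> HC_bdry H n \<Longrightarrow> on_columns f u \<in> HC_bdry G n"
  using tot_d_on_columns[of _ "n + 1"] on_columns_closed[of _ "n + 1"] unfolding HC_bdry_def by force

lemma HH_cycles_map: "c \<in> HH_cycles H n \<Longrightarrow> f c \<in> HH_cycles G n"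
  unfolding HH_cycles_def using closed map_hoch_b[of c n] by auto

lemma HC_cycles_map: "z \<in> HC_cycles H n \<Longrightarrow> on_columns f z \<in> HC_cycles G n"
proof -
  assume z: "z \<in> HC_cycles H n"
  have "on_columns f 0 = 0" by (rule column_eqI) (simp add: fun_eq_iff)
  thus ?thesis using z on_columns_closed[of z n] tot_d_on_columns[of z n] by (auto simp: HC_cycles_def)
qed

end

locale precyclic_same_type = precyclic H G f
  for H :: "('g, 'm) monoid_scheme" and G :: "('g, 'k) monoid_scheme" and f
begin

lemma H_induced_HH:
  assumes c: "c \<in> chains H n"
  shows "fst (H_induced G f) n (coset (HH_bdry H n) c) = coset (HH_bdry G n) (f c)"
  unfolding H_induced_def fst_conv
proof (rule induced_coset[OF H.HH_bdry_subspace G.HH_bdry_subspace])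
  fix w assume w: "w - c \<in> HH_bdry H n"
  have "f w - f c = f (w - c)"
    using H.HH_bdry_chains[OF w c] c by (intro linear_map_diff[OF linear, symmetric]) (auto simp: chains_def)
  thus "f w - f c \<in> HH_bdry G n" using HH_bdry_map[OF w] by simp
qed

lemma H_induced_HC:
  assumes z: "z \<in> tot_chains H n"
  shows "snd (H_induced G f) n (coset (HC_bdry H n) z) = coset (HC_bdry G n) (on_columns f z)"
  unfolding H_induced_def snd_conv on_columns_eq
proof (rule induced_coset[OF H.HC_bdry_subspace G.HC_bdry_subspace])
  fix w assume w: "w - z \<in> HC_bdry H n"
  have wz: "w - z \<in> tot_chains H n" by (rule tot_chains_diff[OF H.HC_bdry_chains[OF w z] z])
  have "on_columns f w = on_columns f ((w - z) + z)" by simp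
  also have "\<dots> = on_columns f (w - z) + on_columns f z" by (rule on_columns_add[OF wz z])
  finally have "on_columns f w - on_columns f z = on_columns f (w - z)" by simp
  thus "on_columns f w - on_columns f z \<in> HC_bdry G n" using HC_bdry_map[OF w] by simp
qed

end

section \<open>Class functions acting on homology\<close>

definition class_mult :: "('g, 'm) monoid_scheme \<Rightarrow> ('g \<Rightarrow> complex) \<Rightarrow> ('g list \<Rightarrow> complex) \<Rightarrow> 'g list \<Rightarrow> complex" where
  "class_mult G F c = (\<lambda>gs. F (foldr (\<otimes>\<^bsub>G\<^esub>) gs \<one>\<^bsub>G\<^esub>) * c gs)"

lemma H_act_eq: "H_act G F = H_induced G (class_mult G F)"
  by (simp add: H_act_def class_mult_def[abs_def])

text \<open>\<open>E\<close> may come from a different map of chains than multiplication by \<open>m\<close>; only its effect on the classes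
  of cycles is compared.\<close>

definition acts_as :: "('g, 'm) monoid_scheme \<Rightarrow> 'g H_map \<Rightarrow> ('g \<Rightarrow> complex) \<Rightarrow> bool" where
  "acts_as G E m \<longleftrightarrow> (\<forall>n.
     (\<forall>c\<in>HH_cycles G n. fst E n (coset (HH_bdry G n) c) = coset (HH_bdry G n) (class_mult G m c)) \<and>
     (\<forall>z\<in>HC_cycles G n. snd E n (coset (HC_bdry G n) z) = coset (HC_bdry G n) (on_columns (class_mult G m) z)))"

context group begin

sublocale C: left_unital_semigroup G
  by (rule left_unital_semigroup)

lemma class_mult_linear: "linear_map (tuples G n) (tuples G n) (class_mult G F)"
  unfolding class_mult_def[abs_def] by (rule linear_map_mult)

lemma class_mult_delta: "class_mult G F (delta gs) = fscale (F (foldr (\<otimes>) gs \<one>)) (delta gs)"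
  by (auto simp: class_mult_def delta_def fun_eq_iff)

lemma class_mult_precyclic:
  assumes F: "F \<in> class_functions G" shows "precyclic G G (class_mult G F)"
proof (rule precyclic_mapI[OF left_unital_semigroup left_unital_semigroup class_mult_linear])
  fix n gs assume gs: "gs \<in> tuples G n"
  obtain us g where us: "gs = us @ [g]" using gs by (cases gs rule: rev_cases) (auto simp: tuples_def)
  have c: "set us \<subseteq> carrier G" "g \<in> carrier G" using gs us by (auto simp: tuples_def)
  let ?P = "foldr (\<otimes>) us \<one>"
  have P: "?P \<in> carrier G" by (rule foldr_closed[OF c(1)])
  have "foldr (\<otimes>) gs \<one> = ?P \<otimes> g" using foldr_append[of us "[g]"] c us by simp
  moreover have "g \<otimes> (?P \<otimes> g) \<otimes> inv g = g \<otimes> ?P" using c P by (simp add: m_assoc)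
  moreover have "F (g \<otimes> (?P \<otimes> g) \<otimes> inv g) = F (?P \<otimes> g)" using F c P by (auto simp: class_functions_def)
  ultimately have "F (foldr (\<otimes>) (rot gs) \<one>) = F (foldr (\<otimes>) gs \<one>)" by (simp add: us)
  moreover have "rot_map (fscale a (delta gs)) = fscale a (delta (rot gs))" for a
    using linear_map_fscale[OF rot_map_linear, of "delta gs" G n a] gs by simp
  ultimately show "class_mult G F (delta (rot gs)) = rot_map (class_mult G F (delta gs))"
    by (simp only: class_mult_delta)
next
  fix n gs i assume gs: "gs \<in> tuples G (Suc n)" and i: "i \<le> n"
  have "foldr (\<otimes>) (face G i gs) \<one> = foldr (\<otimes>) gs \<one>"
    using gs i by (intro foldr_face) (auto simp: tuples_def)
  moreover have "face_map G i (fscale a (delta gs)) = fscale a (delta (face G i gs))" for a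
    using linear_map_fscale[OF C.face_map_linear[of n], of "delta gs" i a] gs by simp
  ultimately show "class_mult G F (delta (face G i gs)) = face_map G i (class_mult G F (delta gs))"
    by (simp only: class_mult_delta)
qed

lemma class_mult_contr:
  assumes c: "c \<in> chains G n" shows "class_mult G F (contr G c) = contr G (class_mult G F c)"
proof (rule linear_map_eqI[OF linear_map_comp[OF class_mult_linear C.contr_linear]
      linear_map_comp[OF C.contr_linear class_mult_linear] _ c[unfolded chains_def]])
  fix gs assume gs: "gs \<in> tuples G n"
  hence "foldr (\<otimes>) gs \<one> \<in> carrier G" by (intro foldr_closed) (auto simp: tuples_def)
  moreover have "contr G (fscale a (delta gs)) = fscale a (delta (\<one> # gs))" for a
    using linear_map_fscale[OF C.contr_linear[of n], of "delta gs" a] gs by simp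
  ultimately show "class_mult G F (contr G (delta gs)) = contr G (class_mult G F (delta gs))"
    by (simp add: class_mult_delta)
qed

lemma class_mult_cong:
  assumes "c \<in> chains G n" "\<And>g. g \<in> carrier G \<Longrightarrow> F g = F' g"
  shows "class_mult G F c = class_mult G F' c"
proof
  fix gs
  show "class_mult G F c gs = class_mult G F' c gs"
  proof (cases "c gs = 0")
    case False
    hence "gs \<in> tuples G n" using fin_span_supp assms(1) by (auto simp: chains_def)
    hence "foldr (\<otimes>) gs \<one> \<in> carrier G" by (intro foldr_closed) (auto simp: tuples_def)
    thus ?thesis using assms(2) by (simp add: class_mult_def)
  qed (simp add: class_mult_def)
qed

lemma on_columns_class_mult_cong:
  assumes "z \<in> tot_chains G n" "\<And>g. g \<in> carrier G \<Longrightarrow> F g = F' g"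
  shows "on_columns (class_mult G F) z = on_columns (class_mult G F') z"
proof (rule column_eqI)
  fix p
  show "column (on_columns (class_mult G F) z) p = column (on_columns (class_mult G F') z) p"
    using class_mult_cong[OF _ assms(2), of "column z p" "n - p"] assms(1)
    by (cases "p \<le> n") (auto simp: tot_chains_iff class_mult_def)
qed

lemma class_mult_class_mult: "class_mult G F (class_mult G F' c) = class_mult G (\<lambda>g. F g * F' g) c"
  by (simp add: class_mult_def mult.assoc)

lemma on_columns_class_mult:
  "on_columns (class_mult G F) (on_columns (class_mult G F') z) = on_columns (class_mult G (\<lambda>g. F g * F' g)) z"
  by (rule column_eqI) (simp add: class_mult_class_mult)

lemma acts_as_H_act: "m \<in> class_functions G \<Longrightarrow> acts_as G (H_act G m) m"
  unfolding acts_as_def H_act_eq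
  using precyclic_same_type.H_induced_HH[OF precyclic_same_type.intro[OF class_mult_precyclic]] precyclic_same_type.H_induced_HC[OF precyclic_same_type.intro[OF class_mult_precyclic]]
  by (auto simp: HH_cycles_def HC_cycles_def)

lemma acts_as_cong:
  assumes "acts_as G E m" "\<And>g. g \<in> carrier G \<Longrightarrow> m g = m' g" shows "acts_as G E m'"
proof -
  have "class_mult G m c = class_mult G m' c" if "c \<in> HH_cycles G n" for c n
    using that by (intro class_mult_cong[OF _ assms(2)]) (auto simp: HH_cycles_def)
  moreover have "on_columns (class_mult G m) z = on_columns (class_mult G m') z" if "z \<in> HC_cycles G n" for z n
    using that by (intro on_columns_class_mult_cong[OF _ assms(2)]) (auto simp: HC_cycles_def)
  ultimately show ?thesis using assms(1) by (simp add: acts_as_def)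
qed

lemma acts_as_unique:
  assumes "acts_as G E m" "acts_as G E' m'" "\<And>g. g \<in> carrier G \<Longrightarrow> m g = m' g"
  shows "H_eq G E E'"
  using acts_as_cong[OF assms(1,3)] assms(2)
  unfolding H_eq_def acts_as_def C.HH_carrier C.HC_carrier by auto

lemma acts_as_comp:
  assumes "acts_as G E m" "acts_as G E' m'" "m' \<in> class_functions G"
  shows "acts_as G (E \<circ>\<^sub>H E') (\<lambda>g. m g * m' g)"
  using assms(1,2) precyclic.HH_cycles_map[OF class_mult_precyclic[OF assms(3)]]
    precyclic.HC_cycles_map[OF class_mult_precyclic[OF assms(3)]]
  by (simp add: acts_as_def H_comp_def class_mult_class_mult on_columns_class_mult)

lemma acts_as_id: "acts_as G H_id (\<lambda>g. 1)"
  by (simp add: acts_as_def H_id_def class_mult_def on_columns_def column_def)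

lemma acts_as_zero: "acts_as G (H_zero G) (\<lambda>g. 0)"
proof -
  have "class_mult G (\<lambda>g. 0) c = 0" for c by (simp add: class_mult_def fun_eq_iff)
  moreover have "on_columns (class_mult G (\<lambda>g. 0)) z = 0" for z
    by (simp add: class_mult_def on_columns_def fun_eq_iff)
  ultimately show ?thesis
    by (simp add: acts_as_def H_zero_def HH_quot HC_quot quot_zero[OF C.HH_bdry_subspace] quot_zero[OF C.HC_bdry_subspace])
qed

lemma acts_as_sum:
  assumes J: "finite J" and E: "\<And>j. j \<in> J \<Longrightarrow> acts_as G (E j) (m j)" and m: "\<And>j. j \<in> J \<Longrightarrow> m j \<in> class_functions G"
  shows "acts_as G (H_sum G E J) (\<lambda>g. \<Sum>j\<in>J. m j g)"
  unfolding acts_as_def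
proof (intro allI conjI ballI)
  fix n c assume c: "c \<in> HH_cycles G n"
  have "fst (H_sum G E J) n (coset (HH_bdry G n) c) = coset (HH_bdry G n) (\<Sum>j\<in>J. class_mult G (m j) c)"
    unfolding H_sum_def fst_conv HH_quot
  proof (rule quot_finsum[OF C.HH_bdry_subspace C.HH_cycles_subspace J])
    fix j assume j: "j \<in> J"
    show "class_mult G (m j) c \<in> HH_cycles G n"
      by (rule precyclic.HH_cycles_map[OF class_mult_precyclic[OF m[OF j]] c])
    show "fst (E j) n (coset (HH_bdry G n) c) = coset (HH_bdry G n) (class_mult G (m j) c)"
      using E[OF j] c by (simp add: acts_as_def)
  qed
  moreover have "(\<Sum>j\<in>J. class_mult G (m j) c) = class_mult G (\<lambda>g. \<Sum>j\<in>J. m j g) c"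
    by (simp add: fun_eq_iff sum_fun_apply class_mult_def sum_distrib_right)
  ultimately show "fst (H_sum G E J) n (coset (HH_bdry G n) c) =
      coset (HH_bdry G n) (class_mult G (\<lambda>g. \<Sum>j\<in>J. m j g) c)" by simp
next
  fix n z assume z: "z \<in> HC_cycles G n"
  have "snd (H_sum G E J) n (coset (HC_bdry G n) z) = coset (HC_bdry G n) (\<Sum>j\<in>J. on_columns (class_mult G (m j)) z)"
    unfolding H_sum_def snd_conv HC_quot
  proof (rule quot_finsum[OF C.HC_bdry_subspace C.HC_cycles_subspace J])
    fix j assume j: "j \<in> J"
    show "on_columns (class_mult G (m j)) z \<in> HC_cycles G n"
      by (rule precyclic.HC_cycles_map[OF class_mult_precyclic[OF m[OF j]] z])
    show "snd (E j) n (coset (HC_bdry G n) z) = coset (HC_bdry G n) (on_columns (class_mult G (m j)) z)"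
      using E[OF j] z by (simp add: acts_as_def)
  qed
  moreover have "(\<Sum>j\<in>J. on_columns (class_mult G (m j)) z) = on_columns (class_mult G (\<lambda>g. \<Sum>j\<in>J. m j g)) z"
    by (auto simp: fun_eq_iff sum_fun_apply class_mult_def on_columns_def sum_distrib_right)
  ultimately show "snd (H_sum G E J) n (coset (HC_bdry G n) z) =
      coset (HC_bdry G n) (on_columns (class_mult G (\<lambda>g. \<Sum>j\<in>J. m j g)) z)" by simp
qed

subsection \<open>Compatibility with the long exact sequence\<close>

definition shift2 :: "(nat \<times> 'x \<Rightarrow> complex) \<Rightarrow> nat \<times> 'x \<Rightarrow> complex" where
  "shift2 z = (\<lambda>(p, xs). z (p + 2, xs))"

definition connecting :: "nat \<Rightarrow> (nat \<times> 'a list \<Rightarrow> complex) \<Rightarrow> 'a list \<Rightarrow> complex" where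
  "connecting n z = contr G (cyc_norm n (column z 0)) - cyc (n + 1) (contr G (cyc_norm n (column z 0)))"

lemma tot_d_single_column: "tot_d G n (single_column 0 c) = single_column 0 (hoch_b G n c)"
proof (rule column_eqI)
  fix p
  show "column (tot_d G n (single_column 0 c)) p = column (single_column 0 (hoch_b G n c)) p"
  proof (cases "p = 0")
    case True
    thus ?thesis by (cases "n = 0") (simp_all add: column_tot_d vert_def[of G 0])
  next
    case False
    thus ?thesis by (simp add: column_tot_d)
  qed
qed

lemma map_I_coset:
  assumes c: "c \<in> chains G n"
  shows "map_I G n (coset (HH_bdry G n) c) = coset (HC_bdry G n) (single_column 0 c)"
proof -
  have eq: "map_I G n = induced (HC_bdry G n) (single_column 0)"
    by (simp add: map_I_def single_column_def[abs_def])
  show ?thesis unfolding eq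
  proof (rule induced_coset[OF C.HH_bdry_subspace C.HC_bdry_subspace])
    fix w assume "w - c \<in> HH_bdry G n"
    then obtain y where y: "y \<in> chains G (n + 1)" "w - c = hoch_b G (n + 1) y" by (auto simp: HH_bdry_def)
    have "tot_d G (n + 1) (single_column 0 y) = single_column 0 w - single_column 0 c"
      unfolding tot_d_single_column y(2)[symmetric] by (rule column_eqI) simp
    moreover have "single_column 0 y \<in> tot_chains G (n + 1)" using y by (intro single_column_tot_chains) auto
    ultimately show "single_column 0 w - single_column 0 c \<in> HC_bdry G n" unfolding HC_bdry_def by force
  qed
qed

lemma column_shift2 [simp]: "column (shift2 z) p = column z (Suc (Suc p))"
  by (simp add: column_def shift2_def)

lemma shift2_tot_chains: "z \<in> tot_chains G (Suc (Suc n)) \<Longrightarrow> shift2 z \<in> tot_chains G n"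
  using column_chains[of z G "Suc (Suc n)"] by (force simp: tot_chains_iff)

lemma tot_d_shift2: "tot_d G n (shift2 z) = shift2 (tot_d G (Suc (Suc n)) z)"
  by (rule column_eqI) (simp add: column_tot_d vert_def horiz_def)

lemma map_S_coset:
  assumes z: "z \<in> tot_chains G (n + 2)"
  shows "map_S G n (coset (HC_bdry G (n + 2)) z) = coset (HC_bdry G n) (shift2 z)"
proof -
  have eq: "map_S G n = induced (HC_bdry G n) shift2"
    by (simp add: map_S_def shift2_def[abs_def])
  show ?thesis unfolding eq
  proof (rule induced_coset[OF C.HC_bdry_subspace C.HC_bdry_subspace])
    fix w assume "w - z \<in> HC_bdry G (n + 2)"
    then obtain y where y: "y \<in> tot_chains G (Suc (Suc (n + 1)))" "w - z = tot_d G (Suc (Suc (n + 1))) y"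
      by (auto simp: HC_bdry_def)
    have "shift2 w - shift2 z = shift2 (w - z)" by (auto simp: shift2_def fun_eq_iff)
    hence "shift2 w - shift2 z = tot_d G (n + 1) (shift2 y)" unfolding y(2) tot_d_shift2 .
    thus "shift2 w - shift2 z \<in> HC_bdry G n" using shift2_tot_chains[OF y(1)] unfolding HC_bdry_def by force
  qed
qed

lemma connecting_linear: "linear_map {(p, xs). p \<le> n \<and> xs \<in> tuples G (n - p)} (tuples G (n + 1)) (connecting n)"
proof -
  have col: "linear_map {(p, xs). p \<le> n \<and> xs \<in> tuples G (n - p)} (tuples G n) (\<lambda>z. column z 0)"
    using column_chains[of _ G n 0] by (simp add: linear_map_def tot_chains_def chains_def)
  note s = linear_map_comp[OF C.contr_linear linear_map_comp[OF cyc_norm_linear col]]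
  show ?thesis unfolding connecting_def[abs_def] using s linear_map_comp[OF cyc_linear s]
    by (intro linear_map_minus) simp_all
qed

text \<open>On a boundary, the connecting map gives \<open>(1 - t) s N b = (1 - t) s b' N = - b (1 - t) s N\<close>.\<close>

lemma connecting_bdry:
  assumes "u \<in> HC_bdry G n" shows "connecting n u \<in> HH_bdry G (n + 1)"
proof -
  obtain y where y: "y \<in> tot_chains G (Suc n)" "u = tot_d G (Suc n) y" using assms by (auto simp: HC_bdry_def)
  have y0: "column y 0 \<in> chains G (Suc n)" and y1: "column y (Suc 0) \<in> chains G n"
    using column_chains[OF y(1), of 0] column_chains[OF y(1), of "Suc 0"] by auto
  let ?w = "cyc_norm (Suc n) (column y 0)" and ?s = "contr G (cyc_norm (Suc n) (column y 0))"
  have w: "?w \<in> chains G (Suc n)" by (rule cyc_norm_closed[OF y0])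
  have s: "?s \<in> chains G (Suc (Suc n))" by (rule C.contr_closed[OF w])
  have b's: "hoch_b' G (Suc (Suc n)) ?s \<in> chains G (Suc n)" using C.hoch_b'_closed[OF s] by simp
  have "column u 0 = hoch_b G (Suc n) (column y 0) + horiz 0 n (column y (Suc 0))"
    by (simp add: y(2) column_tot_d vert_def)
  hence "cyc_norm n (column u 0) = cyc_norm n (hoch_b G (Suc n) (column y 0)) + horiz (Suc 0) n (horiz (Suc (Suc 0)) n (column y (Suc 0)))"
    using linear_map_add[OF cyc_norm_linear[of G n], of "hoch_b G (Suc n) (column y 0)" "horiz 0 n (column y (Suc 0))"]
      C.hoch_b_closed[OF y0] horiz_closed[OF y1, of 0] by (simp add: chains_def horiz_def)
  also have "horiz (Suc 0) n (horiz (Suc (Suc 0)) n (column y (Suc 0))) = 0" by (rule horiz_horiz[OF y1])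
  also have "cyc_norm n (hoch_b G (Suc n) (column y 0)) = hoch_b' G (Suc n) ?w"
    using C.hoch_b'_cyc_norm[OF y0] by simp
  finally have N: "cyc_norm n (column u 0) = hoch_b' G (Suc n) ?w" by simp
  have sN: "contr G (cyc_norm n (column u 0)) = ?w - hoch_b' G (Suc (Suc n)) ?s"
    using C.hoch_b'_contr[OF w] unfolding N by (simp add: fun_eq_iff eq_diff_eq add.commute)
  have "cyc (Suc n) (?w - hoch_b' G (Suc (Suc n)) ?s) = ?w - cyc (Suc n) (hoch_b' G (Suc (Suc n)) ?s)"
    using linear_map_diff[OF cyc_linear[of G "Suc n"], of ?w "hoch_b' G (Suc (Suc n)) ?s"] w b's cyc_cyc_norm[OF y0]
    by (simp add: chains_def)
  hence "connecting n u = - (hoch_b' G (Suc (Suc n)) ?s - cyc (Suc n) (hoch_b' G (Suc (Suc n)) ?s))"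
    unfolding connecting_def sN by (simp add: fun_eq_iff)
  also have "\<dots> = - hoch_b G (Suc (Suc n)) (?s - cyc (Suc (Suc n)) ?s)"
    using C.hoch_b_one_minus_cyc[OF s] by simp
  also have "\<dots> \<in> HH_bdry G (n + 1)"
  proof (rule fun_subspaceD(4)[OF C.HH_bdry_subspace])
    have "?s - cyc (Suc (Suc n)) ?s \<in> chains G (Suc (Suc n))" by (rule chains_diff[OF s cyc_closed[OF s]])
    thus "hoch_b G (Suc (Suc n)) (?s - cyc (Suc (Suc n)) ?s) \<in> HH_bdry G (n + 1)" by (simp add: HH_bdry_def)
  qed
  finally show ?thesis .
qed

lemma map_B_coset:
  assumes z: "z \<in> tot_chains G n"
  shows "map_B G n (coset (HC_bdry G n) z) = coset (HH_bdry G (n + 1)) (connecting n z)"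
proof -
  have eq: "map_B G n = induced (HH_bdry G (n + 1)) (connecting n)"
    by (simp add: map_B_def connecting_def[abs_def] Let_def fun_diff_def)
  show ?thesis unfolding eq
  proof (rule induced_coset[OF C.HC_bdry_subspace C.HH_bdry_subspace])
    fix w assume w: "w - z \<in> HC_bdry G n"
    have "connecting n w - connecting n z = connecting n (w - z)"
      using C.HC_bdry_chains[OF w z] z
      by (intro linear_map_diff[OF connecting_linear, symmetric]) (auto simp: tot_chains_def)
    thus "connecting n w - connecting n z \<in> HH_bdry G (n + 1)" using connecting_bdry[OF w] by simp
  qed
qed

lemma single_column_cycle:
  assumes "c \<in> HH_cycles G n" shows "single_column 0 c \<in> HC_cycles G n"
proof -
  have b: "hoch_b G n c = 0" using assms by (simp add: HH_cycles_def)
  have "tot_d G n (single_column 0 c) = 0" unfolding tot_d_single_column b by (rule column_eqI) simp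
  thus ?thesis using assms single_column_tot_chains[of c G n 0] by (simp add: HC_cycles_def HH_cycles_def)
qed

lemma shift2_cycle:
  assumes "z \<in> HC_cycles G (n + 2)" shows "shift2 z \<in> HC_cycles G n"
proof -
  have "tot_d G n (shift2 z) = shift2 0" using assms by (simp add: tot_d_shift2 HC_cycles_def)
  also have "\<dots> = 0" by (auto simp: shift2_def fun_eq_iff)
  finally show ?thesis using assms shift2_tot_chains by (simp add: HC_cycles_def)
qed

text \<open>The columns 0 and 1 of a cycle give \<open>b' N z\<^sub>0 = N b z\<^sub>0 = - N (1 - t) z\<^sub>1 = 0\<close>.\<close>

lemma connecting_cycle:
  assumes z: "z \<in> HC_cycles G n" shows "connecting n z \<in> HH_cycles G (n + 1)"
proof -
  have zt: "z \<in> tot_chains G n" "tot_d G n z = 0" using z by (auto simp: HC_cycles_def)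
  have z0: "column z 0 \<in> chains G n" using column_chains[OF zt(1), of 0] by simp
  let ?w = "cyc_norm n (column z 0)"
  have w: "?w \<in> chains G n" by (rule cyc_norm_closed[OF z0])
  have b'w: "hoch_b' G n ?w = 0"
  proof (cases n)
    case (Suc m)
    have z1: "column z (Suc 0) \<in> chains G m" using column_chains[OF zt(1), of "Suc 0"] Suc by simp
    have "column (tot_d G n z) 0 = 0" unfolding zt(2) by simp
    hence e: "hoch_b G n (column z 0) + horiz 0 m (column z (Suc 0)) = 0"
      by (simp add: column_tot_d vert_def Suc)
    have "hoch_b' G n ?w = cyc_norm m (hoch_b G n (column z 0))"
      using C.hoch_b'_cyc_norm[OF z0] by (simp add: Suc)
    also have "hoch_b G n (column z 0) = - horiz 0 m (column z (Suc 0))"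
      using e by (simp add: eq_neg_iff_add_eq_0)
    also have "cyc_norm m (- horiz 0 m (column z (Suc 0))) = - horiz (Suc 0) m (horiz (Suc (Suc 0)) m (column z (Suc 0)))"
      using linear_map_uminus[OF cyc_norm_linear[of G m], of "horiz 0 m (column z (Suc 0))"] horiz_closed[OF z1, of 0]
      by (simp add: chains_def horiz_def)
    also have "\<dots> = 0" unfolding horiz_horiz[OF z1] by simp
    finally show ?thesis .
  qed simp
  have s: "contr G ?w \<in> chains G (Suc n)" by (rule C.contr_closed[OF w])
  have "hoch_b' G (Suc n) (contr G ?w) = ?w"
    using C.hoch_b'_contr[OF w] linear_map_zero[OF C.contr_linear] unfolding b'w by simp
  hence "hoch_b G (Suc n) (connecting n z) = ?w - cyc n ?w"
    using C.hoch_b_one_minus_cyc[OF s] by (simp add: connecting_def)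
  also have "\<dots> = 0" using cyc_cyc_norm[OF z0] by simp
  finally have "hoch_b G (Suc n) (connecting n z) = 0" .
  thus ?thesis using chains_diff[OF s cyc_closed[OF s]] by (simp add: HH_cycles_def connecting_def)
qed

text \<open>Multiplication by a class function also commutes with the contraction, because inserting a unit does
  not change the product of the factors. Hence it is compatible with the connecting map.\<close>

theorem acts_as_H_endo:
  assumes E: "acts_as G E m" and m: "m \<in> class_functions G"
  shows "H_endo G E"
proof -
  interpret f: precyclic G G "class_mult G m" by (rule class_mult_precyclic[OF m])
  let ?f = "class_mult G m"
  have E1: "fst E n (coset (HH_bdry G n) c) = coset (HH_bdry G n) (?f c)" if "c \<in> HH_cycles G n" for n c
    using E that by (simp add: acts_as_def)
  have E2: "snd E n (coset (HC_bdry G n) z) = coset (HC_bdry G n) (on_columns ?f z)" if "z \<in> HC_cycles G n" for n z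
    using E that by (simp add: acts_as_def)
  have f0: "?f 0 = 0" by (rule f.zero)
  show ?thesis unfolding H_endo_def
  proof (intro allI conjI ballI)
    fix n
    show "fst E n \<in> lin_maps (HH G n) (HH G n)" unfolding HH_quot
      by (rule lin_maps_quotI[OF C.HH_bdry_subspace C.HH_bdry_subspace C.HH_cycles_subspace, where f = ?f],
          erule E1, erule f.HH_cycles_map) (auto simp: class_mult_def fun_eq_iff algebra_simps)
    show "snd E n \<in> lin_maps (HC G n) (HC G n)" unfolding HC_quot
      by (rule lin_maps_quotI[OF C.HC_bdry_subspace C.HC_bdry_subspace C.HC_cycles_subspace, where f = "on_columns ?f"],
          erule E2, erule f.HC_cycles_map) (auto simp: f.on_columns_add f.on_columns_fscale HC_cycles_def)
  next
    fix n x assume "x \<in> carrier (HH G n)"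
    then obtain c where c: "c \<in> HH_cycles G n" "x = coset (HH_bdry G n) c" unfolding C.HH_carrier by blast
    have cc: "c \<in> chains G n" using c(1) by (simp add: HH_cycles_def)
    have "single_column 0 (?f c) = on_columns ?f (single_column 0 c)" by (rule column_eqI) (auto simp: f0)
    thus "map_I G n (fst E n x) = snd E n (map_I G n x)"
      unfolding c(2) by (simp add: E1[OF c(1)] map_I_coset[OF cc] map_I_coset[OF f.closed[OF cc]]
          E2[OF single_column_cycle[OF c(1)]])
  next
    fix n x assume "x \<in> carrier (HC G (n + 2))"
    then obtain z where z: "z \<in> HC_cycles G (n + 2)" "x = coset (HC_bdry G (n + 2)) z" unfolding C.HC_carrier by blast
    have zc: "z \<in> tot_chains G (n + 2)" using z(1) by (simp add: HC_cycles_def)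
    have "shift2 (on_columns ?f z) = on_columns ?f (shift2 z)" by (rule column_eqI) simp
    thus "map_S G n (snd E (n + 2) x) = snd E n (map_S G n x)"
      unfolding z(2) E2[OF z(1)] map_S_coset[OF zc] map_S_coset[OF f.on_columns_closed[OF zc]]
        E2[OF shift2_cycle[OF z(1)]] by simp
  next
    fix n x assume "x \<in> carrier (HC G n)"
    then obtain z where z: "z \<in> HC_cycles G n" "x = coset (HC_bdry G n) z" unfolding C.HC_carrier by blast
    have zc: "z \<in> tot_chains G n" using z(1) by (simp add: HC_cycles_def)
    have z0: "column z 0 \<in> chains G n" using column_chains[OF zc, of 0] by simp
    let ?s = "contr G (cyc_norm n (column z 0))"
    have s: "?s \<in> chains G (Suc n)" by (rule C.contr_closed[OF cyc_norm_closed[OF z0]])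
    have fs: "?f ?s = contr G (cyc_norm n (?f (column z 0)))"
      unfolding class_mult_contr[OF cyc_norm_closed[OF z0]] f.map_cyc_norm[OF z0] ..
    have "?f (connecting n z) = ?f ?s - ?f (cyc (Suc n) ?s)"
      unfolding connecting_def Suc_eq_plus1[symmetric] using s cyc_closed[OF s]
      by (intro linear_map_diff[OF f.linear]) (auto simp: chains_def)
    also have "\<dots> = connecting n (on_columns ?f z)"
      unfolding f.map_cyc[OF s] fs connecting_def by simp
    finally have "connecting n (on_columns ?f z) = ?f (connecting n z)" ..
    thus "map_B G n (snd E n x) = fst E (n + 1) (map_B G n x)"
      unfolding z(2) E2[OF z(1)] map_B_coset[OF zc] map_B_coset[OF f.on_columns_closed[OF zc]]
        E1[OF connecting_cycle[OF z(1)]] by simp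
  qed
qed

end

section \<open>Induction after restriction on homology\<close>

context transversal_iso begin

text \<open>The trace map on labelled tensors interpolates between \<open>i F r\<close>, formed with \<open>\<phi>\<close>, and the multiplication
  by the function that \<open>F\<close> induces on \<open>G\<close>. In particular the result does not depend on \<open>\<phi>\<close>.\<close>

theorem induction_restriction_acts_as:
  assumes F: "F \<in> class_functions GL" and off: "\<And>h. h \<in> carrier G \<Longrightarrow> h \<notin> L \<Longrightarrow> F h = 0"
    and m: "m \<in> class_functions G" and eq: "\<And>g. g \<in> carrier G \<Longrightarrow> m g = transfer_index F g"
  shows "acts_as G (H_ind G \<circ>\<^sub>H H_act GL F \<circ>\<^sub>H H_res G L \<phi>) m"
proof -
  interpret GL: group GL by (rule L_group)
  interpret r: precyclic_same_type G GL "trace_map G L \<phi>"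
    by (rule precyclic_same_type.intro[OF trace_map_precyclic])
  interpret a: precyclic_same_type GL GL "class_mult GL F"
    by (rule precyclic_same_type.intro[OF GL.class_mult_precyclic[OF F]])
  have incl: "precyclic_same_type GL G (\<lambda>c. c)"
  proof (rule precyclic_same_type.intro, rule precyclic_mapI[OF GL.left_unital_semigroup left_unital_semigroup])
    show "linear_map (tuples GL n) (tuples G n) (\<lambda>c. c)" for n
      by (rule linear_map_mono[OF linear_map_id subset_refl]) (use L.subset in \<open>auto simp: tuples_def\<close>)
  qed simp_all
  have inv_F: "F (l \<otimes> h \<otimes> inv l) = F h" if l: "l \<in> L" and h: "h \<in> carrier G" for l h
  proof (cases "h \<in> L")
    case True
    have "F (l \<otimes> h \<otimes> inv\<^bsub>GL\<^esub> l) = F h" using F l True by (simp add: class_functions_def)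
    thus ?thesis using m_inv_consistent[OF L.subgroup_axioms l] by simp
  next
    case False
    have lc: "l \<in> carrier G" using l by simp
    have "l \<otimes> h \<otimes> inv l \<notin> L"
    proof
      assume "l \<otimes> h \<otimes> inv l \<in> L"
      hence "inv l \<otimes> (l \<otimes> h \<otimes> inv l) \<otimes> l \<in> L"
        by (rule L.m_closed[OF L.m_closed[OF L.m_inv_closed[OF l]] l])
      moreover have "inv l \<otimes> (l \<otimes> h \<otimes> inv l) \<otimes> l = h"
      proof -
        have "inv l \<otimes> (l \<otimes> h \<otimes> inv l) \<otimes> l = inv l \<otimes> (l \<otimes> (h \<otimes> (inv l \<otimes> l)))" using lc h by (simp add: m_assoc)
        also have "\<dots> = h" using lc h by (simp add: m_assoc[symmetric])
        finally show ?thesis .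
      qed
      ultimately show False using False by simp
    qed
    thus ?thesis using off False lc h by simp
  qed
  define \<Phi> where "\<Phi> = rep_trace index_set labelled_entry (weight F)"
  interpret W: weighted_matrix_rep "labelled G" G index_set labelled_entry "weight F"
    by (rule labelled_entry_matrix_rep[OF inv_F])
  interpret P: precyclic "labelled G" G \<Phi> unfolding \<Phi>_def by (rule W.rep_trace_precyclic)
  have True': "\<Phi> (label True c) = class_mult GL F (trace_map G L \<phi> c)" if c: "c \<in> chains G n" for c n
    by (rule linear_map_eqI[OF linear_map_comp[OF P.linear precyclic.linear[OF label_precyclic]]
        linear_map_comp[OF a.linear r.linear] _ c[unfolded chains_def]])
      (simp add: \<Phi>_def rep_trace_def label_def trace_label_True class_mult_def)
  have False': "\<Phi> (label False c) = class_mult G m c" if c: "c \<in> chains G n" for c n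
  proof -
    have "\<Phi> (label False c) = class_mult G (transfer_index F) c"
      by (rule linear_map_eqI[OF linear_map_comp[OF P.linear precyclic.linear[OF label_precyclic]]
          class_mult_linear _ c[unfolded chains_def]])
        (simp add: \<Phi>_def rep_trace_def label_def trace_label_False[OF _ off] class_mult_def)
    thus ?thesis using class_mult_cong[OF c, of m "transfer_index F"] eq by simp
  qed
  show ?thesis unfolding acts_as_def
  proof (intro allI conjI ballI)
    fix n c assume c: "c \<in> HH_cycles G n"
    hence cc: "c \<in> chains G n" "hoch_b G n c = 0" by (auto simp: HH_cycles_def)
    have "fst (H_ind G \<circ>\<^sub>H H_act GL F \<circ>\<^sub>H H_res G L \<phi>) n (coset (HH_bdry G n) c) =
        coset (HH_bdry G n) (class_mult GL F (trace_map G L \<phi> c))"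
      unfolding H_comp_def H_ind_def H_act_eq H_res_def fst_conv o_apply
        r.H_induced_HH[OF cc(1)] a.H_induced_HH[OF r.closed[OF cc(1)]]
        precyclic_same_type.H_induced_HH[OF incl a.closed[OF r.closed[OF cc(1)]]] ..
    also have "\<dots> = coset (HH_bdry G n) (class_mult G m c)"
      unfolding True'[OF cc(1), symmetric] False'[OF cc(1), symmetric]
      by (rule coset_eqI[OF C.HH_bdry_subspace labels_homotopic_HH[OF P.precyclic_axioms cc]])
    finally show "fst (H_ind G \<circ>\<^sub>H H_act GL F \<circ>\<^sub>H H_res G L \<phi>) n (coset (HH_bdry G n) c) =
        coset (HH_bdry G n) (class_mult G m c)" .
  next
    fix n z assume z: "z \<in> HC_cycles G n"
    hence zc: "z \<in> tot_chains G n" "tot_d G n z = 0" by (auto simp: HC_cycles_def)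
    have "snd (H_ind G \<circ>\<^sub>H H_act GL F \<circ>\<^sub>H H_res G L \<phi>) n (coset (HC_bdry G n) z) =
        coset (HC_bdry G n) (on_columns (\<lambda>c. c) (on_columns (class_mult GL F) (on_columns (trace_map G L \<phi>) z)))"
      unfolding H_comp_def H_ind_def H_act_eq H_res_def snd_conv o_apply
        r.H_induced_HC[OF zc(1)] a.H_induced_HC[OF r.on_columns_closed[OF zc(1)]]
        precyclic_same_type.H_induced_HC[OF incl a.on_columns_closed[OF r.on_columns_closed[OF zc(1)]]] ..
    also have "on_columns (\<lambda>c. c) (on_columns (class_mult GL F) (on_columns (trace_map G L \<phi>) z)) =
        on_columns \<Phi> (on_columns (label True) z)"
    proof (rule column_eqI)
      fix p
      have "column z p \<in> chains G (n - p)" using zc(1) by (cases "p \<le> n") (auto simp: tot_chains_iff)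
      thus "column (on_columns (\<lambda>c. c) (on_columns (class_mult GL F) (on_columns (trace_map G L \<phi>) z))) p =
          column (on_columns \<Phi> (on_columns (label True) z)) p"
        using True' by simp
    qed
    also have "coset (HC_bdry G n) (on_columns \<Phi> (on_columns (label True) z)) =
        coset (HC_bdry G n) (on_columns \<Phi> (on_columns (label False) z))"
      by (rule coset_eqI[OF C.HC_bdry_subspace labels_homotopic_HC[OF P.precyclic_axioms zc]])
    also have "on_columns \<Phi> (on_columns (label False) z) = on_columns (class_mult G m) z"
    proof (rule column_eqI)
      fix p
      have "column z p \<in> chains G (n - p)" using zc(1) by (cases "p \<le> n") (auto simp: tot_chains_iff)
      thus "column (on_columns \<Phi> (on_columns (label False) z)) p = column (on_columns (class_mult G m) z) p"
        using False' by simp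
    qed
    finally show "snd (H_ind G \<circ>\<^sub>H H_act GL F \<circ>\<^sub>H H_res G L \<phi>) n (coset (HC_bdry G n) z) =
        coset (HC_bdry G n) (on_columns (class_mult G m) z)" .
  qed
qed

end

section \<open>Reflection groups\<close>

lemma pairing_add: "pairing (v + w) \<alpha> = pairing v \<alpha> + pairing w \<alpha>"
  and pairing_scaleR: "pairing (c *\<^sub>R v) \<alpha> = c * pairing v \<alpha>"
  and pairing_sum: "pairing (\<Sum>i\<in>A. f i) \<alpha> = (\<Sum>i\<in>A. pairing (f i) \<alpha>)"
  by (simp_all add: pairing_def inner_add_left inner_sum_left add_divide_distrib sum_distrib_left
      sum_divide_distrib distrib_left)

lemma reflection_linear: "linear (reflection \<alpha>)"
  by (rule linearI) (simp_all add: reflection_def pairing_add pairing_scaleR algebra_simps)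

lemma reflection_reflection: "\<alpha> \<noteq> 0 \<Longrightarrow> reflection \<alpha> (reflection \<alpha> v) = v"
  by (simp add: reflection_def pairing_def inner_diff_left algebra_simps diff_divide_distrib)

lemma reflection_isometry: "\<alpha> \<noteq> 0 \<Longrightarrow> reflection \<alpha> v \<bullet> reflection \<alpha> w = v \<bullet> w"
  by (simp add: reflection_def pairing_def inner_diff_left inner_diff_right inner_commute field_simps)

lemma reflection_self: "\<alpha> \<noteq> 0 \<Longrightarrow> reflection \<alpha> \<alpha> = - \<alpha>"
  by (simp add: reflection_def pairing_def scaleR_2)

lemma reflection_fixes: "v \<bullet> \<alpha> = 0 \<Longrightarrow> reflection \<alpha> v = v"
  by (simp add: reflection_def pairing_def)

lemma reflection_fixed_iff: "\<alpha> \<noteq> 0 \<Longrightarrow> reflection \<alpha> v = v \<longleftrightarrow> v \<bullet> \<alpha> = 0"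
  by (simp add: reflection_def pairing_def)

lemma reflection_conjugate:
  assumes "linear f" "\<And>x y. f x \<bullet> f y = x \<bullet> y"
  shows "f (reflection \<alpha> v) = reflection (f \<alpha>) (f v)"
  using assms by (simp add: reflection_def pairing_def linear_diff linear_scale)

lemma reflection_minus: "reflection (- \<alpha>) = reflection \<alpha>"
  by (simp add: reflection_def pairing_def fun_eq_iff)

definition refl_word :: "'a::euclidean_space list \<Rightarrow> 'a \<Rightarrow> 'a" where
  "refl_word \<alpha>s = foldr (\<lambda>\<alpha> f. reflection \<alpha> \<circ> f) \<alpha>s id"

lemma refl_word_Nil [simp]: "refl_word [] = id"
  and refl_word_Cons: "refl_word (\<alpha> # \<alpha>s) = reflection \<alpha> \<circ> refl_word \<alpha>s"
  by (simp_all add: refl_word_def)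

lemma refl_word_append: "refl_word (us @ ws) = refl_word us \<circ> refl_word ws"
  by (induction us) (simp_all add: refl_word_Cons comp_assoc)

lemma refl_word_linear: "linear (refl_word us)"
proof (induction us)
  case Nil
  show ?case by (rule linearI) simp_all
next
  case (Cons u us)
  thus ?case unfolding refl_word_Cons by (intro linear_compose reflection_linear)
qed

lemma refl_word_isometry: "0 \<notin> set us \<Longrightarrow> refl_word us x \<bullet> refl_word us y = x \<bullet> y"
  by (induction us) (auto simp: refl_word_Cons reflection_isometry)

lemma refl_word_rev: "0 \<notin> set us \<Longrightarrow> refl_word us \<circ> refl_word (rev us) = id"
proof (induction us)
  case (Cons u us)
  hence "refl_word us (refl_word (rev us) y) = y" for y by (simp add: fun_eq_iff)
  hence "refl_word (u # us) (refl_word (rev (u # us)) x) = x" for x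
    using Cons.prems by (simp add: refl_word_Cons refl_word_append reflection_reflection)
  thus ?case by (simp add: fun_eq_iff)
qed simp

lemma refl_word_bij: "0 \<notin> set us \<Longrightarrow> bij (refl_word us)"
  using refl_word_rev[of us] refl_word_rev[of "rev us"] by (intro o_bij) auto

lemma BijGroup_UNIV:
  "\<one>\<^bsub>BijGroup UNIV\<^esub> = id" "f \<in> carrier (BijGroup UNIV) \<longleftrightarrow> bij f"
  "bij f \<Longrightarrow> bij g \<Longrightarrow> f \<otimes>\<^bsub>BijGroup UNIV\<^esub> g = f \<circ> g"
  by (auto simp: BijGroup_def Bij_def compose_def fun_eq_iff)

text \<open>Reflections are involutions, so inverses of generators are generators.\<close>

lemma reflection_group_words:
  assumes "0 \<notin> S" shows "reflection_group S = {refl_word us | us. set us \<subseteq> S}"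
proof (intro equalityI subsetI)
  fix w assume "w \<in> reflection_group S"
  thus "w \<in> {refl_word us | us. set us \<subseteq> S}" unfolding reflection_group_def
  proof (induction rule: generate.induct)
    case one
    show ?case by (auto simp: BijGroup_UNIV intro!: exI[of _ "[]"])
  next
    case (incl h)
    then obtain \<alpha> where "\<alpha> \<in> S" "h = reflection \<alpha>" by blast
    thus ?case by (auto simp: refl_word_Cons intro!: exI[of _ "[\<alpha>]"])
  next
    case (inv h)
    then obtain \<alpha> where \<alpha>: "\<alpha> \<in> S" "h = refl_word [\<alpha>]" by (auto simp: refl_word_Cons)
    have b: "bij h" unfolding \<alpha> using \<alpha>(1) assms by (intro refl_word_bij) auto
    have "h \<circ> h = id" using refl_word_rev[of "[\<alpha>]"] \<alpha> assms by auto
    hence "inv\<^bsub>BijGroup UNIV\<^esub> h = h"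
      using b by (intro group.inv_equality[OF group_BijGroup]) (auto simp: BijGroup_UNIV)
    thus ?case using \<alpha> by (auto intro!: exI[of _ "[\<alpha>]"])
  next
    case (eng h1 h2)
    then obtain us ws where uw: "h1 = refl_word us" "set us \<subseteq> S" "h2 = refl_word ws" "set ws \<subseteq> S" by blast
    have "h1 \<otimes>\<^bsub>BijGroup UNIV\<^esub> h2 = refl_word (us @ ws)"
      unfolding uw refl_word_append using uw assms by (intro BijGroup_UNIV refl_word_bij) auto
    thus ?case using uw by (auto intro!: exI[of _ "us @ ws"])
  qed
next
  fix w assume "w \<in> {refl_word us | us. set us \<subseteq> S}"
  then obtain us where us: "w = refl_word us" "set us \<subseteq> S" by blast
  have "refl_word us \<in> generate (BijGroup UNIV) (reflection ` S)" using us(2)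
  proof (induction us)
    case Nil
    show ?case using generate.one[of "BijGroup UNIV" "reflection ` S"] unfolding BijGroup_UNIV(1) refl_word_Nil .
  next
    case (Cons u us)
    have "refl_word [u] \<otimes>\<^bsub>BijGroup UNIV\<^esub> refl_word us = refl_word [u] \<circ> refl_word us"
      using Cons.prems assms by (intro BijGroup_UNIV refl_word_bij) auto
    moreover have "refl_word [u] \<otimes>\<^bsub>BijGroup UNIV\<^esub> refl_word us \<in> generate (BijGroup UNIV) (reflection ` S)"
    proof (rule generate.eng)
      show "refl_word [u] \<in> generate (BijGroup UNIV) (reflection ` S)"
        using Cons.prems by (intro generate.incl) (auto simp: refl_word_Cons)
      show "refl_word us \<in> generate (BijGroup UNIV) (reflection ` S)" using Cons by simp
    qed
    moreover have "refl_word (u # us) = refl_word [u] \<circ> refl_word us"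
      using refl_word_append[of "[u]" us] by (simp only: append.simps)
    ultimately show ?case by (simp only:)
  qed
  thus "w \<in> reflection_group S" by (simp add: reflection_group_def us)
qed

section \<open>Weyl groups and the dominant chamber\<close>

locale based_root_system =
  fixes V R B :: "'a::euclidean_space set"
  assumes root_sys: "root_system V R" and basis: "root_basis V R B"
begin

abbreviation "W \<equiv> reflection_group"

lemma R_nonzero: "\<alpha> \<in> R \<Longrightarrow> \<alpha> \<noteq> 0"
  and finite_R: "finite R"
  and span_R: "span R = V"
  and reflection_R: "\<alpha> \<in> R \<Longrightarrow> \<beta> \<in> R \<Longrightarrow> reflection \<alpha> \<beta> \<in> R"
  and pairing_R: "\<alpha> \<in> R \<Longrightarrow> \<beta> \<in> R \<Longrightarrow> pairing \<beta> \<alpha> \<in> \<int>"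
  and reduced: "\<alpha> \<in> R \<Longrightarrow> c *\<^sub>R \<alpha> \<in> R \<Longrightarrow> c = 1 \<or> c = -1"
  using root_sys unfolding root_system_def by blast+

lemma B_sub: "B \<subseteq> R" and B_indep: "independent B" and span_B: "span B = V"
  using basis unfolding root_basis_def by blast+

lemma finite_B: "finite B"
  using B_sub finite_R finite_subset by blast

lemma zero_notin: "S \<subseteq> R \<Longrightarrow> 0 \<notin> S"
  using R_nonzero by blast

lemma W_wordE:
  assumes "w \<in> W S" "S \<subseteq> R" obtains us where "w = refl_word us" "set us \<subseteq> S" "0 \<notin> set us"
  using assms reflection_group_words[OF zero_notin[OF assms(2)]] zero_notin[OF assms(2)] by blast

lemma W_wordI: "set us \<subseteq> S \<Longrightarrow> S \<subseteq> R \<Longrightarrow> refl_word us \<in> W S"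
  using reflection_group_words[OF zero_notin] by blast

lemma W_mono: "S \<subseteq> T \<Longrightarrow> T \<subseteq> R \<Longrightarrow> w \<in> W S \<Longrightarrow> w \<in> W T"
proof -
  assume ST: "S \<subseteq> T" "T \<subseteq> R" and w: "w \<in> W S"
  obtain us where "w = refl_word us" "set us \<subseteq> S" by (rule W_wordE[OF w subset_trans[OF ST]])
  thus ?thesis using W_wordI[of us T] ST by auto
qed

lemma W_id: "S \<subseteq> R \<Longrightarrow> id \<in> W S"
  using W_wordI[of "[]" S] by simp

lemma W_reflection: "\<alpha> \<in> S \<Longrightarrow> S \<subseteq> R \<Longrightarrow> reflection \<alpha> \<in> W S"
  using W_wordI[of "[\<alpha>]" S] by (simp add: refl_word_Cons)

lemma W_comp:
  assumes S: "S \<subseteq> R" and "u \<in> W S" "w \<in> W S" shows "u \<circ> w \<in> W S"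
proof -
  obtain us ws where "u = refl_word us" "set us \<subseteq> S" "w = refl_word ws" "set ws \<subseteq> S"
    using assms by (metis W_wordE)
  thus ?thesis using W_wordI[of "us @ ws" S] S by (simp add: refl_word_append)
qed

lemma W_inv:
  assumes S: "S \<subseteq> R" and w: "w \<in> W S"
  obtains w' where "w' \<in> W S" "w \<circ> w' = id" "w' \<circ> w = id"
proof -
  obtain us where us: "w = refl_word us" "set us \<subseteq> S" "0 \<notin> set us" by (rule W_wordE[OF w S])
  show thesis
  proof (rule that)
    show "refl_word (rev us) \<in> W S" using us(2) S by (intro W_wordI) auto
    show "w \<circ> refl_word (rev us) = id" unfolding us(1) by (rule refl_word_rev[OF us(3)])
    have "0 \<notin> set (rev us)" using us(3) by simp
    thus "refl_word (rev us) \<circ> w = id" using refl_word_rev[of "rev us"] unfolding us(1) rev_rev_ident by blast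
  qed
qed

lemma W_linear: "S \<subseteq> R \<Longrightarrow> w \<in> W S \<Longrightarrow> linear w"
  by (erule W_wordE) (simp_all add: refl_word_linear)

lemma W_isometry: "S \<subseteq> R \<Longrightarrow> w \<in> W S \<Longrightarrow> w x \<bullet> w y = x \<bullet> y"
  by (erule W_wordE) (simp_all add: refl_word_isometry)

lemma W_R:
  assumes S: "S \<subseteq> R" and w: "w \<in> W S" and \<beta>: "\<beta> \<in> R" shows "w \<beta> \<in> R"
proof -
  obtain us where us: "w = refl_word us" "set us \<subseteq> S" by (rule W_wordE[OF w S])
  have "refl_word us \<beta> \<in> R" using us(2)
    by (induction us) (use S \<beta> reflection_R in \<open>auto simp: refl_word_Cons\<close>)
  thus ?thesis using us by simp
qed

lemma W_fixes:
  assumes S: "S \<subseteq> R" and w: "w \<in> W S" and v: "\<And>\<alpha>. \<alpha> \<in> S \<Longrightarrow> v \<bullet> \<alpha> = 0" shows "w v = v"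
proof -
  obtain us where us: "w = refl_word us" "set us \<subseteq> S" by (rule W_wordE[OF w S])
  have "refl_word us v = v" using us(2)
    by (induction us) (use v reflection_fixes in \<open>auto simp: refl_word_Cons\<close>)
  thus ?thesis using us by simp
qed

lemma W_fixed_iff:
  assumes S: "S \<subseteq> R" shows "(\<forall>w\<in>W S. w v = v) \<longleftrightarrow> (\<forall>\<alpha>\<in>S. v \<bullet> \<alpha> = 0)"
proof
  assume f: "\<forall>w\<in>W S. w v = v"
  show "\<forall>\<alpha>\<in>S. v \<bullet> \<alpha> = 0"
  proof
    fix \<alpha> assume \<alpha>: "\<alpha> \<in> S"
    hence "reflection \<alpha> v = v" using f W_reflection[OF \<alpha> S] by blast
    thus "v \<bullet> \<alpha> = 0" using reflection_fixed_iff[OF R_nonzero] \<alpha> S by blast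
  qed
qed (use W_fixes[OF S] in blast)

text \<open>An element of the Weyl group is determined by its action on the roots, since it is the identity
  on the orthogonal complement of their span.\<close>

lemma finite_W:
  assumes S: "S \<subseteq> R" shows "finite (W S)"
proof -
  have "inj_on (\<lambda>w. restrict w R) (W S)"
  proof (rule inj_onI)
    fix u w assume uw: "u \<in> W S" "w \<in> W S" and e: "restrict u R = restrict w R"
    have eq: "u \<beta> = w \<beta>" if "\<beta> \<in> R" for \<beta> using fun_cong[OF e, of \<beta>] that by simp
    show "u = w"
    proof
      fix x
      obtain y z where yz: "y \<in> span R" "\<And>v. v \<in> span R \<Longrightarrow> orthogonal z v" "x = y + z"
        using orthogonal_subspace_decomp_exists[of R x] by metis
      have z: "z \<bullet> \<alpha> = 0" if "\<alpha> \<in> S" for \<alpha>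
        using yz(2)[of \<alpha>] that S by (auto simp: orthogonal_def intro: span_base)
      have "u z = z" "w z = z" using W_fixes[OF S _ z] uw by blast+
      moreover have "u y = w y"
        by (rule linear_eq_on_span[OF W_linear[OF S uw(1)] W_linear[OF S uw(2)] eq yz(1)])
      ultimately show "u x = w x"
        using linear_add[OF W_linear[OF S uw(1)]] linear_add[OF W_linear[OF S uw(2)]] by (simp add: yz(3))
    qed
  qed
  moreover have "(\<lambda>w. restrict w R) ` W S \<subseteq> R \<rightarrow>\<^sub>E R" using W_R[OF S] by auto
  ultimately show ?thesis
    using finite_PiE[OF finite_R, of "\<lambda>_. R"] finite_R by (metis finite_imageD finite_subset)
qed

lemma W_funpow_card:
  assumes S: "S \<subseteq> R" and w: "w \<in> W S" shows "w ^^ card (W S) = id"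
proof -
  let ?G = "\<lparr>carrier = W S, monoid.mult = (\<circ>), one = id\<rparr>"
  interpret group ?G
  proof (rule groupI)
    fix x assume "x \<in> carrier ?G"
    then obtain y where "y \<in> W S" "y \<circ> x = id" using W_inv[OF S] by auto
    thus "\<exists>y\<in>carrier ?G. y \<otimes>\<^bsub>?G\<^esub> x = \<one>\<^bsub>?G\<^esub>" by auto
  qed (use W_comp[OF S] W_id[OF S] in \<open>auto simp: comp_assoc\<close>)
  have "w [^]\<^bsub>?G\<^esub> n = w ^^ n" for n :: nat
    by (induction n) (simp_all add: funpow_Suc_right del: funpow.simps(2))
  thus ?thesis using pow_order_eq_1[of w] w by (simp add: order_def)
qed

definition coef :: "'a \<Rightarrow> 'a \<Rightarrow> real" where
  "coef v \<gamma> = representation B v \<gamma>"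

lemma coef_expand: "v \<in> V \<Longrightarrow> v = (\<Sum>\<gamma>\<in>B. coef v \<gamma> *\<^sub>R \<gamma>)"
  unfolding coef_def using sum_representation_eq[OF B_indep _ finite_B, of v] span_B by simp

lemma coef_diff: "v \<in> V \<Longrightarrow> w \<in> V \<Longrightarrow> coef (v - w) \<gamma> = coef v \<gamma> - coef w \<gamma>"
  unfolding coef_def using representation_diff[OF B_indep] span_B by simp

lemma coef_minus: "v \<in> V \<Longrightarrow> coef (- v) \<gamma> = - coef v \<gamma>"
  unfolding coef_def using representation_neg[OF B_indep] span_B by simp

lemma coef_scale: "v \<in> V \<Longrightarrow> coef (c *\<^sub>R v) \<gamma> = c * coef v \<gamma>"
  unfolding coef_def using representation_scale[OF B_indep] span_B by simp

lemma coef_basis: "\<beta> \<in> B \<Longrightarrow> coef \<beta> \<gamma> = (if \<beta> = \<gamma> then 1 else 0)"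
  unfolding coef_def using representation_basis[OF B_indep] by auto

lemma R_in_V: "\<alpha> \<in> R \<Longrightarrow> \<alpha> \<in> V"
  using span_R span_base by blast

lemma coef_sum: 
  assumes "\<gamma> \<in> B" shows "coef (\<Sum>\<beta>\<in>B. k \<beta> *\<^sub>R \<beta>) \<gamma> = k \<gamma>"
proof -
  have b: "\<beta> \<in> span B" if "\<beta> \<in> B" for \<beta> using that by (rule span_base)
  have "coef (\<Sum>\<beta>\<in>B. k \<beta> *\<^sub>R \<beta>) \<gamma> = (\<Sum>\<beta>\<in>B. coef (k \<beta> *\<^sub>R \<beta>) \<gamma>)"
    unfolding coef_def by (subst representation_sum[OF B_indep]) (auto intro: span_scale b)
  also have "\<dots> = (\<Sum>\<beta>\<in>B. if \<beta> = \<gamma> then k \<beta> else 0)"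
    using R_in_V B_sub by (intro sum.cong) (auto simp: coef_scale coef_basis)
  finally show ?thesis using finite_B assms by (simp add: sum.delta)
qed

definition pos :: "'a \<Rightarrow> bool" where
  "pos \<beta> \<longleftrightarrow> \<beta> \<in> R \<and> (\<forall>\<gamma>\<in>B. coef \<beta> \<gamma> \<ge> 0)"

lemma root_coefs:
  assumes "\<beta> \<in> R"
  shows "\<gamma> \<in> B \<Longrightarrow> coef \<beta> \<gamma> \<in> \<int>" "(\<forall>\<gamma>\<in>B. coef \<beta> \<gamma> \<ge> 0) \<or> (\<forall>\<gamma>\<in>B. coef \<beta> \<gamma> \<le> 0)"
proof -
  obtain k :: "'a \<Rightarrow> int" where k: "\<beta> = (\<Sum>\<gamma>\<in>B. of_int (k \<gamma>) *\<^sub>R \<gamma>)"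
    "(\<forall>\<gamma>\<in>B. k \<gamma> \<ge> 0) \<or> (\<forall>\<gamma>\<in>B. k \<gamma> \<le> 0)"
    using basis assms unfolding root_basis_def by blast
  have c: "coef \<beta> \<gamma> = of_int (k \<gamma>)" if "\<gamma> \<in> B" for \<gamma> unfolding k(1) using that by (rule coef_sum)
  show "\<gamma> \<in> B \<Longrightarrow> coef \<beta> \<gamma> \<in> \<int>" by (simp add: c)
  show "(\<forall>\<gamma>\<in>B. coef \<beta> \<gamma> \<ge> 0) \<or> (\<forall>\<gamma>\<in>B. coef \<beta> \<gamma> \<le> 0)" using k(2) by (simp add: c)
qed

lemma neg_root: "\<beta> \<in> R \<Longrightarrow> - \<beta> \<in> R"
  using reflection_R[of \<beta> \<beta>] reflection_self[OF R_nonzero] by simp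

lemma pos_or_neg: "\<beta> \<in> R \<Longrightarrow> pos \<beta> \<or> pos (- \<beta>)"
  using root_coefs(2)[of \<beta>] neg_root[of \<beta>] R_in_V[of \<beta>] by (auto simp: pos_def coef_minus)

lemma pos_basis: "\<alpha> \<in> B \<Longrightarrow> pos \<alpha>"
  using B_sub by (auto simp: pos_def coef_basis)

text \<open>A simple reflection changes one coefficient only, and a positive root other than the simple root
  itself has another nonzero coefficient.\<close>

lemma simple_reflection_pos:
  assumes \<alpha>: "\<alpha> \<in> B" and \<beta>: "pos \<beta>" "\<beta> \<noteq> \<alpha>" shows "pos (reflection \<alpha> \<beta>)"
proof -
  have R: "\<alpha> \<in> R" "\<beta> \<in> R" using \<alpha> \<beta> B_sub by (auto simp: pos_def)
  have c: "coef (reflection \<alpha> \<beta>) \<gamma> = coef \<beta> \<gamma> - pairing \<beta> \<alpha> * (if \<alpha> = \<gamma> then 1 else 0)" for \<gamma>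
  proof -
    have "pairing \<beta> \<alpha> *\<^sub>R \<alpha> \<in> V" using R_in_V[OF R(1)] span_R span_scale by metis
    thus ?thesis unfolding reflection_def using R_in_V R
      by (simp add: coef_diff coef_scale coef_basis[OF \<alpha>])
  qed
  have "\<exists>\<gamma>\<in>B - {\<alpha>}. coef \<beta> \<gamma> > 0"
  proof (rule ccontr)
    assume "\<not> ?thesis"
    hence z: "coef \<beta> \<gamma> = 0" if "\<gamma> \<in> B - {\<alpha>}" for \<gamma> using \<beta> that by (force simp: pos_def)
    have "\<beta> = (\<Sum>\<gamma>\<in>B. coef \<beta> \<gamma> *\<^sub>R \<gamma>)" by (rule coef_expand[OF R_in_V[OF R(2)]])
    also have "\<dots> = coef \<beta> \<alpha> *\<^sub>R \<alpha>"
      using z by (subst sum.remove[OF finite_B \<alpha>]) (auto intro!: sum.neutral)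
    finally have e: "\<beta> = coef \<beta> \<alpha> *\<^sub>R \<alpha>" .
    hence "coef \<beta> \<alpha> = 1 \<or> coef \<beta> \<alpha> = -1" using reduced[OF R(1)] R(2) by metis
    moreover have "coef \<beta> \<alpha> \<ge> 0" using \<beta> \<alpha> by (simp add: pos_def)
    ultimately have "coef \<beta> \<alpha> = 1" by linarith
    thus False using e \<beta>(2) by simp
  qed
  then obtain \<gamma> where \<gamma>: "\<gamma> \<in> B" "\<gamma> \<noteq> \<alpha>" "coef \<beta> \<gamma> > 0" by blast
  have r: "reflection \<alpha> \<beta> \<in> R" using R by (simp add: reflection_R)
  have "coef (reflection \<alpha> \<beta>) \<gamma> > 0" using \<gamma> by (simp add: c)
  thus ?thesis using root_coefs(2)[OF r] r \<gamma>(1) by (force simp: pos_def)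
qed

lemma exchange:
  assumes "pos \<alpha>" "\<not> pos (refl_word us \<alpha>)" "set us \<subseteq> B"
  shows "\<exists>xs \<beta> ys. us = xs @ \<beta> # ys \<and> refl_word ys \<alpha> = \<beta>"
  using assms(2,3)
proof (induction us)
  case Nil
  thus ?case using assms(1) by simp
next
  case (Cons \<beta> us)
  show ?case
  proof (cases "pos (refl_word us \<alpha>)")
    case True
    have "refl_word us \<alpha> = \<beta>"
      using simple_reflection_pos[of \<beta> "refl_word us \<alpha>"] True Cons.prems by (auto simp: refl_word_Cons)
    thus ?thesis by blast
  next
    case False
    then obtain xs \<beta>' ys where "us = xs @ \<beta>' # ys" "refl_word ys \<alpha> = \<beta>'" using Cons by auto
    thus ?thesis by (intro exI[of _ "\<beta> # xs"]) auto
  qed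
qed

definition dominant :: "'a \<Rightarrow> bool" where
  "dominant v \<longleftrightarrow> (\<forall>\<alpha>\<in>B. v \<bullet> \<alpha> \<ge> 0)"

lemma dominant_pos: "dominant v \<Longrightarrow> pos \<beta> \<Longrightarrow> v \<bullet> \<beta> \<ge> 0"
proof -
  assume d: "dominant v" and p: "pos \<beta>"
  have "v \<bullet> \<beta> = (\<Sum>\<gamma>\<in>B. coef \<beta> \<gamma> * (v \<bullet> \<gamma>))"
    using coef_expand[of \<beta>] p R_in_V by (metis (no_types, lifting) inner_scaleR_right inner_sum_right pos_def sum.cong)
  also have "\<dots> \<ge> 0" using d p by (intro sum_nonneg) (auto simp: dominant_def pos_def)
  finally show ?thesis .
qed

text \<open>If the last letter of the word is sent to a negative root, it fixes \<open>v\<close> and can be dropped. If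
  not, the word is not reduced and can be shortened by the exchange condition.\<close>

lemma dominant_word:
  assumes "set us \<subseteq> B" "dominant v" "dominant (refl_word us v)"
  shows "refl_word us v = v \<and> refl_word us \<in> W {\<alpha>\<in>B. v \<bullet> \<alpha> = 0}"
  using assms(1,3)
proof (induction us rule: length_induct)
  case (1 us)
  let ?S = "{\<alpha>\<in>B. v \<bullet> \<alpha> = 0}"
  have S: "?S \<subseteq> R" using B_sub by auto
  show ?case
  proof (cases us rule: rev_cases)
    case Nil
    show ?thesis unfolding Nil refl_word_Nil by (intro conjI id_apply W_id[OF S])
  next
    case (snoc ws \<alpha>)
    have \<alpha>: "\<alpha> \<in> B" "\<alpha> \<in> R" and ws: "set ws \<subseteq> B" using 1 snoc B_sub by auto
    have nz: "0 \<notin> set us" using 1(2) B_sub zero_notin by blast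
    have w: "refl_word us = refl_word ws \<circ> reflection \<alpha>"
      by (simp add: snoc refl_word_append refl_word_Cons)
    have lin: "linear (refl_word ws)" by (rule refl_word_linear)
    have w\<alpha>: "refl_word us \<alpha> = - refl_word ws \<alpha>"
      using reflection_self[OF R_nonzero[OF \<alpha>(2)]] linear_neg[OF lin] by (simp add: w)
    have wR: "refl_word ws \<alpha> \<in> R" using W_R[OF B_sub W_wordI[OF ws B_sub] \<alpha>(2)] .
    show ?thesis
    proof (cases "pos (refl_word ws \<alpha>)")
      case True
      have "refl_word us v \<bullet> refl_word ws \<alpha> \<ge> 0" by (rule dominant_pos[OF 1(3) True])
      moreover have "refl_word us v \<bullet> refl_word us \<alpha> = v \<bullet> \<alpha>" by (rule refl_word_isometry[OF nz])
      moreover have "v \<bullet> \<alpha> \<ge> 0" using assms(2) \<alpha> by (simp add: dominant_def)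
      ultimately have z: "v \<bullet> \<alpha> = 0" by (simp add: w\<alpha>)
      have f: "refl_word us v = refl_word ws v" using reflection_fixes[OF z] by (simp add: w)
      have IH: "refl_word ws v = v \<and> refl_word ws \<in> W ?S" using 1 snoc ws f by simp
      have "reflection \<alpha> \<in> W ?S" using z \<alpha> by (intro W_reflection[OF _ S]) auto
      hence "refl_word us \<in> W ?S" unfolding w using IH by (intro W_comp[OF S]) auto
      thus ?thesis using f IH by metis
    next
      case False
      then obtain xs \<beta> ys where xy: "ws = xs @ \<beta> # ys" "refl_word ys \<alpha> = \<beta>"
        using exchange[OF pos_basis[OF \<alpha>(1)] _ ws] by blast
      have nz': "0 \<notin> set ys" using nz snoc xy by auto
      have "reflection \<beta> (refl_word ys (reflection \<alpha> x)) = refl_word ys x" for x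
      proof -
        have "refl_word ys (reflection \<alpha> x) = reflection \<beta> (refl_word ys x)"
          using reflection_conjugate[OF refl_word_linear refl_word_isometry[OF nz'], of \<alpha> x] by (simp add: xy(2))
        moreover have "\<beta> \<noteq> 0" using ws xy B_sub R_nonzero by auto
        ultimately show ?thesis by (simp add: reflection_reflection)
      qed
      hence "refl_word us = refl_word (xs @ ys)"
        by (simp add: w xy(1) refl_word_append refl_word_Cons fun_eq_iff)
      moreover have "length (xs @ ys) < length us" "set (xs @ ys) \<subseteq> B" using 1(2) snoc xy by auto
      ultimately show ?thesis using 1 by metis
    qed
  qed
qed

text \<open>By induction on the height: a positive root that is not simple has positive inner product with some
  simple root, and the corresponding reflection lowers its height.\<close>

lemma root_conjugate_simple:
  assumes "pos \<beta>" shows "\<exists>w\<in>W B. \<exists>\<gamma>\<in>B. w \<gamma> = \<beta>"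
  using assms
proof (induction "nat \<lfloor>\<Sum>\<gamma>\<in>B. coef \<beta> \<gamma>\<rfloor>" arbitrary: \<beta> rule: less_induct)
  case less
  show ?case
  proof (cases "\<beta> \<in> B")
    case True
    thus ?thesis by (intro bexI[of _ id] bexI[of _ \<beta>] id_apply W_id[OF B_sub])
  next
    case False
    have \<beta>: "\<beta> \<in> R" "\<beta> \<in> V" using less.prems R_in_V by (auto simp: pos_def)
    have "\<exists>\<alpha>\<in>B. \<beta> \<bullet> \<alpha> > 0"
    proof (rule ccontr)
      assume n: "\<not> ?thesis"
      have "\<beta> \<bullet> \<beta> = \<beta> \<bullet> (\<Sum>\<gamma>\<in>B. coef \<beta> \<gamma> *\<^sub>R \<gamma>)" using coef_expand[OF \<beta>(2)] by simp
      also have "\<dots> = (\<Sum>\<gamma>\<in>B. coef \<beta> \<gamma> * (\<beta> \<bullet> \<gamma>))" by (simp add: inner_sum_right)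
      also have "\<dots> \<le> 0" using n less.prems
        by (intro sum_nonpos mult_nonneg_nonpos) (auto simp: pos_def not_less)
      finally show False using R_nonzero[OF \<beta>(1)] inner_gt_zero_iff[of \<beta>] by linarith
    qed
    then obtain \<alpha> where \<alpha>: "\<alpha> \<in> B" "\<beta> \<bullet> \<alpha> > 0" by blast
    have \<alpha>R: "\<alpha> \<in> R" using \<alpha> B_sub by auto
    let ?\<beta> = "reflection \<alpha> \<beta>"
    have p: "pos ?\<beta>" using simple_reflection_pos[OF \<alpha>(1) less.prems] False \<alpha> by auto
    have pair: "pairing \<beta> \<alpha> > 0" using \<alpha> R_nonzero[OF \<alpha>R] by (simp add: pairing_def)
    have ht: "(\<Sum>\<gamma>\<in>B. coef ?\<beta> \<gamma>) = (\<Sum>\<gamma>\<in>B. coef \<beta> \<gamma>) - pairing \<beta> \<alpha>"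
    proof -
      have "coef ?\<beta> \<gamma> = coef \<beta> \<gamma> - (if \<alpha> = \<gamma> then pairing \<beta> \<alpha> else 0)" for \<gamma>
      proof -
        have "pairing \<beta> \<alpha> *\<^sub>R \<alpha> \<in> V" using R_in_V[OF \<alpha>R] span_R span_scale by metis
        thus ?thesis unfolding reflection_def using \<beta> R_in_V[OF \<alpha>R]
          by (simp add: coef_diff coef_scale coef_basis[OF \<alpha>(1)])
      qed
      thus ?thesis using finite_B \<alpha>(1) by (simp add: sum_subtractf sum.delta')
    qed
    have int: "(\<Sum>\<gamma>\<in>B. coef \<beta> \<gamma>) \<in> \<int>" "pairing \<beta> \<alpha> \<in> \<int>"
      using root_coefs(1)[OF \<beta>(1)] pairing_R[OF \<alpha>R \<beta>(1)] by (auto intro: Ints_sum)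
    then obtain m k :: int where mk: "(\<Sum>\<gamma>\<in>B. coef \<beta> \<gamma>) = of_int m" "pairing \<beta> \<alpha> = of_int k"
      by (meson Ints_cases)
    have "(\<Sum>\<gamma>\<in>B. coef ?\<beta> \<gamma>) \<ge> 0" using p by (intro sum_nonneg) (auto simp: pos_def)
    hence "m - k \<ge> 0" "k > 0" using mk ht pair by (simp_all flip: of_int_diff)
    hence "nat \<lfloor>\<Sum>\<gamma>\<in>B. coef ?\<beta> \<gamma>\<rfloor> < nat \<lfloor>\<Sum>\<gamma>\<in>B. coef \<beta> \<gamma>\<rfloor>"
      unfolding ht mk by (simp flip: of_int_diff)
    from less.hyps[OF this p] obtain w \<gamma> where w: "w \<in> W B" "\<gamma> \<in> B" "w \<gamma> = ?\<beta>" by blast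
    have "(reflection \<alpha> \<circ> w) \<gamma> = \<beta>" using w reflection_reflection[OF R_nonzero[OF \<alpha>R]] by simp
    thus ?thesis using W_comp[OF B_sub W_reflection[OF \<alpha>(1) B_sub] w(1)] w(2) by blast
  qed
qed

lemma W_R_eq_W_B: "W R = W B"
proof
  have refl: "reflection \<beta> \<in> W B" if \<beta>: "pos \<beta>" for \<beta>
  proof -
    obtain w \<gamma> where w: "w \<in> W B" "\<gamma> \<in> B" "w \<gamma> = \<beta>" using root_conjugate_simple[OF \<beta>] by blast
    obtain w' where w': "w' \<in> W B" "w \<circ> w' = id" "w' \<circ> w = id" by (rule W_inv[OF B_sub w(1)])
    have "reflection \<beta> v = (w \<circ> reflection \<gamma> \<circ> w') v" for v
      using reflection_conjugate[OF W_linear[OF B_sub w(1)] W_isometry[OF B_sub w(1)], of \<gamma> "w' v"]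
        fun_cong[OF w'(2), of v] by (simp add: w(3))
    hence "reflection \<beta> = w \<circ> reflection \<gamma> \<circ> w'" by (rule ext)
    thus ?thesis using w w' by (auto intro!: W_comp[OF B_sub] W_reflection[OF _ B_sub])
  qed
  have "refl_word us \<in> W B" if "set us \<subseteq> R" for us
    using that
  proof (induction us)
    case Nil
    show ?case unfolding refl_word_Nil by (rule W_id[OF B_sub])
  next
    case (Cons \<beta> us)
    have "reflection \<beta> \<in> W B"
      using pos_or_neg[of \<beta>] refl[of \<beta>] refl[of "- \<beta>"] Cons.prems by (auto simp: reflection_minus)
    thus ?case unfolding refl_word_Cons using Cons by (intro W_comp[OF B_sub]) auto
  qed
  thus "W R \<subseteq> W B" by (auto elim!: W_wordE[OF _ subset_refl])
  show "W B \<subseteq> W R" using W_mono[OF B_sub subset_refl] by blast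
qed

theorem dominant_unique:
  assumes "w \<in> W R" "dominant v" "dominant (w v)"
  shows "w v = v" "w \<in> W {\<alpha>\<in>B. v \<bullet> \<alpha> = 0}"
proof -
  have "w \<in> W B" using assms(1) W_R_eq_W_B by simp
  then obtain us where us: "w = refl_word us" "set us \<subseteq> B" by (rule W_wordE[OF _ B_sub])
  show "w v = v" "w \<in> W {\<alpha>\<in>B. v \<bullet> \<alpha> = 0}"
    using dominant_word[OF us(2) assms(2)] assms(3) us(1) by auto
qed

text \<open>A point of the orbit is dominant if it maximizes the inner product with a vector \<open>\<rho>\<close> that has
  inner product 1 with every simple root, since the reflection in \<open>\<alpha>\<close> subtracts \<open>\<langle>v, \<alpha>\<rangle>\<close> from this inner product.\<close>

theorem dominant_exists: "\<exists>w\<in>W R. dominant (w v)"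
proof -
  obtain f :: "'a \<Rightarrow> real" where f: "linear f" "\<And>\<alpha>. \<alpha> \<in> B \<Longrightarrow> f \<alpha> = 1"
    using linear_independent_extend[OF B_indep, of "\<lambda>_. 1"] by auto
  define \<rho> where "\<rho> = adjoint f 1"
  have \<rho>: "x \<bullet> \<rho> = f x" for x unfolding \<rho>_def using adjoint_works[OF f(1), of x 1] by simp
  have ne: "(\<lambda>w. w v \<bullet> \<rho>) ` W R \<noteq> {}" using W_id[of R] by auto
  have fin: "finite ((\<lambda>w. w v \<bullet> \<rho>) ` W R)" using finite_W[of R] by simp
  obtain w where w: "w \<in> W R" "w v \<bullet> \<rho> = Max ((\<lambda>w. w v \<bullet> \<rho>) ` W R)"
    using Max_in[OF fin ne] by auto
  have "w v \<bullet> \<alpha> \<ge> 0" if \<alpha>: "\<alpha> \<in> B" for \<alpha>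
  proof -
    have \<alpha>R: "\<alpha> \<in> R" using \<alpha> B_sub by auto
    have "reflection \<alpha> \<circ> w \<in> W R" using W_comp[OF subset_refl W_reflection[OF \<alpha>R subset_refl] w(1)] .
    hence "reflection \<alpha> (w v) \<bullet> \<rho> \<le> w v \<bullet> \<rho>"
      unfolding w(2) using Max_ge[OF fin, of "reflection \<alpha> (w v) \<bullet> \<rho>"] by (force simp: image_iff)
    hence "pairing (w v) \<alpha> \<ge> 0" using f(2)[OF \<alpha>] by (simp add: reflection_def \<rho> linear_diff[OF f(1)] linear_scale[OF f(1)])
    moreover have "\<alpha> \<bullet> \<alpha> > 0" using R_nonzero[OF \<alpha>R] by simp
    ultimately show ?thesis by (auto simp: pairing_def zero_le_divide_iff)
  qed
  thus ?thesis using w(1) by (auto simp: dominant_def)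
qed

end

section \<open>The affine Weyl group\<close>

lemma (in group) pow_conjugate:
  assumes "x \<in> carrier G" "g \<in> carrier G"
  shows "(x \<otimes> g \<otimes> inv x) [^] (n :: nat) = x \<otimes> g [^] n \<otimes> inv x"
proof (induction n)
  case (Suc n)
  have "x \<otimes> g [^] n \<otimes> inv x \<otimes> (x \<otimes> g \<otimes> inv x) = x \<otimes> g [^] n \<otimes> (inv x \<otimes> x) \<otimes> g \<otimes> inv x"
    using assms by (simp only: m_assoc m_closed inv_closed nat_pow_closed)
  thus ?case using Suc assms by (simp add: m_assoc)
qed (use assms in simp)

context based_root_system begin

abbreviation "\<Lambda> \<equiv> root_lattice R"
abbreviation "G \<equiv> affine_weyl R"

lemma lattice_zero: "0 \<in> \<Lambda>"
  unfolding root_lattice_def by (auto intro!: exI[of _ "\<lambda>_. 0"])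

lemma lattice_add: "l \<in> \<Lambda> \<Longrightarrow> l' \<in> \<Lambda> \<Longrightarrow> l + l' \<in> \<Lambda>"
proof -
  assume "l \<in> \<Lambda>" "l' \<in> \<Lambda>"
  then obtain k k' :: "'a \<Rightarrow> int" where "l = (\<Sum>\<alpha>\<in>R. of_int (k \<alpha>) *\<^sub>R \<alpha>)" "l' = (\<Sum>\<alpha>\<in>R. of_int (k' \<alpha>) *\<^sub>R \<alpha>)"
    unfolding root_lattice_def by blast
  hence "l + l' = (\<Sum>\<alpha>\<in>R. of_int (k \<alpha> + k' \<alpha>) *\<^sub>R \<alpha>)" by (simp add: scaleR_add_left sum.distrib)
  thus ?thesis unfolding root_lattice_def by (intro CollectI exI[of _ "\<lambda>\<alpha>. k \<alpha> + k' \<alpha>"]) simp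
qed

lemma lattice_scale_int: "l \<in> \<Lambda> \<Longrightarrow> of_int m *\<^sub>R l \<in> \<Lambda>"
proof -
  assume "l \<in> \<Lambda>"
  then obtain k :: "'a \<Rightarrow> int" where "l = (\<Sum>\<alpha>\<in>R. of_int (k \<alpha>) *\<^sub>R \<alpha>)"
    unfolding root_lattice_def by blast
  hence "of_int m *\<^sub>R l = (\<Sum>\<alpha>\<in>R. of_int (m * k \<alpha>) *\<^sub>R \<alpha>)" by (simp add: scaleR_sum_right)
  thus ?thesis unfolding root_lattice_def by (intro CollectI exI[of _ "\<lambda>\<alpha>. m * k \<alpha>"]) simp
qed

lemma lattice_minus: "l \<in> \<Lambda> \<Longrightarrow> - l \<in> \<Lambda>"
  using lattice_scale_int[of l "-1"] by simp

lemma lattice_sum: "(\<And>i. i \<in> A \<Longrightarrow> f i \<in> \<Lambda>) \<Longrightarrow> (\<Sum>i\<in>A. f i) \<in> \<Lambda>"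
  by (induction A rule: infinite_finite_induct) (auto simp: lattice_zero lattice_add)

lemma lattice_root: "\<alpha> \<in> R \<Longrightarrow> \<alpha> \<in> \<Lambda>"
proof -
  assume \<alpha>: "\<alpha> \<in> R"
  have "(\<Sum>\<beta>\<in>R. of_int (if \<beta> = \<alpha> then 1 else 0) *\<^sub>R \<beta>) = (\<Sum>\<beta>\<in>R. if \<beta> = \<alpha> then \<alpha> else 0)"
    by (intro sum.cong) auto
  also have "\<dots> = \<alpha>" using \<alpha> finite_R by (simp add: sum.delta)
  finally show ?thesis unfolding root_lattice_def
    by (intro CollectI exI[of _ "\<lambda>\<beta>. if \<beta> = \<alpha> then 1 else 0"]) simp
qed

lemma lattice_pairing: "l \<in> \<Lambda> \<Longrightarrow> \<alpha> \<in> R \<Longrightarrow> pairing l \<alpha> \<in> \<int>"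
proof -
  assume "l \<in> \<Lambda>" and \<alpha>: "\<alpha> \<in> R"
  then obtain k :: "'a \<Rightarrow> int" where "l = (\<Sum>\<beta>\<in>R. of_int (k \<beta>) *\<^sub>R \<beta>)"
    unfolding root_lattice_def by blast
  hence "pairing l \<alpha> = (\<Sum>\<beta>\<in>R. of_int (k \<beta>) * pairing \<beta> \<alpha>)" by (simp add: pairing_sum pairing_scaleR)
  also have "\<dots> \<in> \<int>" using pairing_R[OF \<alpha>] by (intro Ints_sum Ints_mult) auto
  finally show ?thesis .
qed

lemma lattice_W:
  assumes S: "S \<subseteq> R" and w: "w \<in> W S" and l: "l \<in> \<Lambda>" shows "w l \<in> \<Lambda>"
proof -
  have refl: "reflection \<alpha> l' \<in> \<Lambda>" if \<alpha>: "\<alpha> \<in> R" and l': "l' \<in> \<Lambda>" for \<alpha> l'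
  proof -
    obtain k :: int where k: "pairing l' \<alpha> = of_int k" using lattice_pairing[OF l' \<alpha>] by (rule Ints_cases)
    have "reflection \<alpha> l' = l' + of_int (- k) *\<^sub>R \<alpha>" by (simp add: reflection_def k)
    thus ?thesis using lattice_add[OF l' lattice_scale_int[OF lattice_root[OF \<alpha>], of "- k"]] by simp
  qed
  obtain us where us: "w = refl_word us" "set us \<subseteq> S" by (rule W_wordE[OF w S])
  have "refl_word us l \<in> \<Lambda>" using us(2)
    by (induction us) (use refl l S in \<open>auto simp: refl_word_Cons\<close>)
  thus ?thesis using us by simp
qed

lemma W_zero: "S \<subseteq> R \<Longrightarrow> w \<in> W S \<Longrightarrow> w 0 = 0"
  using linear_0[OF W_linear] .

lemma affine_simps:
  "carrier G = \<Lambda> \<times> W R" "\<one>\<^bsub>G\<^esub> = (0, id)" "(l, w) \<otimes>\<^bsub>G\<^esub> (l', w') = (l + w l', w \<circ> w')"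
  by (simp_all add: affine_weyl_def)

lemma snd_mult: "snd (x \<otimes>\<^bsub>G\<^esub> y) = snd x \<circ> snd y"
  by (simp add: affine_weyl_def case_prod_beta)

lemma affine_group: "group G"
proof (rule groupI)
  fix x y z assume "x \<in> carrier G" "y \<in> carrier G" "z \<in> carrier G"
  then obtain l w l' w' l'' w'' where x: "x = (l, w)" "y = (l', w')" "z = (l'', w'')"
    and m: "l \<in> \<Lambda>" "w \<in> W R" "l' \<in> \<Lambda>" "w' \<in> W R" "l'' \<in> \<Lambda>" "w'' \<in> W R"
    unfolding affine_simps by blast
  show "x \<otimes>\<^bsub>G\<^esub> y \<in> carrier G"
    unfolding x affine_simps using m lattice_add[OF m(1) lattice_W[OF subset_refl m(2,3)]] W_comp[OF subset_refl m(2,4)]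
    by blast
  show "x \<otimes>\<^bsub>G\<^esub> y \<otimes>\<^bsub>G\<^esub> z = x \<otimes>\<^bsub>G\<^esub> (y \<otimes>\<^bsub>G\<^esub> z)"
    unfolding x affine_simps using linear_add[OF W_linear[OF subset_refl m(2)]] by (simp add: comp_assoc add.assoc)
  show "\<one>\<^bsub>G\<^esub> \<otimes>\<^bsub>G\<^esub> x = x" unfolding x affine_simps by simp
  obtain u where u: "u \<in> W R" "w \<circ> u = id" "u \<circ> w = id" by (rule W_inv[OF subset_refl m(2)])
  have "(- u l, u) \<otimes>\<^bsub>G\<^esub> x = \<one>\<^bsub>G\<^esub>" unfolding x affine_simps u(3) by simp
  moreover have "(- u l, u) \<in> carrier G"
    unfolding affine_simps using lattice_minus[OF lattice_W[OF subset_refl u(1) m(1)]] u(1) by simp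
  ultimately show "\<exists>y\<in>carrier G. y \<otimes>\<^bsub>G\<^esub> x = \<one>\<^bsub>G\<^esub>" by blast
qed (use lattice_zero W_id[OF subset_refl] in \<open>simp only: affine_simps mem_Times_iff fst_conv snd_conv\<close>)

end

sublocale based_root_system \<subseteq> A: group "affine_weyl R"
  by (rule affine_group)

context based_root_system begin

lemma affine_inv:
  assumes "l \<in> \<Lambda>" "w \<in> W R" "u \<in> W R" "u \<circ> w = id"
  shows "inv\<^bsub>G\<^esub> (l, w) = (- u l, u)"
proof (rule A.inv_equality)
  show "(- u l, u) \<otimes>\<^bsub>G\<^esub> (l, w) = \<one>\<^bsub>G\<^esub>" unfolding affine_simps assms(4) by simp
  show "(l, w) \<in> carrier G" "(- u l, u) \<in> carrier G"
    unfolding affine_simps using assms lattice_minus[OF lattice_W[OF subset_refl assms(3,1)]] by simp_all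
qed

lemma parabolic_subgroup:
  assumes S: "S \<subseteq> R" shows "subgroup (parabolic R S) G"
proof (rule A.subgroupI)
  show "parabolic R S \<subseteq> carrier G"
    unfolding parabolic_def affine_simps using W_mono[OF S subset_refl] by blast
  show "parabolic R S \<noteq> {}" unfolding parabolic_def using lattice_zero W_id[OF S] by blast
next
  fix x assume "x \<in> parabolic R S"
  then obtain l w where x: "x = (l, w)" "l \<in> \<Lambda>" "w \<in> W S" unfolding parabolic_def by blast
  obtain u where u: "u \<in> W S" "w \<circ> u = id" "u \<circ> w = id" by (rule W_inv[OF S x(3)])
  have "inv\<^bsub>G\<^esub> x = (- u l, u)"
    unfolding x(1) using x u W_mono[OF S subset_refl] by (intro affine_inv) auto
  thus "inv\<^bsub>G\<^esub> x \<in> parabolic R S"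
    using lattice_minus[OF lattice_W[OF S u(1) x(2)]] u(1) by (simp add: parabolic_def)
next
  fix x y assume "x \<in> parabolic R S" "y \<in> parabolic R S"
  then obtain l w l' w' where x: "x = (l, w)" "y = (l', w')"
    and m: "l \<in> \<Lambda>" "w \<in> W S" "l' \<in> \<Lambda>" "w' \<in> W S"
    unfolding parabolic_def by blast
  show "x \<otimes>\<^bsub>G\<^esub> y \<in> parabolic R S"
    unfolding x affine_simps parabolic_def
    using lattice_add[OF m(1) lattice_W[OF S m(2,3)]] W_comp[OF S m(2,4)] by blast
qed

lemma snd_pow: "snd (g [^]\<^bsub>G\<^esub> (n :: nat)) = snd g ^^ n"
proof (induction n)
  case 0
  show ?case by (simp only: nat_pow_0 affine_simps snd_conv funpow.simps)
next
  case (Suc n)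
  have "snd (g [^]\<^bsub>G\<^esub> Suc n) = snd (g [^]\<^bsub>G\<^esub> n) \<circ> snd g"
    using snd_mult[of "g [^]\<^bsub>G\<^esub> n" g] by (simp only: A.nat_pow_Suc)
  thus ?case unfolding Suc funpow_Suc_right .
qed

lemma translation_pow: "(\<mu>, u) [^]\<^bsub>G\<^esub> (n :: nat) = (real n *\<^sub>R \<mu>, u ^^ n)" if "u \<mu> = \<mu>"
proof (induction n)
  case 0
  show ?case unfolding nat_pow_0 affine_simps by (simp only: funpow.simps scaleR_zero_left of_nat_0)
next
  case (Suc n)
  have "(u ^^ n) \<mu> = \<mu>" by (induction n) (simp_all add: that)
  hence e: "real n *\<^sub>R \<mu> + (u ^^ n) \<mu> = real (Suc n) *\<^sub>R \<mu>" by (simp add: algebra_simps)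
  show ?case unfolding A.nat_pow_Suc Suc affine_simps funpow_Suc_right e ..
qed

abbreviation "N \<equiv> card (W R)"

lemma N_pos: "N > 0"
  using finite_W[of R] W_id[of R] by (auto simp: card_gt_0_iff)

lemma card_W_pos: "S \<subseteq> R \<Longrightarrow> card (W S) > 0"
  using finite_W[of S] W_id[of S] by (auto simp: card_gt_0_iff)

text \<open>The Newton point of \<open>g\<close> is the translation vector of a power of \<open>g\<close> that is a translation, divided
  by the exponent.\<close>

definition newton :: "'a \<times> ('a \<Rightarrow> 'a) \<Rightarrow> 'a" where
  "newton g = (1 / real N) *\<^sub>R fst (g [^]\<^bsub>G\<^esub> N)"

lemma pow_newton: "g \<in> carrier G \<Longrightarrow> g [^]\<^bsub>G\<^esub> N = (real N *\<^sub>R newton g, id)"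
proof -
  assume g: "g \<in> carrier G"
  have "snd (g [^]\<^bsub>G\<^esub> N) = id"
    unfolding snd_pow using g by (intro W_funpow_card) (auto simp: affine_simps)
  moreover have "real N *\<^sub>R newton g = fst (g [^]\<^bsub>G\<^esub> N)" using N_pos by (simp add: newton_def)
  ultimately show ?thesis by (simp only: prod_eq_iff fst_conv snd_conv)
qed

lemma newton_lattice: "g \<in> carrier G \<Longrightarrow> real N *\<^sub>R newton g \<in> \<Lambda>"
  using A.nat_pow_closed[of g N] pow_newton[of g] by (simp add: affine_simps)

lemma newton_fixed: "g \<in> carrier G \<Longrightarrow> snd g (newton g) = newton g"
proof -
  assume g: "g \<in> carrier G"
  obtain l w where lw: "g = (l, w)" "w \<in> W R" using g unfolding affine_simps by blast
  have "g \<otimes>\<^bsub>G\<^esub> g [^]\<^bsub>G\<^esub> N = g [^]\<^bsub>G\<^esub> N \<otimes>\<^bsub>G\<^esub> g"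
    using A.nat_pow_Suc2[OF g, of N] by (simp only: A.nat_pow_Suc)
  hence "l + w (real N *\<^sub>R newton g) = real N *\<^sub>R newton g + l"
    unfolding pow_newton[OF g] unfolding lw affine_simps by simp
  hence "real N *\<^sub>R w (newton g) = real N *\<^sub>R newton g"
    using linear_scale[OF W_linear[OF subset_refl lw(2)]] by simp
  thus ?thesis using N_pos lw by simp
qed

lemma newton_conjugate:
  assumes x: "x \<in> carrier G" and g: "g \<in> carrier G"
  shows "newton (x \<otimes>\<^bsub>G\<^esub> g \<otimes>\<^bsub>G\<^esub> inv\<^bsub>G\<^esub> x) = snd x (newton g)"
proof -
  obtain l u where lu: "x = (l, u)" "l \<in> \<Lambda>" "u \<in> W R" using x unfolding affine_simps by blast
  obtain u' where u': "u' \<in> W R" "u \<circ> u' = id" "u' \<circ> u = id" by (rule W_inv[OF subset_refl lu(3)])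
  note lin = W_linear[OF subset_refl lu(3)]
  have uu: "u (u' l) = l" using fun_cong[OF u'(2), of l] by simp
  have i: "inv\<^bsub>G\<^esub> x = (- u' l, u')" unfolding lu(1) by (rule affine_inv[OF lu(2,3) u'(1,3)])
  have c: "x \<otimes>\<^bsub>G\<^esub> g \<otimes>\<^bsub>G\<^esub> inv\<^bsub>G\<^esub> x \<in> carrier G" using x g by simp
  have "(x \<otimes>\<^bsub>G\<^esub> g \<otimes>\<^bsub>G\<^esub> inv\<^bsub>G\<^esub> x) [^]\<^bsub>G\<^esub> N = x \<otimes>\<^bsub>G\<^esub> (real N *\<^sub>R newton g, id) \<otimes>\<^bsub>G\<^esub> inv\<^bsub>G\<^esub> x"
    unfolding A.pow_conjugate[OF x g] pow_newton[OF g] ..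
  hence "fst ((x \<otimes>\<^bsub>G\<^esub> g \<otimes>\<^bsub>G\<^esub> inv\<^bsub>G\<^esub> x) [^]\<^bsub>G\<^esub> N) = u (real N *\<^sub>R newton g)"
    unfolding i unfolding lu(1) affine_simps using linear_neg[OF lin] uu by simp
  thus ?thesis unfolding newton_def[of "x \<otimes>\<^bsub>G\<^esub> g \<otimes>\<^bsub>G\<^esub> inv\<^bsub>G\<^esub> x"]
    using linear_scale[OF lin] N_pos by (simp add: lu(1))
qed

section \<open>Parabolic subgroups\<close>

lemma parabolic_carrier: "S \<subseteq> R \<Longrightarrow> g \<in> parabolic R S \<Longrightarrow> g \<in> carrier G"
  using subgroup.mem_carrier[OF parabolic_subgroup] .

text \<open>A power of \<open>g\<close> in the centre of \<open>G\<^sub>S\<close> has a translation part that is invariant under \<open>W\<^sub>S\<close> and is a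
  multiple of the Newton point. Conversely the translation \<open>g\<^sup>N\<close> is central if it is invariant under \<open>W\<^sub>S\<close>.\<close>

lemma center_torsion_iff:
  assumes S: "S \<subseteq> R" and g: "g \<in> parabolic R S"
  shows "g \<in> center_torsion (parabolic_group R S) \<longleftrightarrow> (\<forall>\<alpha>\<in>S. newton g \<bullet> \<alpha> = 0)"
proof -
  note gG = parabolic_carrier[OF S g]
  have pow: "x [^]\<^bsub>parabolic_group R S\<^esub> (n :: nat) = x [^]\<^bsub>G\<^esub> n" for x n
    by (rule A.nat_pow_consistent[symmetric])
  show ?thesis
  proof
    assume "g \<in> center_torsion (parabolic_group R S)"
    then obtain m :: nat where m: "m > 0" "g [^]\<^bsub>G\<^esub> m \<in> center (parabolic_group R S)"
      by (auto simp: center_torsion_def pow)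
    obtain \<mu> u where z: "g [^]\<^bsub>G\<^esub> m = (\<mu>, u)" by (cases "g [^]\<^bsub>G\<^esub> m")
    have zp: "(\<mu>, u) \<in> parabolic R S"
      and comm: "\<And>h. h \<in> parabolic R S \<Longrightarrow> (\<mu>, u) \<otimes>\<^bsub>G\<^esub> h = h \<otimes>\<^bsub>G\<^esub> (\<mu>, u)"
      using m(2) unfolding z by (auto simp: center_def)
    have \<mu>: "\<mu> \<in> \<Lambda>" and u: "u \<in> W S" using zp by (auto simp: parabolic_def)
    have "w \<mu> = \<mu>" if w: "w \<in> W S" for w
    proof -
      have "(0, w) \<in> parabolic R S" using w lattice_zero by (simp add: parabolic_def)
      from comm[OF this] show ?thesis unfolding affine_simps using W_zero[OF S u] by simp
    qed
    hence fixed: "\<forall>\<alpha>\<in>S. \<mu> \<bullet> \<alpha> = 0" using W_fixed_iff[OF S] by blast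
    have u\<mu>: "u \<mu> = \<mu>" using W_fixes[OF S u] fixed by blast
    have "(g [^]\<^bsub>G\<^esub> m) [^]\<^bsub>G\<^esub> N = (g [^]\<^bsub>G\<^esub> N) [^]\<^bsub>G\<^esub> m"
      using gG by (simp add: A.nat_pow_pow mult.commute)
    moreover have "(g [^]\<^bsub>G\<^esub> N) [^]\<^bsub>G\<^esub> m = (real m *\<^sub>R (real N *\<^sub>R newton g), id ^^ m)"
      unfolding pow_newton[OF gG] by (rule translation_pow) simp
    moreover have "(g [^]\<^bsub>G\<^esub> m) [^]\<^bsub>G\<^esub> N = (real N *\<^sub>R \<mu>, u ^^ N)"
      unfolding z by (rule translation_pow[of u \<mu> N, OF u\<mu>])
    ultimately have "real N *\<^sub>R \<mu> = real m *\<^sub>R (real N *\<^sub>R newton g)" by simp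
    also have "\<dots> = real N *\<^sub>R (real m *\<^sub>R newton g)" by (simp add: mult.commute)
    finally have "\<mu> = real m *\<^sub>R newton g"
      using N_pos by (metis scaleR_cancel_left of_nat_0_less_iff less_irrefl)
    thus "\<forall>\<alpha>\<in>S. newton g \<bullet> \<alpha> = 0" using fixed m(1) by simp
  next
    assume f: "\<forall>\<alpha>\<in>S. newton g \<bullet> \<alpha> = 0"
    have "(real N *\<^sub>R newton g, id) \<in> center (parabolic_group R S)"
      unfolding center_def
    proof (intro CollectI conjI ballI)
      have "(real N *\<^sub>R newton g, id) \<in> parabolic R S"
        using newton_lattice[OF gG] W_id[OF S] by (simp only: parabolic_def mem_Times_iff fst_conv snd_conv)
      thus "(real N *\<^sub>R newton g, id) \<in> carrier (parabolic_group R S)" by simp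
      fix h assume "h \<in> carrier (parabolic_group R S)"
      then obtain l w where h: "h = (l, w)" "w \<in> W S" by (auto simp: parabolic_def)
      have "w (real N *\<^sub>R newton g) = real N *\<^sub>R newton g"
        by (rule W_fixes[OF S h(2)]) (simp add: f)
      thus "(real N *\<^sub>R newton g, id) \<otimes>\<^bsub>parabolic_group R S\<^esub> h = h \<otimes>\<^bsub>parabolic_group R S\<^esub> (real N *\<^sub>R newton g, id)"
        by (simp add: h affine_simps add.commute)
    qed
    hence "g [^]\<^bsub>parabolic_group R S\<^esub> N \<in> center (parabolic_group R S)" unfolding pow pow_newton[OF gG] .
    thus "g \<in> center_torsion (parabolic_group R S)" using N_pos g by (auto simp: center_torsion_def)
  qed
qed

text \<open>The properties by which \<open>root_hom\<close> is described; the next lemmas show that they determine a function.\<close>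

definition is_root_hom :: "'a set \<Rightarrow> 'a \<Rightarrow> ('a \<times> ('a \<Rightarrow> 'a) \<Rightarrow> int) \<Rightarrow> bool" where
  "is_root_hom S \<alpha> f \<longleftrightarrow> f \<in> extensional (parabolic R S) \<and>
     f \<in> hom (parabolic_group R S) integer_group \<and>
     (\<forall>l\<in>invariants R S. real_of_int (f (l, id)) = real (card (W S)) * pairing l \<alpha>)"

definition orbit_sum :: "'a set \<Rightarrow> 'a \<Rightarrow> 'a" where
  "orbit_sum S l = (\<Sum>u\<in>W S. u l)"

lemma orbit_sum_invariant:
  assumes S: "S \<subseteq> R" and w: "w \<in> W S"
  shows "w (orbit_sum S l) = orbit_sum S l" "orbit_sum S (w l) = orbit_sum S l"
proof -
  obtain w' where w': "w' \<in> W S" "w \<circ> w' = id" "w' \<circ> w = id" by (rule W_inv[OF S w])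
  have "w (orbit_sum S l) = (\<Sum>u\<in>W S. (w \<circ> u) l)"
    unfolding orbit_sum_def by (simp add: linear_sum[OF W_linear[OF S w]])
  also have "\<dots> = orbit_sum S l" unfolding orbit_sum_def
    by (rule sum.reindex_bij_witness[of _ "\<lambda>u. w' \<circ> u" "\<lambda>u. w \<circ> u"])
      (use w w' W_comp[OF S] in \<open>auto simp only: comp_assoc[symmetric] id_comp\<close>)
  finally show "w (orbit_sum S l) = orbit_sum S l" .
  have "orbit_sum S (w l) = (\<Sum>u\<in>W S. (u \<circ> w) l)" by (simp add: orbit_sum_def)
  also have "\<dots> = orbit_sum S l" unfolding orbit_sum_def
    by (rule sum.reindex_bij_witness[of _ "\<lambda>u. u \<circ> w'" "\<lambda>u. u \<circ> w"])
      (use w w' W_comp[OF S] in \<open>auto simp only: comp_assoc comp_id\<close>)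
  finally show "orbit_sum S (w l) = orbit_sum S l" .
qed

lemma orbit_sum_lattice: "S \<subseteq> R \<Longrightarrow> l \<in> \<Lambda> \<Longrightarrow> orbit_sum S l \<in> \<Lambda>"
  unfolding orbit_sum_def by (rule lattice_sum) (rule lattice_W)

lemma orbit_sum_add: "S \<subseteq> R \<Longrightarrow> orbit_sum S (l + l') = orbit_sum S l + orbit_sum S l'"
  unfolding orbit_sum_def by (simp add: linear_add[OF W_linear] flip: sum.distrib)

lemma integer_hom:
  assumes S: "S \<subseteq> R" and f: "f \<in> hom (parabolic_group R S) integer_group"
  shows "x \<in> parabolic R S \<Longrightarrow> y \<in> parabolic R S \<Longrightarrow> f (x \<otimes>\<^bsub>G\<^esub> y) = f x + f y"
    and "f \<one>\<^bsub>G\<^esub> = 0"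
    and "x \<in> parabolic R S \<Longrightarrow> f (x [^]\<^bsub>G\<^esub> (n :: nat)) = int n * f x"
proof -
  interpret P: subgroup "parabolic R S" G by (rule parabolic_subgroup[OF S])
  show add: "f (x \<otimes>\<^bsub>G\<^esub> y) = f x + f y" if "x \<in> parabolic R S" "y \<in> parabolic R S" for x y
    using f that by (simp add: hom_def integer_group_def)
  show one: "f \<one>\<^bsub>G\<^esub> = 0" using add[OF P.one_closed P.one_closed] by simp
  show "f (x [^]\<^bsub>G\<^esub> (n :: nat)) = int n * f x" if x: "x \<in> parabolic R S"
  proof (induction n)
    case (Suc n)
    have "x [^]\<^bsub>G\<^esub> n \<in> parabolic R S"
      by (induction n) (use x P.m_closed P.one_closed in auto)
    thus ?case using add[of "x [^]\<^bsub>G\<^esub> n" x] x Suc by (simp add: algebra_simps)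
  qed (simp add: one)
qed

text \<open>A homomorphism to the integers kills the finite group \<open>W\<^sub>S\<close> and is invariant under conjugation, so on
  a translation \<open>l\<close> its value is the average over the orbit, which is prescribed.\<close>

lemma is_root_hom_value:
  assumes S: "S \<subseteq> R" and f: "is_root_hom S \<alpha> f" and l: "l \<in> \<Lambda>" and w: "w \<in> W S"
  shows "real_of_int (f (l, w)) = pairing (orbit_sum S l) \<alpha>"
proof -
  let ?K = "card (W S)"
  have hom: "f \<in> hom (parabolic_group R S) integer_group" using f by (simp add: is_root_hom_def)
  note add = integer_hom(1)[OF S hom] and one = integer_hom(2)[OF S hom] and pow = integer_hom(3)[OF S hom]
  have zero: "f (0, u) = 0" if u: "u \<in> W S" for u
  proof -
    have p: "(0, u) \<in> parabolic R S" using u lattice_zero by (simp add: parabolic_def)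
    have "(0, u) [^]\<^bsub>G\<^esub> ?K = \<one>\<^bsub>G\<^esub>"
      using translation_pow[of u 0 ?K] W_zero[OF S u] W_funpow_card[OF S u] by (simp only: affine_simps scaleR_zero_right)
    hence "int ?K * f (0, u) = 0" using pow[OF p, of ?K] one by simp
    thus ?thesis using card_W_pos[OF S] by simp
  qed
  have trans: "(l', id) \<in> parabolic R S" if "l' \<in> \<Lambda>" for l' using that W_id[OF S] by (simp only: parabolic_def mem_Times_iff fst_conv snd_conv)
  have lin: "(0, u) \<in> parabolic R S" if "u \<in> W S" for u using that lattice_zero by (simp add: parabolic_def)
  have split: "f (l', u) = f (l', id)" if "l' \<in> \<Lambda>" "u \<in> W S" for l' u
  proof -
    have "(l', id) \<otimes>\<^bsub>G\<^esub> (0, u) = (l', u)" unfolding affine_simps by simp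
    thus ?thesis using add[OF trans[OF that(1)] lin[OF that(2)]] zero[OF that(2)] by simp
  qed
  have inv': "f (u l, id) = f (l, id)" if u: "u \<in> W S" for u
  proof -
    have "(0, u) \<otimes>\<^bsub>G\<^esub> (l, id) = (u l, u)" unfolding affine_simps by simp
    hence "f (u l, u) = f (l, id)" using add[OF lin[OF u] trans[OF l]] zero[OF u] by simp
    thus ?thesis using split[OF lattice_W[OF S u l] u] by simp
  qed
  have "f ((\<Sum>u\<in>A. u l), id) = (\<Sum>u\<in>A. f (u l, id))" if "finite A" "A \<subseteq> W S" for A
    using that
  proof (induction A rule: finite_induct)
    case empty
    show ?case unfolding sum.empty using one unfolding affine_simps .
  next
    case (insert u A)
    have "A \<subseteq> W S" "u \<in> W S" using insert.prems by auto
    have m: "u l \<in> \<Lambda>" by (rule lattice_W[OF S \<open>u \<in> W S\<close> l])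
    have m': "(\<Sum>u\<in>A. u l) \<in> \<Lambda>"
      by (rule lattice_sum, rule lattice_W[OF S _ l]) (use \<open>A \<subseteq> W S\<close> in blast)
    have "(u l, id) \<otimes>\<^bsub>G\<^esub> ((\<Sum>u\<in>A. u l), id) = ((\<Sum>u\<in>insert u A. u l), id)"
      unfolding affine_simps sum.insert[OF insert.hyps] by (simp only: id_apply id_comp)
    hence "f ((\<Sum>u\<in>insert u A. u l), id) = f (u l, id) + f ((\<Sum>u\<in>A. u l), id)"
      using add[OF trans[OF m] trans[OF m']] by (simp only:)
    also have "f ((\<Sum>u\<in>A. u l), id) = (\<Sum>u\<in>A. f (u l, id))" by (rule insert.IH[OF \<open>A \<subseteq> W S\<close>])
    finally show ?case unfolding sum.insert[OF insert.hyps] .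
  qed
  from this[OF finite_W[OF S] subset_refl] have "f (orbit_sum S l, id) = int ?K * f (l, id)"
    by (simp add: orbit_sum_def inv')
  moreover have "orbit_sum S l \<in> invariants R S"
    using orbit_sum_lattice[OF S l] orbit_sum_invariant(1)[OF S] by (simp add: invariants_def)
  hence "real_of_int (f (orbit_sum S l, id)) = real ?K * pairing (orbit_sum S l) \<alpha>"
    using f by (simp add: is_root_hom_def)
  ultimately have "real ?K * real_of_int (f (l, id)) = real ?K * pairing (orbit_sum S l) \<alpha>" by simp
  thus ?thesis using card_W_pos[OF S] split[OF l w] by simp
qed

lemma root_hom_exists:
  assumes S: "S \<subseteq> R" and \<alpha>: "\<alpha> \<in> R"
  shows "\<exists>f. is_root_hom S \<alpha> f"
proof -
  define f where "f = restrict (\<lambda>x. \<lfloor>pairing (orbit_sum S (fst x)) \<alpha>\<rfloor>) (parabolic R S)"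
  have fv: "real_of_int (f (l, w)) = pairing (orbit_sum S l) \<alpha>" if "l \<in> \<Lambda>" "w \<in> W S" for l w
    using lattice_pairing[OF orbit_sum_lattice[OF S that(1)] \<alpha>] that by (simp add: f_def parabolic_def)
  interpret P: subgroup "parabolic R S" G by (rule parabolic_subgroup[OF S])
  have "f (x \<otimes>\<^bsub>G\<^esub> y) = f x + f y" if xy: "x \<in> parabolic R S" "y \<in> parabolic R S" for x y
  proof -
    obtain l w l' w' where x: "x = (l, w)" "y = (l', w')" and m: "l \<in> \<Lambda>" "w \<in> W S" "l' \<in> \<Lambda>" "w' \<in> W S"
      using xy unfolding parabolic_def by blast
    have "real_of_int (f (x \<otimes>\<^bsub>G\<^esub> y)) = pairing (orbit_sum S (l + w l')) \<alpha>"
      unfolding x affine_simps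
      by (rule fv[OF lattice_add[OF m(1) lattice_W[OF S m(2,3)]] W_comp[OF S m(2,4)]])
    also have "\<dots> = real_of_int (f x + f y)"
      unfolding x by (simp add: orbit_sum_add[OF S] orbit_sum_invariant(2)[OF S m(2)] pairing_add fv m)
    finally show ?thesis by linarith
  qed
  hence "f \<in> hom (parabolic_group R S) integer_group" by (simp add: hom_def integer_group_def)
  moreover have "real_of_int (f (l, id)) = real (card (W S)) * pairing l \<alpha>" if "l \<in> invariants R S" for l
  proof -
    have l: "l \<in> \<Lambda>" "\<And>w. w \<in> W S \<Longrightarrow> w l = l" using that by (auto simp: invariants_def)
    have "orbit_sum S l = (\<Sum>u\<in>W S. l)" unfolding orbit_sum_def using l(2) by (intro sum.cong) auto
    hence "orbit_sum S l = real (card (W S)) *\<^sub>R l" by (simp add: sum_constant_scaleR)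
    thus ?thesis using fv[OF l(1) W_id[OF S]] by (simp add: pairing_scaleR)
  qed
  moreover have "f \<in> extensional (parabolic R S)" by (simp add: f_def)
  ultimately show ?thesis unfolding is_root_hom_def by blast
qed

lemma root_hom:
  assumes S: "S \<subseteq> R" and \<alpha>: "\<alpha> \<in> R"
  shows "is_root_hom S \<alpha> (root_hom R S \<alpha>)"
proof -
  obtain f where f: "is_root_hom S \<alpha> f" using root_hom_exists[OF S \<alpha>] by blast
  have "h = f" if h: "is_root_hom S \<alpha> h" for h
  proof (rule extensionalityI)
    show "h \<in> extensional (parabolic R S)" "f \<in> extensional (parabolic R S)"
      using f h by (simp_all add: is_root_hom_def)
    fix x assume "x \<in> parabolic R S"
    then obtain l w where x: "x = (l, w)" "l \<in> \<Lambda>" "w \<in> W S" unfolding parabolic_def by blast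
    have "real_of_int (h x) = real_of_int (f x)"
      unfolding x(1) is_root_hom_value[OF S h x(2,3)] is_root_hom_value[OF S f x(2,3)] ..
    thus "h x = f x" by simp
  qed
  from theI[of "is_root_hom S \<alpha>", OF f this] show ?thesis
    unfolding root_hom_def is_root_hom_def .
qed

text \<open>Evaluate the homomorphism on \<open>g\<^sup>N\<close>, which is translation by a multiple of the Newton point.\<close>

lemma root_hom_sign:
  assumes S: "S \<subseteq> R" and \<alpha>: "\<alpha> \<in> R" and g: "g \<in> parabolic R S" and f: "\<forall>\<beta>\<in>S. newton g \<bullet> \<beta> = 0"
  shows "root_hom R S \<alpha> g > 0 \<longleftrightarrow> newton g \<bullet> \<alpha> > 0"
proof -
  note gG = parabolic_carrier[OF S g] and rh = root_hom[OF S \<alpha>]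
  have hom: "root_hom R S \<alpha> \<in> hom (parabolic_group R S) integer_group" using rh by (simp add: is_root_hom_def)
  have "real N *\<^sub>R newton g \<in> invariants R S"
    using newton_lattice[OF gG] W_fixes[OF S, of _ "real N *\<^sub>R newton g"] f by (simp add: invariants_def)
  hence "real_of_int (root_hom R S \<alpha> (real N *\<^sub>R newton g, id)) =
      real (card (W S)) * pairing (real N *\<^sub>R newton g) \<alpha>"
    using rh by (simp add: is_root_hom_def)
  moreover have "root_hom R S \<alpha> (real N *\<^sub>R newton g, id) = int N * root_hom R S \<alpha> g"
    unfolding pow_newton[OF gG, symmetric] by (rule integer_hom(3)[OF S hom g])
  ultimately have "real N * real_of_int (root_hom R S \<alpha> g) = real N * (real (card (W S)) * pairing (newton g) \<alpha>)"
    by (simp add: pairing_scaleR)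
  hence "real_of_int (root_hom R S \<alpha> g) = real (card (W S)) * pairing (newton g) \<alpha>" using N_pos by simp
  moreover have "real (card (W S)) * pairing (newton g) \<alpha> > 0 \<longleftrightarrow> newton g \<bullet> \<alpha> > 0"
  proof -
    have "0 < 2 * x / a \<longleftrightarrow> 0 < x" if "a > 0" for a x :: real using that by (simp add: zero_less_divide_iff)
    moreover have "\<alpha> \<bullet> \<alpha> > 0" using R_nonzero[OF \<alpha>] by simp
    ultimately have "pairing (newton g) \<alpha> > 0 \<longleftrightarrow> newton g \<bullet> \<alpha> > 0" unfolding pairing_def by blast
    thus ?thesis using card_W_pos[OF S] by (simp add: zero_less_mult_iff)
  qed
  ultimately show ?thesis by (metis of_int_0_less_iff)
qed

text \<open>The points of the face of the dominant chamber that corresponds to \<open>S\<close>.\<close>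

definition on_face :: "'a set \<Rightarrow> 'a \<Rightarrow> bool" where
  "on_face S v \<longleftrightarrow> (\<forall>\<alpha>\<in>S. v \<bullet> \<alpha> = 0) \<and> (\<forall>\<alpha>\<in>B - S. v \<bullet> \<alpha> > 0)"

lemma on_face_dominant: "on_face S v \<Longrightarrow> S \<subseteq> B \<Longrightarrow> dominant v"
  unfolding on_face_def dominant_def by (metis DiffI less_imp_le order_refl)

lemma on_face_zeros: "on_face S v \<Longrightarrow> S \<subseteq> B \<Longrightarrow> {\<alpha>\<in>B. v \<bullet> \<alpha> = 0} = S"
  unfolding on_face_def by force

text \<open>The linear part of \<open>g\<close> fixes the Newton point. If that lies on the face of \<open>S\<close>, its stabilizer is \<open>W\<^sub>S\<close>,
  so \<open>g\<close> automatically belongs to \<open>G\<^sub>S\<close>.\<close>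

lemma parabolic_cz_plus_iff:
  assumes S: "S \<subseteq> B" and g: "g \<in> carrier G"
  shows "g \<in> parabolic_cz_plus R B S \<longleftrightarrow> on_face S (newton g)"
proof -
  have SR: "S \<subseteq> R" using S B_sub by blast
  have "g \<in> parabolic R S" if f: "on_face S (newton g)"
  proof -
    obtain l w where lw: "g = (l, w)" "l \<in> \<Lambda>" "w \<in> W R" using g unfolding affine_simps by blast
    have d: "dominant (newton g)" by (rule on_face_dominant[OF f S])
    have "w (newton g) = newton g" using newton_fixed[OF g] lw by simp
    hence "w \<in> W {\<alpha>\<in>B. newton g \<bullet> \<alpha> = 0}" using dominant_unique(2)[OF lw(3) d] d by simp
    thus ?thesis unfolding on_face_zeros[OF f S] using lw by (simp add: parabolic_def)
  qed
  moreover have "g \<in> parabolic_cz_plus R B S \<longleftrightarrow> on_face S (newton g)" if p: "g \<in> parabolic R S"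
    using center_torsion_iff[OF SR p] root_hom_sign[OF SR subsetD[OF B_sub] p] p
    by (auto simp: parabolic_cz_plus_def parabolic_plus_def on_face_def)
  moreover have "g \<in> parabolic R S" if "g \<in> parabolic_cz_plus R B S"
    using that by (auto simp: parabolic_cz_plus_def parabolic_plus_def)
  ultimately show ?thesis by blast
qed

text \<open>The representative depends only on the set that the choice operator is applied to, which is the
  same for elements of the same coset of \<open>W\<^sub>S\<close>.\<close>

definition transversal :: "'a set \<Rightarrow> ('a \<times> ('a \<Rightarrow> 'a)) set" where
  "transversal S = (\<lambda>u. (0, SOME u'. u' \<in> W R \<and> (\<exists>t\<in>W S. u = t \<circ> u'))) ` W R"

lemma transversal:
  assumes S: "S \<subseteq> R"
  shows "finite (transversal S)" "transversal S \<subseteq> carrier G"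
    "g \<in> carrier G \<Longrightarrow> \<exists>!x. x \<in> transversal S \<and> g \<otimes>\<^bsub>G\<^esub> inv\<^bsub>G\<^esub> x \<in> parabolic R S"
proof -
  define rep where "rep = (\<lambda>u. SOME u'. u' \<in> W R \<and> (\<exists>t\<in>W S. u = t \<circ> u'))"
  have rep: "rep u \<in> W R \<and> (\<exists>t\<in>W S. u = t \<circ> rep u)" if "u \<in> W R" for u
    unfolding rep_def by (rule someI[of _ u]) (use that W_id[OF S] id_comp in metis)
  have T: "transversal S = (\<lambda>u. (0, rep u)) ` W R" by (simp add: transversal_def rep_def)
  show "finite (transversal S)" unfolding T using finite_W[of R] by simp
  show sub: "transversal S \<subseteq> carrier G" unfolding T affine_simps using rep lattice_zero by auto
  have mem: "(l, w) \<otimes>\<^bsub>G\<^esub> inv\<^bsub>G\<^esub> (0, v) \<in> parabolic R S \<longleftrightarrow> (\<exists>t\<in>W S. w = t \<circ> v)"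
    if l: "l \<in> \<Lambda>" and w: "w \<in> W R" and v: "v \<in> W R" for l w v
  proof -
    obtain v' where v': "v' \<in> W R" "v \<circ> v' = id" "v' \<circ> v = id" by (rule W_inv[OF subset_refl v])
    have "inv\<^bsub>G\<^esub> (0, v) = (- v' 0, v')" by (rule affine_inv[OF lattice_zero v v'(1,3)])
    hence "(l, w) \<otimes>\<^bsub>G\<^esub> inv\<^bsub>G\<^esub> (0, v) = (l, w \<circ> v')"
      using W_zero[OF subset_refl v'(1)] W_zero[OF subset_refl w] by (simp add: affine_simps)
    hence "(l, w) \<otimes>\<^bsub>G\<^esub> inv\<^bsub>G\<^esub> (0, v) \<in> parabolic R S \<longleftrightarrow> w \<circ> v' \<in> W S" using l by (simp add: parabolic_def)
    also have "\<dots> \<longleftrightarrow> (\<exists>t\<in>W S. w = t \<circ> v)"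
      using v' by (metis comp_assoc comp_id)
    finally show ?thesis .
  qed
  assume "g \<in> carrier G"
  then obtain l w where g: "g = (l, w)" "l \<in> \<Lambda>" "w \<in> W R" unfolding affine_simps by blast
  show "\<exists>!x. x \<in> transversal S \<and> g \<otimes>\<^bsub>G\<^esub> inv\<^bsub>G\<^esub> x \<in> parabolic R S"
  proof (rule ex1I[of _ "(0, rep w)"])
    have "rep w \<in> W R" using rep[OF g(3)] by blast
    thus "(0, rep w) \<in> transversal S \<and> g \<otimes>\<^bsub>G\<^esub> inv\<^bsub>G\<^esub> (0, rep w) \<in> parabolic R S"
      unfolding T g(1) mem[OF g(2,3) \<open>rep w \<in> W R\<close>] using g(3) rep[OF g(3)] by blast
    fix x assume x: "x \<in> transversal S \<and> g \<otimes>\<^bsub>G\<^esub> inv\<^bsub>G\<^esub> x \<in> parabolic R S"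
    then obtain u where u: "u \<in> W R" "x = (0, rep u)" unfolding T by blast
    have ru: "rep u \<in> W R" using rep[OF u(1)] by blast
    obtain t where t: "t \<in> W S" "w = t \<circ> rep u" using x mem[OF g(2,3) ru] unfolding u(2) g(1) by blast
    obtain s where s: "s \<in> W S" "u = s \<circ> rep u" using rep[OF u(1)] by blast
    obtain t' where t': "t' \<in> W S" "t \<circ> t' = id" "t' \<circ> t = id" by (rule W_inv[OF S t(1)])
    obtain s' where s': "s' \<in> W S" "s \<circ> s' = id" "s' \<circ> s = id" by (rule W_inv[OF S s(1)])
    have rt: "rep u = t' \<circ> w"
    proof -
      have "t' \<circ> w = (t' \<circ> t) \<circ> rep u" by (subst t(2)) (rule comp_assoc[symmetric])
      thus ?thesis unfolding t'(3) id_comp by (rule sym)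
    qed
    have rs: "rep u = s' \<circ> u"
    proof -
      have "s' \<circ> u = (s' \<circ> s) \<circ> rep u" by (subst s(2)) (rule comp_assoc[symmetric])
      thus ?thesis unfolding s'(3) id_comp by (rule sym)
    qed
    have uw: "u = (s \<circ> t') \<circ> w" using s(2) rt by (simp only: comp_assoc)
    have wu: "w = (t \<circ> s') \<circ> u" using t(2) rs by (simp only: comp_assoc)
    have "(\<exists>a\<in>W S. u = a \<circ> u') \<longleftrightarrow> (\<exists>a\<in>W S. w = a \<circ> u')" for u'
    proof
      assume "\<exists>a\<in>W S. u = a \<circ> u'"
      then obtain a where a: "a \<in> W S" "u = a \<circ> u'" by blast
      have "w = (t \<circ> s' \<circ> a) \<circ> u'" using wu a(2) by (simp only: comp_assoc)
      thus "\<exists>a\<in>W S. w = a \<circ> u'" using W_comp[OF S W_comp[OF S t(1) s'(1)] a(1)] by blast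
    next
      assume "\<exists>a\<in>W S. w = a \<circ> u'"
      then obtain a where a: "a \<in> W S" "w = a \<circ> u'" by blast
      have "u = (s \<circ> t' \<circ> a) \<circ> u'" using uw a(2) by (simp only: comp_assoc)
      thus "\<exists>a\<in>W S. u = a \<circ> u'" using W_comp[OF S W_comp[OF S s(1) t'(1)] a(1)] by blast
    qed
    hence "rep u = rep w" by (simp only: rep_def)
    thus "x = (0, rep w)" by (simp only: u(2))
  qed
qed

text \<open>The class function on \<open>G\<close> that selects the elements whose Newton point has its dominant conjugate on
  the face of \<open>S\<close>.\<close>

definition face_indicator :: "'a set \<Rightarrow> 'a \<times> ('a \<Rightarrow> 'a) \<Rightarrow> complex" where
  "face_indicator S g = (if \<exists>u\<in>W R. on_face S (u (newton g)) then 1 else 0)"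

lemma on_face_W: "S \<subseteq> R \<Longrightarrow> u \<in> W S \<Longrightarrow> on_face S v \<Longrightarrow> u v = v"
  using W_fixes[of S u v] by (auto simp: on_face_def)

lemma face_indicator_class: "face_indicator S \<in> class_functions G"
  unfolding class_functions_def
proof (intro CollectI ballI)
  fix g h assume g: "g \<in> carrier G" and h: "h \<in> carrier G"
  have w: "snd h \<in> W R" using h unfolding affine_simps by auto
  obtain w' where w': "w' \<in> W R" "snd h \<circ> w' = id" "w' \<circ> snd h = id" by (rule W_inv[OF subset_refl w])
  have "(\<exists>u\<in>W R. on_face S (u (snd h (newton g)))) \<longleftrightarrow> (\<exists>u\<in>W R. on_face S (u (newton g)))"
  proof
    assume "\<exists>u\<in>W R. on_face S (u (snd h (newton g)))"
    then obtain u where "u \<in> W R" "on_face S ((u \<circ> snd h) (newton g))" by auto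
    thus "\<exists>u\<in>W R. on_face S (u (newton g))" using W_comp[OF subset_refl _ w] by blast
  next
    assume "\<exists>u\<in>W R. on_face S (u (newton g))"
    then obtain u where u: "u \<in> W R" "on_face S (u (newton g))" by blast
    have "(u \<circ> w') (snd h (newton g)) = u (newton g)" using fun_cong[OF w'(3), of "newton g"] by simp
    thus "\<exists>u\<in>W R. on_face S (u (snd h (newton g)))" using W_comp[OF subset_refl u(1) w'(1)] u(2) by metis
  qed
  thus "face_indicator S (h \<otimes>\<^bsub>G\<^esub> g \<otimes>\<^bsub>G\<^esub> inv\<^bsub>G\<^esub> h) = face_indicator S g"
    unfolding face_indicator_def newton_conjugate[OF h g] by simp
qed

lemma cz_plus_class:
  assumes S: "S \<subseteq> B"
  shows "indicator (parabolic_cz_plus R B S) \<in> class_functions (parabolic_group R S)"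
  unfolding class_functions_def
proof (intro CollectI ballI)
  fix g h assume "g \<in> carrier (parabolic_group R S)" "h \<in> carrier (parabolic_group R S)"
  hence gh: "g \<in> parabolic R S" "h \<in> parabolic R S" by auto
  have SR: "S \<subseteq> R" using S B_sub by blast
  note P = parabolic_subgroup[OF SR]
  have gG: "g \<in> carrier G" "h \<in> carrier G" using gh parabolic_carrier[OF SR] by auto
  have w: "snd h \<in> W S" using gh(2) by (auto simp: parabolic_def)
  obtain w' where w': "w' \<in> W S" "snd h \<circ> w' = id" "w' \<circ> snd h = id" by (rule W_inv[OF SR w])
  have i: "inv\<^bsub>parabolic_group R S\<^esub> h = inv\<^bsub>G\<^esub> h" by (rule A.m_inv_consistent[OF P gh(2)])
  have c: "h \<otimes>\<^bsub>G\<^esub> g \<otimes>\<^bsub>G\<^esub> inv\<^bsub>G\<^esub> h \<in> carrier G" using gG by simp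
  have "on_face S (snd h (newton g)) \<longleftrightarrow> on_face S (newton g)"
    using on_face_W[OF SR w, of "newton g"] on_face_W[OF SR w'(1), of "snd h (newton g)"]
      fun_cong[OF w'(3), of "newton g"] by auto
  hence "h \<otimes>\<^bsub>G\<^esub> g \<otimes>\<^bsub>G\<^esub> inv\<^bsub>G\<^esub> h \<in> parabolic_cz_plus R B S \<longleftrightarrow> g \<in> parabolic_cz_plus R B S"
    unfolding parabolic_cz_plus_iff[OF S c] parabolic_cz_plus_iff[OF S gG(1)] newton_conjugate[OF gG(2,1)] .
  thus "indicator (parabolic_cz_plus R B S) (h \<otimes>\<^bsub>parabolic_group R S\<^esub> g \<otimes>\<^bsub>parabolic_group R S\<^esub> inv\<^bsub>parabolic_group R S\<^esub> h) =
      indicator (parabolic_cz_plus R B S) g"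
    unfolding i by (simp add: indicator_def)
qed

text \<open>If two elements of the transversal move the Newton point to the face of \<open>S\<close>, their quotient moves a
  dominant vector to a dominant vector, so it lies in the stabilizer \<open>W\<^sub>S\<close>.\<close>

lemma face_indicator_transfer:
  assumes S: "S \<subseteq> B" and g: "g \<in> carrier G"
  shows "face_indicator S g =
    (\<Sum>x\<in>transversal S. indicator (parabolic_cz_plus R B S) (x \<otimes>\<^bsub>G\<^esub> g \<otimes>\<^bsub>G\<^esub> inv\<^bsub>G\<^esub> x))"
proof -
  have SR: "S \<subseteq> R" using S B_sub by blast
  note T = transversal[OF SR]
  define v where "v = newton g"
  let ?X = "{x \<in> transversal S. on_face S (snd x v)}"
  have "indicator (parabolic_cz_plus R B S) (x \<otimes>\<^bsub>G\<^esub> g \<otimes>\<^bsub>G\<^esub> inv\<^bsub>G\<^esub> x) = (if on_face S (snd x v) then 1 else 0 :: complex)"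
    if x: "x \<in> transversal S" for x
  proof -
    have xG: "x \<in> carrier G" using T(2) x by blast
    hence "x \<otimes>\<^bsub>G\<^esub> g \<otimes>\<^bsub>G\<^esub> inv\<^bsub>G\<^esub> x \<in> carrier G" using g by simp
    from parabolic_cz_plus_iff[OF S this] show ?thesis
      unfolding newton_conjugate[OF xG g] v_def by (simp add: indicator_def)
  qed
  hence "(\<Sum>x\<in>transversal S. indicator (parabolic_cz_plus R B S) (x \<otimes>\<^bsub>G\<^esub> g \<otimes>\<^bsub>G\<^esub> inv\<^bsub>G\<^esub> x) :: complex) =
      (\<Sum>x\<in>transversal S. if on_face S (snd x v) then 1 else 0)" by simp
  also have "\<dots> = of_nat (card ?X)" using T(1) by (simp add: sum.If_cases Int_def)
  finally have sum: "(\<Sum>x\<in>transversal S. indicator (parabolic_cz_plus R B S) (x \<otimes>\<^bsub>G\<^esub> g \<otimes>\<^bsub>G\<^esub> inv\<^bsub>G\<^esub> x) :: complex) =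
      of_nat (card ?X)" .
  have unique: "x = y" if "x \<in> ?X" "y \<in> ?X" for x y
  proof -
    have xy: "x \<in> transversal S" "y \<in> transversal S" "on_face S (snd x v)" "on_face S (snd y v)" using that by auto
    have xG: "x \<in> carrier G" "y \<in> carrier G" using T(2) xy by auto
    have q: "y \<otimes>\<^bsub>G\<^esub> inv\<^bsub>G\<^esub> x \<in> carrier G" using xG by simp
    have "snd (y \<otimes>\<^bsub>G\<^esub> inv\<^bsub>G\<^esub> x) \<circ> snd x = snd y"
      unfolding snd_mult[symmetric] using xG by (simp add: A.m_assoc)
    hence e: "snd (y \<otimes>\<^bsub>G\<^esub> inv\<^bsub>G\<^esub> x) (snd x v) = snd y v" by (metis comp_apply)
    have qW: "snd (y \<otimes>\<^bsub>G\<^esub> inv\<^bsub>G\<^esub> x) \<in> W R" "fst (y \<otimes>\<^bsub>G\<^esub> inv\<^bsub>G\<^esub> x) \<in> \<Lambda>"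
      using q unfolding affine_simps by auto
    have "snd (y \<otimes>\<^bsub>G\<^esub> inv\<^bsub>G\<^esub> x) \<in> W {\<alpha>\<in>B. snd x v \<bullet> \<alpha> = 0}"
      using dominant_unique(2)[OF qW(1) on_face_dominant[OF xy(3) S]] on_face_dominant[OF xy(4) S] e by simp
    hence "y \<otimes>\<^bsub>G\<^esub> inv\<^bsub>G\<^esub> x \<in> parabolic R S"
      unfolding on_face_zeros[OF xy(3) S] using qW(2) by (simp add: parabolic_def mem_Times_iff)
    moreover have "y \<otimes>\<^bsub>G\<^esub> inv\<^bsub>G\<^esub> y \<in> parabolic R S"
      using xG subgroup.one_closed[OF parabolic_subgroup[OF SR]] by simp
    ultimately show ?thesis using T(3)[OF xG(2)] xy by blast
  qed
  show ?thesis
  proof (cases "\<exists>u\<in>W R. on_face S (u v)")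
    case True
    then obtain u where u: "u \<in> W R" "on_face S (u v)" by blast
    have uG: "(0, u) \<in> carrier G" using u lattice_zero by (simp add: affine_simps)
    obtain x where x: "x \<in> transversal S" "(0, u) \<otimes>\<^bsub>G\<^esub> inv\<^bsub>G\<^esub> x \<in> parabolic R S" using T(3)[OF uG] by blast
    have xG: "x \<in> carrier G" using T(2) x by blast
    let ?t = "snd ((0, u) \<otimes>\<^bsub>G\<^esub> inv\<^bsub>G\<^esub> x)"
    have t: "?t \<in> W S" using x(2) by (auto simp: parabolic_def)
    obtain t' where t': "t' \<in> W S" "?t \<circ> t' = id" "t' \<circ> ?t = id" by (rule W_inv[OF SR t])
    have "?t \<circ> snd x = u" unfolding snd_mult[symmetric] using xG uG by (simp add: A.m_assoc)
    hence tx: "?t (snd x v) = u v" by (metis comp_apply)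
    have "snd x v = t' (?t (snd x v))" using fun_cong[OF t'(3), of "snd x v"] by simp
    also have "\<dots> = u v" unfolding tx by (rule on_face_W[OF SR t'(1) u(2)])
    finally have "x \<in> ?X" using x(1) u(2) by simp
    hence "?X = {x}" using unique by blast
    hence "card ?X = 1" by simp
    thus ?thesis using sum True by (simp add: face_indicator_def v_def)
  next
    case False
    have "snd x \<in> W R" if "x \<in> transversal S" for x using T(2) that unfolding affine_simps by auto
    hence X: "?X = {}" using False by blast
    show ?thesis unfolding sum X using False by (simp add: face_indicator_def v_def)
  qed
qed

text \<open>The two points are dominant and conjugate, hence equal, and each face determines its set of roots.\<close>

lemma face_unique:
  assumes "S \<subseteq> B" "T \<subseteq> B" "u \<in> W R" "w \<in> W R" "on_face S (u v)" "on_face T (w v)"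
  shows "S = T"
proof -
  obtain u' where u': "u' \<in> W R" "u \<circ> u' = id" "u' \<circ> u = id" by (rule W_inv[OF subset_refl assms(3)])
  have e: "(w \<circ> u') (u v) = w v" using fun_cong[OF u'(3), of v] by simp
  have "(w \<circ> u') (u v) = u v"
    using dominant_unique(1)[OF W_comp[OF subset_refl assms(4) u'(1)] on_face_dominant[OF assms(5,1)]]
      on_face_dominant[OF assms(6,2)] e by simp
  hence "w v = u v" using e by simp
  thus ?thesis using on_face_zeros[OF assms(5,1)] on_face_zeros[OF assms(6,2)] by simp
qed

lemma face_indicator_mult:
  assumes "S \<subseteq> B" "T \<subseteq> B"
  shows "face_indicator S g * face_indicator T g = (if S = T then face_indicator S g else 0)"
  using face_unique[OF assms] by (auto simp: face_indicator_def)

lemma face_indicator_sum: "(\<Sum>S\<in>Pow B. face_indicator S g) = 1"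
proof -
  obtain u where u: "u \<in> W R" "dominant (u (newton g))" using dominant_exists by blast
  let ?S = "{\<alpha>\<in>B. u (newton g) \<bullet> \<alpha> = 0}"
  have f: "on_face ?S (u (newton g))" using u(2) by (force simp: on_face_def dominant_def)
  have "face_indicator S g = (if S = ?S then 1 else 0)" if "S \<in> Pow B" for S
  proof (cases "S = ?S")
    case True
    thus ?thesis using u(1) f by (auto simp: face_indicator_def)
  next
    case False
    hence "\<not> (\<exists>w\<in>W R. on_face S (w (newton g)))"
      using face_unique[of S ?S _ u "newton g"] that u(1) f by auto
    thus ?thesis using False by (simp add: face_indicator_def)
  qed
  hence "(\<Sum>S\<in>Pow B. face_indicator S g) = (\<Sum>S\<in>Pow B. if S = ?S then 1 else 0)" by simp
  also have "\<dots> = 1" using finite_B by (subst sum.delta) auto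
  finally show ?thesis .
qed

theorem parabolic_endo_acts_as:
  assumes S: "S \<subseteq> B" and \<phi>: "equivariant_iso G (parabolic R S) \<phi>"
  shows "acts_as G (parabolic_endo R B \<phi> S) (face_indicator S)"
proof -
  have SR: "S \<subseteq> R" using S B_sub by blast
  interpret T: transversal_iso G "parabolic R S" \<phi> "transversal S"
    by (intro transversal_iso.intro affine_group parabolic_subgroup[OF SR] transversal_iso_axioms.intro
        \<phi> transversal[OF SR])
  show ?thesis unfolding parabolic_endo_def
  proof (rule T.induction_restriction_acts_as[OF cz_plus_class[OF S] _ face_indicator_class])
    show "indicator (parabolic_cz_plus R B S) h = 0" if "h \<in> carrier G" "h \<notin> parabolic R S" for h
      using that by (simp add: indicator_def parabolic_cz_plus_def parabolic_plus_def)
    show "face_indicator S g = T.transfer_index (indicator (parabolic_cz_plus R B S)) g" if "g \<in> carrier G" for g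
      unfolding T.transfer_index_def by (rule face_indicator_transfer[OF S that])
  qed
qed

end

theorem proposition4p3:
  fixes V R B :: "'a::euclidean_space set"
    and \<phi> :: "'a set \<Rightarrow> ('a \<times> ('a \<Rightarrow> 'a) \<Rightarrow> complex) \<Rightarrow> nat \<Rightarrow> 'a \<times> ('a \<Rightarrow> 'a) \<Rightarrow> complex"
  assumes "root_system V R"
    and "root_basis V R B"
    and "\<And>S. S \<subseteq> B \<Longrightarrow> equivariant_iso (affine_weyl R) (parabolic R S) (\<phi> S)"
  defines "G \<equiv> affine_weyl R"
  defines "E \<equiv> \<lambda>S. parabolic_endo R B (\<phi> S) S"
  shows "(\<forall>S. S \<subseteq> B \<longrightarrow> H_endo G (E S))
    \<and> (\<forall>S F. S \<subseteq> B \<longrightarrow> F \<in> class_functions G \<longrightarrow> H_eq G (E S \<circ>\<^sub>H H_act G F) (H_act G F \<circ>\<^sub>H E S))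
    \<and> (\<forall>S. S \<subseteq> B \<longrightarrow> H_eq G (E S \<circ>\<^sub>H E S) (E S))
    \<and> (\<forall>S T. S \<subseteq> B \<longrightarrow> T \<subseteq> B \<longrightarrow> S \<noteq> T \<longrightarrow> H_eq G (E S \<circ>\<^sub>H E T) (H_zero G))
    \<and> H_eq G (H_sum G E (Pow B)) H_id"
proof -
  interpret based_root_system V R B using assms(1,2) by unfold_locales
  note m = face_indicator_class[folded G_def]
  have acts: "acts_as G (E S) (face_indicator S)" if "S \<subseteq> B" for S
    unfolding G_def E_def by (rule parabolic_endo_acts_as[OF that assms(3)[OF that]])
  interpret group G unfolding G_def by (rule affine_group)
  show ?thesis
  proof (intro conjI allI impI)
    fix S assume S: "S \<subseteq> B"
    show "H_endo G (E S)" by (rule acts_as_H_endo[OF acts[OF S] m])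
    show "H_eq G (E S \<circ>\<^sub>H E S) (E S)"
      by (rule acts_as_unique[OF acts_as_comp[OF acts[OF S] acts[OF S] m] acts[OF S]])
        (simp add: face_indicator_mult S)
  next
    fix S F assume S: "S \<subseteq> B" and F: "F \<in> class_functions G"
    show "H_eq G (E S \<circ>\<^sub>H H_act G F) (H_act G F \<circ>\<^sub>H E S)"
      by (rule acts_as_unique[OF acts_as_comp[OF acts[OF S] acts_as_H_act[OF F] F]
            acts_as_comp[OF acts_as_H_act[OF F] acts[OF S] m]]) (rule mult.commute)
  next
    fix S T assume "S \<subseteq> B" "T \<subseteq> B" "S \<noteq> T"
    thus "H_eq G (E S \<circ>\<^sub>H E T) (H_zero G)"
      by (intro acts_as_unique[OF acts_as_comp[OF acts acts m] acts_as_zero]) (simp_all add: face_indicator_mult)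
  next
    show "H_eq G (H_sum G E (Pow B)) H_id"
      by (rule acts_as_unique[OF acts_as_sum acts_as_id])
        (use finite_B acts m face_indicator_sum in auto)
  qed
qed

end
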